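(* Let $r>0$, let $L(\mu)$ ($\mu\in\mathbb{R}^s$) be a smooth parameterized family of bounded linear operators from $C=C([-r,0],\mathbb{R})$ to $\mathbb{R}$, and put $L_0=L(0)$. For each $\mu$ let $\Lambda_\mu$ be the set of eigenvalues with zero real part of the infinitesimal generator $A(\mu)$ of the flow of $\dot z(t)=L(\mu)z_t$. Suppose that: (a) $\mathrm{Card}(\Lambda_\mu)<\mathrm{Card}(\Lambda_0)$ for all sufficiently small $\mu\neq 0$; (b) each element of $\Lambda_0$ is a simple eigenvalue of $A(0)$, and either $\Lambda_0=\{\pm i\omega_1,\ldots,\pm i\omega_p\}$ (put $d=p$, $\kappa=2p$) or $\Lambda_0=\{0,\pm i\omega_1,\ldots,\pm i\omega_p\}$ (put $d=p+1$, $\kappa=2p+1$), where $\omega_1,\ldots,\omega_p>0$ are linearly independent over the rationals. Let $\ell\ge 2$ be an integer. Then for each $$h=\sum_{j=2}^{\ell}h_j\in\mathcal{H}^d_\ell(\mathbb{R}^d,\mathbb{Z}_{2,p}),\qquad q=\sum_{j=2}^{\ell}q_j\in\mathcal{P}^{d+s}_\ell(\mathbb{R}^d,\mathbb{Z}_{2,p})$$ (with $h_j\in H^d_j(\mathbb{R}^d,\mathbb{Z}_{2,p})$ and $q_j\in P^{d+s}_j(\mathbb{R}^d,\mathbb{Z}_{2,p})$) there are $d$ distinct points $\tau_1,\ldots,\tau_d\in[-r,0]$, an $\eta=\sum_{j=2}^{\ell}\eta_j\in\widehat{\mathcal V}^d_\ell(\mathbb{R})$ (with $\eta_j\in\widehat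 V^d_j(\mathbb{R})$) and a $\xi=\sum_{j=2}^{\ell}\xi_j\in\widehat{\mathcal W}^{d+s}_\ell(\mathbb{R})$ (with $\xi_j\in\widehat W^{d+s}_j(\mathbb{R})$) such that for the retarded functional differential equation $$\dot z(t)=L_0z_t+\eta(z(t+\tau_1),\ldots,z(t+\tau_d))+\xi(z(t+\tau_1),\ldots,z(t+\tau_d),\mu)$$ the radial part, in polar coordinates, of the center manifold equations in $\mathbb{T}^p$-equivariant normal form up to degree $\ell$ is $$\dot\rho=h(\rho)+q(\rho,\mu).$$ In fact, $\tau=(\tau_1,\ldots,\tau_d)$ can be chosen in an open and dense subset of $[-r,0]^d$ which does not depend on the particular $h$ and $q$ to be realized: for every $\tau$ in this set and every $h\in\mathcal{H}^d_\ell(\mathbb{R}^d,\mathbb{Z}_{2,p})$ and $q\in\mathcal{P}^{d+s}_\ell(\mathbb{R}^d,\mathbb{Z}_{2,p})$ there exist $\eta\in\widehat{\mathcal V}^d_\ell(\mathbb{R})$ and $\xi\in\widehat{\mathcal W}^{d+s}_\ell(\mathbb{R})$ such that the radial part, in polar coordinates, of the center manifold equations in $\mathbb{T}^p$-equivariant normal form up to degree $\ell$ for $\dot z(t)=L_0z_t+\eta(z(t+\tau_1),\ldots,z(t+\tau_d))+\xi(z(t+\tau_1),\ldots,z(t+\tau_d),\mu)$ is $\dot\rho=h(\rho)+q(\rho,\mu)$ (only $\eta$ and $\xi$ must be changed in order to account for different $h$ and $q$).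
   Context: Notation: $p\ge1$, $s\ge0$ integers; $z_t(\theta)=z(t+\theta)$, $-r\le\theta\le0$; $C=C([-r,0],\mathbb{R})$ with the supremum norm. Complex coordinates. $\mathbb{R}^\kappa$ is identified with $\{x=(x_1,\overline{x_1},\ldots,x_p,\overline{x_p}):x_j\in\mathbb{C}\}$ if $\kappa=2p$, and with $\{x=(x_0,x_1,\overline{x_1},\ldots,x_p,\overline{x_p}):x_0\in\mathbb{R},x_j\in\mathbb{C}\}$ if $\kappa=2p+1$. $B=\mathrm{diag}(i\omega_1,-i\omega_1,\ldots,i\omega_p,-i\omega_p)$, resp. $B=\mathrm{diag}(0,i\omega_1,-i\omega_1,\ldots,i\omega_p,-i\omega_p)$. $\Gamma_0\cong\mathbb{T}^p$ is the group of matrices $\mathrm{diag}(e^{i\theta_1},e^{-i\theta_1},\ldots,e^{i\theta_p},e^{-i\theta_p})$, resp. $\mathrm{diag}(1,e^{i\theta_1},e^{-i\theta_1},\ldots,e^{i\theta_p},e^{-i\theta_p})$. Polynomial spaces. $H^{\kappa+s}_j(X)$ is the space of homogeneous polynomials of degree $j$ in $(x,\mu)\in\mathbb{R}^{\kappa}\times\mathbb{R}^s$ with coefficients in $X$; $H^{\kappa+s}_j(\mathbb{R}^\kappa,\mathbb{T}^p)$ is the set of $f\in H^{\kappa+s}_j(\mathbb{R}^\kappa)$ with $f(\gamma x,\mu)=\gamma f(x,\mu)$ for all $\gamma\in\Gamma_0$. Its general element has components $a_j(x_1\overline{x_1},\ldots,x_p\overline{x_p},\mu)x_j$ and their conjugates,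 $j=1,\ldots,p$ (if $\kappa=2p$), or a real first component $a_0(x_0,x_1\overline{x_1},\ldots,x_p\overline{x_p},\mu)$ followed by $a_j(x_0,x_1\overline{x_1},\ldots,x_p\overline{x_p},\mu)x_j$ and conjugates (if $\kappa=2p+1$). $\mathcal{L}_B$ is defined on $H^{\kappa+s}_j(\mathbb{R}^\kappa)$ by $(\mathcal{L}_Bf)(x,\mu)=D_xf(x,\mu)Bx-Bf(x,\mu)$, and $A$ by $(Af)(x,\mu)=\int_{\Gamma_0}\gamma f(\gamma^{-1}x,\mu)\,d\gamma$ (normalized Haar integral); $A$ is a projection onto $H^{\kappa+s}_j(\mathbb{R}^\kappa,\mathbb{T}^p)$ with $\ker A=\mathrm{range}\,\mathcal{L}_B$. Put $\rho=(\rho_1,\ldots,\rho_p)$ if $d=p$ and $\rho=(\rho_0,\rho_1,\ldots,\rho_p)$ if $d=p+1$. $\mathbb{Z}_{2,p}$ acts on $\mathbb{R}^d$ by $\rho_j\mapsto\lambda_j\rho_j$, $\lambda_j\in\{1,-1\}$, $j=1,\ldots,p$ (fixing $\rho_0$ if $d=p+1$). $H^{d+s}_j(X)$: homogeneous polynomials of degree $j$ in $d+s$ variables (the last $s$ being $\mu$) with coefficients in $X$; $H^{d}_j(X)$: its $\mu$-independent elements; $P^{d+s}_j(X)$: its elements vanishing at $\mu=0$. $H^{d+s}_j(\mathbb{R}^d,\mathbb{Z}_{2,p})$, $H^{d}_j(\mathbb{R}^d,\mathbb{Z}_{2,p})$, $P^{d+s}_j(\mathbb{R}^d,\mathbb{Z}_{2,p})$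 are the corresponding subspaces of $\mathbb{Z}_{2,p}$-equivariant maps. The linear map $\Pi:H^{\kappa+s}_j(\mathbb{R}^\kappa,\mathbb{T}^p)\to H^{d+s}_j(\mathbb{R}^d,\mathbb{Z}_{2,p})$ sends the general element above to the map with components $\mathrm{Re}(a_j(\rho_1^2,\ldots,\rho_p^2,\mu))\rho_j$, $j=1,\ldots,p$ (if $d=p$), or $a_0(\rho_0,\rho_1^2,\ldots,\rho_p^2,\mu)$ followed by $\mathrm{Re}(a_j(\rho_0,\rho_1^2,\ldots,\rho_p^2,\mu))\rho_j$ (if $d=p+1$). The spaces $\widehat V,\widehat W$. $V^{d+s}_j(\mathbb{R})\subset H^{d+s}_j(\mathbb{R})$ is spanned, if $d=p$ and $v=(v_1,\ldots,v_p)$, by the monomials $\mu^qv_1^{2k_1}\cdots v_p^{2k_p}v_c$ of degree $j$ with $c\in\{1,\ldots,p\}$; if $d=p+1$ and $v=(v_0,\ldots,v_p)$, by the monomials $\mu^qv_0^{k_0}v_1^{2k_1}\cdots v_p^{2k_p}v_c$ of degree $j$ with $c\in\{1,\ldots,p\}$ and the monomials $\mu^qv_0^{k_0}v_1^{2k_1}\cdots v_p^{2k_p}$ of degree $j$ (all exponents nonnegative integers). $V^d_j(\mathbb{R})$ is its subspace of $\mu$-independent elements and $W^{d+s}_j(\mathbb{R})$ its subspace of elements vanishing at $\mu=0$. Let $K$ be the (invertible) $d\times d$ matrix with $K_{j,k}=-1$ if $j+k>d+1$ and $K_{j,k}=1$ otherwise ($1\le j,k\le d$), and $(\mathcal{K}h)(v,\mu)=h(vK^T,\mu)$.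 Then $\widehat V^d_j(\mathbb{R})=\mathcal{K}^{-1}(V^d_j(\mathbb{R}))$ and $\widehat W^{d+s}_j(\mathbb{R})=\mathcal{K}^{-1}(W^{d+s}_j(\mathbb{R}))$. Calligraphic spaces are direct sums over degrees $2,\ldots,\ell$: $\widehat{\mathcal V}^d_\ell(\mathbb{R})=\oplus_{j=2}^\ell\widehat V^d_j(\mathbb{R})$, $\widehat{\mathcal W}^{d+s}_\ell(\mathbb{R})=\oplus_{j=2}^\ell\widehat W^{d+s}_j(\mathbb{R})$, $\mathcal{H}^d_\ell(\mathbb{R}^d,\mathbb{Z}_{2,p})=\oplus_{j=2}^\ell H^d_j(\mathbb{R}^d,\mathbb{Z}_{2,p})$, $\mathcal{P}^{d+s}_\ell(\mathbb{R}^d,\mathbb{Z}_{2,p})=\oplus_{j=2}^\ell P^{d+s}_j(\mathbb{R}^d,\mathbb{Z}_{2,p})$. Linear theory. Write $L_0\phi=\int_{-r}^0[d\nu(\theta)]\phi(\theta)$. $\Lambda_0$ is the set of roots with zero real part of $\Delta(z)=z-\int_{-r}^0[d\nu(\theta)]e^{z\theta}=0$. Let $\Phi(\theta)=(e^{i\omega_1\theta},e^{-i\omega_1\theta},\ldots,e^{i\omega_p\theta},e^{-i\omega_p\theta})$, preceded by an entry $1$ if $\kappa=2p+1$; its entries span the center subspace $P$. Let $(\psi,\phi)=\psi(0)\phi(0)-\int_{-r}^0\int_0^\theta\psi(\zeta-\theta)[d\nu(\theta)]\phi(\zeta)\,d\zeta$ for $\psi\in C([0,r])$, $\phi\in C$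 (extended to complex-valued functions). $\Psi(\zeta)=e^{-B\zeta}\Psi(0)$, $\zeta\in[0,r]$, is the $\kappa\times1$ column normalized by $(\Psi,\Phi)=I$. $Q=\{\phi\in C:(\Psi,\phi)=0\}$, $Q^1=Q\cap C^1$. $BC$ is the space of functions on $[-r,0]$ uniformly continuous on $[-r,0)$ with a possible jump at $0$; $X_0(\theta)=0$ for $\theta<0$, $X_0(0)=1$; $\pi(\varphi+X_0\lambda)=\Phi[(\Psi,\varphi)+\Psi(0)\lambda]$ for $\varphi\in C,\lambda\in\mathbb{R}$; $A_{Q^1}\varphi=\dot\varphi+X_0[L_0\varphi-\dot\varphi(0)]$ for $\varphi\in Q^1$. Normal form and radial part. For $\dot z(t)=L_0z_t+G(z_t,\mu)$ with $G:C\times\mathbb{R}^s\to\mathbb{R}$ smooth, $G(0,0)=0$, $DG(0,0)=0$, write the Taylor expansion $G=\sum_{j\ge2}G_j$ ($G_j$ homogeneous of degree $j$ in $(u,\mu)$). With $z_t=\Phi x+y$ the equation becomes $\dot x=Bx+\sum_{j\ge2}f^1_j(x,y,\mu)$, $\frac{d}{dt}y=A_{Q^1}y+\sum_{j\ge2}f_j^2(x,y,\mu)$, where $f^1_j=\Psi(0)G_j(\Phi x+y,\mu)$, $f^2_j=(I-\pi)X_0G_j(\Phi x+y,\mu)$. Successively for $j=2,\ldots,\ell$ apply the change of variables $(x,y)=(\hat x,\hat y)+(U^1_j(\hat x,\mu),U^2_j(\hat x,\mu))$ where, if $\bar f_j=(\bar f_j^1,\bar f^2_j)$ denotes the degree-$j$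 terms after the previous changes, $U^1_j$ is the unique element of $\mathrm{range}\,\mathcal{L}_B=\ker A$ with $\mathcal{L}_BU^1_j=(I-A)\bar f^1_j(\cdot,0,\cdot)$, and $U^2_j$ is the unique homogeneous polynomial of degree $j$ with coefficients in $Q^1$ such that $D_xU^2_j(x,\mu)Bx-A_{Q^1}U_j^2(x,\mu)=\bar f^2_j(x,0,\mu)$. Then, to order $\ell$, the local center manifold is $y=0$ and its flow is given by the center manifold equations in $\mathbb{T}^p$-equivariant normal form up to degree $\ell$: $\dot x=Bx+\sum_{j=2}^\ell g_j(x,\mu)$, $g_j=A\bar f^1_j(\cdot,0,\cdot)\in H^{\kappa+s}_j(\mathbb{R}^\kappa,\mathbb{T}^p)$. In polar coordinates $x_0=\rho_0$, $x_j=\rho_je^{i\theta_j}$ its $\dot\rho$ equations decouple from $\theta$, and the radial part up to degree $\ell$ is $\dot\rho=\sum_{j=2}^\ell(\Pi g_j)(\rho,\mu)$. *)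

theory Defs
  imports "HOL-Analysis.Analysis"
begin

(* Points of R^n are functions vanishing off a finite index set, so that every dimension
   (including s = 0) is an ordinary natural number.  The flag zr says whether 0 is an
   eigenvalue; it selects between d = p, kappa = 2p and d = p+1, kappa = 2p+1. *)

definition vecs :: "'i set \<Rightarrow> ('i \<Rightarrow> 'a::zero) set" where
  "vecs I = {v. \<forall>i. i \<notin> I \<longrightarrow> v i = 0}"

abbreviation params :: "nat \<Rightarrow> (nat \<Rightarrow> real) set" where
  "params s \<equiv> vecs {1..s}"

definition ridx :: "bool \<Rightarrow> nat \<Rightarrow> nat set" where
  "ridx zr p = (if zr then {0..p} else {1..p})"

definition rdim :: "bool \<Rightarrow> nat \<Rightarrow> nat" where
  "rdim zr p = (if zr then p + 1 else p)"

(* The kappa complex coordinates (x_0,) x_1, cnj x_1, ..., x_p, cnj x_p are indexed by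
   integers, with x_(-k) = cnj x_k; in particular x_0 is real. *)

definition cidx :: "bool \<Rightarrow> nat \<Rightarrow> int set" where
  "cidx zr p = {- int p..int p} - (if zr then {} else {0})"

definition cpts :: "bool \<Rightarrow> nat \<Rightarrow> (int \<Rightarrow> complex) set" where
  "cpts zr p = {x \<in> vecs (cidx zr p). \<forall>k. x (- k) = cnj (x k)}"

definition odd_ext :: "(nat \<Rightarrow> real) \<Rightarrow> int \<Rightarrow> real" where
  "odd_ext a k = of_int (sgn k) * a (nat \<bar>k\<bar>)"


section \<open>Homogeneous polynomials\<close>

definition mexps :: "'i set \<Rightarrow> nat \<Rightarrow> nat \<Rightarrow> (('i \<Rightarrow> nat) \<times> (nat \<Rightarrow> nat)) set" where
  "mexps I s j = {(m, q). m \<in> vecs I \<and> q \<in> vecs {1..s} \<and> sum m I + sum q {1..s} = j}"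

definition mon :: "'i set \<Rightarrow> nat \<Rightarrow> ('i \<Rightarrow> nat) \<Rightarrow> (nat \<Rightarrow> nat) \<Rightarrow>
    ('i \<Rightarrow> 'a::real_normed_field) \<Rightarrow> (nat \<Rightarrow> real) \<Rightarrow> 'a" where
  "mon I s m q x \<mu> = (\<Prod>i\<in>I. x i ^ m i) * of_real (\<Prod>i\<in>{1..s}. \<mu> i ^ q i)"

definition heval :: "'i set \<Rightarrow> nat \<Rightarrow> nat \<Rightarrow> (('i \<Rightarrow> nat) \<Rightarrow> (nat \<Rightarrow> nat) \<Rightarrow> 'a) \<Rightarrow>
    ('i \<Rightarrow> 'a::real_normed_field) \<Rightarrow> (nat \<Rightarrow> real) \<Rightarrow> 'a" where
  "heval I s j c x \<mu> = (\<Sum>(m, q)\<in>mexps I s j. c m q * mon I s m q x \<mu>)"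

definition Hscal :: "bool \<Rightarrow> nat \<Rightarrow> nat \<Rightarrow> nat \<Rightarrow> ((nat \<Rightarrow> real) \<Rightarrow> (nat \<Rightarrow> real) \<Rightarrow> real) set" where
  "Hscal zr p s j =
     {f. \<exists>c. \<forall>v\<in>vecs (ridx zr p). \<forall>\<mu>\<in>params s. f v \<mu> = heval (ridx zr p) s j c v \<mu>}"

definition HK :: "bool \<Rightarrow> nat \<Rightarrow> nat \<Rightarrow> nat \<Rightarrow>
    ((int \<Rightarrow> complex) \<Rightarrow> (nat \<Rightarrow> real) \<Rightarrow> int \<Rightarrow> complex) set" where
  "HK zr p s j =
     {f. (\<forall>x\<in>cpts zr p. \<forall>\<mu>\<in>params s. f x \<mu> \<in> cpts zr p) \<and>
         (\<forall>k\<in>cidx zr p. \<exists>c. \<forall>x\<in>cpts zr p. \<forall>\<mu>\<in>params s. f x \<mu> k = heval (cidx zr p) s j c x \<mu>)}"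


section \<open>Maps equivariant under sign changes\<close>

definition sign_vecs :: "nat \<Rightarrow> (nat \<Rightarrow> real) set" where
  "sign_vecs p = {\<sigma>. \<sigma> 0 = 1 \<and> (\<forall>i\<in>{1..p}. \<sigma> i = 1 \<or> \<sigma> i = - 1)}"

definition HZ2 :: "bool \<Rightarrow> nat \<Rightarrow> nat \<Rightarrow> nat \<Rightarrow>
    ((nat \<Rightarrow> real) \<Rightarrow> (nat \<Rightarrow> real) \<Rightarrow> nat \<Rightarrow> real) set" where
  "HZ2 zr p s j =
     {f. (\<forall>i\<in>ridx zr p. (\<lambda>\<rho> \<mu>. f \<rho> \<mu> i) \<in> Hscal zr p s j) \<and>
         (\<forall>\<sigma>\<in>sign_vecs p. \<forall>\<rho>\<in>vecs (ridx zr p). \<forall>\<mu>\<in>params s. \<forall>i\<in>ridx zr p.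
            f (\<lambda>k. \<sigma> k * \<rho> k) \<mu> i = \<sigma> i * f \<rho> \<mu> i)}"

definition HdZ2 :: "bool \<Rightarrow> nat \<Rightarrow> nat \<Rightarrow> nat \<Rightarrow> ((nat \<Rightarrow> real) \<Rightarrow> nat \<Rightarrow> real) set" where
  "HdZ2 zr p s j = {f. (\<lambda>\<rho> \<mu>. f \<rho>) \<in> HZ2 zr p s j}"

definition PZ2 :: "bool \<Rightarrow> nat \<Rightarrow> nat \<Rightarrow> nat \<Rightarrow>
    ((nat \<Rightarrow> real) \<Rightarrow> (nat \<Rightarrow> real) \<Rightarrow> nat \<Rightarrow> real) set" where
  "PZ2 zr p s j =
     {f \<in> HZ2 zr p s j. \<forall>\<rho>\<in>vecs (ridx zr p). \<forall>i\<in>ridx zr p. f \<rho> (\<lambda>_. 0) i = 0}"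


section \<open>The spaces of nonlinearities\<close>

definition Vmon :: "bool \<Rightarrow> nat \<Rightarrow> (nat \<Rightarrow> nat) \<Rightarrow> bool" where
  "Vmon zr p m \<longleftrightarrow>
     (\<exists>k. \<exists>c\<in>{1..p}. \<forall>i\<in>{1..p}. m i = 2 * k i + (if i = c then 1 else 0)) \<or>
     (zr \<and> (\<exists>k. \<forall>i\<in>{1..p}. m i = 2 * k i))"

definition Vsp :: "bool \<Rightarrow> nat \<Rightarrow> nat \<Rightarrow> nat \<Rightarrow> ((nat \<Rightarrow> real) \<Rightarrow> (nat \<Rightarrow> real) \<Rightarrow> real) set" where
  "Vsp zr p s j =
     {f. \<exists>c. \<forall>v\<in>vecs (ridx zr p). \<forall>\<mu>\<in>params s.
        f v \<mu> = (\<Sum>(m, q)\<in>{(m, q)\<in>mexps (ridx zr p) s j. Vmon zr p m}.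
                   c m q * mon (ridx zr p) s m q v \<mu>)}"

definition Wsp :: "bool \<Rightarrow> nat \<Rightarrow> nat \<Rightarrow> nat \<Rightarrow> ((nat \<Rightarrow> real) \<Rightarrow> (nat \<Rightarrow> real) \<Rightarrow> real) set" where
  "Wsp zr p s j = {f \<in> Vsp zr p s j. \<forall>v\<in>vecs (ridx zr p). f v (\<lambda>_. 0) = 0}"

definition Kmat :: "nat \<Rightarrow> nat \<Rightarrow> nat \<Rightarrow> real" where
  "Kmat d j k = (if j + k > d + 1 then - 1 else 1)"

(* The index set of R^d starts at 0 if zr, otherwise at 1; pos is the position (1, ..., d) of an index. *)

definition pos :: "bool \<Rightarrow> nat \<Rightarrow> nat" where
  "pos zr i = (if zr then i + 1 else i)"

definition mulKT :: "bool \<Rightarrow> nat \<Rightarrow> (nat \<Rightarrow> real) \<Rightarrow> nat \<Rightarrow> real" where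
  "mulKT zr p v = (\<lambda>i. if i \<in> ridx zr p
     then \<Sum>k\<in>ridx zr p. v k * Kmat (rdim zr p) (pos zr i) (pos zr k) else 0)"

definition calK :: "bool \<Rightarrow> nat \<Rightarrow> ((nat \<Rightarrow> real) \<Rightarrow> (nat \<Rightarrow> real) \<Rightarrow> real) \<Rightarrow>
    (nat \<Rightarrow> real) \<Rightarrow> (nat \<Rightarrow> real) \<Rightarrow> real" where
  "calK zr p f = (\<lambda>v \<mu>. f (mulKT zr p v) \<mu>)"

definition Vhat :: "bool \<Rightarrow> nat \<Rightarrow> nat \<Rightarrow> nat \<Rightarrow> ((nat \<Rightarrow> real) \<Rightarrow> real) set" where
  "Vhat zr p s j =
     {f. (\<lambda>v \<mu>. f v) \<in> Hscal zr p s j \<and> calK zr p (\<lambda>v \<mu>. f v) \<in> Vsp zr p s j}"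

definition What :: "bool \<Rightarrow> nat \<Rightarrow> nat \<Rightarrow> nat \<Rightarrow> ((nat \<Rightarrow> real) \<Rightarrow> (nat \<Rightarrow> real) \<Rightarrow> real) set" where
  "What zr p s j = {f \<in> Hscal zr p s j. calK zr p f \<in> Wsp zr p s j}"


section \<open>Linear retarded equations\<close>

(* C([-r,0],R) consists of the functions continuous on {-r..0}, identified when they agree there.
   bounded_op forces a functional to depend on the restriction to {-r..0} only. *)

definition bounded_op :: "real \<Rightarrow> ((real \<Rightarrow> real) \<Rightarrow> real) \<Rightarrow> bool" where
  "bounded_op r M \<longleftrightarrow>
     (\<forall>\<phi> \<psi>. continuous_on {-r..0} \<phi> \<longrightarrow> continuous_on {-r..0} \<psi> \<longrightarrow>
        M (\<lambda>\<theta>. \<phi> \<theta> + \<psi> \<theta>) = M \<phi> + M \<psi>) \<and>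
     (\<forall>a \<phi>. continuous_on {-r..0} \<phi> \<longrightarrow> M (\<lambda>\<theta>. a * \<phi> \<theta>) = a * M \<phi>) \<and>
     (\<exists>b. \<forall>\<phi>. continuous_on {-r..0} \<phi> \<longrightarrow> \<bar>M \<phi>\<bar> \<le> b * (SUP \<theta>\<in>{-r..0}. \<bar>\<phi> \<theta>\<bar>))"

definition unit_ballC :: "real \<Rightarrow> (real \<Rightarrow> real) set" where
  "unit_ballC r = {\<phi>. continuous_on {-r..0} \<phi> \<and> (\<forall>\<theta>\<in>{-r..0}. \<bar>\<phi> \<theta>\<bar> \<le> 1)}"

(* Smooth map from R^s into the dual of C: continuous partial derivatives of all orders
   (D [i_1, ..., i_n] being an iterated partial derivative of L).  Uniform limits on the unit ball
   are limits in the operator norm. *)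

definition smooth_family :: "real \<Rightarrow> nat \<Rightarrow> ((nat \<Rightarrow> real) \<Rightarrow> (real \<Rightarrow> real) \<Rightarrow> real) \<Rightarrow> bool" where
  "smooth_family r s L \<longleftrightarrow>
     (\<exists>D :: nat list \<Rightarrow> (nat \<Rightarrow> real) \<Rightarrow> (real \<Rightarrow> real) \<Rightarrow> real.
        D [] = L \<and>
        (\<forall>is\<in>lists {1..s}. \<forall>\<mu>\<in>params s.
           bounded_op r (D is \<mu>) \<and>
           uniform_limit (unit_ballC r) (D is) (D is \<mu>) (at \<mu> within params s) \<and>
           (\<forall>i\<in>{1..s}. uniform_limit (unit_ballC r)
              (\<lambda>h \<phi>. (D is (\<mu>(i := \<mu> i + h)) \<phi> - D is \<mu> \<phi>) / h) (D (i # is) \<mu>) (at 0))))"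

definition Lc :: "((real \<Rightarrow> real) \<Rightarrow> real) \<Rightarrow> (real \<Rightarrow> complex) \<Rightarrow> complex" where
  "Lc M \<phi> = Complex (M (\<lambda>\<theta>. Re (\<phi> \<theta>))) (M (\<lambda>\<theta>. Im (\<phi> \<theta>)))"

definition lin_solution :: "real \<Rightarrow> ((real \<Rightarrow> real) \<Rightarrow> real) \<Rightarrow> (real \<Rightarrow> complex) \<Rightarrow>
    (real \<Rightarrow> complex) \<Rightarrow> bool" where
  "lin_solution r M \<phi> z \<longleftrightarrow>
     continuous_on {-r..} z \<and> (\<forall>\<theta>\<in>{-r..0}. z \<theta> = \<phi> \<theta>) \<and>
     (\<forall>t\<ge>0. (z has_vector_derivative Lc M (\<lambda>\<theta>. z (t + \<theta>))) (at t within {0..}))"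

(* gen r M is the graph of the (complexified) infinitesimal generator of the semigroup
   T(h) phi = z_h, where z is the solution with initial function phi. *)

definition gen :: "real \<Rightarrow> ((real \<Rightarrow> real) \<Rightarrow> real) \<Rightarrow> (real \<Rightarrow> complex) \<Rightarrow>
    (real \<Rightarrow> complex) \<Rightarrow> bool" where
  "gen r M \<phi> \<upsilon> \<longleftrightarrow>
     continuous_on {-r..0} \<phi> \<and> continuous_on {-r..0} \<upsilon> \<and>
     (\<exists>z. lin_solution r M \<phi> z \<and>
        uniform_limit {-r..0} (\<lambda>h \<theta>. (z (h + \<theta>) - \<phi> \<theta>) /\<^sub>R h) \<upsilon> (at_right 0))"

definition is_eigenvalue :: "real \<Rightarrow> ((real \<Rightarrow> real) \<Rightarrow> real) \<Rightarrow> complex \<Rightarrow> bool" where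
  "is_eigenvalue r M \<zeta> \<longleftrightarrow>
     (\<exists>\<phi>. (\<exists>\<theta>\<in>{-r..0}. \<phi> \<theta> \<noteq> 0) \<and> gen r M \<phi> (\<lambda>\<theta>. \<zeta> * \<phi> \<theta>))"

primrec gen_kernel :: "real \<Rightarrow> ((real \<Rightarrow> real) \<Rightarrow> real) \<Rightarrow> complex \<Rightarrow> nat \<Rightarrow>
    (real \<Rightarrow> complex) \<Rightarrow> bool" where
  "gen_kernel r M \<zeta> 0 \<phi> \<longleftrightarrow> (\<forall>\<theta>\<in>{-r..0}. \<phi> \<theta> = 0)"
| "gen_kernel r M \<zeta> (Suc n) \<phi> \<longleftrightarrow>
     (\<exists>\<upsilon>. gen r M \<phi> \<upsilon> \<and> gen_kernel r M \<zeta> n (\<lambda>\<theta>. \<upsilon> \<theta> - \<zeta> * \<phi> \<theta>))"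

(* Simple = the generalized eigenspace is one-dimensional. *)

definition simple_eigenvalue :: "real \<Rightarrow> ((real \<Rightarrow> real) \<Rightarrow> real) \<Rightarrow> complex \<Rightarrow> bool" where
  "simple_eigenvalue r M \<zeta> \<longleftrightarrow>
     is_eigenvalue r M \<zeta> \<and>
     (\<exists>\<phi>0. \<forall>n \<phi>. gen_kernel r M \<zeta> n \<phi> \<longrightarrow> (\<exists>a. \<forall>\<theta>\<in>{-r..0}. \<phi> \<theta> = a * \<phi>0 \<theta>))"

definition imag_spectrum :: "real \<Rightarrow> ((real \<Rightarrow> real) \<Rightarrow> real) \<Rightarrow> complex set" where
  "imag_spectrum r M = {\<zeta>. Re \<zeta> = 0 \<and> is_eigenvalue r M \<zeta>}"


section \<open>The decomposition of the phase space\<close>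

(* M phi is the integral of phi against d nu; hence an iterated integral with inner limits 0 and theta
   and outer integrator d nu(theta) is M applied to the inner integral.
   The sign change comes from writing the inner integral over {theta..0}. *)

definition bform :: "((real \<Rightarrow> real) \<Rightarrow> real) \<Rightarrow> (real \<Rightarrow> complex) \<Rightarrow> (real \<Rightarrow> complex) \<Rightarrow> complex" where
  "bform M \<psi> \<phi> =
     \<psi> 0 * \<phi> 0 + Lc M (\<lambda>\<theta>. integral {\<theta>..0} (\<lambda>\<zeta>. \<psi> (\<zeta> - \<theta>) * \<phi> \<zeta>))"

definition Phi :: "(nat \<Rightarrow> real) \<Rightarrow> int \<Rightarrow> real \<Rightarrow> complex" where
  "Phi \<omega> k \<theta> = exp (\<i> * of_real (odd_ext \<omega> k * \<theta>))"

(* b stands for the column Psi(0). *)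

definition Psi :: "(nat \<Rightarrow> real) \<Rightarrow> (int \<Rightarrow> complex) \<Rightarrow> int \<Rightarrow> real \<Rightarrow> complex" where
  "Psi \<omega> b k \<zeta> = exp (- \<i> * of_real (odd_ext \<omega> k * \<zeta>)) * b k"

definition Psi_normalized :: "((real \<Rightarrow> real) \<Rightarrow> real) \<Rightarrow> bool \<Rightarrow> nat \<Rightarrow> (nat \<Rightarrow> real) \<Rightarrow>
    (int \<Rightarrow> complex) \<Rightarrow> bool" where
  "Psi_normalized M zr p \<omega> b \<longleftrightarrow>
     b \<in> vecs (cidx zr p) \<and>
     (\<forall>k\<in>cidx zr p. \<forall>l\<in>cidx zr p. bform M (Psi \<omega> b k) (Phi \<omega> l) = (if k = l then 1 else 0))"

definition Phix :: "bool \<Rightarrow> nat \<Rightarrow> (nat \<Rightarrow> real) \<Rightarrow> (int \<Rightarrow> complex) \<Rightarrow> real \<Rightarrow> real" where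
  "Phix zr p \<omega> x \<theta> = Re (\<Sum>k\<in>cidx zr p. Phi \<omega> k \<theta> * x k)"

definition C1_on :: "real \<Rightarrow> (real \<Rightarrow> 'a::real_normed_vector) \<Rightarrow> bool" where
  "C1_on r \<phi> \<longleftrightarrow>
     (\<exists>\<phi>'. continuous_on {-r..0} \<phi>' \<and>
        (\<forall>\<theta>\<in>{-r..0}. (\<phi> has_vector_derivative \<phi>' \<theta>) (at \<theta> within {-r..0})))"

definition Q1c :: "real \<Rightarrow> ((real \<Rightarrow> real) \<Rightarrow> real) \<Rightarrow> bool \<Rightarrow> nat \<Rightarrow> (nat \<Rightarrow> real) \<Rightarrow>
    (int \<Rightarrow> complex) \<Rightarrow> (real \<Rightarrow> complex) set" where
  "Q1c r M zr p \<omega> b = {\<phi>. C1_on r \<phi> \<and> (\<forall>k\<in>cidx zr p. bform M (Psi \<omega> b k) \<phi> = 0)}"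

definition Q1 :: "real \<Rightarrow> ((real \<Rightarrow> real) \<Rightarrow> real) \<Rightarrow> bool \<Rightarrow> nat \<Rightarrow> (nat \<Rightarrow> real) \<Rightarrow>
    (int \<Rightarrow> complex) \<Rightarrow> (real \<Rightarrow> real) set" where
  "Q1 r M zr p \<omega> b = {\<phi>. (\<lambda>\<theta>. of_real (\<phi> \<theta>)) \<in> Q1c r M zr p \<omega> b}"

definition X0 :: "real \<Rightarrow> real" where
  "X0 \<theta> = (if \<theta> = 0 then 1 else 0)"

(* The value of pi at phi + X_0 a. *)

definition proj_BC :: "((real \<Rightarrow> real) \<Rightarrow> real) \<Rightarrow> bool \<Rightarrow> nat \<Rightarrow> (nat \<Rightarrow> real) \<Rightarrow>
    (int \<Rightarrow> complex) \<Rightarrow> (real \<Rightarrow> real) \<Rightarrow> real \<Rightarrow> real \<Rightarrow> real" where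
  "proj_BC M zr p \<omega> b \<phi> a =
     Phix zr p \<omega> (\<lambda>k. bform M (Psi \<omega> b k) (\<lambda>\<theta>. of_real (\<phi> \<theta>)) + b k * of_real a)"

definition AQ1 :: "real \<Rightarrow> ((real \<Rightarrow> real) \<Rightarrow> real) \<Rightarrow> (real \<Rightarrow> real) \<Rightarrow> real \<Rightarrow> real" where
  "AQ1 r M y \<theta> =
     vector_derivative y (at \<theta> within {-r..0}) +
     X0 \<theta> * (M y - vector_derivative y (at 0 within {-r..0}))"

(* Homogeneous polynomials in (x, mu) with coefficients in Q1: in the complex coordinates x
   the coefficients lie in the complexification Q1c. *)

definition HQ1 :: "real \<Rightarrow> ((real \<Rightarrow> real) \<Rightarrow> real) \<Rightarrow> bool \<Rightarrow> nat \<Rightarrow> (nat \<Rightarrow> real) \<Rightarrow>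
    (int \<Rightarrow> complex) \<Rightarrow> nat \<Rightarrow> nat \<Rightarrow> ((int \<Rightarrow> complex) \<Rightarrow> (nat \<Rightarrow> real) \<Rightarrow> real \<Rightarrow> real) set" where
  "HQ1 r M zr p \<omega> b s j =
     {U. \<exists>c. (\<forall>m q. c m q \<in> Q1c r M zr p \<omega> b) \<and>
        (\<forall>x\<in>cpts zr p. \<forall>\<mu>\<in>params s. \<forall>\<theta>\<in>{-r..0}.
           of_real (U x \<mu> \<theta>) = heval (cidx zr p) s j (\<lambda>m q. c m q \<theta>) x \<mu>)}"


section \<open>The torus action\<close>

definition rot :: "(nat \<Rightarrow> real) \<Rightarrow> (int \<Rightarrow> complex) \<Rightarrow> int \<Rightarrow> complex" where
  "rot \<theta> x k = exp (\<i> * of_real (odd_ext \<theta> k)) * x k"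

definition haar_torus :: "nat \<Rightarrow> (nat \<Rightarrow> real) measure" where
  "haar_torus p = Pi\<^sub>M {1..p} (\<lambda>_. uniform_measure lborel {0..2 * pi})"

definition average :: "nat \<Rightarrow> ((int \<Rightarrow> complex) \<Rightarrow> (nat \<Rightarrow> real) \<Rightarrow> int \<Rightarrow> complex) \<Rightarrow>
    (int \<Rightarrow> complex) \<Rightarrow> (nat \<Rightarrow> real) \<Rightarrow> int \<Rightarrow> complex" where
  "average p f x \<mu> k = (\<integral>\<theta>. rot \<theta> (f (rot (\<lambda>i. - \<theta> i) x) \<mu>) k \<partial>haar_torus p)"

definition Bop :: "(nat \<Rightarrow> real) \<Rightarrow> (int \<Rightarrow> complex) \<Rightarrow> int \<Rightarrow> complex" where
  "Bop \<omega> x k = \<i> * of_real (odd_ext \<omega> k) * x k"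

(* D_x F(x) w, for F depending on x only. *)

definition dirD :: "((int \<Rightarrow> complex) \<Rightarrow> 'a::real_normed_vector) \<Rightarrow> (int \<Rightarrow> complex) \<Rightarrow>
    (int \<Rightarrow> complex) \<Rightarrow> 'a" where
  "dirD F x w = vector_derivative (\<lambda>t. F (\<lambda>k. x k + of_real t * w k)) (at 0)"

definition LB :: "(nat \<Rightarrow> real) \<Rightarrow> ((int \<Rightarrow> complex) \<Rightarrow> (nat \<Rightarrow> real) \<Rightarrow> int \<Rightarrow> complex) \<Rightarrow>
    (int \<Rightarrow> complex) \<Rightarrow> (nat \<Rightarrow> real) \<Rightarrow> int \<Rightarrow> complex" where
  "LB \<omega> f x \<mu> k = dirD (\<lambda>x. f x \<mu> k) x (Bop \<omega> x) - Bop \<omega> (f x \<mu>) k"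

definition range_LB :: "bool \<Rightarrow> nat \<Rightarrow> (nat \<Rightarrow> real) \<Rightarrow> nat \<Rightarrow> nat \<Rightarrow>
    ((int \<Rightarrow> complex) \<Rightarrow> (nat \<Rightarrow> real) \<Rightarrow> int \<Rightarrow> complex) set" where
  "range_LB zr p \<omega> s j =
     {U \<in> HK zr p s j. \<exists>f\<in>HK zr p s j. \<forall>x\<in>cpts zr p. \<forall>\<mu>\<in>params s. U x \<mu> = LB \<omega> f x \<mu>}"


section \<open>Normal forms\<close>

(* m-th Taylor coefficient at 0 of a curve; applied to t \<mapsto> F (t u) it gives the
   homogeneous term of degree m of F at u. *)

definition taylor_coeff :: "nat \<Rightarrow> (real \<Rightarrow> 'a::real_normed_vector) \<Rightarrow> 'a" where
  "taylor_coeff m f = ((\<lambda>g t. vector_derivative g (at t)) ^^ m) f 0 /\<^sub>R fact m"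

definition Gterm :: "((real \<Rightarrow> real) \<Rightarrow> (nat \<Rightarrow> real) \<Rightarrow> real) \<Rightarrow> nat \<Rightarrow>
    (real \<Rightarrow> real) \<Rightarrow> (nat \<Rightarrow> real) \<Rightarrow> real" where
  "Gterm G m u \<mu> = taylor_coeff m (\<lambda>t. G (\<lambda>\<theta>. t * u \<theta>) (\<lambda>i. t * \<mu> i))"

type_synonym xterms =
  "nat \<Rightarrow> (int \<Rightarrow> complex) \<Rightarrow> (real \<Rightarrow> real) \<Rightarrow> (nat \<Rightarrow> real) \<Rightarrow> int \<Rightarrow> complex"
type_synonym yterms =
  "nat \<Rightarrow> (int \<Rightarrow> complex) \<Rightarrow> (real \<Rightarrow> real) \<Rightarrow> (nat \<Rightarrow> real) \<Rightarrow> real \<Rightarrow> real"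

(* A system x' = sum of f1_m(x,y,mu), y' = sum of f2_m(x,y,mu) is given by its homogeneous terms
   of degree m = 1, 2, ...; those of degree 1 are B x and A_Q1 y. *)

definition f1_init :: "bool \<Rightarrow> nat \<Rightarrow> (nat \<Rightarrow> real) \<Rightarrow> (int \<Rightarrow> complex) \<Rightarrow>
    ((real \<Rightarrow> real) \<Rightarrow> (nat \<Rightarrow> real) \<Rightarrow> real) \<Rightarrow> xterms" where
  "f1_init zr p \<omega> b G m x y \<mu> =
     (if m = 1 then Bop \<omega> x
      else (\<lambda>k. b k * of_real (Gterm G m (\<lambda>\<theta>. Phix zr p \<omega> x \<theta> + y \<theta>) \<mu>)))"

definition f2_init :: "real \<Rightarrow> ((real \<Rightarrow> real) \<Rightarrow> real) \<Rightarrow> bool \<Rightarrow> nat \<Rightarrow> (nat \<Rightarrow> real) \<Rightarrow>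
    (int \<Rightarrow> complex) \<Rightarrow> ((real \<Rightarrow> real) \<Rightarrow> (nat \<Rightarrow> real) \<Rightarrow> real) \<Rightarrow> yterms" where
  "f2_init r M zr p \<omega> b G m x y \<mu> =
     (if m = 1 then AQ1 r M y
      else (\<lambda>\<theta>. let a = Gterm G m (\<lambda>\<theta>. Phix zr p \<omega> x \<theta> + y \<theta>) \<mu>
                 in X0 \<theta> * a - proj_BC M zr p \<omega> b (\<lambda>_. 0) a \<theta>))"

(* The change of variables (x,y) = (X,Y) + (U1(X,mu), U2(X,mu)), with U1, U2 homogeneous of degree
   j >= 2, takes (f1,f2) to (g1,g2): the equations
     (I + D_x U1) X' = F1(X + U1, Y + U2, mu),   Y' + (D_x U2) X' = F2(X + U1, Y + U2, mu)
   are compared in each degree m.  Terms of F1, F2 of degree > m do not contribute to degree m. *)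

definition transformed :: "real \<Rightarrow> (real \<Rightarrow> real) set \<Rightarrow> bool \<Rightarrow> nat \<Rightarrow> nat \<Rightarrow> nat \<Rightarrow>
    ((int \<Rightarrow> complex) \<Rightarrow> (nat \<Rightarrow> real) \<Rightarrow> int \<Rightarrow> complex) \<Rightarrow>
    ((int \<Rightarrow> complex) \<Rightarrow> (nat \<Rightarrow> real) \<Rightarrow> real \<Rightarrow> real) \<Rightarrow>
    xterms \<Rightarrow> yterms \<Rightarrow> xterms \<Rightarrow> yterms \<Rightarrow> bool" where
  "transformed r Y zr p s j U1 U2 f1 f2 g1 g2 \<longleftrightarrow>
     (\<forall>m\<ge>1. \<forall>x\<in>cpts zr p. \<forall>y\<in>Y. \<forall>\<mu>\<in>params s.
        let X = (\<lambda>t k. of_real t * x k + U1 (\<lambda>k. of_real t * x k) (\<lambda>i. t * \<mu> i) k);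
            Z = (\<lambda>t \<theta>. t * y \<theta> + U2 (\<lambda>k. of_real t * x k) (\<lambda>i. t * \<mu> i) \<theta>);
            N = (\<lambda>t i. t * \<mu> i)
        in (\<forall>k. g1 m x y \<mu> k
                 + (if j \<le> m then dirD (\<lambda>x. U1 x \<mu> k) x (g1 (m + 1 - j) x y \<mu>) else 0)
               = taylor_coeff m (\<lambda>t. \<Sum>n = 1..m. f1 n (X t) (Z t) (N t) k)) \<and>
           (\<forall>\<theta>\<in>{-r..0}. g2 m x y \<mu> \<theta>
                 + (if j \<le> m then dirD (\<lambda>x. U2 x \<mu> \<theta>) x (g1 (m + 1 - j) x y \<mu>) else 0)
               = taylor_coeff m (\<lambda>t. \<Sum>n = 1..m. f2 n (X t) (Z t) (N t) \<theta>)))"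

(* f1 n, f2 n are the terms after the changes of variables of degrees 2, ..., n. *)

definition normal_form :: "real \<Rightarrow> ((real \<Rightarrow> real) \<Rightarrow> real) \<Rightarrow> bool \<Rightarrow> nat \<Rightarrow> (nat \<Rightarrow> real) \<Rightarrow>
    nat \<Rightarrow> nat \<Rightarrow> ((real \<Rightarrow> real) \<Rightarrow> (nat \<Rightarrow> real) \<Rightarrow> real) \<Rightarrow>
    (nat \<Rightarrow> (int \<Rightarrow> complex) \<Rightarrow> (nat \<Rightarrow> real) \<Rightarrow> int \<Rightarrow> complex) \<Rightarrow> bool" where
  "normal_form r M zr p \<omega> s l G g \<longleftrightarrow>
     (\<exists>b f1 f2 U1 U2.
        Psi_normalized M zr p \<omega> b \<and>
        f1 1 = f1_init zr p \<omega> b G \<and> f2 1 = f2_init r M zr p \<omega> b G \<and>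
        (\<forall>j\<in>{2..l}.
           let F1 = (\<lambda>x \<mu>. f1 (j - 1) j x (\<lambda>_. 0) \<mu>);
               F2 = (\<lambda>x \<mu>. f2 (j - 1) j x (\<lambda>_. 0) \<mu>)
           in U1 j \<in> range_LB zr p \<omega> s j \<and>
              (\<forall>x\<in>cpts zr p. \<forall>\<mu>\<in>params s. \<forall>k\<in>cidx zr p.
                 LB \<omega> (U1 j) x \<mu> k = F1 x \<mu> k - average p F1 x \<mu> k) \<and>
              U2 j \<in> HQ1 r M zr p \<omega> b s j \<and>
              (\<forall>x\<in>cpts zr p. \<forall>\<mu>\<in>params s. \<forall>\<theta>\<in>{-r..0}.
                 dirD (\<lambda>x. U2 j x \<mu> \<theta>) x (Bop \<omega> x) - AQ1 r M (U2 j x \<mu>) \<theta> = F2 x \<mu> \<theta>) \<and>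
              transformed r (Q1 r M zr p \<omega> b) zr p s j (U1 j) (U2 j)
                (f1 (j - 1)) (f2 (j - 1)) (f1 j) (f2 j) \<and>
              (\<forall>x\<in>cpts zr p. \<forall>\<mu>\<in>params s. \<forall>k\<in>cidx zr p.
                 g j x \<mu> k = average p F1 x \<mu> k)))"

(* Graph of Pi: g has components a_i(x_0, x_1 cnj x_1, ..., x_p cnj x_p, mu) x_i
   (and a_0, real, if zr) with polynomials a_i, and R has components Re(a_i) rho_i. *)

definition radial_map :: "bool \<Rightarrow> nat \<Rightarrow> nat \<Rightarrow>
    ((int \<Rightarrow> complex) \<Rightarrow> (nat \<Rightarrow> real) \<Rightarrow> int \<Rightarrow> complex) \<Rightarrow>
    ((nat \<Rightarrow> real) \<Rightarrow> (nat \<Rightarrow> real) \<Rightarrow> nat \<Rightarrow> real) \<Rightarrow> bool" where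
  "radial_map zr p s g R \<longleftrightarrow>
     (\<exists>N c.
        let a = (\<lambda>i u \<mu>. \<Sum>n\<le>N. heval (ridx zr p) s n (c i) u \<mu>);
            ivs = (\<lambda>x i. if i = 0 then x 0 else x (int i) * x (- int i));
            sq = (\<lambda>\<rho> i. complex_of_real (if i = 0 then \<rho> 0 else (\<rho> i)\<^sup>2))
        in (\<forall>x\<in>cpts zr p. \<forall>\<mu>\<in>params s.
              (\<forall>i\<in>{1..p}. g x \<mu> (int i) = a i (ivs x) \<mu> * x (int i) \<and>
                           g x \<mu> (- int i) = cnj (g x \<mu> (int i))) \<and>
              (zr \<longrightarrow> g x \<mu> 0 = a 0 (ivs x) \<mu> \<and> g x \<mu> 0 \<in> \<real>)) \<and>
           (\<forall>\<rho>\<in>vecs (ridx zr p). \<forall>\<mu>\<in>params s.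
              (\<forall>i\<in>{1..p}. R \<rho> \<mu> i = Re (a i (sq \<rho>) \<mu>) * \<rho> i) \<and>
              (zr \<longrightarrow> R \<rho> \<mu> 0 = Re (a 0 (sq \<rho>) \<mu>))))"

(* The radial part, up to degree l, of the center manifold equations in equivariant normal form of
   z'(t) = M z_t + G(z_t, mu)  is  rho' = F(rho, mu). *)

definition radial_part :: "real \<Rightarrow> ((real \<Rightarrow> real) \<Rightarrow> real) \<Rightarrow> bool \<Rightarrow> nat \<Rightarrow> (nat \<Rightarrow> real) \<Rightarrow>
    nat \<Rightarrow> nat \<Rightarrow> ((real \<Rightarrow> real) \<Rightarrow> (nat \<Rightarrow> real) \<Rightarrow> real) \<Rightarrow>
    ((nat \<Rightarrow> real) \<Rightarrow> (nat \<Rightarrow> real) \<Rightarrow> nat \<Rightarrow> real) \<Rightarrow> bool" where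
  "radial_part r M zr p \<omega> s l G F \<longleftrightarrow>
     (\<exists>g R. normal_form r M zr p \<omega> s l G g \<and>
        (\<forall>j\<in>{2..l}. radial_map zr p s (g j) (R j)) \<and>
        (\<forall>\<rho>\<in>vecs (ridx zr p). \<forall>\<mu>\<in>params s. \<forall>i\<in>ridx zr p.
           F \<rho> \<mu> i = (\<Sum>j = 2..l. R j \<rho> \<mu> i)))"

definition delay_args :: "bool \<Rightarrow> nat \<Rightarrow> (nat \<Rightarrow> real) \<Rightarrow> (real \<Rightarrow> real) \<Rightarrow> nat \<Rightarrow> real" where
  "delay_args zr p \<tau> u = (\<lambda>i. if i \<in> ridx zr p then u (\<tau> (pos zr i)) else 0)"

definition delay_cube :: "real \<Rightarrow> nat \<Rightarrow> (nat \<Rightarrow> real) set" where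
  "delay_cube r d = {\<tau> \<in> vecs {1..d}. \<forall>i\<in>{1..d}. \<tau> i \<in> {-r..0}}"

definition realizes :: "real \<Rightarrow> ((real \<Rightarrow> real) \<Rightarrow> real) \<Rightarrow> bool \<Rightarrow> nat \<Rightarrow> (nat \<Rightarrow> real) \<Rightarrow>
    nat \<Rightarrow> nat \<Rightarrow> (nat \<Rightarrow> real) \<Rightarrow>
    (nat \<Rightarrow> (nat \<Rightarrow> real) \<Rightarrow> real) \<Rightarrow> (nat \<Rightarrow> (nat \<Rightarrow> real) \<Rightarrow> (nat \<Rightarrow> real) \<Rightarrow> real) \<Rightarrow>
    (nat \<Rightarrow> (nat \<Rightarrow> real) \<Rightarrow> nat \<Rightarrow> real) \<Rightarrow>
    (nat \<Rightarrow> (nat \<Rightarrow> real) \<Rightarrow> (nat \<Rightarrow> real) \<Rightarrow> nat \<Rightarrow> real) \<Rightarrow> bool" where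
  "realizes r M zr p \<omega> s l \<tau> \<eta> \<xi> h q \<longleftrightarrow>
     radial_part r M zr p \<omega> s l
       (\<lambda>u \<mu>. (\<Sum>j = 2..l. \<eta> j (delay_args zr p \<tau> u)) + (\<Sum>j = 2..l. \<xi> j (delay_args zr p \<tau> u) \<mu>))
       (\<lambda>\<rho> \<mu> i. (\<Sum>j = 2..l. h j \<rho> i) + (\<Sum>j = 2..l. q j \<rho> \<mu> i))"

end

theory Submission
  imports Defs "HOL-Complex_Analysis.Conformal_Mappings"
begin

text \<open>The terms of degree \<open>j\<close> that enter step \<open>j\<close> of the normal form procedure depend on the
  nonlinearity of degree \<open>j\<close> only through the additive term \<open>\<Psi>(0) H\<^sub>j(\<Phi>x, \<mu>)\<close>, all other contributions
  coming from lower degrees. So \<open>\<eta>\<close> and \<open>\<xi>\<close> can be built degree by degree, provided that the linear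
  map from delayed nonlinearities of degree \<open>j\<close> to radial parts of their averages is onto. The delays
  enter this map only through the angles \<open>\<omega>\<^sub>k \<tau>\<^sub>c\<close>. Treating the angles as independent variables,
  one choice of them decouples the linear forms \<open>\<Phi>(\<tau>\<^sub>c) x\<close> up to the sign matrix \<open>K\<close> and
  makes the map diagonal in monomials with positive entries. Surjectivity there is witnessed by a product of
  pivots, a trigonometric polynomial in the angles. By Kronecker's theorem it is nonzero at some
  real vector \<open>\<tau>\<close>, and by analyticity it then vanishes on no open set of delay vectors.\<close>

section \<open>Functionals on continuous functions\<close>

text \<open>A delayed value of \<Phi> x is a linear form whose coefficients all have modulus one, so
  no choice of angles turns the \<open>d\<close> delayed values into coordinates. With angles
  shifted by 0 or \<pi> the coefficients form a matrix of signs, and an invertible sign matrix can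
  be undone linearly. A zero eigenvalue has no angle to shift, so its column must consist of ones.
  This is what \<open>K\<close> provides, and why the nonlinearities are polynomials in the inverse
  of \<open>K\<close> applied to the delayed values. The linear problem is square: a monomial of
  \<open>V\<close> has exactly one parity pattern, hence belongs to exactly one component of a
  sign-equivariant map. The phases of \<Psi>(0) must be compensated because only real parts survive
  in the radial equations. The delays supplied by Kronecker's theorem may lie anywhere on the real
  line. They only show that an analytic function of the delays is not identically zero, which
  already keeps its zeros inside the cube from having interior. Contributions of lower degrees are
  never computed: their averages are sign-equivariant, so they can be subtracted from the prescribed
  radial part.\<close>

locale delay_functional =
  fixes r :: real and M :: "(real \<Rightarrow> real) \<Rightarrow> real"
  assumes r_pos: "r > 0" and bounded: "bounded_op r M"
begin

abbreviation I :: "real set" where "I \<equiv> {-r..0}"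
abbreviation cont :: "(real \<Rightarrow> 'a::topological_space) \<Rightarrow> bool" where "cont f \<equiv> continuous_on I f"

lemma M_add: "cont f \<Longrightarrow> cont g \<Longrightarrow> M (\<lambda>\<theta>. f \<theta> + g \<theta>) = M f + M g"
  and M_scale: "cont f \<Longrightarrow> M (\<lambda>\<theta>. a * f \<theta>) = a * M f"
  using bounded unfolding bounded_op_def by blast+

text \<open>The bound by the supremum over \<open>I\<close> leaves no room for values off
  \<open>I\<close>: a difference that vanishes on \<open>I\<close> has norm zero.\<close>

lemma M_cong:
  assumes "cont f" "cont g" and eq: "\<And>\<theta>. \<theta> \<in> I \<Longrightarrow> f \<theta> = g \<theta>"
  shows "M f = M g"
proof -
  obtain b where b: "\<And>\<phi>. cont \<phi> \<Longrightarrow> \<bar>M \<phi>\<bar> \<le> b * (SUP \<theta>\<in>I. \<bar>\<phi> \<theta>\<bar>)"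
    using bounded unfolding bounded_op_def by blast
  have c: "cont (\<lambda>\<theta>. f \<theta> - g \<theta>)" using assms by (intro continuous_intros)
  have "(SUP \<theta>\<in>I. \<bar>f \<theta> - g \<theta>\<bar>) = (SUP \<theta>\<in>I. (0::real))"
    using eq by (intro SUP_cong) auto
  also have "\<dots> = 0" using r_pos by simp
  finally have "M (\<lambda>\<theta>. f \<theta> - g \<theta>) = 0" using b[OF c] by simp
  moreover have "M f = M (\<lambda>\<theta>. g \<theta> + (f \<theta> - g \<theta>))" by simp
  ultimately show ?thesis using M_add[OF assms(2) c] by simp
qed

lemma M_minus: "cont f \<Longrightarrow> M (\<lambda>\<theta>. - f \<theta>) = - M f"
  using M_scale[of f "-1"] by simp

lemma M_zero: "M (\<lambda>_. 0) = 0"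
  using M_scale[of "\<lambda>_. 0" 0] by simp

lemma M_diff: "cont f \<Longrightarrow> cont g \<Longrightarrow> M (\<lambda>\<theta>. f \<theta> - g \<theta>) = M f - M g"
  using M_add[of f "\<lambda>\<theta>. - g \<theta>"] M_minus[of g] by (simp add: continuous_on_minus)

lemma Lc_cong:
  assumes "cont f" "cont g" "\<And>\<theta>. \<theta> \<in> I \<Longrightarrow> f \<theta> = g \<theta>"
  shows "Lc M f = Lc M g"
  unfolding Lc_def using assms
  by (intro arg_cong2[where f=Complex] M_cong) (auto intro!: continuous_intros)

lemma Lc_add: "cont f \<Longrightarrow> cont g \<Longrightarrow> Lc M (\<lambda>\<theta>. f \<theta> + g \<theta>) = Lc M f + Lc M g"
  unfolding Lc_def by (simp add: M_add continuous_intros complex_eq_iff)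

lemma Lc_scale: "cont f \<Longrightarrow> Lc M (\<lambda>\<theta>. a * f \<theta>) = a * Lc M f"
  unfolding Lc_def
  by (simp add: M_add M_diff M_scale continuous_intros complex_eq_iff)

lemma Lc_minus: "cont f \<Longrightarrow> Lc M (\<lambda>\<theta>. - f \<theta>) = - Lc M f"
  using Lc_scale[of f "-1"] by simp

lemma Lc_diff: "cont f \<Longrightarrow> cont g \<Longrightarrow> Lc M (\<lambda>\<theta>. f \<theta> - g \<theta>) = Lc M f - Lc M g"
  using Lc_add[of f "\<lambda>\<theta>. - g \<theta>"] Lc_minus[of g] by (simp add: continuous_on_minus)

lemma Lc_cnj: "cont f \<Longrightarrow> Lc M (\<lambda>\<theta>. cnj (f \<theta>)) = cnj (Lc M f)"
  unfolding Lc_def by (simp add: M_minus continuous_intros complex_eq_iff)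

definition E :: "complex \<Rightarrow> real \<Rightarrow> complex" where
  "E z \<theta> = exp (z * of_real \<theta>)"

lemma E_0 [simp]: "E z 0 = 1" "E 0 \<theta> = 1" by (simp_all add: E_def)

lemma E_add: "E z (s + t) = E z s * E z t"
  by (simp add: E_def exp_add distrib_left)

lemma E_nonzero [simp]: "E z \<theta> \<noteq> 0" by (simp add: E_def)

lemma E_minus: "E (- z) \<theta> * E z \<theta> = 1" "E z \<theta> * E (- z) \<theta> = 1"
  by (simp_all add: E_def flip: exp_add)

lemma E_deriv: "(E z has_vector_derivative z * E z \<theta>) (at \<theta> within S)"
  unfolding E_def
  by (auto intro!: derivative_eq_intros has_vector_derivative_real_field)

lemma E_cont [continuous_intros]: "continuous_on S (E z)"
  unfolding E_def by (intro continuous_intros)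

text \<open>The solution on \<open>I\<close> of c' = z c - \<phi> with c 0 = 0, the particular part
  of the resolvent of the generator.\<close>

definition exp_conv :: "complex \<Rightarrow> (real \<Rightarrow> complex) \<Rightarrow> real \<Rightarrow> complex" where
  "exp_conv z \<phi> \<theta> = E z \<theta> * integral {\<theta>..0} (\<lambda>\<zeta>. E (- z) \<zeta> * \<phi> \<zeta>)"

text \<open>The form \<open>bform\<close> with first argument \<open>E (- z)\<close>. Each row of
  \<open>Psi\<close> is a constant times such an exponential, so the decomposition of the phase
  space can be expressed through \<open>exp_form\<close>.\<close>

definition exp_form :: "complex \<Rightarrow> (real \<Rightarrow> complex) \<Rightarrow> complex" where
  "exp_form z \<phi> = \<phi> 0 + Lc M (exp_conv z \<phi>)"

definition \<Delta> :: "complex \<Rightarrow> complex" where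
  "\<Delta> z = z - Lc M (E z)"

lemma exp_conv_0 [simp]: "exp_conv z \<phi> 0 = 0" by (simp add: exp_conv_def)

lemma exp_conv_deriv:
  assumes "cont \<phi>" "\<theta> \<in> I"
  shows "(exp_conv z \<phi> has_vector_derivative z * exp_conv z \<phi> \<theta> - \<phi> \<theta>) (at \<theta> within I)"
proof -
  have c: "cont (\<lambda>\<zeta>. E (- z) \<zeta> * \<phi> \<zeta>)" by (intro continuous_intros assms)
  note d = integral_has_vector_derivative'[OF c assms(2)]
  have "(exp_conv z \<phi> has_vector_derivative E z \<theta> * - (E (- z) \<theta> * \<phi> \<theta>)
      + z * E z \<theta> * integral {\<theta>..0} (\<lambda>\<zeta>. E (- z) \<zeta> * \<phi> \<zeta>)) (at \<theta> within I)"
    unfolding exp_conv_def[abs_def] by (rule has_vector_derivative_mult[OF E_deriv d])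
  moreover have "E z \<theta> * - (E (- z) \<theta> * \<phi> \<theta>)
      + z * E z \<theta> * integral {\<theta>..0} (\<lambda>\<zeta>. E (- z) \<zeta> * \<phi> \<zeta>) = z * exp_conv z \<phi> \<theta> - \<phi> \<theta>"
    using E_minus(2)[of z \<theta>] unfolding exp_conv_def by (simp add: mult.assoc[symmetric])
  ultimately show ?thesis by metis
qed

lemma exp_conv_cont: "cont \<phi> \<Longrightarrow> cont (exp_conv z \<phi>)"
  using exp_conv_deriv by (meson continuous_on_eq_continuous_within has_vector_derivative_continuous)

lemma exp_conv_cong: "(\<And>\<theta>. \<theta> \<in> I \<Longrightarrow> f \<theta> = g \<theta>) \<Longrightarrow> \<theta> \<in> I \<Longrightarrow> exp_conv z f \<theta> = exp_conv z g \<theta>"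
  unfolding exp_conv_def by (intro arg_cong2[where f="(*)"] integral_cong refl) auto

lemma exp_form_cong: "cont f \<Longrightarrow> cont g \<Longrightarrow> (\<And>\<theta>. \<theta> \<in> I \<Longrightarrow> f \<theta> = g \<theta>) \<Longrightarrow> exp_form z f = exp_form z g"
  unfolding exp_form_def using r_pos
  by (intro arg_cong2[where f="(+)"] Lc_cong exp_conv_cont) (auto intro: exp_conv_cong)

lemma integrable_E:
  assumes "cont f" "\<theta> \<in> I" shows "(\<lambda>\<zeta>. E z \<zeta> * f \<zeta>) integrable_on {\<theta>..0}"
proof -
  have "continuous_on {\<theta>..0} f" using assms by (auto intro: continuous_on_subset)
  then show ?thesis by (intro integrable_continuous_real continuous_intros)
qed

lemma exp_conv_add:
  "cont f \<Longrightarrow> cont g \<Longrightarrow> \<theta> \<in> I \<Longrightarrow> exp_conv z (\<lambda>\<theta>. f \<theta> + g \<theta>) \<theta> = exp_conv z f \<theta> + exp_conv z g \<theta>"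
  unfolding exp_conv_def by (simp add: distrib_left integral_add integrable_E)

lemma exp_conv_scale: "exp_conv z (\<lambda>\<theta>. a * f \<theta>) \<theta> = a * exp_conv z f \<theta>"
proof -
  have "(\<lambda>\<zeta>. E (- z) \<zeta> * (a * f \<zeta>)) = (\<lambda>\<zeta>. a * (E (- z) \<zeta> * f \<zeta>))" by (simp add: ac_simps)
  then show ?thesis by (simp add: exp_conv_def)
qed

lemma exp_form_add: "cont f \<Longrightarrow> cont g \<Longrightarrow> exp_form z (\<lambda>\<theta>. f \<theta> + g \<theta>) = exp_form z f + exp_form z g"
proof -
  assume f: "cont f" and g: "cont g"
  have "Lc M (exp_conv z (\<lambda>\<theta>. f \<theta> + g \<theta>)) = Lc M (\<lambda>\<theta>. exp_conv z f \<theta> + exp_conv z g \<theta>)"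
    using f g by (intro Lc_cong continuous_intros exp_conv_cont) (auto simp: exp_conv_add)
  then show ?thesis by (simp add: exp_form_def Lc_add exp_conv_cont f g)
qed

lemma exp_form_scale: "cont f \<Longrightarrow> exp_form z (\<lambda>\<theta>. a * f \<theta>) = a * exp_form z f"
  unfolding exp_form_def by (simp add: exp_conv_scale[abs_def] Lc_scale exp_conv_cont distrib_left)

lemma exp_form_zero [simp]: "exp_form z (\<lambda>_. 0) = 0"
  using exp_form_scale[of "\<lambda>_. 0" z 0] by simp

lemma exp_form_diff: "cont f \<Longrightarrow> cont g \<Longrightarrow> exp_form z (\<lambda>\<theta>. f \<theta> - g \<theta>) = exp_form z f - exp_form z g"
  using exp_form_add[of f "\<lambda>\<theta>. (-1) * g \<theta>" z] exp_form_scale[of g z "-1"] by (simp add: continuous_on_minus)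

lemma exp_form_sum:
  "finite A \<Longrightarrow> (\<And>a. a \<in> A \<Longrightarrow> cont (f a)) \<Longrightarrow>
    exp_form z (\<lambda>\<theta>. \<Sum>a\<in>A. f a \<theta>) = (\<Sum>a\<in>A. exp_form z (f a))"
  by (induction A rule: finite_induct) (simp_all add: exp_form_add continuous_on_sum)

lemma E_cnj: "cnj (E z \<theta>) = E (cnj z) \<theta>"
  by (simp add: E_def exp_cnj)

lemma exp_conv_cnj: "exp_conv (cnj z) (\<lambda>\<theta>. cnj (f \<theta>)) \<theta> = cnj (exp_conv z f \<theta>)"
  by (simp add: exp_conv_def E_cnj integral_cnj)

lemma exp_form_cnj: "cont f \<Longrightarrow> exp_form (cnj z) (\<lambda>\<theta>. cnj (f \<theta>)) = cnj (exp_form z f)"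
  unfolding exp_form_def by (simp add: exp_conv_cnj[abs_def] Lc_cnj exp_conv_cont)

lemma bform_eq_exp_form:
  assumes "cont \<phi>"
  shows "bform M (\<lambda>\<zeta>. E (- z) \<zeta> * a) \<phi> = a * exp_form z \<phi>"
proof -
  have "integral {\<theta>..0} (\<lambda>\<zeta>. E (- z) (\<zeta> - \<theta>) * a * \<phi> \<zeta>) = a * exp_conv z \<phi> \<theta>" for \<theta>
  proof -
    have "(\<lambda>\<zeta>. E (- z) (\<zeta> - \<theta>) * a * \<phi> \<zeta>) = (\<lambda>\<zeta>. (a * E z \<theta>) * (E (- z) \<zeta> * \<phi> \<zeta>))"
      by (simp add: E_def fun_eq_iff algebra_simps exp_diff exp_minus field_simps)
    then show ?thesis by (simp add: exp_conv_def)
  qed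
  then show ?thesis
    unfolding bform_def exp_form_def by (simp add: Lc_scale exp_conv_cont assms distrib_left)
qed

text \<open>Duality between the generator and its formal adjoint.\<close>

lemma exp_form_deriv:
  assumes d: "\<And>\<theta>. \<theta> \<in> I \<Longrightarrow> (c has_vector_derivative c' \<theta>) (at \<theta> within I)" and c': "cont c'"
  shows "exp_form z c' = c' 0 - Lc M c + z * exp_form z c - \<Delta> z * c 0"
proof -
  have c: "cont c" using d by (meson continuous_on_eq_continuous_within has_vector_derivative_continuous)
  have "exp_conv z c' \<theta> = c 0 * E z \<theta> - c \<theta> + z * exp_conv z c \<theta>" if \<theta>: "\<theta> \<in> I" for \<theta>
  proof -
    \<comment> \<open>Integration by parts: the derivative is shifted from \<open>c\<close> to the
      exponential weight.\<close>
    have "((\<lambda>\<zeta>. E (- z) \<zeta> * c' \<zeta> + (- z * E (- z) \<zeta>) * c \<zeta>) has_integral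
        E (- z) 0 * c 0 - E (- z) \<theta> * c \<theta>) {\<theta>..0}"
    proof (rule fundamental_theorem_of_calculus)
      fix \<zeta> assume "\<zeta> \<in> {\<theta>..0}"
      with \<theta> have "(c has_vector_derivative c' \<zeta>) (at \<zeta> within {\<theta>..0})"
        by (intro has_vector_derivative_within_subset[OF d]) auto
      then show "((\<lambda>\<zeta>. E (- z) \<zeta> * c \<zeta>) has_vector_derivative
          E (- z) \<zeta> * c' \<zeta> + (- z * E (- z) \<zeta>) * c \<zeta>) (at \<zeta> within {\<theta>..0})"
        by (rule has_vector_derivative_mult[OF E_deriv])
    qed (use \<theta> in auto)
    then have 1: "integral {\<theta>..0} (\<lambda>\<zeta>. E (- z) \<zeta> * c' \<zeta> + (- z) * (E (- z) \<zeta> * c \<zeta>))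
        = c 0 - E (- z) \<theta> * c \<theta>"
      by (simp add: integral_unique mult.assoc)
    have 2: "integral {\<theta>..0} (\<lambda>\<zeta>. E (- z) \<zeta> * c' \<zeta> + (- z) * (E (- z) \<zeta> * c \<zeta>))
        = integral {\<theta>..0} (\<lambda>\<zeta>. E (- z) \<zeta> * c' \<zeta>) + (- z) * integral {\<theta>..0} (\<lambda>\<zeta>. E (- z) \<zeta> * c \<zeta>)"
      using integrable_E[OF c' \<theta>] integrable_E[OF c \<theta>]
      by (subst integral_add) (simp_all only: integral_mult_right integrable_on_mult_right)
    have *: "integral {\<theta>..0} (\<lambda>\<zeta>. E (- z) \<zeta> * c' \<zeta>)
        = c 0 - E (- z) \<theta> * c \<theta> + z * integral {\<theta>..0} (\<lambda>\<zeta>. E (- z) \<zeta> * c \<zeta>)"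
      using trans[OF 2[symmetric] 1] by (simp add: algebra_simps)
    have "exp_conv z c' \<theta> = c 0 * E z \<theta> - (E z \<theta> * E (- z) \<theta>) * c \<theta> + z * exp_conv z c \<theta>"
      unfolding exp_conv_def * by (simp add: algebra_simps)
    then show ?thesis by (simp add: E_minus)
  qed
  then have "Lc M (exp_conv z c') = Lc M (\<lambda>\<theta>. c 0 * E z \<theta> - c \<theta> + z * exp_conv z c \<theta>)"
    using c c' by (intro Lc_cong continuous_intros exp_conv_cont)
  also have "\<dots> = c 0 * Lc M (E z) - Lc M c + z * Lc M (exp_conv z c)"
    using c by (simp add: Lc_add Lc_diff Lc_scale exp_conv_cont continuous_intros)
  finally show ?thesis by (simp add: exp_form_def \<Delta>_def algebra_simps)
qed

text \<open>Duality applied to \<open>c = E w\<close>. For two distinct zeros of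
  \<open>\<Delta>\<close> it yields orthogonality, which is why \<open>Psi\<close> and
  \<open>Phi\<close> are dual bases up to scaling.\<close>

lemma exp_form_E: "(w - z) * exp_form z (E w) = \<Delta> w - \<Delta> z"
proof -
  have "exp_form z (\<lambda>\<theta>. w * E w \<theta>) = w - Lc M (E w) + z * exp_form z (E w) - \<Delta> z"
    using exp_form_deriv[OF E_deriv, of w z] by (simp add: continuous_intros)
  then show ?thesis by (simp add: exp_form_scale continuous_intros \<Delta>_def algebra_simps)
qed

text \<open>The right-hand side is the derivative of \<open>\<Delta>\<close> at \<open>z\<close>,
  the limit of the quotient in \<open>exp_form_E\<close>. At a zero of \<open>\<Delta>\<close> its
  vanishing means a multiple zero.\<close>

lemma exp_form_E_same: "exp_form z (E z) = 1 - Lc M (\<lambda>\<theta>. of_real \<theta> * E z \<theta>)"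
proof -
  have "Lc M (exp_conv z (E z)) = Lc M (\<lambda>\<theta>. - (of_real \<theta> * E z \<theta>))"
    by (intro Lc_cong exp_conv_cont continuous_intros) (auto simp: exp_conv_def E_minus scaleR_conv_of_real)
  then show ?thesis by (simp add: exp_form_def Lc_minus continuous_intros)
qed

subsection \<open>Eigenvalues of the generator\<close>

text \<open>The eigenvectors and generalized eigenvectors in question extend to explicit functions
  on the whole line, so one function can serve both as initial value and as solution. Uniform
  continuity of \<open>u'\<close> makes the difference quotient converge uniformly.\<close>

lemma gen_intro:
  assumes d: "\<And>t. (u has_vector_derivative u' t) (at t)" and u': "continuous_on UNIV u'"
    and eq: "\<And>t. t \<ge> 0 \<Longrightarrow> u' t = Lc M (\<lambda>\<theta>. u (t + \<theta>))"
  shows "gen r M u u'"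
proof -
  have cu: "continuous_on S u" for S
    by (meson continuous_at_imp_continuous_on d has_vector_derivative_continuous)
  have cu': "continuous_on S u'" for S using u' continuous_on_subset by blast
  have "lin_solution r M u u"
    unfolding lin_solution_def
    using cu eq[symmetric] d by (auto intro: has_vector_derivative_at_within)
  moreover have "uniform_limit I (\<lambda>h \<theta>. (u (h + \<theta>) - u \<theta>) /\<^sub>R h) u' (at_right 0)"
  proof (rule uniform_limitI)
    fix e :: real assume e: "e > 0"
    \<comment> \<open>The interval reaches to 1 because the quotient at \<theta> with step
      \<open>h < 1\<close> sees arguments up to \<theta> + h.\<close>
    have "uniformly_continuous_on {-r..1} u'"
      by (intro compact_uniformly_continuous cu') simp
    then obtain \<delta> where \<delta>: "\<delta> > 0"
      "\<And>s t. s \<in> {-r..1} \<Longrightarrow> t \<in> {-r..1} \<Longrightarrow> dist s t < \<delta> \<Longrightarrow> dist (u' s) (u' t) < e / 2"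
      unfolding uniformly_continuous_on_def using e by (metis half_gt_zero_iff)
    have "\<forall>\<^sub>F h in at_right (0::real). h < min \<delta> 1 \<and> h > 0"
      using \<delta>(1) by (intro eventually_conj eventually_at_right_less eventually_at_right_real)
        (auto simp: eventually_at_right intro!: exI[of _ "min \<delta> 1"])
    then show "\<forall>\<^sub>F h in at_right 0. \<forall>\<theta>\<in>I. dist ((u (h + \<theta>) - u \<theta>) /\<^sub>R h) (u' \<theta>) < e"
    proof (eventually_elim, intro ballI)
      fix h \<theta> assume h: "h < min \<delta> 1 \<and> h > 0" and \<theta>: "\<theta> \<in> I"
      have "norm (u (h + \<theta>) - u \<theta> - (h + \<theta> - \<theta>) *\<^sub>R u' \<theta>) \<le> norm (h + \<theta> - \<theta>) * (e / 2)"
      proof (rule vector_differentiable_bound_linearization)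
        show "closed_segment \<theta> (h + \<theta>) \<subseteq> {\<theta>..h + \<theta>}"
          using h by (simp add: closed_segment_eq_real_ivl)
        show "norm (u' x - u' \<theta>) \<le> e / 2" if "x \<in> {\<theta>..h + \<theta>}" for x
          using \<delta>(2)[of x \<theta>] that h \<theta> by (auto simp: dist_norm dist_real_def intro!: less_imp_le)
      qed (use h d in \<open>auto intro: has_vector_derivative_at_within\<close>)
      then have "norm ((u (h + \<theta>) - u \<theta> - h *\<^sub>R u' \<theta>) /\<^sub>R h) \<le> e / 2"
        unfolding norm_scaleR using h by (simp add: field_simps)
      moreover have "(u (h + \<theta>) - u \<theta> - h *\<^sub>R u' \<theta>) /\<^sub>R h = (u (h + \<theta>) - u \<theta>) /\<^sub>R h - u' \<theta>"
        using h by (simp add: scaleR_diff_right)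
      ultimately show "dist ((u (h + \<theta>) - u \<theta>) /\<^sub>R h) (u' \<theta>) < e"
        using e by (simp add: dist_norm)
    qed
  qed
  ultimately show ?thesis unfolding gen_def using cu cu' by blast
qed

lemma gen_E:
  assumes "\<Delta> z = 0"
  shows "gen r M (E z) (\<lambda>\<theta>. z * E z \<theta>)"
proof (rule gen_intro)
  show "z * E z t = Lc M (\<lambda>\<theta>. E z (t + \<theta>))" for t
    using assms by (simp add: E_add Lc_scale E_cont \<Delta>_def)
qed (auto intro!: E_deriv continuous_intros)

lemma eigenvalueI: "\<Delta> z = 0 \<Longrightarrow> is_eigenvalue r M z"
  unfolding is_eigenvalue_def using gen_E r_pos
  by (intro exI[of _ "E z"]) (auto intro!: bexI[of _ 0])

text \<open>The generator is defined by a right-hand difference quotient only. Its uniformity in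
  \<theta> upgrades it to a two-sided derivative of \<phi> on \<open>I\<close>, so \<phi> is a
  multiple of \<open>E z\<close>. Comparing right derivatives of the solution at 0 then gives the
  characteristic equation.\<close>

lemma eigenvalue_root:
  assumes "is_eigenvalue r M z"
  shows "\<Delta> z = 0"
proof -
  obtain \<phi> u where nz: "\<exists>\<theta>\<in>I. \<phi> \<theta> \<noteq> 0" and c: "cont \<phi>"
    and sol: "lin_solution r M \<phi> u"
    and lim: "uniform_limit I (\<lambda>h \<theta>. (u (h + \<theta>) - \<phi> \<theta>) /\<^sub>R h) (\<lambda>\<theta>. z * \<phi> \<theta>) (at_right 0)"
    using assms unfolding is_eigenvalue_def gen_def by blast
  have u\<phi>: "\<And>\<theta>. \<theta> \<in> I \<Longrightarrow> u \<theta> = \<phi> \<theta>" and uc: "continuous_on {-r..} u"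
    using sol by (auto simp: lin_solution_def)
  \<comment> \<open>The limit as a remainder estimate that is uniform in the base point, so that it
    can be used at \<open>y\<close> as well as at \<theta>.\<close>
  have step: "\<exists>d>0. \<forall>\<theta>\<in>I. \<forall>h. 0 < h \<and> h < d \<longrightarrow> norm (u (h + \<theta>) - \<phi> \<theta> - h *\<^sub>R (z * \<phi> \<theta>)) \<le> e * h"
    if e: "e > 0" for e
  proof -
    have "\<forall>\<^sub>F h in at_right 0. \<forall>\<theta>\<in>I. dist ((u (h + \<theta>) - \<phi> \<theta>) /\<^sub>R h) (z * \<phi> \<theta>) < e"
      by (rule uniform_limitD[OF lim e])
    then obtain d where d: "d > 0"
      "\<And>h \<theta>. 0 < h \<Longrightarrow> h < d \<Longrightarrow> \<theta> \<in> I \<Longrightarrow> dist ((u (h + \<theta>) - \<phi> \<theta>) /\<^sub>R h) (z * \<phi> \<theta>) < e"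
      unfolding eventually_at_right_field by auto
    have "norm (u (h + \<theta>) - \<phi> \<theta> - h *\<^sub>R (z * \<phi> \<theta>)) \<le> e * h" if h: "0 < h" "h < d" and \<theta>: "\<theta> \<in> I" for h \<theta>
    proof -
      have "u (h + \<theta>) - \<phi> \<theta> - h *\<^sub>R (z * \<phi> \<theta>) = h *\<^sub>R ((u (h + \<theta>) - \<phi> \<theta>) /\<^sub>R h - z * \<phi> \<theta>)"
        using h by (simp add: scaleR_diff_right)
      then have "norm (u (h + \<theta>) - \<phi> \<theta> - h *\<^sub>R (z * \<phi> \<theta>)) = h * dist ((u (h + \<theta>) - \<phi> \<theta>) /\<^sub>R h) (z * \<phi> \<theta>)"
        using h by (simp only: dist_norm norm_scaleR abs_of_pos)
      also have "\<dots> \<le> h * e" using d(2)[OF h \<theta>] h by (intro mult_left_mono) auto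
      finally show ?thesis by (simp add: mult.commute)
    qed
    then show ?thesis using d(1) by blast
  qed
  have bl: "bounded_linear (\<lambda>h::real. h *\<^sub>R (a::complex))" for a
    by (rule bounded_linear_scaleR_left)
  have d\<phi>: "(\<phi> has_vector_derivative z * \<phi> \<theta>) (at \<theta> within I)" if \<theta>: "\<theta> \<in> I" for \<theta>
    unfolding has_vector_derivative_def has_derivative_within_alt
  proof (intro conjI bl allI impI)
    fix e :: real assume e: "e > 0"
    then have e2: "e / 2 > 0" by simp
    obtain d1 where d1: "d1 > 0" "\<And>\<theta> h. \<theta> \<in> I \<Longrightarrow> 0 < h \<Longrightarrow> h < d1 \<Longrightarrow>
        norm (u (h + \<theta>) - \<phi> \<theta> - h *\<^sub>R (z * \<phi> \<theta>)) \<le> e / 2 * h"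
      using step[OF e2] by blast
    have "cont (\<lambda>\<theta>. z * \<phi> \<theta>)" by (intro continuous_intros c)
    then obtain d2 where d2: "d2 > 0" "\<And>y. y \<in> I \<Longrightarrow> dist y \<theta> < d2 \<Longrightarrow> dist (z * \<phi> y) (z * \<phi> \<theta>) < e / 2"
      using \<theta> e2 unfolding continuous_on_iff by metis
    have "norm (\<phi> y - \<phi> \<theta> - (y - \<theta>) *\<^sub>R (z * \<phi> \<theta>)) \<le> e * norm (y - \<theta>)"
      if y: "y \<in> I" and lt: "norm (y - \<theta>) < min d1 d2" for y
    proof -
      consider "y = \<theta>" | "y > \<theta>" | "y < \<theta>" by linarith
      then show ?thesis
      proof cases
        case 2
        have "norm (\<phi> y - \<phi> \<theta> - (y - \<theta>) *\<^sub>R (z * \<phi> \<theta>)) \<le> e / 2 * (y - \<theta>)"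
          using d1(2)[OF \<theta>, of "y - \<theta>"] 2 lt u\<phi>[OF y] by simp
        also have "\<dots> \<le> e * (y - \<theta>)" using 2 e by simp
        finally show ?thesis using 2 by simp
      next
        \<comment> \<open>To the left of \<theta> the quotient is based at \<open>y\<close>, and
          continuity of z \<phi> replaces the slope at \<open>y\<close> by the slope at
          \<theta>.\<close>
        case 3
        have n1: "norm (\<phi> \<theta> - \<phi> y - (\<theta> - y) *\<^sub>R (z * \<phi> y)) \<le> e / 2 * (\<theta> - y)"
          using d1(2)[OF y, of "\<theta> - y"] 3 lt u\<phi>[OF \<theta>] by simp
        have n2: "norm ((\<theta> - y) *\<^sub>R (z * \<phi> y - z * \<phi> \<theta>)) \<le> (\<theta> - y) * (e / 2)"
          using d2(2)[OF y] lt 3 by (auto simp: dist_norm intro!: mult_left_mono less_imp_le)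
        have n3: "\<phi> y - \<phi> \<theta> - (y - \<theta>) *\<^sub>R (z * \<phi> \<theta>)
          = - (\<phi> \<theta> - \<phi> y - (\<theta> - y) *\<^sub>R (z * \<phi> y)) - (\<theta> - y) *\<^sub>R (z * \<phi> y - z * \<phi> \<theta>)"
          by (simp add: scaleR_diff_right scaleR_diff_left algebra_simps)
        have "norm (\<phi> y - \<phi> \<theta> - (y - \<theta>) *\<^sub>R (z * \<phi> \<theta>))
          \<le> norm (- (\<phi> \<theta> - \<phi> y - (\<theta> - y) *\<^sub>R (z * \<phi> y))) + norm ((\<theta> - y) *\<^sub>R (z * \<phi> y - z * \<phi> \<theta>))"
          unfolding n3 by (rule norm_triangle_ineq4)
        also have "\<dots> \<le> e / 2 * (\<theta> - y) + (\<theta> - y) * (e / 2)"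
          unfolding norm_minus_cancel using n1 n2 by (rule add_mono)
        finally have "norm (\<phi> y - \<phi> \<theta> - (y - \<theta>) *\<^sub>R (z * \<phi> \<theta>)) \<le> e / 2 * (\<theta> - y) + (\<theta> - y) * (e / 2)" .
        then show ?thesis using 3 by simp
      qed simp
    qed
    then show "\<exists>d>0. \<forall>y\<in>I. norm (y - \<theta>) < d \<longrightarrow>
        norm (\<phi> y - \<phi> \<theta> - (y - \<theta>) *\<^sub>R (z * \<phi> \<theta>)) \<le> e * norm (y - \<theta>)"
      using d1(1) d2(1) by (intro exI[of _ "min d1 d2"]) auto
  qed
  have "((\<lambda>\<theta>. E (- z) \<theta> * \<phi> \<theta>) has_vector_derivative 0) (at \<theta> within I)" if "\<theta> \<in> I" for \<theta>
    using has_vector_derivative_mult[OF E_deriv d\<phi>[OF that], of "-z"] by (simp add: algebra_simps)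
  then obtain a where a: "\<And>\<theta>. \<theta> \<in> I \<Longrightarrow> E (- z) \<theta> * \<phi> \<theta> = a"
    using has_vector_derivative_zero_constant[OF convex_real_interval(5)] by blast
  have \<phi>E: "\<phi> \<theta> = a * E z \<theta>" if "\<theta> \<in> I" for \<theta>
  proof -
    have "\<phi> \<theta> = E z \<theta> * (E (- z) \<theta> * \<phi> \<theta>)" by (simp add: E_minus flip: mult.assoc)
    then show ?thesis unfolding a[OF that] by (simp add: mult.commute)
  qed
  have a0: "a \<noteq> 0" using nz \<phi>E by auto
  \<comment> \<open>At \<theta> = 0 the quotient is the right derivative of the solution itself, for
    which the delay equation prescribes \<open>Lc M u\<close>.\<close>
  have "(u has_vector_derivative z * \<phi> 0) (at 0 within {0..})"
    unfolding has_vector_derivative_def has_derivative_within_alt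
  proof (intro conjI bl allI impI)
    fix e :: real assume e: "e > 0"
    show "\<exists>d>0. \<forall>y\<in>{0..}. norm (y - 0) < d \<longrightarrow>
        norm (u y - u 0 - (y - 0) *\<^sub>R (z * \<phi> 0)) \<le> e * norm (y - 0)"
    proof -
      obtain d where d: "d > 0" "\<And>\<theta> h. \<theta> \<in> I \<Longrightarrow> 0 < h \<Longrightarrow> h < d \<Longrightarrow>
          norm (u (h + \<theta>) - \<phi> \<theta> - h *\<^sub>R (z * \<phi> \<theta>)) \<le> e * h"
        using step[OF e] by blast
      have "norm (u y - u 0 - (y - 0) *\<^sub>R (z * \<phi> 0)) \<le> e * norm (y - 0)" if "y \<ge> 0" "norm (y - 0) < d" for y
        using d(2)[of 0 y] u\<phi>[of 0] r_pos that by (cases "y = 0") auto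
      then show ?thesis using d(1) by auto
    qed
  qed
  moreover have "(u has_vector_derivative Lc M u) (at 0 within {0..})"
    using sol unfolding lin_solution_def by force
  ultimately have "z * \<phi> 0 = Lc M u"
    by (rule vector_derivative_unique_within[rotated]) (simp add: at_within_Ici_at_right)
  also have "\<dots> = Lc M (\<lambda>\<theta>. a * E z \<theta>)"
    using \<phi>E u\<phi> by (intro Lc_cong continuous_intros continuous_on_subset[OF uc]) auto
  finally show ?thesis
    using \<phi>E[of 0] r_pos a0 by (simp add: Lc_scale E_cont \<Delta>_def)
qed

text \<open>A double zero of \<open>\<Delta>\<close> produces the generalized eigenvector \<open>\<theta> * E z \<theta>\<close>.\<close>

lemma simple_eigenvalue_exp_form:
  assumes simple: "simple_eigenvalue r M z"
  shows "exp_form z (E z) \<noteq> 0"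
proof
  assume 0: "exp_form z (E z) = 0"
  have Delta_root: "\<Delta> z = 0" using simple eigenvalue_root by (simp add: simple_eigenvalue_def)
  let ?v = "\<lambda>t. of_real t * E z t" and ?v' = "\<lambda>t. (1 + z * of_real t) * E z t"
  have M1: "Lc M ?v = 1" using 0 by (simp add: exp_form_E_same)
  have "gen r M ?v ?v'"
  proof (rule gen_intro)
    show "(?v has_vector_derivative ?v' t) (at t)" for t
    proof -
      have "(complex_of_real has_vector_derivative 1) (at t)"
        using has_vector_derivative_of_real[OF DERIV_ident] by simp
      from has_vector_derivative_mult[OF this E_deriv] show ?thesis
        by (simp add: algebra_simps)
    qed
    show "?v' t = Lc M (\<lambda>\<theta>. ?v (t + \<theta>))" for t
    proof -
      have "Lc M (\<lambda>\<theta>. ?v (t + \<theta>)) = Lc M (\<lambda>\<theta>. (of_real t * E z t) * E z \<theta> + E z t * ?v \<theta>)"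
        by (simp add: E_add algebra_simps)
      also have "\<dots> = of_real t * E z t * Lc M (E z) + E z t * Lc M ?v"
        by (subst Lc_add) (simp_all add: Lc_scale continuous_intros)
      finally show ?thesis using Delta_root M1 by (simp add: \<Delta>_def algebra_simps)
    qed
  qed (auto intro!: continuous_intros)
  moreover have "gen_kernel r M z 1 (\<lambda>\<theta>. ?v' \<theta> - z * ?v \<theta>)"
    using gen_E[OF Delta_root] by (auto simp: algebra_simps cong: bex_cong)
  ultimately have k2: "gen_kernel r M z (Suc 1) ?v" unfolding gen_kernel.simps(2)[of _ _ _ 1] by blast
  have k1: "gen_kernel r M z 1 (E z)" using gen_E[OF Delta_root] by auto
  obtain \<phi>0 where \<phi>0: "\<And>n \<phi>. gen_kernel r M z n \<phi> \<Longrightarrow> \<exists>a. \<forall>\<theta>\<in>I. \<phi> \<theta> = a * \<phi>0 \<theta>"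
    using simple unfolding simple_eigenvalue_def by blast
  obtain a where a: "\<And>\<theta>. \<theta> \<in> I \<Longrightarrow> E z \<theta> = a * \<phi>0 \<theta>" using \<phi>0[OF k1] by blast
  obtain c where c: "\<And>\<theta>. \<theta> \<in> I \<Longrightarrow> ?v \<theta> = c * \<phi>0 \<theta>" using \<phi>0[OF k2] by blast
  \<comment> \<open>\<open>E z\<close> is 1 at 0, while \<open>\<theta> * E z \<theta>\<close>
    vanishes there but not at \<open>- r\<close>; hence the two cannot be multiples of one
    function.\<close>
  have "\<phi>0 0 \<noteq> 0" "c * \<phi>0 0 = 0" using a[of 0] c[of 0] r_pos by auto
  then have "c = 0" by simp
  then have "?v (- r) = 0" using c[of "- r"] r_pos by simp
  then show False using r_pos by simp
qed

end

subsection \<open>Functions with continuous derivative\<close>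

context delay_functional
begin

abbreviation D :: "(real \<Rightarrow> 'a::real_normed_vector) \<Rightarrow> real \<Rightarrow> 'a" where
  "D \<phi> \<theta> \<equiv> vector_derivative \<phi> (at \<theta> within I)"

lemma D_eqI: "(\<phi> has_vector_derivative d) (at \<theta> within I) \<Longrightarrow> \<theta> \<in> I \<Longrightarrow> D \<phi> \<theta> = d"
  using vector_derivative_within_cbox[of "-r" 0] r_pos by simp

lemma C1_D:
  assumes "C1_on r \<phi>" "\<theta> \<in> I" shows "(\<phi> has_vector_derivative D \<phi> \<theta>) (at \<theta> within I)"
proof -
  obtain \<phi>' where "\<forall>\<theta>\<in>I. (\<phi> has_vector_derivative \<phi>' \<theta>) (at \<theta> within I)"
    using assms(1) unfolding C1_on_def by blast
  then show ?thesis using assms(2) D_eqI[of \<phi> "\<phi>' \<theta>" \<theta>] by simp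
qed

lemma C1_D_cont:
  assumes "C1_on r \<phi>" shows "cont (D \<phi>)"
proof -
  obtain \<phi>' where \<phi>': "cont \<phi>'" "\<forall>\<theta>\<in>I. (\<phi> has_vector_derivative \<phi>' \<theta>) (at \<theta> within I)"
    using assms unfolding C1_on_def by blast
  then have "D \<phi> \<theta> = \<phi>' \<theta>" if "\<theta> \<in> I" for \<theta> using that D_eqI by blast
  then show ?thesis using \<phi>'(1) continuous_on_cong[of I I "D \<phi>" \<phi>'] by blast
qed

lemma C1_cont: "C1_on r \<phi> \<Longrightarrow> cont \<phi>"
  by (meson C1_D continuous_on_eq_continuous_within has_vector_derivative_continuous)

lemma C1I:
  "(\<And>\<theta>. \<theta> \<in> I \<Longrightarrow> (\<phi> has_vector_derivative \<phi>' \<theta>) (at \<theta> within I)) \<Longrightarrow> cont \<phi>' \<Longrightarrow> C1_on r \<phi>"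
  unfolding C1_on_def by blast

lemma C1_add: "C1_on r f \<Longrightarrow> C1_on r g \<Longrightarrow> C1_on r (\<lambda>\<theta>. f \<theta> + g \<theta>)"
  by (rule C1I[where \<phi>' = "\<lambda>\<theta>. D f \<theta> + D g \<theta>"])
    (auto intro!: has_vector_derivative_add C1_D continuous_intros C1_D_cont)

lemma C1_bounded_linear:
  assumes "bounded_linear h" "C1_on r f" shows "C1_on r (\<lambda>\<theta>. h (f \<theta>))"
  by (rule C1I[where \<phi>' = "\<lambda>\<theta>. h (D f \<theta>)"])
    (auto intro!: bounded_linear.has_vector_derivative[OF assms(1)] C1_D assms
       bounded_linear.continuous_on[OF assms(1)] C1_D_cont)

lemma D_bounded_linear:
  assumes "bounded_linear h" "C1_on r f" "\<theta> \<in> I" shows "D (\<lambda>\<theta>. h (f \<theta>)) \<theta> = h (D f \<theta>)"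
  by (intro D_eqI bounded_linear.has_vector_derivative[OF assms(1)] C1_D assms)

lemma C1_scale: "C1_on r f \<Longrightarrow> C1_on r (\<lambda>\<theta>. a * f \<theta>)" for a :: "'a::real_normed_algebra"
  by (rule C1_bounded_linear[OF bounded_linear_mult_right])

lemma C1_cong:
  assumes "C1_on r f" and eq: "\<And>\<theta>. \<theta> \<in> I \<Longrightarrow> f \<theta> = g \<theta>"
  shows "C1_on r g" and "\<And>\<theta>. \<theta> \<in> I \<Longrightarrow> D g \<theta> = D f \<theta>"
proof -
  have d: "(g has_vector_derivative D f \<theta>) (at \<theta> within I)" if "\<theta> \<in> I" for \<theta>
    by (rule has_vector_derivative_transform[OF that _ C1_D[OF assms(1) that]]) (simp add: eq)
  then show "C1_on r g" by (rule C1I) (assumption, rule C1_D_cont[OF assms(1)])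
  show "D g \<theta> = D f \<theta>" if "\<theta> \<in> I" for \<theta> by (rule D_eqI[OF d that]) (rule that)
qed

lemma D_add: "C1_on r f \<Longrightarrow> C1_on r g \<Longrightarrow> \<theta> \<in> I \<Longrightarrow> D (\<lambda>\<theta>. f \<theta> + g \<theta>) \<theta> = D f \<theta> + D g \<theta>"
  by (intro D_eqI has_vector_derivative_add C1_D)

lemma C1_zero: "C1_on r (\<lambda>_. 0)"
  by (rule C1I[where \<phi>' = "\<lambda>_. 0"]) auto

text \<open>\<open>AQ1\<close> with complex values: polynomials in the complex coordinates have
  complex coefficient functions, and the homological equation is solved one coefficient at a
  time.\<close>

definition AQc :: "(real \<Rightarrow> complex) \<Rightarrow> real \<Rightarrow> complex" where
  "AQc \<phi> \<theta> = D \<phi> \<theta> + of_real (X0 \<theta>) * (Lc M \<phi> - D \<phi> 0)"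

lemma zero_in_I [simp]: "0 \<in> I" using r_pos by simp

lemma AQc_add:
  "C1_on r f \<Longrightarrow> C1_on r g \<Longrightarrow> \<theta> \<in> I \<Longrightarrow> AQc (\<lambda>\<theta>. f \<theta> + g \<theta>) \<theta> = AQc f \<theta> + AQc g \<theta>"
  unfolding AQc_def by (simp only: D_add zero_in_I Lc_add C1_cont) (simp only: algebra_simps)

lemma AQc_scale: "C1_on r f \<Longrightarrow> \<theta> \<in> I \<Longrightarrow> AQc (\<lambda>\<theta>. a * f \<theta>) \<theta> = a * AQc f \<theta>"
  unfolding AQc_def
  by (simp only: D_bounded_linear[OF bounded_linear_mult_right] zero_in_I Lc_scale C1_cont)
    (simp only: algebra_simps)

lemma AQc_cong:
  assumes "C1_on r f" and eq: "\<And>\<theta>. \<theta> \<in> I \<Longrightarrow> f \<theta> = g \<theta>" and "\<theta> \<in> I"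
  shows "AQc g \<theta> = AQc f \<theta>"
proof -
  have "Lc M f = Lc M g" using assms(1) C1_cong(1)[OF assms(1) eq] eq by (intro Lc_cong C1_cont) auto
  then show ?thesis
    using C1_cong(2)[OF assms(1) eq] assms(3) zero_in_I unfolding AQc_def by metis
qed

lemma AQc_sum:
  "finite A \<Longrightarrow> (\<And>a. a \<in> A \<Longrightarrow> C1_on r (f a)) \<Longrightarrow> \<theta> \<in> I \<Longrightarrow>
    C1_on r (\<lambda>\<theta>. \<Sum>a\<in>A. f a \<theta>) \<and> AQc (\<lambda>\<theta>. \<Sum>a\<in>A. f a \<theta>) \<theta> = (\<Sum>a\<in>A. AQc (f a) \<theta>)"
proof (induction A rule: finite_induct)
  case empty
  then show ?case using AQc_scale[OF C1_zero, of \<theta> 0] C1_zero by simp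
qed (simp_all add: AQc_add C1_add)

lemma C1_of_real: "C1_on r (\<lambda>\<theta>. complex_of_real (y \<theta>)) \<longleftrightarrow> C1_on r y"
  using C1_bounded_linear[OF bounded_linear_of_real[where 'a=complex], of y]
    C1_bounded_linear[OF bounded_linear_Re, of "\<lambda>\<theta>. complex_of_real (y \<theta>)"] by auto

lemma AQ1_of_real:
  assumes "C1_on r y" "\<theta> \<in> I"
  shows "complex_of_real (AQ1 r M y \<theta>) = AQc (\<lambda>\<theta>. of_real (y \<theta>)) \<theta>"
  using D_bounded_linear[OF bounded_linear_of_real[where 'a=complex] assms]
    D_bounded_linear[OF bounded_linear_of_real[where 'a=complex] assms(1) zero_in_I]
  by (simp add: AQ1_def AQc_def Lc_def M_zero complex_eq_iff)

lemma AQ1_Re: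
  assumes "C1_on r c" "\<theta> \<in> I"
  shows "AQ1 r M (\<lambda>\<theta>. Re (c \<theta>)) \<theta> = Re (AQc c \<theta>)"
  using D_bounded_linear[OF bounded_linear_Re assms] D_bounded_linear[OF bounded_linear_Re assms(1) zero_in_I]
  by (simp add: AQ1_def AQc_def Lc_def)

end

subsection \<open>The center spectrum\<close>

lemma odd_ext_minus [simp]: "odd_ext a (- k) = - odd_ext a k"
  by (simp add: odd_ext_def sgn_minus)

lemma odd_ext_simps [simp]: "odd_ext a 0 = 0" "n > 0 \<Longrightarrow> odd_ext a (int n) = a n"
  by (simp_all add: odd_ext_def)

lemma cidx_finite [simp]: "finite (cidx zr p)"
  and cidx_minus [simp]: "- k \<in> cidx zr p \<longleftrightarrow> k \<in> cidx zr p"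
  and zero_cidx [simp]: "0 \<in> cidx zr p \<longleftrightarrow> zr"
  and pos_cidx [simp]: "i \<in> {1..p} \<Longrightarrow> int i \<in> cidx zr p"
  by (auto simp: cidx_def)

lemma cidx_cases:
  assumes "k \<in> cidx zr p"
  obtains "k = 0" zr | i where "i \<in> {1..p}" "k = int i" | i where "i \<in> {1..p}" "k = - int i"
proof -
  consider "k = 0" | "k > 0" | "k < 0" by linarith
  then show thesis
  proof cases
    case 1 then show ?thesis using that(1) assms by auto
  next
    case 2 then show ?thesis using that(2)[of "nat k"] assms by (auto simp: cidx_def)
  next
    case 3 then show ?thesis using that(3)[of "nat (- k)"] assms by (auto simp: cidx_def)
  qed
qed

lemma sum_cidx:
  fixes f :: "int \<Rightarrow> 'a::comm_monoid_add"
  shows "(\<Sum>k\<in>cidx zr p. f k) = (if zr then f 0 else 0) + (\<Sum>i = 1..p. f (int i) + f (- int i))"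
proof -
  have K: "cidx zr p = (if zr then {0} else {}) \<union> (int ` {1..p} \<union> (\<lambda>i. - int i) ` {1..p})"
    by (auto elim!: cidx_cases split: if_splits)
  have "(\<Sum>k\<in>cidx zr p. f k) = (if zr then f 0 else 0) + (\<Sum>k\<in>int ` {1..p} \<union> (\<lambda>i. - int i) ` {1..p}. f k)"
    unfolding K by (cases zr) (simp_all add: image_iff)
  also have "(\<Sum>k\<in>int ` {1..p} \<union> (\<lambda>i. - int i) ` {1..p}. f k) = (\<Sum>i = 1..p. f (int i)) + (\<Sum>i = 1..p. f (- int i))"
    by (subst sum.union_disjoint) (auto simp: sum.reindex inj_on_def)
  finally show ?thesis by (simp add: sum.distrib)
qed

locale center_spectrum = delay_functional +
  fixes zr :: bool and p :: nat and \<omega> :: "nat \<Rightarrow> real"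
  assumes simple: "\<forall>\<zeta>\<in>imag_spectrum r M. simple_eigenvalue r M \<zeta>"
    and spectrum: "imag_spectrum r M =
           (if zr then {0} else {}) \<union> (\<Union>j\<in>{1..p}. {\<i> * of_real (\<omega> j), - \<i> * of_real (\<omega> j)})"
    and \<omega>_pos: "\<forall>j\<in>{1..p}. \<omega> j > 0"
    and indep: "\<forall>c :: nat \<Rightarrow> rat. (\<Sum>j = 1..p. of_rat (c j) * \<omega> j) = 0 \<longrightarrow> (\<forall>j\<in>{1..p}. c j = 0)"
begin

abbreviation K :: "int set" where "K \<equiv> cidx zr p"

definition \<sigma> :: "int \<Rightarrow> complex" where "\<sigma> k = \<i> * of_real (odd_ext \<omega> k)"

lemma \<sigma>_minus: "\<sigma> (- k) = cnj (\<sigma> k)" by (simp add: \<sigma>_def)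

lemma spectrum_\<sigma>: "imag_spectrum r M = \<sigma> ` K"
proof (intro set_eqI iffI)
  fix z assume "z \<in> imag_spectrum r M"
  then consider "zr" "z = 0" | j where "j \<in> {1..p}" "z = \<i> * of_real (\<omega> j)"
    | j where "j \<in> {1..p}" "z = - \<i> * of_real (\<omega> j)"
    unfolding spectrum by (auto split: if_splits)
  then show "z \<in> \<sigma> ` K"
  proof cases
    case 1 then show ?thesis by (intro image_eqI[of _ _ 0]) (simp_all add: \<sigma>_def)
  next
    case (2 j) then show ?thesis by (intro image_eqI[of _ _ "int j"]) (simp_all add: \<sigma>_def)
  next
    case (3 j) then show ?thesis by (intro image_eqI[of _ _ "- int j"]) (simp_all add: \<sigma>_def)
  qed
next
  fix z assume "z \<in> \<sigma> ` K"
  then show "z \<in> imag_spectrum r M"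
    unfolding spectrum by (auto elim!: cidx_cases simp: \<sigma>_def)
qed

lemma Delta_root: "k \<in> K \<Longrightarrow> \<Delta> (\<sigma> k) = 0"
  using spectrum_\<sigma> eigenvalue_root by (auto simp: imag_spectrum_def)

lemma Delta_zero_imag_iff: "\<Delta> z = 0 \<Longrightarrow> Re z = 0 \<Longrightarrow> \<exists>k\<in>K. z = \<sigma> k"
  using spectrum_\<sigma> eigenvalueI[of z] by (auto simp: imag_spectrum_def)

lemma exp_form_nonzero: "k \<in> K \<Longrightarrow> exp_form (\<sigma> k) (E (\<sigma> k)) \<noteq> 0"
  using spectrum_\<sigma> simple simple_eigenvalue_exp_form by blast

lemma indep_int:
  fixes c :: "nat \<Rightarrow> int"
  assumes "(\<Sum>j = 1..p. of_int (c j) * \<omega> j) = 0" "j \<in> {1..p}"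
  shows "c j = 0"
  using indep[rule_format, of "\<lambda>j. of_int (c j)" j] assms by simp

text \<open>Collecting opposite indices leaves an integer combination of the
  \<open>\<omega> j\<close> with coefficients \<open>m (int j) - m (- int j)\<close>, which rational
  independence kills. Index 0 has frequency zero and drops out.\<close>

lemma nonresonance:
  fixes m :: "int \<Rightarrow> int"
  assumes "(\<Sum>k\<in>K. odd_ext \<omega> k * of_int (m k)) = 0" "i \<in> {1..p}"
  shows "m (int i) = m (- int i)"
proof -
  have "(\<Sum>j = 1..p. of_int (m (int j) - m (- int j)) * \<omega> j) = 0"
    using assms(1) unfolding sum_cidx by (simp add: algebra_simps split: if_splits)
  from indep_int[OF this assms(2)] show ?thesis by simp
qed

lemma inj_\<sigma>: "inj_on \<sigma> K"
proof (rule inj_onI)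
  fix k l assume kl: "k \<in> K" "l \<in> K" "\<sigma> k = \<sigma> l"
  \<comment> \<open>The difference of the point masses at \<open>k\<close> and \<open>l\<close>. It
    is balanced at every pair of opposite indices, which is impossible for distinct \<open>k\<close>
    and \<open>l\<close>.\<close>
  define m :: "int \<Rightarrow> int" where "m = (\<lambda>x. (if x = k then 1 else 0) - (if x = l then 1 else 0))"
  have "(\<Sum>x\<in>K. odd_ext \<omega> x * of_int (m x)) = odd_ext \<omega> k - odd_ext \<omega> l"
    using kl by (simp add: m_def right_diff_distrib sum_subtractf if_distrib[of real_of_int] if_distrib[of "(*) _"] cong: if_cong)
  also have "\<dots> = 0" using kl by (simp add: \<sigma>_def)
  finally have *: "m (int i) = m (- int i)" if "i \<in> {1..p}" for i using nonresonance that by blast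
  show "k = l"
    using kl(1)
  proof (cases rule: cidx_cases)
    case 1
    from kl(2) show ?thesis
    proof (cases rule: cidx_cases)
      case (2 i) then show ?thesis using 1 *[of i] by (auto simp: m_def split: if_splits)
    next
      case (3 i) then show ?thesis using 1 *[of i] by (auto simp: m_def split: if_splits)
    qed (use 1 in simp)
  next
    case (2 i) then show ?thesis using *[of i] by (auto simp: m_def split: if_splits)
  next
    case (3 i) then show ?thesis using *[of i] by (auto simp: m_def split: if_splits)
  qed
qed

text \<open>The vector \<Psi>(0). Orthogonality for different frequencies is automatic, so the
  normalization fixes one scalar per index, and simplicity of the eigenvalue makes the divisor
  nonzero.\<close>

definition b :: "int \<Rightarrow> complex" where
  "b k = (if k \<in> K then 1 / exp_form (\<sigma> k) (E (\<sigma> k)) else 0)"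

lemma b_nonzero: "k \<in> K \<Longrightarrow> b k \<noteq> 0" using exp_form_nonzero by (simp add: b_def)

lemma b_minus: "b (- k) = cnj (b k)"
  using exp_form_cnj[of "E (\<sigma> k)" "\<sigma> k"] by (simp add: b_def \<sigma>_minus E_cnj E_cont)

lemma Phi_E: "Phi \<omega> k = E (\<sigma> k)"
  by (auto simp: Phi_def E_def \<sigma>_def fun_eq_iff mult.assoc)

lemma Psi_E: "Psi \<omega> b k = (\<lambda>\<zeta>. E (- \<sigma> k) \<zeta> * b k)"
  by (auto simp: Psi_def E_def \<sigma>_def fun_eq_iff mult.assoc)

lemma bform_Psi: "cont \<phi> \<Longrightarrow> bform M (Psi \<omega> b k) \<phi> = b k * exp_form (\<sigma> k) \<phi>"
  by (simp add: Psi_E bform_eq_exp_form)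

lemma exp_form_\<sigma>_E: "k \<in> K \<Longrightarrow> l \<in> K \<Longrightarrow> k \<noteq> l \<Longrightarrow> exp_form (\<sigma> k) (E (\<sigma> l)) = 0"
  using exp_form_E[of "\<sigma> l" "\<sigma> k"] Delta_root inj_\<sigma> by (auto simp: inj_on_def)

lemma Psi_normalized: "Psi_normalized M zr p \<omega> b"
  unfolding Psi_normalized_def
proof (intro conjI ballI)
  show "b \<in> vecs K" by (simp add: vecs_def b_def)
  show "bform M (Psi \<omega> b k) (Phi \<omega> l) = (if k = l then 1 else 0)" if "k \<in> K" "l \<in> K" for k l
    using that exp_form_\<sigma>_E[OF that] exp_form_nonzero
    by (simp add: Phi_E bform_Psi E_cont) (simp add: b_def)
qed

section \<open>The complement of the center subspace and the resolvent of the generator on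
  it\<close>

definition QC :: "(real \<Rightarrow> complex) set" where "QC = Q1c r M zr p \<omega> b"

lemma QC_iff: "\<phi> \<in> QC \<longleftrightarrow> C1_on r \<phi> \<and> (\<forall>k\<in>K. exp_form (\<sigma> k) \<phi> = 0)"
  unfolding QC_def Q1c_def mem_Collect_eq using bform_Psi[OF C1_cont] b_nonzero by (metis mult_eq_0_iff)

lemma QC_C1: "\<phi> \<in> QC \<Longrightarrow> C1_on r \<phi>" by (simp add: QC_iff)

lemma QC_zero: "(\<lambda>_. 0) \<in> QC" by (simp add: QC_iff C1_zero)

lemma QC_add: "f \<in> QC \<Longrightarrow> g \<in> QC \<Longrightarrow> (\<lambda>\<theta>. f \<theta> + g \<theta>) \<in> QC"
  by (simp add: QC_iff C1_add exp_form_add C1_cont)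

lemma QC_scale: "f \<in> QC \<Longrightarrow> (\<lambda>\<theta>. a * f \<theta>) \<in> QC"
  by (simp add: QC_iff C1_scale exp_form_scale C1_cont)

lemma QC_cnj: "f \<in> QC \<Longrightarrow> (\<lambda>\<theta>. cnj (f \<theta>)) \<in> QC"
  using C1_bounded_linear[OF bounded_linear_cnj, of f] exp_form_cnj[of f] cidx_minus
  by (metis C1_cont QC_iff \<sigma>_minus complex_cnj_cnj complex_cnj_zero)

lemma QC_cong: "f \<in> QC \<Longrightarrow> (\<And>\<theta>. \<theta> \<in> I \<Longrightarrow> f \<theta> = g \<theta>) \<Longrightarrow> g \<in> QC"
  using exp_form_cong[of f g] C1_cong(1)[of f g] by (simp add: QC_iff C1_cont)

text \<open>The complexified kernel of the projection \<open>\<pi>\<close> in \<open>BC\<close>: the functions \<open>\<phi> + X0 a\<close> with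
  \<open>(\<Psi>, \<phi>) + \<Psi>(0) a = 0\<close>.\<close>

definition BQ :: "(real \<Rightarrow> complex) set" where
  "BQ = {e. \<exists>\<phi> a. cont \<phi> \<and> (\<forall>\<theta>\<in>I. e \<theta> = \<phi> \<theta> + of_real (X0 \<theta>) * a) \<and> (\<forall>k\<in>K. exp_form (\<sigma> k) \<phi> + a = 0)}"

lemma BQ_I:
  "cont \<phi> \<Longrightarrow> (\<And>\<theta>. \<theta> \<in> I \<Longrightarrow> e \<theta> = \<phi> \<theta> + of_real (X0 \<theta>) * a) \<Longrightarrow>
    (\<And>k. k \<in> K \<Longrightarrow> exp_form (\<sigma> k) \<phi> + a = 0) \<Longrightarrow> e \<in> BQ"
  unfolding BQ_def by blast

lemma QC_BQ: "\<phi> \<in> QC \<Longrightarrow> \<phi> \<in> BQ"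
  by (rule BQ_I[of \<phi> _ 0]) (auto simp: QC_iff C1_cont)

lemma BQ_add: assumes "e \<in> BQ" "f \<in> BQ" shows "(\<lambda>\<theta>. e \<theta> + f \<theta>) \<in> BQ"
proof -
  obtain \<phi> a where e: "cont \<phi>" "\<forall>\<theta>\<in>I. e \<theta> = \<phi> \<theta> + of_real (X0 \<theta>) * a" "\<forall>k\<in>K. exp_form (\<sigma> k) \<phi> + a = 0"
    using assms(1) unfolding BQ_def by blast
  obtain \<psi> c where f: "cont \<psi>" "\<forall>\<theta>\<in>I. f \<theta> = \<psi> \<theta> + of_real (X0 \<theta>) * c" "\<forall>k\<in>K. exp_form (\<sigma> k) \<psi> + c = 0"
    using assms(2) unfolding BQ_def by blast
  have "exp_form (\<sigma> k) \<phi> + exp_form (\<sigma> k) \<psi> + (a + c) = 0" if "k \<in> K" for k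
  proof -
    have "exp_form (\<sigma> k) \<phi> = - a" "exp_form (\<sigma> k) \<psi> = - c" using e(3) f(3) that by (auto simp: eq_neg_iff_add_eq_0)
    then show ?thesis by simp
  qed
  then show ?thesis using e f
    by (intro BQ_I[of "\<lambda>\<theta>. \<phi> \<theta> + \<psi> \<theta>" _ "a + c"] continuous_intros)
      (simp_all add: exp_form_add distrib_left)
qed

lemma BQ_scale: assumes "e \<in> BQ" shows "(\<lambda>\<theta>. c * e \<theta>) \<in> BQ"
proof -
  obtain \<phi> a where e: "cont \<phi>" "\<forall>\<theta>\<in>I. e \<theta> = \<phi> \<theta> + of_real (X0 \<theta>) * a" "\<forall>k\<in>K. exp_form (\<sigma> k) \<phi> + a = 0"
    using assms unfolding BQ_def by blast
  then show ?thesis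
    by (intro BQ_I[of "\<lambda>\<theta>. c * \<phi> \<theta>" _ "c * a"] continuous_intros)
      (simp_all add: exp_form_scale distrib_left mult.left_commute flip: distrib_left[of c "exp_form _ _"])
qed

lemma BQ_zero: "(\<lambda>_. 0) \<in> BQ" by (intro QC_BQ QC_zero)

text \<open>At a zero of \<open>\<Delta>\<close> and on \<open>QC\<close> the duality identity
  reduces to \<open>exp_form (\<sigma> k) (D c) = D c 0 - Lc M c\<close>, which is minus the
  coefficient of the jump at 0.\<close>

lemma AQc_BQ: assumes "c \<in> QC" shows "AQc c \<in> BQ"
proof (rule BQ_I[of "D c" _ "Lc M c - D c 0"])
  have c: "C1_on r c" using assms by (rule QC_C1)
  show "cont (D c)" using c by (rule C1_D_cont)
  show "exp_form (\<sigma> k) (D c) + (Lc M c - D c 0) = 0" if "k \<in> K" for k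
    using exp_form_deriv[OF C1_D[OF c] C1_D_cont[OF c], of "\<sigma> k"] that Delta_root[of k] assms
    by (simp add: QC_iff)
qed (simp add: AQc_def)

text \<open>This function is \<open>(I - \<pi>) X0\<close>, through which every nonlinear term of
  the initial y-equation depends on \<theta>.\<close>

lemma projected_X0_BQ: "(\<lambda>\<theta>. of_real (X0 \<theta>) - (\<Sum>k\<in>K. Phi \<omega> k \<theta> * b k)) \<in> BQ"
proof (rule BQ_I[of "\<lambda>\<theta>. - 1 * (\<Sum>k\<in>K. b k * E (\<sigma> k) \<theta>)" _ 1])
  fix k assume k: "k \<in> K"
  have "exp_form (\<sigma> k) (\<lambda>\<theta>. - 1 * (\<Sum>l\<in>K. b l * E (\<sigma> l) \<theta>)) = - (\<Sum>l\<in>K. b l * exp_form (\<sigma> k) (E (\<sigma> l)))"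
    by (subst exp_form_scale) (simp_all add: exp_form_sum exp_form_scale continuous_intros)
  also have "(\<Sum>l\<in>K. b l * exp_form (\<sigma> k) (E (\<sigma> l))) = (\<Sum>l\<in>K. if l = k then 1 else 0)"
    using k exp_form_\<sigma>_E exp_form_nonzero by (intro sum.cong) (auto simp: b_def)
  finally show "exp_form (\<sigma> k) (\<lambda>\<theta>. - 1 * (\<Sum>k\<in>K. b k * E (\<sigma> k) \<theta>)) + 1 = 0" using k by simp
qed (auto intro!: continuous_intros simp: Phi_E mult.commute)

text \<open>The ansatz is \<open>c0 * E z\<close> plus \<open>exp_conv\<close>, and the jump at 0 is
  one scalar equation for \<open>c0\<close>. If \<open>z\<close> is no zero of
  \<open>\<Delta>\<close>, it determines \<open>c0\<close>. If \<open>z = \<sigma> k\<close>, it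
  holds for every \<open>c0\<close> because the right-hand side lies in \<open>BQ\<close>, and
  \<open>c0\<close> is spent on orthogonality to the k-th row instead. Thus imaginary
  \<open>z\<close> cause no obstruction, resonant or not.\<close>

lemma AQc_resolvent:
  assumes "e \<in> BQ" and z: "Re z = 0"
  shows "\<exists>c\<in>QC. \<forall>\<theta>\<in>I. z * c \<theta> - AQc c \<theta> = e \<theta>"
proof -
  obtain \<phi> a where \<phi>: "cont \<phi>" and e: "\<forall>\<theta>\<in>I. e \<theta> = \<phi> \<theta> + of_real (X0 \<theta>) * a"
    and 0: "\<forall>k\<in>K. exp_form (\<sigma> k) \<phi> + a = 0"
    using assms(1) unfolding BQ_def by blast
  define c where "c c0 \<theta> = c0 * E z \<theta> + exp_conv z \<phi> \<theta>" for c0 \<theta>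
  have dc: "(c c0 has_vector_derivative z * c c0 \<theta> - \<phi> \<theta>) (at \<theta> within I)" if "\<theta> \<in> I" for c0 \<theta>
    using has_vector_derivative_add[OF has_vector_derivative_mult[OF has_vector_derivative_const E_deriv, of c0 z]
        exp_conv_deriv[OF \<phi> that, of z]]
    unfolding c_def by (simp add: algebra_simps)
  have cc: "cont (c c0)" for c0 unfolding c_def by (intro continuous_intros exp_conv_cont \<phi>)
  have cd: "cont (\<lambda>\<theta>. z * c c0 \<theta> - \<phi> \<theta>)" for c0 by (intro continuous_intros cc \<phi>)
  have C1: "C1_on r (c c0)" for c0 by (rule C1I[OF dc cd])
  have c0: "c c0 0 = c0" for c0 by (simp add: c_def)
  have ex: "\<exists>c0. z * c0 - Lc M (c c0) = \<phi> 0 + a \<and> (\<forall>k\<in>K. z = \<sigma> k \<longrightarrow> exp_form (\<sigma> k) (c c0) = 0)"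
  proof -
    have 1: "z * c0 - Lc M (c c0) = c0 * \<Delta> z - Lc M (exp_conv z \<phi>)" for c0
      unfolding c_def[abs_def]
      by (simp add: Lc_add Lc_scale continuous_intros exp_conv_cont \<phi> \<Delta>_def algebra_simps)
    show ?thesis
    proof (cases "\<Delta> z = 0")
      case False
      then show ?thesis using Delta_root
        by (intro exI[of _ "(exp_form z \<phi> + a) / \<Delta> z"], unfold 1) (auto simp: exp_form_def)
    next
      case True
      then obtain k where k: "k \<in> K" "z = \<sigma> k" using Delta_zero_imag_iff z by blast
      have "exp_form z \<phi> + a = 0" using 0 k by auto
      then have "- Lc M (exp_conv z \<phi>) = \<phi> 0 + a" unfolding exp_form_def by algebra
      then have 2: "z * c0 - Lc M (c c0) = \<phi> 0 + a" for c0
        unfolding 1 using True by simp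
      let ?c0 = "- exp_form z (exp_conv z \<phi>) / exp_form z (E z)"
      have "exp_form z (c c0) = c0 * exp_form z (E z) + exp_form z (exp_conv z \<phi>)" for c0 unfolding c_def[abs_def]
        by (simp add: exp_form_add exp_form_scale continuous_intros exp_conv_cont \<phi>)
      then have "exp_form z (c ?c0) = 0" using exp_form_nonzero[OF k(1)] k(2) by simp
      then show ?thesis using 2 by metis
    qed
  qed
  then obtain c0 where c1: "z * c0 - Lc M (c c0) = \<phi> 0 + a"
    and c2: "\<forall>k\<in>K. z = \<sigma> k \<longrightarrow> exp_form (\<sigma> k) (c c0) = 0" by blast
  have D: "D (c c0) \<theta> = z * c c0 \<theta> - \<phi> \<theta>" if "\<theta> \<in> I" for \<theta> by (rule D_eqI[OF dc[OF that] that])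
  have "c c0 \<in> QC"
    unfolding QC_iff
  proof (intro conjI ballI C1)
    fix k assume k: "k \<in> K"
    \<comment> \<open>Duality turns the jump condition into
      \<open>(z - \<sigma> k) * exp_form (\<sigma> k) (c c0) = 0\<close>, so orthogonality is
      automatic for all rows with \<open>\<sigma> k \<noteq> z\<close>.\<close>
    have "z * exp_form (\<sigma> k) (c c0) - exp_form (\<sigma> k) \<phi> = z * c0 - \<phi> 0 - Lc M (c c0) + \<sigma> k * exp_form (\<sigma> k) (c c0)"
      using exp_form_deriv[OF dc[of _ c0] cd, of "\<sigma> k"] Delta_root[OF k]
      by (simp add: exp_form_diff exp_form_scale cc \<phi> c0 continuous_intros)
    then have "(z - \<sigma> k) * exp_form (\<sigma> k) (c c0) = 0"
      using 0 k c1 by (simp add: algebra_simps add_eq_0_iff)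
    then show "exp_form (\<sigma> k) (c c0) = 0" using c2 k by auto
  qed
  moreover have "z * c c0 \<theta> - AQc (c c0) \<theta> = e \<theta>" if "\<theta> \<in> I" for \<theta>
    using that e c1 D[OF that] D[OF zero_in_I] by (simp add: AQc_def c0 X0_def algebra_simps)
  ultimately show ?thesis by blast
qed

end

section \<open>Homogeneous polynomial functions\<close>

text \<open>Generated by coordinate functions instead of being given by exponents, since y enters
  through point evaluations. The zero function has every degree, so that each degree forms a vector
  space.\<close>

inductive hpoly :: "('p \<Rightarrow> complex) set \<Rightarrow> nat \<Rightarrow> ('p \<Rightarrow> complex) \<Rightarrow> bool" for V where
  const: "hpoly V 0 (\<lambda>_. c)"
| zero: "hpoly V n (\<lambda>_. 0)"
| var: "f \<in> V \<Longrightarrow> hpoly V 1 f"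
| add: "hpoly V n P \<Longrightarrow> hpoly V n Q \<Longrightarrow> hpoly V n (\<lambda>z. P z + Q z)"
| mult: "hpoly V m P \<Longrightarrow> hpoly V n Q \<Longrightarrow> hpoly V (m + n) (\<lambda>z. P z * Q z)"

lemma hpoly_mono: "hpoly V n P \<Longrightarrow> V \<subseteq> W \<Longrightarrow> hpoly W n P"
  by (induction rule: hpoly.induct) (auto intro: hpoly.intros simp del: One_nat_def)

lemma hpoly_scale: "hpoly V n P \<Longrightarrow> hpoly V n (\<lambda>z. c * P z)"
  using hpoly.mult[OF hpoly.const] by fastforce

lemma hpoly_minus: "hpoly V n P \<Longrightarrow> hpoly V n (\<lambda>z. - P z)"
  using hpoly_scale[of V n P "-1"] by simp

lemma hpoly_diff: "hpoly V n P \<Longrightarrow> hpoly V n Q \<Longrightarrow> hpoly V n (\<lambda>z. P z - Q z)"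
  using hpoly.add[OF _ hpoly_minus, of V n P Q] by simp

lemma hpoly_sum: "finite A \<Longrightarrow> (\<And>a. a \<in> A \<Longrightarrow> hpoly V n (P a)) \<Longrightarrow> hpoly V n (\<lambda>z. \<Sum>a\<in>A. P a z)"
  by (induction A rule: finite_induct) (auto intro: hpoly.intros)

lemma hpoly_power: "hpoly V n P \<Longrightarrow> hpoly V (n * k) (\<lambda>z. P z ^ k)"
  by (induction k) (auto intro: hpoly.intros)

lemma hpoly_monomial:
  "finite A \<Longrightarrow> (\<And>a. a \<in> A \<Longrightarrow> hpoly V 1 (P a)) \<Longrightarrow> hpoly V (sum m A) (\<lambda>z. \<Prod>a\<in>A. P a z ^ m a)"
proof (induction A rule: finite_induct)
  case (insert a A)
  then show ?case using hpoly.mult[OF hpoly_power[of V 1 "P a" "m a"]] by simp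
qed (simp add: hpoly.const)

text \<open>A change of variables of degree \<open>j\<close> bends the ray \<open>t z\<close> to
  \<open>t z + t^j g z\<close>. As \<open>g\<close> itself has degree \<open>j\<close>, powers of
  \<open>t\<close> and degrees in \<open>z\<close> stay equal, so each coefficient in
  \<open>t\<close> is homogeneous of its own order. Because \<open>j \<ge> 2\<close>, the correction
  stays out of the leading order, where \<open>P\<close> itself appears.\<close>

lemma hpoly_curve:
  assumes "hpoly V m P" and VW: "V \<subseteq> W" and j: "j \<ge> 2"
    and \<gamma>: "\<And>f. f \<in> V \<Longrightarrow> \<exists>g. hpoly W j g \<and>
      (\<forall>z\<in>S. \<forall>t::real. f (\<gamma> z t) = of_real t * f z + of_real t ^ j * g z)"
  shows "\<exists>C. (\<forall>n. hpoly W n (\<lambda>z. coeff (C z) n)) \<and>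
    (\<forall>z\<in>S. (\<forall>t::real. P (\<gamma> z t) = poly (C z) (of_real t)) \<and>
       (\<forall>n<m. coeff (C z) n = 0) \<and> coeff (C z) m = P z)"
  using assms(1)
proof (induction rule: hpoly.induct)
  case (const c)
  show ?case
    by (rule exI[of _ "\<lambda>_. [:c:]"]) (auto simp: coeff_pCons split: nat.split intro: hpoly.intros)
next
  case (zero n)
  show ?case by (rule exI[of _ "\<lambda>_. 0"]) (auto intro: hpoly.intros)
next
  case (var f)
  obtain g where g: "hpoly W j g"
    "\<And>z t. z \<in> S \<Longrightarrow> f (\<gamma> z t) = of_real t * f z + of_real t ^ j * g z" using \<gamma>[OF var] by blast
  have f: "hpoly W 1 f" using var VW by (blast intro: hpoly.var)
  have "hpoly W n (\<lambda>z. coeff (monom (f z) 1 + monom (g z) j) n)" for n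
  proof -
    consider "n = 1" | "n = j" | "n \<noteq> 1" "n \<noteq> j" by blast
    then show ?thesis using j f g(1) by cases (auto intro: hpoly.zero simp del: One_nat_def)
  qed
  then show ?case using j g(2)
    by (intro exI[of _ "\<lambda>z. monom (f z) 1 + monom (g z) j"]) (auto simp: poly_monom mult.commute)
next
  case (add n P Q)
  then obtain C C' where "\<forall>n. hpoly W n (\<lambda>z. coeff (C z) n)" "\<forall>n. hpoly W n (\<lambda>z. coeff (C' z) n)"
    "\<forall>z\<in>S. (\<forall>t::real. P (\<gamma> z t) = poly (C z) (of_real t)) \<and> (\<forall>i<n. coeff (C z) i = 0) \<and> coeff (C z) n = P z"
    "\<forall>z\<in>S. (\<forall>t::real. Q (\<gamma> z t) = poly (C' z) (of_real t)) \<and> (\<forall>i<n. coeff (C' z) i = 0) \<and> coeff (C' z) n = Q z"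
    by blast
  then show ?case by (intro exI[of _ "\<lambda>z. C z + C' z"]) (auto intro: hpoly.add)
next
  case (mult m P n Q)
  then obtain C C' where C: "\<forall>n. hpoly W n (\<lambda>z. coeff (C z) n)" "\<forall>n. hpoly W n (\<lambda>z. coeff (C' z) n)"
    "\<forall>z\<in>S. (\<forall>t::real. P (\<gamma> z t) = poly (C z) (of_real t)) \<and> (\<forall>i<m. coeff (C z) i = 0) \<and> coeff (C z) m = P z"
    "\<forall>z\<in>S. (\<forall>t::real. Q (\<gamma> z t) = poly (C' z) (of_real t)) \<and> (\<forall>i<n. coeff (C' z) i = 0) \<and> coeff (C' z) n = Q z"
    by blast
  have "hpoly W i (\<lambda>z. coeff (C z * C' z) i)" for i
    unfolding coeff_mult
  proof (rule hpoly_sum)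
    fix l assume "l \<in> {..i}"
    then show "hpoly W i (\<lambda>z. coeff (C z) l * coeff (C' z) (i - l))"
      using hpoly.mult[OF C(1)[rule_format, of l] C(2)[rule_format, of "i - l"]] by simp
  qed simp
  moreover have "coeff (C z * C' z) i = 0" if "z \<in> S" "i < m + n" for z i
    unfolding coeff_mult
  proof (intro sum.neutral ballI)
    fix l assume "l \<in> {..i}"
    with that have "l < m \<or> i - l < n" by auto
    then show "coeff (C z) l * coeff (C' z) (i - l) = 0" using C(3,4) that by auto
  qed
  moreover have "coeff (C z * C' z) (m + n) = P z * Q z" if z: "z \<in> S" for z
  proof -
    have "coeff (C z * C' z) (m + n) = (\<Sum>i\<in>{m}. coeff (C z) i * coeff (C' z) (m + n - i))"
      unfolding coeff_mult
    proof (rule sum.mono_neutral_right)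
      show "\<forall>i\<in>{..m + n} - {m}. coeff (C z) i * coeff (C' z) (m + n - i) = 0"
      proof
        fix i assume "i \<in> {..m + n} - {m}"
        then have "i < m \<or> m + n - i < n" by auto
        then show "coeff (C z) i * coeff (C' z) (m + n - i) = 0" using C(3,4) z by auto
      qed
    qed auto
    then show ?thesis using C(3,4) z by simp
  qed
  ultimately show ?case using C(3,4) by (intro exI[of _ "\<lambda>z. C z * C' z"]) auto
qed

text \<open>The polynomial has complex coefficients but real values at real arguments. That this
  survives differentiation follows from differentiating the vanishing imaginary part.\<close>

lemma taylor_coeff_poly_real:
  assumes "\<And>t. complex_of_real (g t) = poly q (of_real t)"
  shows "complex_of_real (taylor_coeff m g) = coeff q m"
proof -
  have "(\<forall>t. complex_of_real (((\<lambda>g t. vector_derivative g (at t)) ^^ m) g t) = poly ((pderiv ^^ m) q) (of_real t))"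
  proof (induction m)
    case 0 then show ?case using assms by simp
  next
    case (Suc m)
    let ?g = "((\<lambda>g t. vector_derivative g (at t)) ^^ m) g" and ?q = "(pderiv ^^ m) q"
    have "complex_of_real (vector_derivative ?g (at t)) = poly (pderiv ?q) (of_real t)" for t
    proof -
      have d: "((\<lambda>t. complex_of_real (?g t)) has_vector_derivative poly (pderiv ?q) (of_real t)) (at t)"
        using has_vector_derivative_real_field[OF poly_DERIV, of ?q t UNIV] Suc.IH by simp
      have "(?g has_vector_derivative Re (poly (pderiv ?q) (of_real t))) (at t)"
        using bounded_linear.has_vector_derivative[OF bounded_linear_Re d] by simp
      moreover have "((\<lambda>_. 0) has_vector_derivative Im (poly (pderiv ?q) (of_real t))) (at t)"
        using bounded_linear.has_vector_derivative[OF bounded_linear_Im d] by simp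
      then have "Im (poly (pderiv ?q) (of_real t)) = 0"
        using vector_derivative_at by fastforce
      ultimately show ?thesis using vector_derivative_at by (fastforce simp: complex_eq_iff)
    qed
    then show ?case by simp
  qed
  then have "complex_of_real (taylor_coeff m g) = poly ((pderiv ^^ m) q) 0 / fact m"
    by (simp add: taylor_coeff_def scaleR_conv_of_real divide_inverse mult.commute)
  also have "poly ((pderiv ^^ m) q) 0 = fact m * coeff q m"
    by (simp add: poly_0_coeff_0 coeff_higher_pderiv pochhammer_fact)
  finally show ?thesis by simp
qed

lemma taylor_coeff_poly:
  assumes "\<And>t::real. f t = poly q (of_real t)"
  shows "taylor_coeff m f = (coeff q m :: complex)"
proof -
  have "(\<forall>t. ((\<lambda>g t. vector_derivative g (at t)) ^^ m) f t = poly ((pderiv ^^ m) q) (of_real t))"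
  proof (induction m)
    case 0 then show ?case using assms by simp
  next
    case (Suc m)
    let ?q = "(pderiv ^^ m) q"
    have "vector_derivative (\<lambda>t. poly ?q (complex_of_real t)) (at t) = poly (pderiv ?q) (of_real t)" for t
      using has_vector_derivative_real_field[OF poly_DERIV, of ?q t UNIV] by (simp add: vector_derivative_at)
    then show ?case using Suc.IH by (simp add: fun_eq_iff[symmetric] flip: fun_eq_iff)
  qed
  then have "taylor_coeff m f = poly ((pderiv ^^ m) q) 0 / fact m"
    by (simp add: taylor_coeff_def scaleR_conv_of_real divide_inverse mult.commute)
  also have "poly ((pderiv ^^ m) q) 0 = fact m * coeff q m"
    by (simp add: poly_0_coeff_0 coeff_higher_pderiv pochhammer_fact)
  finally show ?thesis by simp
qed

subsection \<open>Monomials\<close>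

lemma finite_mexps [simp]: "finite I \<Longrightarrow> finite (mexps I s j)"
proof -
  assume I: "finite I"
  have fin: "finite {m \<in> vecs J. sum m J \<le> j}" if J: "finite J" for J :: "'b set"
  proof (rule finite_subset)
    show "{m \<in> vecs J. sum m J \<le> j} \<subseteq> {m. \<forall>x. (x \<in> J \<longrightarrow> m x \<in> {..j}) \<and> (x \<notin> J \<longrightarrow> m x = (0::nat))}"
      using J by (auto simp: vecs_def intro: order_trans[OF member_le_sum])
    show "finite {m. \<forall>x. (x \<in> J \<longrightarrow> m x \<in> {..j}) \<and> (x \<notin> J \<longrightarrow> m x = (0::nat))}"
      using J by (intro finite_set_of_finite_funs) auto
  qed
  have "mexps I s j \<subseteq> {m \<in> vecs I. sum m I \<le> j} \<times> {q \<in> vecs {1..s}. sum q {1..s} \<le> j}"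
    by (auto simp: mexps_def)
  then show ?thesis using fin[OF I] fin[of "{1..s}"] by (meson finite_SigmaI finite_subset finite_atLeastAtMost)
qed

lemma mon_mult:
  "finite I \<Longrightarrow> mon I s m q x \<mu> * mon I s m' q' x \<mu> = mon I s (\<lambda>i. m i + m' i) (\<lambda>i. q i + q' i) x \<mu>"
  by (simp add: mon_def power_add prod.distrib ac_simps)

lemma mexps_add:
  "(m, q) \<in> mexps I s i \<Longrightarrow> (m', q') \<in> mexps I s j \<Longrightarrow>
    ((\<lambda>i. m i + m' i), (\<lambda>i. q i + q' i)) \<in> mexps I s (i + j)"
  by (auto simp: mexps_def vecs_def sum.distrib)

text \<open>Expansions produce the same exponent many times; summing over the fibres of the exponent
  map brings them back to coefficient form.\<close>

lemma heval_collect: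
  assumes I: "finite I" and A: "finite A" "\<And>a. a \<in> A \<Longrightarrow> (m a, q a) \<in> mexps I s j"
  shows "(\<Sum>a\<in>A. C a * mon I s (m a) (q a) x \<mu>) =
    heval I s j (\<lambda>m' q'. \<Sum>a\<in>{a \<in> A. (m a, q a) = (m', q')}. C a) x \<mu>"
proof -
  have "(\<Sum>a\<in>A. C a * mon I s (m a) (q a) x \<mu>) =
      (\<Sum>e\<in>mexps I s j. \<Sum>a\<in>{a \<in> A. (m a, q a) = e}. C a * mon I s (m a) (q a) x \<mu>)"
    using I A by (intro sum.group[symmetric]) auto
  also have "\<dots> = (\<Sum>(m', q')\<in>mexps I s j. (\<Sum>a\<in>{a \<in> A. (m a, q a) = (m', q')}. C a) * mon I s m' q' x \<mu>)"
    unfolding sum_distrib_right by (intro sum.cong refl) (auto intro!: sum.cong)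
  finally show ?thesis by (simp add: heval_def)
qed

lemma heval_mult:
  assumes "finite I"
  shows "\<exists>e. \<forall>x \<mu>. heval I s i c x \<mu> * heval I s j d x \<mu> = heval I s (i + j) e x \<mu>"
proof -
  let ?A = "mexps I s i \<times> mexps I s j"
  let ?m = "\<lambda>a. \<lambda>k. fst (fst a) k + fst (snd a) k" and ?q = "\<lambda>a. \<lambda>k. snd (fst a) k + snd (snd a) k"
  let ?C = "\<lambda>a. c (fst (fst a)) (snd (fst a)) * d (fst (snd a)) (snd (snd a))"
  have "heval I s i c x \<mu> * heval I s j d x \<mu> = (\<Sum>a\<in>?A. ?C a * mon I s (?m a) (?q a) x \<mu>)" for x \<mu>
    unfolding heval_def sum_product sum.cartesian_product
    by (intro sum.cong refl) (auto simp: mon_mult[OF assms, symmetric] ac_simps)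
  moreover have "(?m a, ?q a) \<in> mexps I s (i + j)" if "a \<in> ?A" for a
    using that mexps_add[of "fst (fst a)" "snd (fst a)" I s i "fst (snd a)" "snd (snd a)" j] by auto
  ultimately show ?thesis
    using heval_collect[of I ?A ?m ?q s "i + j" ?C] assms by (intro exI allI) simp
qed

lemma heval_add: "heval I s j c x \<mu> + heval I s j d x \<mu> = heval I s j (\<lambda>m q. c m q + d m q) x \<mu>"
  by (auto simp: heval_def sum.distrib distrib_right case_prod_unfold)

lemma heval_scale: "a * heval I s j c x \<mu> = heval I s j (\<lambda>m q. a * c m q) x \<mu>"
  by (auto simp: heval_def sum_distrib_left mult.assoc case_prod_unfold)

lemma heval_zero: "heval I s j (\<lambda>_ _. 0) x \<mu> = 0"
  by (simp add: heval_def)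

lemma heval_of_real:
  "of_real (heval I s j c v \<mu>) = (heval I s j (\<lambda>m q. of_real (c m q)) (\<lambda>i. of_real (v i)) \<mu> :: 'a::real_normed_field)"
  by (auto simp: heval_def mon_def case_prod_unfold)

lemma heval_single:
  assumes "finite I" "(m, q) \<in> mexps I s j"
  shows "\<exists>c. \<forall>x \<mu>. mon I s m q x \<mu> = heval I s j c x \<mu>"
  using heval_collect[OF assms(1), of "{()}" "\<lambda>_. m" "\<lambda>_. q" s j "\<lambda>_. 1"] assms(2)
  by (intro exI allI) simp

type_synonym point = "(int \<Rightarrow> complex) \<times> (real \<Rightarrow> real) \<times> (nat \<Rightarrow> real)"

definition xvar :: "int \<Rightarrow> point \<Rightarrow> complex" where "xvar k = (\<lambda>(x, y, \<mu>). x k)"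
definition yvar :: "real \<Rightarrow> point \<Rightarrow> complex" where "yvar \<theta> = (\<lambda>(x, y, \<mu>). of_real (y \<theta>))"
definition \<mu>var :: "nat \<Rightarrow> point \<Rightarrow> complex" where "\<mu>var i = (\<lambda>(x, y, \<mu>). of_real (\<mu> i))"

definition Vx :: "int set \<Rightarrow> nat \<Rightarrow> (point \<Rightarrow> complex) set" where
  "Vx K s = xvar ` K \<union> \<mu>var ` {1..s}"

text \<open>\<open>Y\<close> holds the points at which y is evaluated; it becomes the set of delays
  in the locale \<open>realization\<close>.\<close>

definition Vxy :: "int set \<Rightarrow> nat \<Rightarrow> real set \<Rightarrow> (point \<Rightarrow> complex) set" where
  "Vxy K s Y = Vx K s \<union> yvar ` Y"

text \<open>Every evaluation of y is zero on the slice y = 0, so what remains is a polynomial in x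
  and \<mu> alone, as the homological equations require.\<close>

lemma hpoly_heval:
  assumes "hpoly (Vxy K s Y) j P" "finite K"
  shows "\<exists>c. \<forall>x \<mu>. P (x, (\<lambda>_. 0), \<mu>) = heval K s j c x \<mu>"
  using assms(1)
proof (induction rule: hpoly.induct)
  case (const c)
  have "(\<lambda>_. 0, \<lambda>_. 0) \<in> mexps K s 0" by (simp add: mexps_def vecs_def)
  from heval_single[OF assms(2) this] obtain d :: "(int \<Rightarrow> nat) \<Rightarrow> (nat \<Rightarrow> nat) \<Rightarrow> complex"
    where d: "\<And>x \<mu>. mon K s (\<lambda>_. 0) (\<lambda>_. 0) x \<mu> = heval K s 0 d x \<mu>"
    by metis
  have "c = heval K s 0 (\<lambda>m q. c * d m q) x \<mu>" for x \<mu>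
    using d[of x \<mu>] by (simp add: mon_def flip: heval_scale)
  then show ?case by blast
next
  case (zero n)
  show ?case by (rule exI[of _ "\<lambda>_ _. 0"]) (simp add: heval_zero)
next
  case (var f)
  then consider k where "k \<in> K" "f = xvar k" | i where "i \<in> {1..s}" "f = \<mu>var i" | \<theta> where "f = yvar \<theta>"
    by (auto simp: Vxy_def Vx_def)
  then show ?case
  proof cases
    case (1 k)
    let ?m = "\<lambda>i. if i = k then 1 else (0::nat)"
    have "(?m, \<lambda>_. 0) \<in> mexps K s 1" using 1 assms(2) by (auto simp: mexps_def vecs_def)
    from heval_single[OF assms(2) this] show ?thesis using 1 assms(2)
      by (simp add: mon_def xvar_def if_distrib[of "power _"] cong: if_cong)
  next
    case (2 i)
    let ?q = "\<lambda>l. if l = i then 1 else (0::nat)"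
    have "(\<lambda>_. 0, ?q) \<in> mexps K s 1" using 2 by (auto simp: mexps_def vecs_def)
    from heval_single[OF assms(2) this] show ?thesis using 2
      by (simp add: mon_def \<mu>var_def if_distrib[of "power _"] cong: if_cong)
  next
    case 3 then show ?thesis by (intro exI[of _ "\<lambda>_ _. 0"]) (simp add: heval_zero yvar_def)
  qed
next
  case (add n P Q)
  then obtain c d where "\<And>x \<mu>. P (x, (\<lambda>_. 0), \<mu>) = heval K s n c x \<mu>" "\<And>x \<mu>. Q (x, (\<lambda>_. 0), \<mu>) = heval K s n d x \<mu>"
    by blast
  then show ?case by (intro exI[of _ "\<lambda>m q. c m q + d m q"]) (simp add: heval_add)
next
  case (mult m P n Q)
  then obtain c d where "\<And>x \<mu>. P (x, (\<lambda>_. 0), \<mu>) = heval K s m c x \<mu>" "\<And>x \<mu>. Q (x, (\<lambda>_. 0), \<mu>) = heval K s n d x \<mu>"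
    by blast
  moreover obtain e where "\<And>x \<mu>. heval K s m c x \<mu> * heval K s n d x \<mu> = heval K s (m + n) e x \<mu>"
    using heval_mult[OF assms(2)] by blast
  ultimately show ?case by (intro exI[of _ e]) simp
qed

lemma heval_hpoly:
  assumes "finite I" "\<And>i. i \<in> I \<Longrightarrow> hpoly V 1 (\<lambda>z. X z i)" "\<mu>var ` {1..s} \<subseteq> V"
  shows "hpoly V j (\<lambda>z. heval I s j c (X z) (snd (snd z)))"
  unfolding heval_def
proof (rule hpoly_sum)
  fix e assume e: "e \<in> mexps I s j"
  obtain m q where mq: "e = (m, q)" by force
  have "hpoly V (sum m I) (\<lambda>z. \<Prod>i\<in>I. X z i ^ m i)" using assms by (intro hpoly_monomial) auto
  moreover have "hpoly V (sum q {1..s}) (\<lambda>z. \<Prod>i\<in>{1..s}. \<mu>var i z ^ q i)"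
    using assms(3) by (intro hpoly_monomial) (auto intro!: hpoly.var simp del: One_nat_def)
  ultimately have "hpoly V j (\<lambda>z. (\<Prod>i\<in>I. X z i ^ m i) * (\<Prod>i\<in>{1..s}. \<mu>var i z ^ q i))"
    using hpoly.mult e mq by (fastforce simp: mexps_def)
  from hpoly_scale[OF this, of "c m q"]
  show "hpoly V j (\<lambda>z. case e of (m, q) \<Rightarrow> c m q * mon I s m q (X z) (snd (snd z)))"
    by (simp add: mq mon_def \<mu>var_def case_prod_unfold)
qed (simp add: assms)

text \<open>Differentiation costs one degree and the direction brings \<open>Suc n\<close>, so the
  degree rises by \<open>n\<close>. This is the count behind the index \<open>m + 1 - j\<close> in
  \<open>transformed\<close>.\<close>

lemma hpoly_dirD:
  assumes "hpoly (Vx K s) m P" and W: "\<And>k. k \<in> K \<Longrightarrow> hpoly V (Suc n) (\<lambda>z. W z k)" and V: "Vx K s \<subseteq> V"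
  shows "\<exists>D. hpoly V (m + n) D \<and> (\<forall>z. ((\<lambda>t. P (\<lambda>k. fst z k + of_real t * W z k, fst (snd z), snd (snd z)))
     has_vector_derivative D z) (at 0))"
  using assms(1)
proof (induction rule: hpoly.induct)
  case (var f)
  then consider k where "k \<in> K" "f = xvar k" | i where "i \<in> {1..s}" "f = \<mu>var i" by (auto simp: Vx_def)
  then show ?case
  proof cases
    case (1 k)
    have "((\<lambda>t. xvar k (\<lambda>k. fst z k + of_real t * W z k, fst (snd z), snd (snd z)))
     has_vector_derivative W z k) (at 0)" for z
      unfolding xvar_def by (auto intro!: derivative_eq_intros)
    then show ?thesis using 1 W[of k] by (intro exI[of _ "\<lambda>z. W z k"]) simp
  next
    case (2 i)
    then show ?thesis by (intro exI[of _ "\<lambda>_. 0"]) (auto simp: \<mu>var_def intro: hpoly.zero)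
  qed
next
  case (add m P Q)
  then obtain D D' where D: "hpoly V (m + n) D" "hpoly V (m + n) D'"
    "\<And>z. ((\<lambda>t. P (\<lambda>k. fst z k + of_real t * W z k, fst (snd z), snd (snd z))) has_vector_derivative D z) (at 0)"
    "\<And>z. ((\<lambda>t. Q (\<lambda>k. fst z k + of_real t * W z k, fst (snd z), snd (snd z))) has_vector_derivative D' z) (at 0)"
    by blast
  show ?case using hpoly.add[OF D(1,2)] has_vector_derivative_add[OF D(3,4)] by blast
next
  case (mult m P n' Q)
  then obtain D D' where D: "hpoly V (m + n) D" "hpoly V (n' + n) D'"
    "\<And>z. ((\<lambda>t. P (\<lambda>k. fst z k + of_real t * W z k, fst (snd z), snd (snd z))) has_vector_derivative D z) (at 0)"
    "\<And>z. ((\<lambda>t. Q (\<lambda>k. fst z k + of_real t * W z k, fst (snd z), snd (snd z))) has_vector_derivative D' z) (at 0)"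
    by blast
  have P: "hpoly V m P" "hpoly V n' Q" using mult V by (auto intro: hpoly_mono)
  have "hpoly V (m + n' + n) (\<lambda>z. P z * D' z + D z * Q z)"
    using hpoly.add[OF hpoly.mult[OF P(1) D(2)], of "\<lambda>z. D z * Q z"] hpoly.mult[OF D(1) P(2)]
    by (simp add: ac_simps)
  moreover have "((\<lambda>t. P (\<lambda>k. fst z k + of_real t * W z k, fst (snd z), snd (snd z)) *
      Q (\<lambda>k. fst z k + of_real t * W z k, fst (snd z), snd (snd z)))
     has_vector_derivative P z * D' z + D z * Q z) (at 0)" for z
    using has_vector_derivative_mult[OF D(3,4)] by simp
  ultimately show ?case by blast
qed (auto intro!: exI[of _ "\<lambda>_. 0"] intro: hpoly.zero)

section \<open>Equivariant averages and the homological equation\<close>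

lemma prod_cidx:
  fixes f :: "int \<Rightarrow> 'a::comm_monoid_mult"
  shows "(\<Prod>k\<in>cidx zr p. f k) = (if zr then f 0 else 1) * (\<Prod>i = 1..p. f (int i) * f (- int i))"
proof -
  have K: "cidx zr p = (if zr then {0} else {}) \<union> (int ` {1..p} \<union> (\<lambda>i. - int i) ` {1..p})"
    by (auto elim!: cidx_cases split: if_splits)
  have "(\<Prod>k\<in>cidx zr p. f k) = (if zr then f 0 else 1) * (\<Prod>k\<in>int ` {1..p} \<union> (\<lambda>i. - int i) ` {1..p}. f k)"
    unfolding K by (cases zr) (simp_all add: image_iff)
  also have "(\<Prod>k\<in>int ` {1..p} \<union> (\<lambda>i. - int i) ` {1..p}. f k) = (\<Prod>i = 1..p. f (int i)) * (\<Prod>i = 1..p. f (- int i))"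
    by (subst prod.union_disjoint) (auto simp: prod.reindex inj_on_def)
  finally show ?thesis by (simp add: prod.distrib)
qed

lemma ridx_finite [simp]: "finite (ridx zr p)" by (simp add: ridx_def)

lemma int_ridx [simp]: "i \<in> ridx zr p \<Longrightarrow> int i \<in> cidx zr p"
  by (cases "i = 0") (auto simp: ridx_def split: if_splits)

lemma prod_ridx:
  fixes f :: "nat \<Rightarrow> 'a::comm_monoid_mult"
  shows "(\<Prod>i\<in>ridx zr p. f i) = (if zr then f 0 else 1) * (\<Prod>i = 1..p. f i)"
  by (simp add: ridx_def prod.atLeast_Suc_atMost)

lemma cptsD:
  assumes "x \<in> cpts zr p"
  shows "x (- k) = cnj (x k)" "k \<notin> cidx zr p \<Longrightarrow> x k = 0"
  using assms by (auto simp: cpts_def vecs_def)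

lemma cpts_add_scale:
  "x \<in> cpts zr p \<Longrightarrow> w \<in> cpts zr p \<Longrightarrow> (\<lambda>k. x k + of_real t * w k) \<in> cpts zr p"
  and cpts_scale: "x \<in> cpts zr p \<Longrightarrow> (\<lambda>k. of_real t * x k) \<in> cpts zr p"
  by (auto simp: cpts_def vecs_def)

lemma rot_cpts: "x \<in> cpts zr p \<Longrightarrow> rot \<theta> x \<in> cpts zr p"
  by (auto simp: cpts_def vecs_def rot_def exp_cnj)

lemma Bop_cpts: "x \<in> cpts zr p \<Longrightarrow> Bop \<omega> x \<in> cpts zr p"
  by (auto simp: cpts_def vecs_def Bop_def)

lemma mon_cnj:
  assumes "x \<in> cpts zr p"
  shows "cnj (mon (cidx zr p) s m q x \<mu>) = mon (cidx zr p) s (\<lambda>k. m (- k)) q x \<mu>"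
proof -
  have "(\<Prod>k\<in>cidx zr p. cnj (x k) ^ m k) = (\<Prod>k\<in>cidx zr p. x k ^ m (- k))"
    by (rule prod.reindex_bij_witness[of _ uminus uminus]) (auto simp: cptsD(1)[OF assms])
  then show ?thesis by (simp add: mon_def)
qed

lemma mexps_neg: "(m, q) \<in> mexps (cidx zr p) s j \<Longrightarrow> ((\<lambda>k. m (- k)), q) \<in> mexps (cidx zr p) s j"
proof -
  have "(\<Sum>k\<in>cidx zr p. m (- k)) = (\<Sum>k\<in>cidx zr p. m k)"
    by (rule sum.reindex_bij_witness[of _ uminus uminus]) auto
  then show "(m, q) \<in> mexps (cidx zr p) s j \<Longrightarrow> ((\<lambda>k. m (- k)), q) \<in> mexps (cidx zr p) s j"
    by (auto simp: mexps_def vecs_def)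
qed

lemma heval_cnj:
  assumes "x \<in> cpts zr p"
  shows "cnj (heval (cidx zr p) s j c x \<mu>) = heval (cidx zr p) s j (\<lambda>m q. cnj (c (\<lambda>k. m (- k)) q)) x \<mu>"
  unfolding heval_def cnj_sum
  by (rule sum.reindex_bij_witness[of _ "\<lambda>(m, q). (\<lambda>k. m (- k), q)" "\<lambda>(m, q). (\<lambda>k. m (- k), q)"])
    (auto simp: mon_cnj[OF assms] mexps_neg)

lemma heval_diff: "heval I s j c x \<mu> - heval I s j d x \<mu> = heval I s j (\<lambda>m q. c m q - d m q) x \<mu>"
  by (auto simp: heval_def sum_subtractf left_diff_distrib case_prod_unfold)

lemma heval_coeff_cong:
  "(\<And>m q. (m, q) \<in> mexps I s j \<Longrightarrow> c m q = d m q) \<Longrightarrow> heval I s j c x \<mu> = heval I s j d x \<mu>"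
  unfolding heval_def by (intro sum.cong) auto

text \<open>Reality is given for values only, while the coefficients are some arbitrary choice.
  Averaging each coefficient with the conjugate of its mirror image makes the choice itself
  symmetric.\<close>

lemma HK_symmetric:
  assumes "f \<in> HK zr p s j"
  obtains c where "\<And>k x \<mu>. k \<in> cidx zr p \<Longrightarrow> x \<in> cpts zr p \<Longrightarrow> \<mu> \<in> params s \<Longrightarrow>
      f x \<mu> k = heval (cidx zr p) s j (c k) x \<mu>"
    and "\<And>k m q. c (- k) (\<lambda>k. m (- k)) q = cnj (c k m q)"
proof -
  obtain c where c: "\<And>k x \<mu>. k \<in> cidx zr p \<Longrightarrow> x \<in> cpts zr p \<Longrightarrow> \<mu> \<in> params s \<Longrightarrow>
      f x \<mu> k = heval (cidx zr p) s j (c k) x \<mu>"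
    using assms unfolding HK_def mem_Collect_eq by metis
  define c' where "c' k m q = (1/2) * (c k m q + cnj (c (- k) (\<lambda>k. m (- k)) q))" for k m q
  show thesis
  proof
    fix k x \<mu> assume k: "k \<in> cidx zr p" and x: "x \<in> cpts zr p" and \<mu>: "\<mu> \<in> params s"
    have "f x \<mu> \<in> cpts zr p" using assms x \<mu> by (simp add: HK_def)
    then have "f x \<mu> k = (1/2) * (f x \<mu> k + cnj (f x \<mu> (- k)))" by (simp add: cptsD(1))
    also have "\<dots> = heval (cidx zr p) s j (c' k) x \<mu>"
      using k x \<mu> unfolding c'_def[abs_def]
      by (simp only: c heval_cnj cidx_minus heval_add heval_scale[symmetric])
    finally show "f x \<mu> k = heval (cidx zr p) s j (c' k) x \<mu>" .
  qed (simp add: c'_def add.commute)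
qed

lemma HK_I:
  assumes "\<And>k x \<mu>. x \<in> cpts zr p \<Longrightarrow> \<mu> \<in> params s \<Longrightarrow>
      f x \<mu> k = (if k \<in> cidx zr p then heval (cidx zr p) s j (c k) x \<mu> else 0)"
    and "\<And>k m q. k \<in> cidx zr p \<Longrightarrow> (m, q) \<in> mexps (cidx zr p) s j \<Longrightarrow> c (- k) (\<lambda>k. m (- k)) q = cnj (c k m q)"
  shows "f \<in> HK zr p s j"
proof -
  have "f x \<mu> (- k) = cnj (f x \<mu> k)" if x: "x \<in> cpts zr p" and \<mu>: "\<mu> \<in> params s" for x \<mu> k
  proof (cases "k \<in> cidx zr p")
    case True
    have "cnj (c k (\<lambda>k. m (- k)) q) = c (- k) m q" if "(m, q) \<in> mexps (cidx zr p) s j" for m q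
      using assms(2)[OF True mexps_neg[OF that]] by simp
    then show ?thesis using True x \<mu> by (simp add: assms(1) heval_cnj cong: heval_coeff_cong)
  next
    case False
    then have "- k \<notin> cidx zr p" by simp
    then show ?thesis using False unfolding assms(1)[OF x \<mu>] by simp
  qed
  then show ?thesis using assms(1) unfolding HK_def cpts_def vecs_def by (auto 0 4)
qed

subsection \<open>Averages\<close>

lemma integral_exp_circle:
  fixes n :: int
  shows "integral\<^sup>L (uniform_measure lborel {0..2 * pi}) (\<lambda>t. exp (\<i> * of_real (of_int n * t)))
    = (if n = 0 then 1 else (0 :: complex))"
proof -
  let ?f = "\<lambda>t. exp (\<i> * of_real (of_int n * t))"
  have u: "uniform_measure lborel {0..2 * pi} = density lborel (\<lambda>t. ennreal (indicator {0..2 * pi} t / (2 * pi)))"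
    unfolding uniform_measure_def
    by (intro arg_cong2[where f=density] refl ext) (simp add: indicator_def divide_ennreal ennreal_divide_numeral flip: ennreal_1)
  have "integral\<^sup>L (uniform_measure lborel {0..2 * pi}) ?f
      = (\<integral>t. (indicator {0..2 * pi} t / (2 * pi)) *\<^sub>R ?f t \<partial>lborel)"
    unfolding u by (intro integral_density) auto
  also have "\<dots> = (\<integral>t. (1 / (2 * pi)) *\<^sub>R (indicator {0..2 * pi} t *\<^sub>R ?f t) \<partial>lborel)"
    by simp
  also have "\<dots> = (1 / (2 * pi)) *\<^sub>R (LINT t:{0..2*pi}|lborel. ?f t)"
    unfolding set_lebesgue_integral_def by (rule integral_scaleR_right)
  also have "(LINT t:{0..2*pi}|lborel. ?f t) = integral {0..2*pi} ?f"
    by (intro set_borel_integral_eq_integral borel_integrable_atLeastAtMost' continuous_intros)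
  also have "integral {0..2*pi} ?f = (if n = 0 then 2 * pi else 0)"
  proof (cases "n = 0")
    case False
    have "(?f has_integral (exp (\<i> * of_real (of_int n * (2 * pi))) / (\<i> * of_int n) - exp (\<i> * of_real (of_int n * 0)) / (\<i> * of_int n))) {0..2*pi}"
    proof (rule fundamental_theorem_of_calculus)
      fix t :: real
      have "((\<lambda>t. exp (\<i> * (of_int n * t)) / (\<i> * of_int n)) has_field_derivative exp (\<i> * (of_int n * complex_of_real t)))
          (at (of_real t))"
        using False by (auto intro!: derivative_eq_intros simp: field_simps)
      from has_vector_derivative_real_field[OF this]
      show "((\<lambda>t. exp (\<i> * of_real (of_int n * t)) / (\<i> * of_int n)) has_vector_derivative ?f t) (at t within {0..2*pi})"
        by simp
    qed simp
    moreover have "exp (\<i> * of_real (of_int n * (2 * pi))) = 1"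
      using exp_integer_2pi[of "of_int n"] by (simp add: ac_simps)
    ultimately show ?thesis using False by (simp add: integral_unique)
  qed (simp add: scaleR_conv_of_real)
  finally show ?thesis by (simp add: scaleR_conv_of_real)
qed

lemma finite_measure_circle: "finite_measure (uniform_measure lborel {0..2 * pi})"
  by (rule finite_measureI) simp

lemma integral_exp_torus:
  fixes n :: "nat \<Rightarrow> int"
  shows "integrable (haar_torus p) (\<lambda>\<theta>. exp (\<i> * of_real (\<Sum>i = 1..p. of_int (n i) * \<theta> i)))"
    and "(\<integral>\<theta>. exp (\<i> * of_real (\<Sum>i = 1..p. of_int (n i) * \<theta> i)) \<partial>haar_torus p)
    = (if \<forall>i\<in>{1..p}. n i = 0 then 1 else (0 :: complex))"
proof -
  let ?U = "uniform_measure lborel {0..2 * pi :: real}"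
  interpret finite_measure ?U by (rule finite_measure_circle)
  interpret product_sigma_finite "\<lambda>_::nat. ?U" by unfold_locales
  have e: "exp (\<i> * of_real (\<Sum>i = 1..p. of_int (n i) * \<theta> i)) = (\<Prod>i\<in>{1..p}. exp (\<i> * of_real (of_int (n i) * \<theta> i)))"
    for \<theta> :: "nat \<Rightarrow> real" by (simp add: sum_distrib_left exp_sum)
  have int: "integrable ?U (\<lambda>t. exp (\<i> * of_real (of_int (n i) * t)))" for i
    by (rule integrable_const_bound[of _ 1]) (auto simp: norm_exp_i_times)
  show "integrable (haar_torus p) (\<lambda>\<theta>. exp (\<i> * of_real (\<Sum>i = 1..p. of_int (n i) * \<theta> i)))"
    unfolding e haar_torus_def using int by (intro product_integrable_prod) simp_all
  have "(\<integral>\<theta>. exp (\<i> * of_real (\<Sum>i = 1..p. of_int (n i) * \<theta> i)) \<partial>haar_torus p)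
      = (\<integral>\<theta>. (\<Prod>i\<in>{1..p}. exp (\<i> * of_real (of_int (n i) * \<theta> i))) \<partial>haar_torus p)"
    unfolding e ..
  also have "\<dots> = (\<Prod>i\<in>{1..p}. integral\<^sup>L ?U (\<lambda>t. exp (\<i> * of_real (of_int (n i) * t))))"
    unfolding haar_torus_def using int by (intro product_integral_prod) simp_all
  also have "\<dots> = (if \<forall>i\<in>{1..p}. n i = 0 then 1 else 0)"
    unfolding integral_exp_circle by (auto intro!: prod.neutral)
  finally show "(\<integral>\<theta>. exp (\<i> * of_real (\<Sum>i = 1..p. of_int (n i) * \<theta> i)) \<partial>haar_torus p)
    = (if \<forall>i\<in>{1..p}. n i = 0 then 1 else (0 :: complex))" .
qed

text \<open>Under each circle of the torus the monomial and the basis vector \<open>k\<close> have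
  the same weight, so that their product is an equivariant map. For \<open>k = 0\<close> all weights
  vanish.\<close>

definition resonant :: "nat \<Rightarrow> int \<Rightarrow> (int \<Rightarrow> nat) \<Rightarrow> bool" where
  "resonant p k m \<longleftrightarrow> (\<forall>i\<in>{1..p}. int (m (int i)) - int (m (- int i)) =
     (if k = int i then 1 else 0) - (if k = - int i then 1 else 0))"

lemma resonant_minus: "resonant p (- k) (\<lambda>k. m (- k)) \<longleftrightarrow> resonant p k m"
  unfolding resonant_def by (intro ball_cong refl) (auto simp: equation_minus_iff minus_equation_iff)

text \<open>The group action multiplies each monomial by a character of the torus, and a character
  integrates to 1 if it is trivial and to 0 otherwise.\<close>

lemma average_heval:
  assumes F: "\<And>x. x \<in> cpts zr p \<Longrightarrow> F x \<mu> k = heval (cidx zr p) s j c x \<mu>"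
    and k: "k \<in> cidx zr p" and x: "x \<in> cpts zr p"
  shows "average p F x \<mu> k = heval (cidx zr p) s j (\<lambda>m q. if resonant p k m then c m q else 0) x \<mu>"
proof -
  \<comment> \<open>The weights of the character by which the action multiplies the monomial
    \<open>m\<close> in component \<open>k\<close>.\<close>
  define n where "n m i = ((if k = int i then 1 else 0) - (if k = - int i then 1 else 0)) -
      (int (m (int i)) - int (m (- int i)))" for m and i :: nat
  have res: "(\<forall>i\<in>{1..p}. n m i = 0) \<longleftrightarrow> resonant p k m" for m
    unfolding n_def resonant_def by auto
  have k_eq: "odd_ext \<theta> k = (\<Sum>i = 1..p. ((if k = int i then 1 else 0) - (if k = - int i then 1 else 0)) * \<theta> i)" for \<theta>
    using k
  proof (cases rule: cidx_cases)
    case 1 then show ?thesis by (auto intro!: sum.neutral)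
  next
    case (2 i)
    then have "(\<Sum>l = 1..p. ((if k = int l then 1 else 0) - (if k = - int l then 1 else 0)) * \<theta> l) = (\<Sum>l = 1..p. if l = i then \<theta> i else 0)"
      by (intro sum.cong) auto
    then show ?thesis using 2 by simp
  next
    case (3 i)
    then have "(\<Sum>l = 1..p. ((if k = int l then 1 else 0) - (if k = - int l then 1 else 0)) * \<theta> l) = (\<Sum>l = 1..p. if l = i then - \<theta> i else 0)"
      by (intro sum.cong) auto
    then show ?thesis using 3 by simp
  qed
  have mon_rot: "mon (cidx zr p) s m q (rot (\<lambda>i. - \<theta> i) x) \<mu>
      = exp (- \<i> * of_real (\<Sum>l\<in>cidx zr p. odd_ext \<theta> l * m l)) * mon (cidx zr p) s m q x \<mu>" for m q \<theta>
  proof -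
    have "(\<Prod>l\<in>cidx zr p. rot (\<lambda>i. - \<theta> i) x l ^ m l) = (\<Prod>l\<in>cidx zr p. exp (- \<i> * of_real (odd_ext \<theta> l * m l)) * x l ^ m l)"
      by (intro prod.cong refl) (simp add: rot_def power_mult_distrib odd_ext_def flip: exp_of_nat_mult, simp add: ac_simps)
    also have "\<dots> = exp (- \<i> * of_real (\<Sum>l\<in>cidx zr p. odd_ext \<theta> l * m l)) * (\<Prod>l\<in>cidx zr p. x l ^ m l)"
      by (simp add: prod.distrib sum_distrib_left exp_sum sum_negf[symmetric])
    finally show ?thesis by (simp add: mon_def)
  qed
  have int_res: "(\<integral>\<theta>. exp (\<i> * of_real (\<Sum>i = 1..p. of_int (n m i) * \<theta> i)) \<partial>haar_torus p)
      = (if resonant p k m then 1 else (0 :: complex))" for m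
    unfolding integral_exp_torus(2) res ..
  note intg = integral_exp_torus(1)[of p "n m" for m]
  have "average p F x \<mu> k = (\<integral>\<theta>. (\<Sum>(m, q)\<in>mexps (cidx zr p) s j.
      exp (\<i> * of_real (\<Sum>i = 1..p. of_int (n m i) * \<theta> i)) * (c m q * mon (cidx zr p) s m q x \<mu>)) \<partial>haar_torus p)"
    unfolding average_def
  proof (intro Bochner_Integration.integral_cong refl)
    fix \<theta> :: "nat \<Rightarrow> real"
    have e: "odd_ext \<theta> k - (\<Sum>l\<in>cidx zr p. odd_ext \<theta> l * m l) = (\<Sum>i = 1..p. of_int (n m i) * \<theta> i)" for m
    proof -
      have "(\<Sum>l\<in>cidx zr p. odd_ext \<theta> l * m l) = (\<Sum>i = 1..p. odd_ext \<theta> (int i) * m (int i) + odd_ext \<theta> (- int i) * m (- int i))"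
        unfolding sum_cidx by simp
      also have "\<dots> = (\<Sum>i = 1..p. (int (m (int i)) - int (m (- int i))) * \<theta> i)"
        by (intro sum.cong) (auto simp: algebra_simps)
      finally show ?thesis unfolding k_eq n_def
        by (simp add: sum_subtractf[symmetric]) (intro sum.cong, auto simp: algebra_simps)
    qed
    have "rot \<theta> (F (rot (\<lambda>i. - \<theta> i) x) \<mu>) k = exp (\<i> * of_real (odd_ext \<theta> k)) * heval (cidx zr p) s j c (rot (\<lambda>i. - \<theta> i) x) \<mu>"
      using F[OF rot_cpts[OF x]] by (simp add: rot_def)
    also have "\<dots> = (\<Sum>(m, q)\<in>mexps (cidx zr p) s j. exp (\<i> * of_real (odd_ext \<theta> k)) *
        exp (- \<i> * of_real (\<Sum>l\<in>cidx zr p. odd_ext \<theta> l * m l)) * (c m q * mon (cidx zr p) s m q x \<mu>))"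
      unfolding heval_def sum_distrib_left mon_rot by (intro sum.cong) (auto simp: ac_simps)
    also have "\<dots> = (\<Sum>(m, q)\<in>mexps (cidx zr p) s j.
      exp (\<i> * of_real (\<Sum>i = 1..p. of_int (n m i) * \<theta> i)) * (c m q * mon (cidx zr p) s m q x \<mu>))"
      unfolding e[symmetric] by (intro sum.cong refl) (auto simp: algebra_simps simp flip: exp_add)
    finally show "rot \<theta> (F (rot (\<lambda>i. - \<theta> i) x) \<mu>) k = \<dots>" .
  qed
  also have "\<dots> = (\<Sum>(m, q)\<in>mexps (cidx zr p) s j. (if resonant p k m then 1 else 0) * (c m q * mon (cidx zr p) s m q x \<mu>))"
    using int_res intg by (subst Bochner_Integration.integral_sum) (auto simp: case_prod_unfold)
  also have "\<dots> = heval (cidx zr p) s j (\<lambda>m q. if resonant p k m then c m q else 0) x \<mu>"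
    unfolding heval_def by (intro sum.cong) auto
  finally show ?thesis .
qed

lemma average_cnj:
  assumes F: "F \<in> HK zr p s j" and x: "x \<in> cpts zr p" and \<mu>: "\<mu> \<in> params s"
  shows "average p F x \<mu> (- k) = cnj (average p F x \<mu> k)"
proof -
  have "F (rot (\<lambda>i. - \<theta> i) x) \<mu> \<in> cpts zr p" for \<theta>
    using F rot_cpts[OF x] \<mu> by (simp add: HK_def)
  then have "rot \<theta> (F (rot (\<lambda>i. - \<theta> i) x) \<mu>) (- k) = cnj (rot \<theta> (F (rot (\<lambda>i. - \<theta> i) x) \<mu>) k)" for \<theta>
    using cptsD(1) rot_cpts by blast
  then show ?thesis unfolding average_def by simp
qed

text \<open>Along a diagonal linear field each coordinate is multiplied by
  \<open>1 + t * w k\<close>, so monomials are eigenvectors, and the eigenvalue is the derivative of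
  the resulting product at \<open>t = 0\<close>.\<close>

lemma dirD_heval:
  fixes w :: "'i \<Rightarrow> complex"
  assumes "finite K"
  shows "((\<lambda>t. heval K s j c (\<lambda>k. x k + of_real t * (w k * x k)) \<mu>) has_vector_derivative
     heval K s j (\<lambda>m q. (\<Sum>k\<in>K. of_nat (m k) * w k) * c m q) x \<mu>) (at 0)"
proof -
  have d: "((\<lambda>t. \<Prod>k\<in>A. (1 + complex_of_real t * w k) ^ m k) has_vector_derivative (\<Sum>k\<in>A. of_nat (m k) * w k)) (at 0)"
    if "finite A" for A :: "'i set" and m
    using that
  proof (induction A rule: finite_induct)
    case (insert a A)
    have "((\<lambda>z. (1 + z * w a) ^ m a) has_field_derivative of_nat (m a) * w a) (at 0)"
      by (auto intro!: derivative_eq_intros)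
    then have "((\<lambda>t. (1 + complex_of_real t * w a) ^ m a) has_vector_derivative of_nat (m a) * w a) (at 0)"
      using has_vector_derivative_real_field[of "\<lambda>z. (1 + z * w a) ^ m a" _ 0 UNIV] by simp
    from has_vector_derivative_mult[OF this insert.IH] show ?case
      using insert.hyps by (simp add: add.commute)
  qed simp
  have mon: "mon K s m q (\<lambda>k. x k + of_real t * (w k * x k)) \<mu>
      = (\<Prod>k\<in>K. (1 + of_real t * w k) ^ m k) * mon K s m q x \<mu>" for m q t
  proof -
    have "x k + of_real t * (w k * x k) = (1 + of_real t * w k) * x k" for k
      by (simp add: algebra_simps)
    then show ?thesis by (simp add: mon_def power_mult_distrib prod.distrib)
  qed
  have "((\<lambda>t. \<Sum>(m, q)\<in>mexps K s j. (\<Prod>k\<in>K. (1 + complex_of_real t * w k) ^ m k) * (c m q * mon K s m q x \<mu>)) has_vector_derivative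
     (\<Sum>(m, q)\<in>mexps K s j. (\<Sum>k\<in>K. of_nat (m k) * w k) * (c m q * mon K s m q x \<mu>))) (at 0)"
    unfolding case_prod_unfold
    by (intro has_vector_derivative_sum bounded_linear.has_vector_derivative[OF bounded_linear_mult_left] d assms)
  moreover have "heval K s j c (\<lambda>k. x k + of_real t * (w k * x k)) \<mu>
      = (\<Sum>(m, q)\<in>mexps K s j. (\<Prod>k\<in>K. (1 + complex_of_real t * w k) ^ m k) * (c m q * mon K s m q x \<mu>))" for t
    unfolding heval_def mon by (intro sum.cong) (auto simp: ac_simps)
  moreover have "heval K s j (\<lambda>m q. (\<Sum>k\<in>K. of_nat (m k) * w k) * c m q) x \<mu>
     = (\<Sum>(m, q)\<in>mexps K s j. (\<Sum>k\<in>K. of_nat (m k) * w k) * (c m q * mon K s m q x \<mu>))"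
    unfolding heval_def by (intro sum.cong) (auto simp: ac_simps)
  ultimately show ?thesis by simp
qed

context center_spectrum
begin

lemma Bop_\<sigma>: "Bop \<omega> x k = \<sigma> k * x k" by (simp add: Bop_def \<sigma>_def)

lemma dirD_heval_cpts:
  assumes f: "\<And>x. x \<in> cpts zr p \<Longrightarrow> f x = heval K s j c x \<mu>" and x: "x \<in> cpts zr p"
  shows "dirD f x (Bop \<omega> x) = heval K s j (\<lambda>m q. (\<Sum>k\<in>K. of_nat (m k) * \<sigma> k) * c m q) x \<mu>"
proof -
  have "f (\<lambda>k. x k + of_real t * Bop \<omega> x k) = heval K s j c (\<lambda>k. x k + of_real t * (\<sigma> k * x k)) \<mu>" for t
    using f[OF cpts_add_scale[OF x Bop_cpts[OF x, of \<omega>]], of t] by (simp add: Bop_\<sigma>)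
  then show ?thesis unfolding dirD_def by (simp add: vector_derivative_at[OF dirD_heval])
qed

text \<open>Rational independence makes the single frequency relation equivalent to the
  \<open>p\<close> weight relations. Hence the monomials annihilated by \<open>LB\<close> are
  exactly those that averaging keeps.\<close>

lemma resonant_iff:
  assumes "k \<in> K"
  shows "resonant p k m \<longleftrightarrow> (\<Sum>l\<in>K. of_nat (m l) * \<sigma> l) = \<sigma> k"
proof -
  define n where "n l = int (m l) - (if l = k then 1 else 0)" for l
  have "(\<Sum>l\<in>K. odd_ext \<omega> l * n l) = (\<Sum>l\<in>K. odd_ext \<omega> l * m l) - (\<Sum>l\<in>K. if l = k then odd_ext \<omega> l else 0)"
    unfolding sum_subtractf[symmetric] by (intro sum.cong) (auto simp: n_def algebra_simps)
  then have sn: "(\<Sum>l\<in>K. odd_ext \<omega> l * n l) = (\<Sum>l\<in>K. odd_ext \<omega> l * m l) - odd_ext \<omega> k"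
    using assms by simp
  have "(\<Sum>l\<in>K. of_nat (m l) * \<sigma> l) = \<i> * of_real (\<Sum>l\<in>K. odd_ext \<omega> l * m l)"
    by (simp add: \<sigma>_def sum_distrib_left ac_simps)
  then have "(\<Sum>l\<in>K. of_nat (m l) * \<sigma> l) = \<sigma> k \<longleftrightarrow> (\<Sum>l\<in>K. odd_ext \<omega> l * n l) = 0"
    unfolding sn \<sigma>_def by (simp only: mult_cancel_left of_real_eq_iff) auto
  also have "\<dots> \<longleftrightarrow> (\<forall>i\<in>{1..p}. n (int i) = n (- int i))"
  proof
    assume "\<forall>i\<in>{1..p}. n (int i) = n (- int i)"
    then show "(\<Sum>l\<in>K. odd_ext \<omega> l * n l) = 0" unfolding sum_cidx by (auto intro!: sum.neutral)
  qed (use nonresonance in blast)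
  also have "\<dots> \<longleftrightarrow> resonant p k m"
    unfolding resonant_def n_def by (intro ball_cong refl) auto
  finally show ?thesis ..
qed

lemma LB_heval:
  assumes f: "\<And>x. x \<in> cpts zr p \<Longrightarrow> f x \<mu> k = heval K s j c x \<mu>" and x: "x \<in> cpts zr p"
  shows "LB \<omega> f x \<mu> k = heval K s j (\<lambda>m q. ((\<Sum>l\<in>K. of_nat (m l) * \<sigma> l) - \<sigma> k) * c m q) x \<mu>"
  using dirD_heval_cpts[of "\<lambda>x. f x \<mu> k", OF f x]
  by (simp add: LB_def Bop_\<sigma>[of "f x \<mu>"] f[OF x] heval_scale heval_diff left_diff_distrib)

text \<open>\<open>LB\<close> is diagonal on monomials, and its eigenvalue \<open>ev\<close>
  vanishes exactly at the resonant ones. These are left out of \<open>U\<close>, so \<open>U\<close>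
  has zero average; dividing by \<open>ev\<close> preserves the conjugation symmetry.\<close>

lemma homological_solution:
  assumes "F \<in> HK zr p s j"
  shows "\<exists>U\<in>HK zr p s j. (\<forall>x \<mu> k. k \<notin> K \<longrightarrow> U x \<mu> k = 0) \<and>
    (\<forall>x\<in>cpts zr p. \<forall>\<mu>\<in>params s. \<forall>k\<in>K. LB \<omega> U x \<mu> k = F x \<mu> k - average p F x \<mu> k \<and> average p U x \<mu> k = 0)"
proof -
  obtain c where c: "\<And>k x \<mu>. k \<in> K \<Longrightarrow> x \<in> cpts zr p \<Longrightarrow> \<mu> \<in> params s \<Longrightarrow>
      F x \<mu> k = heval K s j (c k) x \<mu>"
    and sym: "\<And>k m q. c (- k) (\<lambda>k. m (- k)) q = cnj (c k m q)"
    using HK_symmetric[OF assms] by metis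
  define ev where "ev k m = (\<Sum>l\<in>K. of_nat (m l) * \<sigma> l) - \<sigma> k" for k m
  have ev_minus: "ev (- k) (\<lambda>k. m (- k)) = cnj (ev k m)" for k m
  proof -
    have "(\<Sum>l\<in>K. of_nat (m (- l)) * \<sigma> l) = (\<Sum>l\<in>K. of_nat (m l) * \<sigma> (- l))"
      by (rule sum.reindex_bij_witness[of _ uminus uminus]) auto
    then show ?thesis by (simp add: ev_def \<sigma>_minus)
  qed
  have res: "resonant p k m \<longleftrightarrow> ev k m = 0" if "k \<in> K" for k m
    using resonant_iff[OF that] by (simp add: ev_def)
  define u where "u k m q = (if resonant p k m then 0 else c k m q / ev k m)" for k m q
  define U where "U x \<mu> k = (if k \<in> K then heval K s j (u k) x \<mu> else 0)" for x \<mu> k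
  have "U \<in> HK zr p s j"
    by (rule HK_I[of _ _ _ _ _ u]) (simp_all add: U_def u_def resonant_minus sym ev_minus)
  moreover have "LB \<omega> U x \<mu> k = F x \<mu> k - average p F x \<mu> k"
    if "x \<in> cpts zr p" "\<mu> \<in> params s" "k \<in> K" for x \<mu> k
  proof -
    have "LB \<omega> U x \<mu> k = heval K s j (\<lambda>m q. ev k m * u k m q) x \<mu>"
      unfolding ev_def by (rule LB_heval) (use that in \<open>auto simp: U_def\<close>)
    also have "\<dots> = heval K s j (\<lambda>m q. c k m q - (if resonant p k m then c k m q else 0)) x \<mu>"
      using res[OF that(3)] by (intro heval_coeff_cong) (simp add: u_def)
    also have "\<dots> = F x \<mu> k - average p F x \<mu> k"
      using average_heval[of zr p F \<mu> k s j "c k", OF c[OF that(3) _ that(2)] that(3,1)] c[OF that(3,1,2)] by (simp add: heval_diff)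
    finally show ?thesis .
  qed
  moreover have "average p U x \<mu> k = 0" if "x \<in> cpts zr p" "\<mu> \<in> params s" "k \<in> K" for x \<mu> k
  proof -
    have "average p U x \<mu> k = heval K s j (\<lambda>m q. if resonant p k m then u k m q else 0) x \<mu>"
      by (rule average_heval) (use that in \<open>auto simp: U_def\<close>)
    also have "\<dots> = heval K s j (\<lambda>m q. 0) x \<mu>" by (intro heval_coeff_cong) (simp add: u_def)
    finally show ?thesis by (simp add: heval_zero)
  qed
  ultimately show ?thesis by (intro bexI[of _ U]) (auto simp: U_def)
qed

text \<open>The solution must itself lie in the range of \<open>LB\<close>. As its average vanishes,
  solving once more with it as right-hand side exhibits a preimage.\<close>

lemma range_LB_solution:
  assumes "F \<in> HK zr p s j"
  shows "\<exists>U\<in>range_LB zr p \<omega> s j. \<forall>x\<in>cpts zr p. \<forall>\<mu>\<in>params s. \<forall>k\<in>K.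
    LB \<omega> U x \<mu> k = F x \<mu> k - average p F x \<mu> k"
proof -
  obtain U where U: "U \<in> HK zr p s j" "\<And>x \<mu> k. k \<notin> K \<Longrightarrow> U x \<mu> k = 0"
    "\<And>x \<mu> k. x \<in> cpts zr p \<Longrightarrow> \<mu> \<in> params s \<Longrightarrow> k \<in> K \<Longrightarrow>
      LB \<omega> U x \<mu> k = F x \<mu> k - average p F x \<mu> k \<and> average p U x \<mu> k = 0"
    using homological_solution[OF assms] by blast
  obtain f where f: "f \<in> HK zr p s j" "\<And>x \<mu> k. k \<notin> K \<Longrightarrow> f x \<mu> k = 0"
    "\<And>x \<mu> k. x \<in> cpts zr p \<Longrightarrow> \<mu> \<in> params s \<Longrightarrow> k \<in> K \<Longrightarrow> LB \<omega> f x \<mu> k = U x \<mu> k - average p U x \<mu> k"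
    using homological_solution[OF U(1)] by blast
  have "U x \<mu> = LB \<omega> f x \<mu>" if "x \<in> cpts zr p" "\<mu> \<in> params s" for x \<mu>
  proof
    \<comment> \<open>Membership in \<open>range_LB\<close> demands equality at every index; off
      \<open>K\<close> both sides are zero by the choice of the solutions.\<close>
    fix k show "U x \<mu> k = LB \<omega> f x \<mu> k"
      using f U that by (cases "k \<in> K") (simp_all add: LB_def dirD_def Bop_def)
  qed
  then have "U \<in> range_LB zr p \<omega> s j" using U(1) f(1) unfolding range_LB_def by blast
  then show ?thesis using U(3) by blast
qed

end

subsection \<open>Radial parts\<close>

lemma heval_collect_le:
  assumes I: "finite I" and A: "finite A" "\<And>a. a \<in> A \<Longrightarrow> (m a, q a) \<in> mexps I s (d a) \<and> d a \<le> N"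
  shows "(\<Sum>a\<in>A. C a * mon I s (m a) (q a) x \<mu>) =
    (\<Sum>n\<le>N. heval I s n (\<lambda>m' q'. \<Sum>a\<in>{a \<in> A. (m a, q a) = (m', q')}. C a) x \<mu>)"
proof -
  have "(\<Sum>a\<in>A. C a * mon I s (m a) (q a) x \<mu>) = (\<Sum>n\<le>N. \<Sum>a\<in>{a \<in> A. d a = n}. C a * mon I s (m a) (q a) x \<mu>)"
    using A by (intro sum.group[symmetric]) auto
  also have "\<dots> = (\<Sum>n\<le>N. heval I s n (\<lambda>m' q'. \<Sum>a\<in>{a \<in> A. (m a, q a) = (m', q')}. C a) x \<mu>)"
  proof (intro sum.cong refl)
    fix n
    have "(\<Sum>a\<in>{a \<in> A. d a = n}. C a * mon I s (m a) (q a) x \<mu>)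
       = heval I s n (\<lambda>m' q'. \<Sum>a\<in>{a \<in> {a \<in> A. d a = n}. (m a, q a) = (m', q')}. C a) x \<mu>"
      using A by (intro heval_collect[OF I]) auto
    also have "\<dots> = heval I s n (\<lambda>m' q'. \<Sum>a\<in>{a \<in> A. (m a, q a) = (m', q')}. C a) x \<mu>"
    proof (rule heval_coeff_cong)
      fix m' q' assume mq: "(m', q') \<in> mexps I s n"
      have "d a = n" if "a \<in> A" "(m a, q a) = (m', q')" for a
        using A(2)[OF that(1)] mq that(2) by (auto simp: mexps_def)
      then have "{a \<in> {a \<in> A. d a = n}. (m a, q a) = (m', q')} = {a \<in> A. (m a, q a) = (m', q')}" by auto
      then show "(\<Sum>a\<in>{a \<in> {a \<in> A. d a = n}. (m a, q a) = (m', q')}. C a) = (\<Sum>a\<in>{a \<in> A. (m a, q a) = (m', q')}. C a)"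
        by (rule arg_cong)
    qed
    finally show "(\<Sum>a\<in>{a \<in> A. d a = n}. C a * mon I s (m a) (q a) x \<mu>) = \<dots>" .
  qed
  finally show ?thesis .
qed

text \<open>The point whose polar radii are \<rho> and whose angles are all zero.\<close>

definition real_point :: "(nat \<Rightarrow> real) \<Rightarrow> int \<Rightarrow> complex" where
  "real_point \<rho> k = of_real (\<rho> (nat \<bar>k\<bar>))"

lemma real_point_cpts:
  assumes "\<rho> \<in> vecs (ridx zr p)" shows "real_point \<rho> \<in> cpts zr p"
proof -
  have "nat \<bar>k\<bar> \<notin> ridx zr p" if "k \<notin> cidx zr p" for k
    using that by (auto simp: cidx_def ridx_def split: if_splits)
  then show ?thesis using assms by (auto simp: cpts_def vecs_def real_point_def)
qed

text \<open>Resonance gives opposite indices equal exponents up to one surplus factor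
  \<open>x (int i)\<close>. The exponent of an invariant is therefore read off at the negative
  index; index 0 is its own opposite.\<close>

lemma resonant_mon:
  assumes x: "x \<in> cpts zr p" and i: "i \<in> ridx zr p" and res: "resonant p (int i) m"
  defines "ivs \<equiv> \<lambda>i::nat. if i = 0 then x 0 else x (int i) * x (- int i)"
    and "m' \<equiv> \<lambda>i. if i \<in> ridx zr p then m (- int i) else 0"
  shows "mon (cidx zr p) s m q x \<mu> = mon (ridx zr p) s m' q ivs \<mu> * (if i = 0 then 1 else x (int i))"
proof -
  have l: "x (int l) ^ m (int l) * x (- int l) ^ m (- int l) = (ivs l) ^ m' l * (if l = i then x (int i) else 1)"
    if "l \<in> {1..p}" for l
  proof -
    have "l \<in> ridx zr p" using that by (auto simp: ridx_def)
    moreover have "m (int l) = m (- int l) + (if l = i then 1 else 0)"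
      using res that unfolding resonant_def by (auto split: if_splits)
    ultimately show ?thesis using that by (auto simp: ivs_def m'_def power_add power_mult_distrib)
  qed
  have "(\<Prod>k\<in>cidx zr p. x k ^ m k) = (if zr then x 0 ^ m 0 else 1) *
      ((\<Prod>l = 1..p. (ivs l) ^ m' l) * (\<Prod>l = 1..p. if l = i then x (int i) else 1))"
    unfolding prod_cidx prod.distrib[symmetric] using l by simp
  also have "(\<Prod>l = 1..p. if l = i then x (int i) else 1) = (if i = 0 then 1 else x (int i))"
    using i by (auto simp: ridx_def split: if_splits)
  also have "(if zr then x 0 ^ m 0 else 1) = (if zr then (ivs 0) ^ m' 0 else 1)"
    by (simp add: ivs_def m'_def ridx_def)
  finally have "(\<Prod>k\<in>cidx zr p. x k ^ m k) = (\<Prod>l\<in>ridx zr p. ivs l ^ m' l) * (if i = 0 then 1 else x (int i))"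
    unfolding prod_ridx by simp
  then show ?thesis by (simp add: mon_def)
qed

text \<open>The coefficient polynomials that \<open>radial_map\<close> asks for consist of the
  resonant monomials with the surplus factor removed. At real points the invariants are the squared
  radii, and \<rho> 0 itself at index 0, so the real part of the average is the radial component.
  This replaces \<Pi> by an evaluation.\<close>

lemma radial_mapI:
  assumes F: "F \<in> HK zr p s j"
    and g: "\<And>x \<mu> k. x \<in> cpts zr p \<Longrightarrow> \<mu> \<in> params s \<Longrightarrow> k \<in> cidx zr p \<Longrightarrow> g x \<mu> k = average p F x \<mu> k"
    and R: "\<And>\<rho> \<mu> i. \<rho> \<in> vecs (ridx zr p) \<Longrightarrow> \<mu> \<in> params s \<Longrightarrow> i \<in> ridx zr p \<Longrightarrow>
      R \<rho> \<mu> i = Re (average p F (real_point \<rho>) \<mu> (int i))"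
  shows "radial_map zr p s g R"
proof -
  let ?K = "cidx zr p" and ?I = "ridx zr p"
  obtain c where c: "\<And>k x \<mu>. k \<in> ?K \<Longrightarrow> x \<in> cpts zr p \<Longrightarrow> \<mu> \<in> params s \<Longrightarrow>
      F x \<mu> k = heval ?K s j (c k) x \<mu>"
    using HK_symmetric[OF F] by metis
  define ivs where "ivs x i = (if i = 0 then x 0 else x (int i) * x (- int i))" for x :: "int \<Rightarrow> complex" and i :: nat
  define A where "A i = {a \<in> mexps ?K s j. resonant p (int i) (fst a)}" for i
  define m' where "m' a = (\<lambda>i. if i \<in> ?I then fst a (- int i) else 0)" for a :: "(int \<Rightarrow> nat) \<times> (nat \<Rightarrow> nat)"
  define d where "d a = sum (m' a) ?I + sum (snd a) {1..s}" for a
  define C where "C i = (\<lambda>m q. \<Sum>a\<in>{a \<in> A i. (m' a, snd a) = (m, q)}. c (int i) (fst a) (snd a))" for i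
  have d: "(m' a, snd a) \<in> mexps ?I s (d a) \<and> d a \<le> j" if "a \<in> A i" for a i
  proof -
    have a: "snd a \<in> vecs {1..s}" "sum (fst a) ?K + sum (snd a) {1..s} = j"
      using that by (auto simp: A_def mexps_def)
    have "sum (m' a) ?I = (\<Sum>k\<in>(\<lambda>i. - int i) ` ?I. fst a k)"
      by (subst sum.reindex) (auto simp: inj_on_def m'_def)
    also have "\<dots> \<le> sum (fst a) ?K" by (rule sum_mono2) auto
    finally show ?thesis using a by (auto simp: mexps_def d_def vecs_def m'_def)
  qed
  have av: "average p F x \<mu> (int i) = (\<Sum>n\<le>j. heval ?I s n (C i) (ivs x) \<mu>) * (if i = 0 then 1 else x (int i))"
    if x: "x \<in> cpts zr p" and \<mu>: "\<mu> \<in> params s" and i: "i \<in> ?I" for x \<mu> i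
  proof -
    have "average p F x \<mu> (int i) = heval ?K s j (\<lambda>m q. if resonant p (int i) m then c (int i) m q else 0) x \<mu>"
      by (rule average_heval) (use x \<mu> i c in auto)
    also have "\<dots> = (\<Sum>a\<in>mexps ?K s j. if resonant p (int i) (fst a) then c (int i) (fst a) (snd a) * mon ?K s (fst a) (snd a) x \<mu> else 0)"
      unfolding heval_def by (intro sum.cong) auto
    also have "\<dots> = (\<Sum>a\<in>A i. c (int i) (fst a) (snd a) * mon ?K s (fst a) (snd a) x \<mu>)"
      unfolding A_def by (simp add: sum.inter_filter)
    also have "\<dots> = (\<Sum>a\<in>A i. c (int i) (fst a) (snd a) * mon ?I s (m' a) (snd a) (ivs x) \<mu>) * (if i = 0 then 1 else x (int i))"
      unfolding sum_distrib_right
      by (intro sum.cong refl) (simp add: A_def m'_def ivs_def[abs_def] resonant_mon[OF x i])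
    also have "(\<Sum>a\<in>A i. c (int i) (fst a) (snd a) * mon ?I s (m' a) (snd a) (ivs x) \<mu>) = (\<Sum>n\<le>j. heval ?I s n (C i) (ivs x) \<mu>)"
      unfolding C_def by (rule heval_collect_le[of _ _ _ _ _ d]) (use d in \<open>auto simp: A_def\<close>)
    finally show ?thesis .
  qed
  have iv_real: "ivs (real_point \<rho>) = (\<lambda>i. complex_of_real (if i = 0 then \<rho> 0 else (\<rho> i)\<^sup>2))" for \<rho>
    by (auto simp: ivs_def real_point_def power2_eq_square)
  show ?thesis
    unfolding radial_map_def Let_def ivs_def[symmetric] iv_real[symmetric]
  proof (intro exI conjI ballI impI)
    fix x \<mu> i assume x: "x \<in> cpts zr p" and \<mu>: "\<mu> \<in> params s"
    { assume "i \<in> {1..p}"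
      then have i: "i \<in> ?I" "i \<noteq> 0" "- int i \<in> ?K" by (auto simp: ridx_def cidx_def)
      show "g x \<mu> (int i) = (\<Sum>n\<le>j. heval ?I s n (C i) (ivs x) \<mu>) * x (int i)"
        using g[OF x \<mu>, of "int i"] av[OF x \<mu> i(1)] i by simp
      show "g x \<mu> (- int i) = cnj (g x \<mu> (int i))"
        using g[OF x \<mu>, of "int i"] g[OF x \<mu>, of "- int i"] i average_cnj[OF F x \<mu>, of "int i"] by simp }
    { assume zr
      then have i: "0 \<in> ?I" by (auto simp: ridx_def)
      show "g x \<mu> 0 = (\<Sum>n\<le>j. heval ?I s n (C 0) (ivs x) \<mu>)"
        using g[OF x \<mu>, of 0] av[OF x \<mu> i] \<open>zr\<close> by simp
      show "g x \<mu> 0 \<in> \<real>"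
        using g[OF x \<mu>, of 0] average_cnj[OF F x \<mu>, of 0] \<open>zr\<close> by (simp add: Reals_cnj_iff) }
  next
    fix \<rho> \<mu> :: "nat \<Rightarrow> real" and i assume \<rho>: "\<rho> \<in> vecs ?I" and \<mu>: "\<mu> \<in> params s"
    note x = real_point_cpts[OF \<rho>]
    { assume "i \<in> {1..p}"
      then have i: "i \<in> ?I" "i \<noteq> 0" by (auto simp: ridx_def)
      then show "R \<rho> \<mu> i = Re (\<Sum>n\<le>j. heval ?I s n (C i) (ivs (real_point \<rho>)) \<mu>) * \<rho> i"
        using R[OF \<rho> \<mu> i(1)] av[OF x \<mu> i(1)] by (simp add: real_point_def) }
    { assume zr
      then have i: "0 \<in> ?I" by (auto simp: ridx_def)
      then show "R \<rho> \<mu> 0 = Re (\<Sum>n\<le>j. heval ?I s n (C 0) (ivs (real_point \<rho>)) \<mu>)"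
        using R[OF \<rho> \<mu> i] av[OF x \<mu> i] by simp }
  qed
qed

section \<open>Changes of variables on Taylor expansions\<close>

text \<open>The algebraic tensor product of the polynomials with a space \<open>X\<close> of
  functions of \<theta>: operators in \<theta> act on the second factor, differentiation in x on the
  first.\<close>

inductive hpoly_in :: "('p \<Rightarrow> complex) set \<Rightarrow> (real \<Rightarrow> complex) set \<Rightarrow> nat \<Rightarrow> ('p \<Rightarrow> real \<Rightarrow> complex) \<Rightarrow> bool"
  for V X where
  zero: "hpoly_in V X n (\<lambda>_ _. 0)"
| tensor: "hpoly V n P \<Longrightarrow> e \<in> X \<Longrightarrow> hpoly_in V X n (\<lambda>z \<theta>. P z * e \<theta>)"
| add: "hpoly_in V X n F \<Longrightarrow> hpoly_in V X n G \<Longrightarrow> hpoly_in V X n (\<lambda>z \<theta>. F z \<theta> + G z \<theta>)"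

lemma hpoly_in_sum:
  "finite A \<Longrightarrow> (\<And>a. a \<in> A \<Longrightarrow> hpoly_in V X n (F a)) \<Longrightarrow> hpoly_in V X n (\<lambda>z \<theta>. \<Sum>a\<in>A. F a z \<theta>)"
  by (induction A rule: finite_induct) (auto intro: hpoly_in.intros)

lemma hpoly_in_minus: "hpoly_in V X n F \<Longrightarrow> hpoly_in V X n (\<lambda>z \<theta>. - F z \<theta>)"
proof (induction rule: hpoly_in.induct)
  case (tensor n P e)
  then show ?case using hpoly_in.tensor[OF hpoly_minus] by fastforce
next
  case (add n F G)
  then show ?case using hpoly_in.add[OF add.IH] by simp
qed (simp add: hpoly_in.zero)

lemma hpoly_in_diff:
  "hpoly_in V X n F \<Longrightarrow> hpoly_in V X n G \<Longrightarrow> hpoly_in V X n (\<lambda>z \<theta>. F z \<theta> - G z \<theta>)"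
  using hpoly_in.add[OF _ hpoly_in_minus, of V X n F G] by simp

lemma hpoly_in_mono: "hpoly_in V X n F \<Longrightarrow> V \<subseteq> W \<Longrightarrow> X \<subseteq> Z \<Longrightarrow> hpoly_in W Z n F"
  by (induction rule: hpoly_in.induct) (auto intro: hpoly_in.intros hpoly_mono)

lemma hpoly_in_eval: "hpoly_in V X n F \<Longrightarrow> hpoly V n (\<lambda>z. F z \<theta>)"
proof (induction rule: hpoly_in.induct)
  case (tensor n P e)
  show ?case using hpoly_scale[OF tensor(1), of "e \<theta>"] by (simp add: mult.commute)
qed (auto intro: hpoly.intros)

lemma hpoly_in_curve:
  assumes "hpoly_in V X m F" and VW: "V \<subseteq> W" and j: "j \<ge> 2"
    and \<gamma>: "\<And>f. f \<in> V \<Longrightarrow> \<exists>g. hpoly W j g \<and>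
      (\<forall>z\<in>S. \<forall>t::real. f (\<gamma> z t) = of_real t * f z + of_real t ^ j * g z)"
  shows "\<exists>C. (\<forall>n. hpoly_in W X n (\<lambda>z \<theta>. coeff (C z \<theta>) n)) \<and>
    (\<forall>z\<in>S. \<forall>t::real. \<forall>\<theta>. F (\<gamma> z t) \<theta> = poly (C z \<theta>) (of_real t))"
  using assms(1)
proof (induction rule: hpoly_in.induct)
  case (zero n)
  show ?case by (rule exI[of _ "\<lambda>_ _. 0"]) (auto intro: hpoly_in.zero)
next
  case (tensor n P e)
  then obtain C where C: "\<And>n. hpoly W n (\<lambda>z. coeff (C z) n)"
    "\<forall>z\<in>S. \<forall>t::real. P (\<gamma> z t) = poly (C z) (of_real t)"
    using hpoly_curve[OF _ VW j \<gamma>] by blast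
  have "hpoly_in W X n (\<lambda>z \<theta>. coeff (smult (e \<theta>) (C z)) n)" for n
    using hpoly_in.tensor[OF C(1) tensor(2)] by (simp add: mult.commute)
  then show ?case using C(2) by (intro exI[of _ "\<lambda>z \<theta>. smult (e \<theta>) (C z)"]) (simp add: mult.commute)
next
  case (add n F G)
  then obtain C C' where "\<And>n. hpoly_in W X n (\<lambda>z \<theta>. coeff (C z \<theta>) n)" "\<And>n. hpoly_in W X n (\<lambda>z \<theta>. coeff (C' z \<theta>) n)"
    "\<forall>z\<in>S. \<forall>t::real. \<forall>\<theta>. F (\<gamma> z t) \<theta> = poly (C z \<theta>) (of_real t)"
    "\<forall>z\<in>S. \<forall>t::real. \<forall>\<theta>. G (\<gamma> z t) \<theta> = poly (C' z \<theta>) (of_real t)"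
    by blast
  then show ?case by (intro exI[of _ "\<lambda>z \<theta>. C z \<theta> + C' z \<theta>"]) (auto intro: hpoly_in.add)
qed

lemma hpoly_in_dirD:
  assumes "hpoly_in (Vx K s) X m F" and W: "\<And>k. k \<in> K \<Longrightarrow> hpoly V (Suc n) (\<lambda>z. W z k)" and V: "Vx K s \<subseteq> V"
  shows "\<exists>D. hpoly_in V X (m + n) D \<and> (\<forall>z \<theta>. ((\<lambda>t. F (\<lambda>k. fst z k + of_real t * W z k, fst (snd z), snd (snd z)) \<theta>)
     has_vector_derivative D z \<theta>) (at 0))"
  using assms(1)
proof (induction rule: hpoly_in.induct)
  case (zero n')
  show ?case by (rule exI[of _ "\<lambda>_ _. 0"]) (auto intro: hpoly_in.zero)
next
  case (tensor m P e)
  obtain D where D: "hpoly V (m + n) D" "\<And>z. ((\<lambda>t. P (\<lambda>k. fst z k + of_real t * W z k, fst (snd z), snd (snd z)))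
     has_vector_derivative D z) (at 0)"
    using hpoly_dirD[OF tensor(1), of V n W] W V by blast
  show ?case
    using hpoly_in.tensor[OF D(1) tensor(2)] bounded_linear.has_vector_derivative[OF bounded_linear_mult_left D(2)]
    by blast
next
  case (add m F G)
  then obtain D D' where D: "hpoly_in V X (m + n) D" "hpoly_in V X (m + n) D'"
    "\<And>z \<theta>. ((\<lambda>t. F (\<lambda>k. fst z k + of_real t * W z k, fst (snd z), snd (snd z)) \<theta>) has_vector_derivative D z \<theta>) (at 0)"
    "\<And>z \<theta>. ((\<lambda>t. G (\<lambda>k. fst z k + of_real t * W z k, fst (snd z), snd (snd z)) \<theta>) has_vector_derivative D' z \<theta>) (at 0)"
    by blast
  show ?case using hpoly_in.add[OF D(1,2)] has_vector_derivative_add[OF D(3,4)] by blast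
qed

lemma hpoly_in_heval:
  assumes "hpoly_in (Vxy K s Y) X j F" "finite K"
    and X: "\<And>e f. e \<in> X \<Longrightarrow> f \<in> X \<Longrightarrow> (\<lambda>\<theta>. e \<theta> + f \<theta>) \<in> X" "\<And>e a. e \<in> X \<Longrightarrow> (\<lambda>\<theta>. a * e \<theta>) \<in> X" "(\<lambda>_. 0) \<in> X"
  shows "\<exists>c. (\<forall>m q. c m q \<in> X) \<and> (\<forall>x \<mu> \<theta>. F (x, (\<lambda>_. 0), \<mu>) \<theta> = heval K s j (\<lambda>m q. c m q \<theta>) x \<mu>)"
  using assms(1)
proof (induction rule: hpoly_in.induct)
  case (zero n)
  show ?case by (rule exI[of _ "\<lambda>_ _ _. 0"]) (simp add: heval_zero X(3))
next
  case (tensor n P e)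
  obtain c where "\<And>x \<mu>. P (x, (\<lambda>_. 0), \<mu>) = heval K s n c x \<mu>" using hpoly_heval[OF tensor(1) assms(2)] by blast
  then show ?case using X(2)[OF tensor(2)]
    by (intro exI[of _ "\<lambda>m q \<theta>. c m q * e \<theta>"]) (simp add: heval_scale mult.commute[of "heval _ _ _ _ _ _"] mult.commute[of "e _"])
next
  case (add n F G)
  then obtain c d where "\<And>m q. c m q \<in> X" "\<And>m q. d m q \<in> X"
    "\<And>x \<mu> \<theta>. F (x, (\<lambda>_. 0), \<mu>) \<theta> = heval K s n (\<lambda>m q. c m q \<theta>) x \<mu>"
    "\<And>x \<mu> \<theta>. G (x, (\<lambda>_. 0), \<mu>) \<theta> = heval K s n (\<lambda>m q. d m q \<theta>) x \<mu>" by blast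
  then show ?case using X(1) by (intro exI[of _ "\<lambda>m q \<theta>. c m q \<theta> + d m q \<theta>"]) (simp add: heval_add)
qed

lemma heval_hpoly_in:
  assumes "finite K" "\<And>m q. c m q \<in> X"
  shows "hpoly_in (Vx K s) X j (\<lambda>z \<theta>. heval K s j (\<lambda>m q. c m q \<theta>) (fst z) (snd (snd z)))"
  unfolding heval_def
proof (rule hpoly_in_sum)
  fix e assume e: "e \<in> mexps K s j"
  obtain m q where mq: "e = (m, q)" by force
  have "hpoly (Vx K s) j (\<lambda>z. heval K s j (\<lambda>m' q'. if (m', q') = e then 1 else 0) (fst z) (snd (snd z)))"
  proof (rule heval_hpoly)
    show "hpoly (Vx K s) 1 (\<lambda>z. fst z k)" if "k \<in> K" for k
    proof -
      have "xvar k \<in> Vx K s" using that by (simp add: Vx_def)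
      moreover have "xvar k = (\<lambda>z. fst z k)" by (auto simp: xvar_def)
      ultimately show ?thesis using hpoly.var by metis
    qed
  qed (use assms in \<open>auto simp: Vx_def\<close>)
  moreover have "heval K s j (\<lambda>m' q'. if (m', q') = e then 1 else 0) x \<mu> = mon K s m q x \<mu>" for x :: "int \<Rightarrow> complex" and \<mu>
  proof -
    have "heval K s j (\<lambda>m' q'. if (m', q') = e then 1 else 0) x \<mu> = (\<Sum>a\<in>mexps K s j. if a = e then mon K s m q x \<mu> else 0)"
      unfolding heval_def by (intro sum.cong refl) (auto simp: mq split: if_splits)
    then show ?thesis using e assms by simp
  qed
  ultimately have "hpoly (Vx K s) j (\<lambda>z. mon K s m q (fst z) (snd (snd z)))" by simp
  from hpoly_in.tensor[OF this assms(2), of m q]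
  show "hpoly_in (Vx K s) X j (\<lambda>z \<theta>. case e of (m, q) \<Rightarrow> c m q \<theta> * mon K s m q (fst z) (snd (snd z)))"
    by (simp add: mq mult.commute)
qed (simp add: assms)

lemma hpoly_Vx_indep: "hpoly (Vx K s) m P \<Longrightarrow> P (x, y, \<mu>) = P (x, y', \<mu>)"
  by (induction rule: hpoly.induct) (auto simp: Vx_def xvar_def \<mu>var_def)

lemma hpoly_homogeneous:
  "hpoly (Vx K s) m P \<Longrightarrow> P (\<lambda>k. of_real t * x k, y, \<lambda>i. t * \<mu> i) = of_real t ^ m * P (x, y, \<mu>)"
  by (induction rule: hpoly.induct) (auto simp: Vx_def xvar_def \<mu>var_def algebra_simps power_add)

type_synonym xfield = "(int \<Rightarrow> complex) \<Rightarrow> (nat \<Rightarrow> real) \<Rightarrow> int \<Rightarrow> complex"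
type_synonym yfield = "(int \<Rightarrow> complex) \<Rightarrow> (nat \<Rightarrow> real) \<Rightarrow> real \<Rightarrow> real"

definition curX :: "xfield \<Rightarrow> (int \<Rightarrow> complex) \<Rightarrow> (nat \<Rightarrow> real) \<Rightarrow> real \<Rightarrow> int \<Rightarrow> complex" where
  "curX U1 x \<mu> = (\<lambda>t k. of_real t * x k + U1 (\<lambda>k. of_real t * x k) (\<lambda>i. t * \<mu> i) k)"

definition curY :: "yfield \<Rightarrow> (int \<Rightarrow> complex) \<Rightarrow> (real \<Rightarrow> real) \<Rightarrow> (nat \<Rightarrow> real) \<Rightarrow> real \<Rightarrow> real \<Rightarrow> real" where
  "curY U2 x y \<mu> = (\<lambda>t \<theta>. t * y \<theta> + U2 (\<lambda>k. of_real t * x k) (\<lambda>i. t * \<mu> i) \<theta>)"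

text \<open>The equations in \<^const>\<open>transformed\<close> determine the new terms by recursion on the degree.\<close>

fun stepx :: "nat \<Rightarrow> xfield \<Rightarrow> yfield \<Rightarrow> xterms \<Rightarrow> xterms" where
  "stepx j U1 U2 f1 m x y \<mu> = (\<lambda>k.
     taylor_coeff m (\<lambda>t. \<Sum>n = 1..m. f1 n (curX U1 x \<mu> t) (curY U2 x y \<mu> t) (\<lambda>i. t * \<mu> i) k)
     - (if 2 \<le> j \<and> j \<le> m then dirD (\<lambda>x. U1 x \<mu> k) x (stepx j U1 U2 f1 (m + 1 - j) x y \<mu>) else 0))"

text \<open>The guard \<open>2 \<le> j\<close> sends the recursive call to the smaller degree
  \<open>m + 1 - j\<close>. The equation is unfolded by hand only, at chosen degrees.\<close>

declare stepx.simps [simp del]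

definition stepy :: "nat \<Rightarrow> xfield \<Rightarrow> yfield \<Rightarrow> xterms \<Rightarrow> yterms \<Rightarrow> yterms" where
  "stepy j U1 U2 f1 f2 m x y \<mu> = (\<lambda>\<theta>.
     taylor_coeff m (\<lambda>t. \<Sum>n = 1..m. f2 n (curX U1 x \<mu> t) (curY U2 x y \<mu> t) (\<lambda>i. t * \<mu> i) \<theta>)
     - (if j \<le> m then dirD (\<lambda>x. U2 x \<mu> \<theta>) x (stepx j U1 U2 f1 (m + 1 - j) x y \<mu>) else 0))"

lemma transformed_step:
  "j \<ge> 2 \<Longrightarrow> transformed r Y zr p s j U1 U2 f1 f2 (stepx j U1 U2 f1) (stepy j U1 U2 f1 f2)"
  unfolding transformed_def Let_def
proof (intro allI impI ballI conjI)
  fix m x y \<mu> assume "2 \<le> j"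
  then show "stepx j U1 U2 f1 m x y \<mu> k + (if j \<le> m then dirD (\<lambda>x. U1 x \<mu> k) x (stepx j U1 U2 f1 (m + 1 - j) x y \<mu>) else 0)
    = taylor_coeff m (\<lambda>t. \<Sum>n = 1..m. f1 n
       (\<lambda>k. of_real t * x k + U1 (\<lambda>k. of_real t * x k) (\<lambda>i. t * \<mu> i) k)
       (\<lambda>\<theta>. t * y \<theta> + U2 (\<lambda>k. of_real t * x k) (\<lambda>i. t * \<mu> i) \<theta>) (\<lambda>i. t * \<mu> i) k)" for k
    by (simp add: stepx.simps[of j U1 U2 f1 m x y \<mu>] curX_def curY_def)
  show "stepy j U1 U2 f1 f2 m x y \<mu> \<theta> + (if j \<le> m then dirD (\<lambda>x. U2 x \<mu> \<theta>) x (stepx j U1 U2 f1 (m + 1 - j) x y \<mu>) else 0)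
    = taylor_coeff m (\<lambda>t. \<Sum>n = 1..m. f2 n
       (\<lambda>k. of_real t * x k + U1 (\<lambda>k. of_real t * x k) (\<lambda>i. t * \<mu> i) k)
       (\<lambda>\<theta>. t * y \<theta> + U2 (\<lambda>k. of_real t * x k) (\<lambda>i. t * \<mu> i) \<theta>) (\<lambda>i. t * \<mu> i) \<theta>)" for \<theta>
    by (simp add: stepy_def curX_def curY_def)
qed

lemma poly_cnj_of_real: "cnj (poly q (of_real t)) = poly (map_poly cnj q) (of_real t)"
  by (induction q) (simp_all add: map_poly_pCons)

section \<open>Expansions in x, values of y and parameters, and their behaviour under changes of
  variables\<close>

locale delayed_center = center_spectrum +
  fixes s :: nat and Y :: "real set"
  assumes Y: "Y \<subseteq> I"
begin

abbreviation QQ :: "(real \<Rightarrow> real) set" where "QQ \<equiv> Q1 r M zr p \<omega> b"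

definition S :: "point set" where
  "S = {(x, y, \<mu>). x \<in> cpts zr p \<and> y \<in> QQ \<and> \<mu> \<in> params s}"

abbreviation V0 :: "(point \<Rightarrow> complex) set" where "V0 \<equiv> Vx K s"
abbreviation V1 :: "(point \<Rightarrow> complex) set" where "V1 \<equiv> Vxy K s Y"

lemma V0_subset_V1: "V0 \<subseteq> V1" by (simp add: Vxy_def)

lemma QQ_iff: "y \<in> QQ \<longleftrightarrow> (\<lambda>\<theta>. of_real (y \<theta>)) \<in> QC" by (simp add: Q1_def QC_def)

lemma zero_QQ: "(\<lambda>_. 0) \<in> QQ" by (simp add: QQ_iff QC_zero)

text \<open>Values are prescribed at every integer index, zero off \<open>K\<close> and conjugate at
  opposite indices: \<open>transformed\<close> compares all indices, and its directions of
  differentiation must stay in \<open>cpts\<close>.\<close>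

definition goodx :: "nat \<Rightarrow> ((int \<Rightarrow> complex) \<Rightarrow> (real \<Rightarrow> real) \<Rightarrow> (nat \<Rightarrow> real) \<Rightarrow> int \<Rightarrow> complex) \<Rightarrow> bool" where
  "goodx m f \<longleftrightarrow> (\<exists>P. (\<forall>k\<in>K. hpoly V1 m (P k)) \<and>
     (\<forall>x y \<mu>. (x, y, \<mu>) \<in> S \<longrightarrow> (\<forall>k. f x y \<mu> k = (if k \<in> K then P k (x, y, \<mu>) else 0) \<and> f x y \<mu> (- k) = cnj (f x y \<mu> k))))"

text \<open>The coefficient functions lie in \<open>BQ\<close> and not in \<open>QC\<close>, since
  the nonlinear terms carry the jump of \<open>X0\<close> at \<theta> = 0.\<close>

definition goody :: "nat \<Rightarrow> ((int \<Rightarrow> complex) \<Rightarrow> (real \<Rightarrow> real) \<Rightarrow> (nat \<Rightarrow> real) \<Rightarrow> real \<Rightarrow> real) \<Rightarrow> bool" where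
  "goody m f \<longleftrightarrow> (\<exists>F. hpoly_in V1 BQ m F \<and>
     (\<forall>x y \<mu>. (x, y, \<mu>) \<in> S \<longrightarrow> (\<forall>\<theta>\<in>I. complex_of_real (f x y \<mu> \<theta>) = F (x, y, \<mu>) \<theta>)))"

lemma goodx_cpts: "goodx m f \<Longrightarrow> (x, y, \<mu>) \<in> S \<Longrightarrow> f x y \<mu> \<in> cpts zr p"
  unfolding goodx_def cpts_def vecs_def by fastforce

definition goodU1 :: "nat \<Rightarrow> xfield \<Rightarrow> bool" where
  "goodU1 j U \<longleftrightarrow> (\<exists>P. (\<forall>k\<in>K. hpoly V0 j (P k)) \<and>
     (\<forall>x\<in>cpts zr p. \<forall>\<mu>\<in>params s. \<forall>k. U x \<mu> k = (if k \<in> K then P k (x, (\<lambda>_. 0), \<mu>) else 0) \<and> U x \<mu> (- k) = cnj (U x \<mu> k)))"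

definition goodU2 :: "nat \<Rightarrow> yfield \<Rightarrow> bool" where
  "goodU2 j U \<longleftrightarrow> (\<exists>F. hpoly_in V0 QC j F \<and>
     (\<forall>x\<in>cpts zr p. \<forall>\<mu>\<in>params s. \<forall>\<theta>\<in>I. complex_of_real (U x \<mu> \<theta>) = F (x, (\<lambda>_. 0), \<mu>) \<theta>))"

lemma HK_goodU1: "U \<in> HK zr p s j \<Longrightarrow> goodU1 j U"
proof -
  assume U: "U \<in> HK zr p s j"
  then obtain c where c: "\<And>k x \<mu>. k \<in> K \<Longrightarrow> x \<in> cpts zr p \<Longrightarrow> \<mu> \<in> params s \<Longrightarrow> U x \<mu> k = heval K s j (c k) x \<mu>"
    unfolding HK_def mem_Collect_eq by metis
  have "hpoly V0 j (\<lambda>z. heval K s j (c k) (fst z) (snd (snd z)))" for k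
    using hpoly_in_eval[OF heval_hpoly_in[of K "\<lambda>m q \<theta>. c k m q" UNIV]] by simp
  moreover have "U x \<mu> \<in> cpts zr p" if "x \<in> cpts zr p" "\<mu> \<in> params s" for x \<mu> using U that by (simp add: HK_def)
  then have "U x \<mu> k = (if k \<in> K then heval K s j (c k) x \<mu> else 0)" "U x \<mu> (- k) = cnj (U x \<mu> k)"
    if "x \<in> cpts zr p" "\<mu> \<in> params s" for x \<mu> k
    using that c[of k x \<mu>] cptsD[of "U x \<mu>" zr p k] by auto
  ultimately show ?thesis
    unfolding goodU1_def
  proof (intro exI[of _ "\<lambda>k z. heval K s j (c k) (fst z) (snd (snd z))"] conjI ballI allI, goal_cases)
    case (2 x \<mu> k) then show ?case unfolding fst_conv snd_conv by blast
  qed blast+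
qed

lemma HQ1_goodU2: "U \<in> HQ1 r M zr p \<omega> b s j \<Longrightarrow> goodU2 j U"
proof -
  assume U: "U \<in> HQ1 r M zr p \<omega> b s j"
  then obtain c where c: "\<And>m q. c m q \<in> QC" "\<And>x \<mu> \<theta>. x \<in> cpts zr p \<Longrightarrow> \<mu> \<in> params s \<Longrightarrow> \<theta> \<in> I \<Longrightarrow>
      of_real (U x \<mu> \<theta>) = heval K s j (\<lambda>m q. c m q \<theta>) x \<mu>"
    unfolding HQ1_def QC_def by blast
  then show ?thesis unfolding goodU2_def
    using heval_hpoly_in[of K c QC s j, OF cidx_finite c(1)]
    by (intro exI[of _ "\<lambda>z \<theta>. heval K s j (\<lambda>m q. c m q \<theta>) (fst z) (snd (snd z))"]) simp
qed

definition repx where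
  "repx m f P \<longleftrightarrow> (\<forall>k\<in>K. hpoly V1 m (P k)) \<and> (\<forall>x y \<mu>. (x, y, \<mu>) \<in> S \<longrightarrow>
      (\<forall>k. f x y \<mu> k = (if k \<in> K then P k (x, y, \<mu>) else 0) \<and> f x y \<mu> (- k) = cnj (f x y \<mu> k)))"

lemma goodx_rep: "goodx m f \<longleftrightarrow> (\<exists>P. repx m f P)"
  unfolding goodx_def repx_def ..

lemma repxD:
  assumes "repx m f P"
  shows "k \<in> K \<Longrightarrow> hpoly V1 m (P k)"
    "(x, y, \<mu>) \<in> S \<Longrightarrow> f x y \<mu> k = (if k \<in> K then P k (x, y, \<mu>) else 0)"
    "(x, y, \<mu>) \<in> S \<Longrightarrow> f x y \<mu> (- k) = cnj (f x y \<mu> k)"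
  using assms unfolding repx_def by blast+

lemma goodxI:
  assumes "\<And>k. k \<in> K \<Longrightarrow> hpoly V1 m (P k)"
    "\<And>x y \<mu> k. (x, y, \<mu>) \<in> S \<Longrightarrow> f x y \<mu> k = (if k \<in> K then P k (x, y, \<mu>) else 0)"
    "\<And>x y \<mu> k. (x, y, \<mu>) \<in> S \<Longrightarrow> f x y \<mu> (- k) = cnj (f x y \<mu> k)"
  shows "goodx m f"
  unfolding goodx_def by (rule exI[of _ P]) (use assms in blast)

definition repU1 where
  "repU1 m f P \<longleftrightarrow> (\<forall>k\<in>K. hpoly V0 m (P k)) \<and> (\<forall>x\<in>cpts zr p. \<forall>\<mu>\<in>params s.
      (\<forall>k. f x \<mu> k = (if k \<in> K then P k (x, (\<lambda>_. 0), \<mu>) else 0) \<and> f x \<mu> (- k) = cnj (f x \<mu> k)))"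

lemma goodU1_rep: "goodU1 m f \<longleftrightarrow> (\<exists>P. repU1 m f P)"
  unfolding goodU1_def repU1_def ..

lemma repU1D:
  assumes "repU1 m f P"
  shows "k \<in> K \<Longrightarrow> hpoly V0 m (P k)"
    "x \<in> cpts zr p \<Longrightarrow> \<mu> \<in> params s \<Longrightarrow> f x \<mu> k = (if k \<in> K then P k (x, (\<lambda>_. 0), \<mu>) else 0)"
    "x \<in> cpts zr p \<Longrightarrow> \<mu> \<in> params s \<Longrightarrow> f x \<mu> (- k) = cnj (f x \<mu> k)"
  using assms unfolding repU1_def by blast+

context
  fixes j :: nat and U1 :: xfield and U2 :: yfield
  assumes j: "j \<ge> 2" and U1: "goodU1 j U1" and U2: "goodU2 j U2"
begin

definition cur :: "point \<Rightarrow> real \<Rightarrow> point" where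
  "cur z t = (case z of (x, y, \<mu>) \<Rightarrow> (curX U1 x \<mu> t, curY U2 x y \<mu> t, \<lambda>i. t * \<mu> i))"

lemma S_scaled: "x \<in> cpts zr p \<Longrightarrow> \<mu> \<in> params s \<Longrightarrow> (\<lambda>k. of_real t * x k) \<in> cpts zr p \<and> (\<lambda>i. t * \<mu> i) \<in> params s"
  by (auto simp: cpts_def vecs_def)

lemma U1_cpts: assumes "x \<in> cpts zr p" "\<mu> \<in> params s" shows "U1 x \<mu> \<in> cpts zr p"
proof -
  obtain P where "repU1 j U1 P" using U1 unfolding goodU1_rep by blast
  note P = repU1D[OF this]
  show ?thesis unfolding cpts_def vecs_def using P(2,3)[OF assms] by simp
qed

text \<open>The representing polynomials are valid on \<open>S\<close> only, so the bent ray has to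
  keep x real in the sense of \<open>cpts\<close> and y in the complement of the center
  subspace.\<close>

lemma cur_S: assumes "z \<in> S" shows "cur z t \<in> S"
proof -
  obtain x y \<mu> where z: "z = (x, y, \<mu>)" "x \<in> cpts zr p" "y \<in> QQ" "\<mu> \<in> params s"
    using assms by (auto simp: S_def)
  note sc = S_scaled[OF z(2,4), of t]
  have "curX U1 x \<mu> t \<in> cpts zr p"
    using U1_cpts[of "\<lambda>k. of_real t * x k" "\<lambda>i. t * \<mu> i"] sc
    by (auto simp: curX_def cpts_def vecs_def)
  moreover have "curY U2 x y \<mu> t \<in> QQ"
  proof -
    obtain F where F: "hpoly_in V0 QC j F"
      "\<And>x \<mu> \<theta>. x \<in> cpts zr p \<Longrightarrow> \<mu> \<in> params s \<Longrightarrow> \<theta> \<in> I \<Longrightarrow> complex_of_real (U2 x \<mu> \<theta>) = F (x, (\<lambda>_. 0), \<mu>) \<theta>"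
      using U2 unfolding goodU2_def by blast
    have "F z \<in> QC" for z
      using F(1) by (induction rule: hpoly_in.induct) (auto intro: QC_zero QC_add QC_scale)
    then have "(\<lambda>\<theta>. of_real t * of_real (y \<theta>) + F (\<lambda>k. of_real t * x k, \<lambda>_. 0, \<lambda>i. t * \<mu> i) \<theta>) \<in> QC"
      using z(3) by (intro QC_add QC_scale) (simp_all add: QQ_iff)
    then show ?thesis unfolding QQ_iff
      by (rule QC_cong) (use F(2) sc in \<open>simp add: curY_def\<close>)
  qed
  ultimately show ?thesis using sc by (simp add: S_def cur_def z)
qed

lemma U2_poly: "\<exists>F. hpoly_in V0 QC j F \<and>
  (\<forall>x y \<mu> \<theta>. \<forall>t::real. (x, y, \<mu>) \<in> S \<longrightarrow> \<theta> \<in> I \<longrightarrow>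
     complex_of_real (U2 (\<lambda>k. of_real t * x k) (\<lambda>i. t * \<mu> i) \<theta>) = of_real t ^ j * F (x, y, \<mu>) \<theta> \<and>
     complex_of_real (U2 x \<mu> \<theta>) = F (x, y, \<mu>) \<theta>)"
proof -
  obtain F where F: "hpoly_in V0 QC j F"
    "\<And>x \<mu> \<theta>. x \<in> cpts zr p \<Longrightarrow> \<mu> \<in> params s \<Longrightarrow> \<theta> \<in> I \<Longrightarrow> complex_of_real (U2 x \<mu> \<theta>) = F (x, (\<lambda>_. 0), \<mu>) \<theta>"
    using U2 unfolding goodU2_def by blast
  note P = hpoly_in_eval[OF F(1)]
  show ?thesis
  proof (intro exI[of _ F] conjI F(1) allI impI)
    fix x y \<mu> \<theta> and t :: real assume *: "(x, y, \<mu>) \<in> S" "\<theta> \<in> I"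
    then have xm: "x \<in> cpts zr p" "\<mu> \<in> params s" by (auto simp: S_def)
    show "complex_of_real (U2 (\<lambda>k. of_real t * x k) (\<lambda>i. t * \<mu> i) \<theta>) = of_real t ^ j * F (x, y, \<mu>) \<theta>"
      using F(2)[of "\<lambda>k. of_real t * x k" "\<lambda>i. t * \<mu> i" \<theta>] S_scaled[OF xm, of t] *(2)
        hpoly_homogeneous[OF P[of \<theta>], of t x "\<lambda>_. 0" \<mu>] hpoly_Vx_indep[OF P[of \<theta>], of x "\<lambda>_. 0" \<mu> y] by simp
    show "complex_of_real (U2 x \<mu> \<theta>) = F (x, y, \<mu>) \<theta>"
      using F(2)[OF xm *(2)] hpoly_Vx_indep[OF P[of \<theta>], of x "\<lambda>_. 0" \<mu> y] by simp
  qed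
qed

lemma U1_poly: "\<exists>P. (\<forall>k\<in>K. hpoly V0 j (P k)) \<and>
  (\<forall>x y \<mu> k. \<forall>t::real. (x, y, \<mu>) \<in> S \<longrightarrow>
     (k \<in> K \<longrightarrow> U1 (\<lambda>k. of_real t * x k) (\<lambda>i. t * \<mu> i) k = of_real t ^ j * P k (x, y, \<mu>)) \<and>
     U1 x \<mu> k = (if k \<in> K then P k (x, y, \<mu>) else 0))"
proof -
  obtain P where "repU1 j U1 P" using U1 unfolding goodU1_rep by blast
  note P = repU1D[OF this]
  show ?thesis
  proof (intro exI[of _ P] conjI allI impI ballI P(1))
    fix x y \<mu> k and t :: real assume *: "(x, y, \<mu>) \<in> S"
    then have xm: "x \<in> cpts zr p" "\<mu> \<in> params s" by (auto simp: S_def)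
    show "U1 (\<lambda>k. of_real t * x k) (\<lambda>i. t * \<mu> i) k = of_real t ^ j * P k (x, y, \<mu>)" if k: "k \<in> K"
      using P(2)[of "\<lambda>k. of_real t * x k" "\<lambda>i. t * \<mu> i" k] S_scaled[OF xm, of t] k
        hpoly_homogeneous[OF P(1)[OF k], of t x "\<lambda>_. 0" \<mu>] hpoly_Vx_indep[OF P(1)[OF k], of x "\<lambda>_. 0" \<mu> y] by simp
    show "U1 x \<mu> k = (if k \<in> K then P k (x, y, \<mu>) else 0)"
      using P(2)[OF xm] hpoly_Vx_indep[OF P(1)[of k], of x "\<lambda>_. 0" \<mu> y] by simp
  qed simp_all
qed

text \<open>The hypothesis of \<open>hpoly_curve\<close> for the change of variables: the correction
  is \<open>U1\<close> for x, the value of \<open>U2\<close> at a point of \<open>Y\<close> for y,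
  and zero for \<mu>. Homogeneity of \<open>U1\<close> and \<open>U2\<close> pulls out the factor
  \<open>t ^ j\<close>.\<close>

lemma cur_var:
  assumes "f \<in> V1"
  shows "\<exists>g. hpoly V1 j g \<and> (\<forall>z\<in>S. \<forall>t::real. f (cur z t) = of_real t * f z + of_real t ^ j * g z)"
proof -
  obtain P where P: "\<And>k. k \<in> K \<Longrightarrow> hpoly V0 j (P k)"
    "\<And>x y \<mu> k t. (x, y, \<mu>) \<in> S \<Longrightarrow> k \<in> K \<Longrightarrow>
     U1 (\<lambda>k. of_real t * x k) (\<lambda>i. t * \<mu> i) k = of_real t ^ j * P k (x, y, \<mu>)"
    using U1_poly by blast
  obtain F where F: "hpoly_in V0 QC j F"
    "\<And>x y \<mu> \<theta> t. (x, y, \<mu>) \<in> S \<Longrightarrow> \<theta> \<in> I \<Longrightarrow>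
     complex_of_real (U2 (\<lambda>k. of_real t * x k) (\<lambda>i. t * \<mu> i) \<theta>) = of_real t ^ j * F (x, y, \<mu>) \<theta>"
    using U2_poly by blast
  from assms consider k where "k \<in> K" "f = xvar k" | i where "f = \<mu>var i" | \<theta> where "\<theta> \<in> Y" "f = yvar \<theta>"
    by (auto simp: Vxy_def Vx_def)
  then show ?thesis
  proof cases
    case (1 k)
    have "xvar k (cur z t) = of_real t * xvar k z + of_real t ^ j * P k z" if "z \<in> S" for z t
      using that P(2)[of "fst z" "fst (snd z)" "snd (snd z)" k t] 1
      by (cases z) (simp add: xvar_def cur_def curX_def)
    then show ?thesis using 1 hpoly_mono[OF P(1) V0_subset_V1] by blast
  next
    case (2 i)
    show ?thesis unfolding 2
      by (rule exI[of _ "\<lambda>_. 0"]) (auto simp: \<mu>var_def cur_def intro: hpoly.zero split: prod.splits)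
  next
    case (3 \<theta>)
    have "yvar \<theta> (cur z t) = of_real t * yvar \<theta> z + of_real t ^ j * F z \<theta>" if "z \<in> S" for z t
      using that F(2)[of "fst z" "fst (snd z)" "snd (snd z)" \<theta> t] 3 Y
      by (cases z) (auto simp: yvar_def cur_def curY_def)
    then show ?thesis using 3 hpoly_mono[OF hpoly_in_eval[OF F(1)] V0_subset_V1] by blast
  qed
qed

lemma cur_hpoly:
  assumes "hpoly V1 m P"
  obtains C where "\<And>n. hpoly V1 n (\<lambda>z. coeff (C z) n)"
    "\<And>z t. z \<in> S \<Longrightarrow> P (cur z t) = poly (C z) (of_real t)" "\<And>z. z \<in> S \<Longrightarrow> coeff (C z) m = P z"
  using hpoly_curve[OF assms order_refl j cur_var] by blast

lemma goodx_curve: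
  assumes f: "\<And>n. n \<ge> 1 \<Longrightarrow> goodx n (f n)"
  shows "\<exists>C. (\<forall>n. \<forall>k\<in>K. hpoly V1 n (\<lambda>z. coeff (C k z) n)) \<and> (\<forall>x y \<mu> k. (x, y, \<mu>) \<in> S \<longrightarrow>
     (\<forall>t. (\<Sum>n = 1..m. f n (curX U1 x \<mu> t) (curY U2 x y \<mu> t) (\<lambda>i. t * \<mu> i) k) = poly (C k (x, y, \<mu>)) (of_real t)) \<and>
     (k \<notin> K \<longrightarrow> C k (x, y, \<mu>) = 0) \<and> (m = 1 \<longrightarrow> coeff (C k (x, y, \<mu>)) 1 = f 1 x y \<mu> k))"
proof -
  have "\<forall>n. \<exists>P. n \<ge> 1 \<longrightarrow> repx n (f n) P" using f unfolding goodx_rep by blast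
  from choice[OF this] obtain P where "\<forall>n. n \<ge> 1 \<longrightarrow> repx n (f n) (P n)" ..
  then have P: "\<And>n k. n \<ge> 1 \<Longrightarrow> k \<in> K \<Longrightarrow> hpoly V1 n (P n k)"
    "\<And>n x y \<mu> k. n \<ge> 1 \<Longrightarrow> (x, y, \<mu>) \<in> S \<Longrightarrow> f n x y \<mu> k = (if k \<in> K then P n k (x, y, \<mu>) else 0)"
    using repxD by blast+
  define cc where "cc n k C \<longleftrightarrow> n \<ge> 1 \<longrightarrow> k \<in> K \<longrightarrow> (\<forall>i. hpoly V1 i (\<lambda>z. coeff (C z) i)) \<and>
    (\<forall>z\<in>S. (\<forall>t. P n k (cur z t) = poly (C z) (of_real t)) \<and> coeff (C z) n = P n k z)" for n k C
  have "\<exists>C. cc n k C" for n k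
  proof (cases "n \<ge> 1 \<and> k \<in> K")
    case True
    then have "hpoly V1 n (P n k)" using P(1) by blast
    from hpoly_curve[OF this order_refl j cur_var] show ?thesis unfolding cc_def by blast
  qed (simp add: cc_def)
  then obtain C where cc: "\<And>n k. cc n k (C n k)" by metis
  have C: "\<And>n k i. n \<ge> 1 \<Longrightarrow> k \<in> K \<Longrightarrow> hpoly V1 i (\<lambda>z. coeff (C n k z) i)"
    "\<And>n k z t. n \<ge> 1 \<Longrightarrow> k \<in> K \<Longrightarrow> z \<in> S \<Longrightarrow> P n k (cur z t) = poly (C n k z) (of_real t)"
    "\<And>n k z. n \<ge> 1 \<Longrightarrow> k \<in> K \<Longrightarrow> z \<in> S \<Longrightarrow> coeff (C n k z) n = P n k z"
    using cc unfolding cc_def by blast+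
  define C' where "C' k z = (if k \<in> K then \<Sum>n = 1..m. C n k z else 0)" for k z
  have "hpoly V1 i (\<lambda>z. coeff (C' k z) i)" if "k \<in> K" for i k
    using that C(1) by (auto simp: C'_def coeff_sum intro!: hpoly_sum)
  moreover have "(\<Sum>n = 1..m. f n (curX U1 x \<mu> t) (curY U2 x y \<mu> t) (\<lambda>i. t * \<mu> i) k) = poly (C' k (x, y, \<mu>)) (of_real t)"
    if "(x, y, \<mu>) \<in> S" for x y \<mu> t k
  proof -
    have "f n (curX U1 x \<mu> t) (curY U2 x y \<mu> t) (\<lambda>i. t * \<mu> i) k = (if k \<in> K then poly (C n k (x, y, \<mu>)) (of_real t) else 0)"
      if n: "n \<ge> 1" for n
      using P(2)[OF n, of "curX U1 x \<mu> t" "curY U2 x y \<mu> t" "\<lambda>i. t * \<mu> i" k] cur_S[OF \<open>(x, y, \<mu>) \<in> S\<close>, of t]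
        C(2)[OF n _ \<open>(x, y, \<mu>) \<in> S\<close>, of k t] by (simp add: cur_def)
    then have "(\<Sum>n = 1..m. f n (curX U1 x \<mu> t) (curY U2 x y \<mu> t) (\<lambda>i. t * \<mu> i) k)
      = (\<Sum>n = 1..m. if k \<in> K then poly (C n k (x, y, \<mu>)) (of_real t) else 0)"
      by (intro sum.cong refl) (meson atLeastAtMost_iff)
    then show ?thesis by (simp add: C'_def poly_sum)
  qed
  moreover have "coeff (C' k (x, y, \<mu>)) 1 = f 1 x y \<mu> k" if "m = 1" "(x, y, \<mu>) \<in> S" for x y \<mu> k
    using that C(3)[of 1 k "(x, y, \<mu>)"] P(2)[of 1 x y \<mu> k] by (auto simp: C'_def)
  ultimately show ?thesis by (intro exI[of _ C']) (simp add: C'_def)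
qed

lemma goodx_taylor:
  assumes f: "\<And>n. n \<ge> 1 \<Longrightarrow> goodx n (f n)"
  shows "goodx i (\<lambda>x y \<mu> k. taylor_coeff i (\<lambda>t. \<Sum>n = 1..m. f n (curX U1 x \<mu> t) (curY U2 x y \<mu> t) (\<lambda>i. t * \<mu> i) k))"
proof -
  obtain C where C: "\<And>n k. k \<in> K \<Longrightarrow> hpoly V1 n (\<lambda>z. coeff (C k z) n)"
    "\<And>x y \<mu> k t. (x, y, \<mu>) \<in> S \<Longrightarrow>
      (\<Sum>n = 1..m. f n (curX U1 x \<mu> t) (curY U2 x y \<mu> t) (\<lambda>i. t * \<mu> i) k) = poly (C k (x, y, \<mu>)) (of_real t)"
    "\<And>x y \<mu> k. (x, y, \<mu>) \<in> S \<Longrightarrow> k \<notin> K \<Longrightarrow> C k (x, y, \<mu>) = 0"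
    using goodx_curve[of f m, OF f] by blast
  show ?thesis
    unfolding goodx_def
  proof (intro exI conjI ballI allI impI)
    show "hpoly V1 i (\<lambda>z. coeff (C k z) i)" if "k \<in> K" for k using C(1) that .
    fix x y \<mu> k assume z: "(x, y, \<mu>) \<in> S"
    note T = taylor_coeff_poly[OF C(2)[OF z], of i]
    show "taylor_coeff i (\<lambda>t. \<Sum>n = 1..m. f n (curX U1 x \<mu> t) (curY U2 x y \<mu> t) (\<lambda>i. t * \<mu> i) k) =
        (if k \<in> K then coeff (C k (x, y, \<mu>)) i else 0)"
      unfolding T using C(3)[OF z] by simp
    have "(\<Sum>n = 1..m. f n (curX U1 x \<mu> t) (curY U2 x y \<mu> t) (\<lambda>i. t * \<mu> i) (- k)) = poly (map_poly cnj (C k (x, y, \<mu>))) (of_real t)" for t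
    proof -
      have "f n (curX U1 x \<mu> t) (curY U2 x y \<mu> t) (\<lambda>i. t * \<mu> i) (- k) = cnj (f n (curX U1 x \<mu> t) (curY U2 x y \<mu> t) (\<lambda>i. t * \<mu> i) k)"
        if n: "n \<ge> 1" for n
        using goodx_cpts[OF f[OF n], THEN cptsD(1)] cur_S[OF z, of t] unfolding cur_def by simp
      then show ?thesis unfolding poly_cnj_of_real[symmetric] C(2)[OF z, symmetric] cnj_sum by (intro sum.cong) auto
    qed
    from taylor_coeff_poly[OF this, of i]
    show "taylor_coeff i (\<lambda>t. \<Sum>n = 1..m. f n (curX U1 x \<mu> t) (curY U2 x y \<mu> t) (\<lambda>i. t * \<mu> i) (- k)) =
      cnj (taylor_coeff i (\<lambda>t. \<Sum>n = 1..m. f n (curX U1 x \<mu> t) (curY U2 x y \<mu> t) (\<lambda>i. t * \<mu> i) k))"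
      unfolding T by (simp add: coeff_map_poly)
  qed
qed

lemma goodx_diff:
  assumes f: "goodx m f" and g: "goodx m g"
  shows "goodx m (\<lambda>x y \<mu> k. f x y \<mu> k - g x y \<mu> k)"
proof -
  obtain P where "repx m f P" using f unfolding goodx_rep by blast
  note P = repxD[OF this]
  obtain Q where "repx m g Q" using g unfolding goodx_rep by blast
  note Q = repxD[OF this]
  show ?thesis
    by (rule goodxI[of m "\<lambda>k z. P k z - Q k z"], simp add: hpoly_diff P(1) Q(1), simp add: P(2) Q(2),
        simp only: P(3) Q(3) complex_cnj_diff)
qed

lemma goodx_direction:
  assumes "goodx (Suc n) w"
  obtains W where "\<And>k. k \<in> K \<Longrightarrow> hpoly V1 (Suc n) (\<lambda>z. W z k)" "\<And>x y \<mu>. (x, y, \<mu>) \<in> S \<Longrightarrow> w x y \<mu> = W (x, y, \<mu>)"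
    "\<And>x y \<mu> t. (x, y, \<mu>) \<in> S \<Longrightarrow> (\<lambda>k. x k + of_real t * W (x, y, \<mu>) k) \<in> cpts zr p"
proof -
  obtain P where "repx (Suc n) w P" using assms unfolding goodx_rep by blast
  note P = repxD[OF this]
  show thesis
  proof (rule that[of "\<lambda>z k. if k \<in> K then P k z else 0"])
    fix x y \<mu> assume z: "(x, y, \<mu>) \<in> S"
    show w: "w x y \<mu> = (\<lambda>k. if k \<in> K then P k (x, y, \<mu>) else 0)" using P(2)[OF z] by auto
    show "(\<lambda>k. x k + of_real t * (if k \<in> K then P k (x, y, \<mu>) else 0)) \<in> cpts zr p" for t
      using cpts_add_scale[OF _ goodx_cpts[OF assms z], of x t] z unfolding w by (simp add: S_def)
  qed (use P(1) in simp)
qed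

lemma goodx_dirD:
  assumes w: "goodx (Suc n) w"
  shows "goodx (j + n) (\<lambda>x y \<mu> k. dirD (\<lambda>x. U1 x \<mu> k) x (w x y \<mu>))"
proof -
  obtain P where "repU1 j U1 P" using U1 unfolding goodU1_rep by blast
  note P = repU1D[OF this]
  obtain W where W: "\<And>k. k \<in> K \<Longrightarrow> hpoly V1 (Suc n) (\<lambda>z. W z k)" "\<And>x y \<mu>. (x, y, \<mu>) \<in> S \<Longrightarrow> w x y \<mu> = W (x, y, \<mu>)"
    "\<And>x y \<mu> t. (x, y, \<mu>) \<in> S \<Longrightarrow> (\<lambda>k. x k + of_real t * W (x, y, \<mu>) k) \<in> cpts zr p"
    using goodx_direction[OF w] by blast
  define dd where "dd k D \<longleftrightarrow> k \<in> K \<longrightarrow> hpoly V1 (j + n) D \<and> (\<forall>z. ((\<lambda>t. P k (\<lambda>k. fst z k + of_real t * W z k, fst (snd z), snd (snd z)))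
     has_vector_derivative D z) (at 0))" for k D
  have "\<exists>D. dd k D" for k
  proof (cases "k \<in> K")
    case True
    show ?thesis using hpoly_dirD[OF P(1)[OF True], of V1 n W] W(1) V0_subset_V1 unfolding dd_def by blast
  qed (simp add: dd_def)
  then obtain D where dd: "\<And>k. dd k (D k)" by metis
  have D: "\<And>k. k \<in> K \<Longrightarrow> hpoly V1 (j + n) (D k)"
    "\<And>k z. k \<in> K \<Longrightarrow> ((\<lambda>t. P k (\<lambda>k. fst z k + of_real t * W z k, fst (snd z), snd (snd z)))
     has_vector_derivative D k z) (at 0)"
    using dd unfolding dd_def by blast+
  have hv: "((\<lambda>t. U1 (\<lambda>k. x k + of_real t * w x y \<mu> k) \<mu> k) has_vector_derivative (if k \<in> K then D k (x, y, \<mu>) else 0)) (at 0)"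
    if z: "(x, y, \<mu>) \<in> S" for x y \<mu> k
  proof -
    have "\<mu> \<in> params s" using z by (simp add: S_def)
    have "U1 (\<lambda>k. x k + of_real t * w x y \<mu> k) \<mu> k =
      (if k \<in> K then P k (\<lambda>k. x k + of_real t * W (x, y, \<mu>) k, y, \<mu>) else 0)" for t
      unfolding W(2)[OF z] P(2)[OF W(3)[OF z] \<open>\<mu> \<in> params s\<close>]
      using hpoly_Vx_indep[OF P(1)[of k], of _ "\<lambda>_. 0" \<mu> y] by simp
    then show ?thesis using D(2)[of k "(x, y, \<mu>)"] by simp
  qed
  have dk: "dirD (\<lambda>x. U1 x \<mu> k) x (w x y \<mu>) = (if k \<in> K then D k (x, y, \<mu>) else 0)" if z: "(x, y, \<mu>) \<in> S" for x y \<mu> k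
    unfolding dirD_def by (rule vector_derivative_at[OF hv[OF z]])
  have "dirD (\<lambda>x. U1 x \<mu> (- k)) x (w x y \<mu>) = cnj (dirD (\<lambda>x. U1 x \<mu> k) x (w x y \<mu>))" if z: "(x, y, \<mu>) \<in> S" for x y \<mu> k
  proof -
    have "\<mu> \<in> params s" using z by (simp add: S_def)
    have "U1 (\<lambda>k. x k + of_real t * w x y \<mu> k) \<mu> (- k) = cnj (U1 (\<lambda>k. x k + of_real t * w x y \<mu> k) \<mu> k)" for t
      unfolding W(2)[OF z] by (rule P(3)[OF W(3)[OF z] \<open>\<mu> \<in> params s\<close>])
    then have "((\<lambda>t. U1 (\<lambda>k. x k + of_real t * w x y \<mu> k) \<mu> (- k)) has_vector_derivative cnj (if k \<in> K then D k (x, y, \<mu>) else 0)) (at 0)"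
      using bounded_linear.has_vector_derivative[OF bounded_linear_cnj hv[OF z, of k]] by simp
    then show ?thesis unfolding dk[OF z, of k] unfolding dirD_def by (rule vector_derivative_at)
  qed
  from goodxI[OF D(1) dk this] show ?thesis .
qed

lemma stepx_good:
  assumes f: "\<And>n. n \<ge> 1 \<Longrightarrow> goodx n (f n)" and "m \<ge> 1"
  shows "goodx m (stepx j U1 U2 f m)"
  using assms(2)
proof (induction m rule: less_induct)
  case (less m)
  note T = goodx_taylor[of f m m, OF f]
  show ?case
  proof (cases "j \<le> m")
    case True
    have "goodx (Suc (m - j)) (stepx j U1 U2 f (m + 1 - j))"
      using less.IH[of "m + 1 - j"] True j by (simp add: Suc_diff_le)
    from goodx_diff[OF T] goodx_dirD[OF this] True j show ?thesis
      by (simp add: stepx.simps[of j U1 U2 f m, abs_def])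
  next
    case False
    then show ?thesis using T by (simp add: stepx.simps[of j U1 U2 f m, abs_def])
  qed
qed

text \<open>A term added in degree \<open>L\<close> passes through a change of variables unaltered
  in that degree: its coefficient of \<open>t ^ L\<close> along the bent ray is the term itself, and
  the derivative correction involves the degree \<open>L + 1 - j < L\<close>, where nothing has
  changed. This is why the nonlinearity of each degree acts affinely on the normal form term of the
  same degree.\<close>

lemma stepx_perturb:
  assumes f: "\<And>n. n \<ge> 1 \<Longrightarrow> goodx n (f n)" and f': "\<And>n. n \<ge> 1 \<Longrightarrow> goodx n (f' n)"
    and eq: "\<And>n x y \<mu>. 1 \<le> n \<Longrightarrow> n < L \<Longrightarrow> (x, y, \<mu>) \<in> S \<Longrightarrow> f' n x y \<mu> = f n x y \<mu>"
    and L: "\<And>x y \<mu> k. (x, y, \<mu>) \<in> S \<Longrightarrow> f' L x y \<mu> k = f L x y \<mu> k + B k * R (x, y, \<mu>)"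
    and R: "hpoly V1 L R" and "L \<ge> 1"
  shows "1 \<le> n \<Longrightarrow> n < L \<Longrightarrow> (x, y, \<mu>) \<in> S \<Longrightarrow> stepx j U1 U2 f' n x y \<mu> = stepx j U1 U2 f n x y \<mu>"
    and "(x, y, \<mu>) \<in> S \<Longrightarrow> stepx j U1 U2 f' L x y \<mu> k = stepx j U1 U2 f L x y \<mu> k + B k * R (x, y, \<mu>)"
proof -
  have S': "(curX U1 x \<mu> t, curY U2 x y \<mu> t, \<lambda>i. t * \<mu> i) \<in> S" if "(x, y, \<mu>) \<in> S" for x y \<mu> t
    using cur_S[OF that, of t] by (simp add: cur_def)
  show *: "stepx j U1 U2 f' n x y \<mu> = stepx j U1 U2 f n x y \<mu>" if "1 \<le> n" "n < L" "(x, y, \<mu>) \<in> S" for n x y \<mu>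
    using that
  proof (induction n rule: less_induct)
    case (less n)
    have 1: "(\<Sum>i = 1..n. f' i (curX U1 x \<mu> t) (curY U2 x y \<mu> t) (\<lambda>i. t * \<mu> i) k)
        = (\<Sum>i = 1..n. f i (curX U1 x \<mu> t) (curY U2 x y \<mu> t) (\<lambda>i. t * \<mu> i) k)" for t k
      using less.prems eq[OF _ _ S'[OF less.prems(3), of t]] by (intro sum.cong refl) auto
    have 2: "stepx j U1 U2 f' (n + 1 - j) x y \<mu> = stepx j U1 U2 f (n + 1 - j) x y \<mu>" if "j \<le> n"
      using less.IH[of "n + 1 - j"] that j less.prems by simp
    show ?case
    proof (cases "j \<le> n")
      case True
      show ?thesis unfolding stepx.simps[of _ _ _ _ n] 1 2[OF True] ..
    next
      case False
      then show ?thesis unfolding stepx.simps[of _ _ _ _ n] 1 by simp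
    qed
  qed
  show "stepx j U1 U2 f' L x y \<mu> k = stepx j U1 U2 f L x y \<mu> k + B k * R (x, y, \<mu>)" if z: "(x, y, \<mu>) \<in> S"
  proof -
    obtain C where C: "\<And>t. (\<Sum>n = 1..L. f n (curX U1 x \<mu> t) (curY U2 x y \<mu> t) (\<lambda>i. t * \<mu> i) k) = poly (C k (x, y, \<mu>)) (of_real t)"
      using goodx_curve[of f L, OF f] z by blast
    obtain C' where C': "\<And>t. R (cur (x, y, \<mu>) t) = poly (C' (x, y, \<mu>)) (of_real t)" "coeff (C' (x, y, \<mu>)) L = R (x, y, \<mu>)"
      using cur_hpoly[OF R] z by metis
    have sumL: "(\<Sum>n = 1..L. a n) = (\<Sum>n = 1..L - 1. a n) + a L" for a :: "nat \<Rightarrow> complex"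
      using \<open>L \<ge> 1\<close> by (cases L) auto
    have "(\<Sum>n = 1..L. f' n (curX U1 x \<mu> t) (curY U2 x y \<mu> t) (\<lambda>i. t * \<mu> i) k)
        = (\<Sum>n = 1..L. f n (curX U1 x \<mu> t) (curY U2 x y \<mu> t) (\<lambda>i. t * \<mu> i) k) + B k * R (cur (x, y, \<mu>) t)" for t
    proof -
      have "(\<Sum>n = 1..L - 1. f' n (curX U1 x \<mu> t) (curY U2 x y \<mu> t) (\<lambda>i. t * \<mu> i) k)
        = (\<Sum>n = 1..L - 1. f n (curX U1 x \<mu> t) (curY U2 x y \<mu> t) (\<lambda>i. t * \<mu> i) k)"
        using eq[OF _ _ S'[OF z, of t]] by (intro sum.cong refl) auto
      then show ?thesis unfolding sumL using L[OF S'[OF z, of t], of k] by (simp add: cur_def)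
    qed
    then have "(\<Sum>n = 1..L. f' n (curX U1 x \<mu> t) (curY U2 x y \<mu> t) (\<lambda>i. t * \<mu> i) k)
        = poly (C k (x, y, \<mu>) + smult (B k) (C' (x, y, \<mu>))) (of_real t)" for t
      by (simp only: C C'(1) poly_add poly_smult)
    from taylor_coeff_poly[OF this, of L] taylor_coeff_poly[OF C, of L] C'(2)
    have 1: "taylor_coeff L (\<lambda>t. \<Sum>n = 1..L. f' n (curX U1 x \<mu> t) (curY U2 x y \<mu> t) (\<lambda>i. t * \<mu> i) k)
      = taylor_coeff L (\<lambda>t. \<Sum>n = 1..L. f n (curX U1 x \<mu> t) (curY U2 x y \<mu> t) (\<lambda>i. t * \<mu> i) k) + B k * R (x, y, \<mu>)"
      by simp
    have 2: "stepx j U1 U2 f' (L + 1 - j) x y \<mu> = stepx j U1 U2 f (L + 1 - j) x y \<mu>" if "j \<le> L"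
      using *[of "L + 1 - j"] that j z by simp
    show ?thesis
    proof (cases "j \<le> L")
      case True
      show ?thesis unfolding stepx.simps[of _ _ _ _ L] 1 2[OF True] by simp
    next
      case False
      then show ?thesis unfolding stepx.simps[of _ _ _ _ L] 1 by simp
    qed
  qed
qed

lemma hpoly_in_AQc:
  "hpoly_in V QC m F \<Longrightarrow> \<exists>G. hpoly_in V BQ m G \<and> (\<forall>z. F z \<in> QC \<and> (\<forall>\<theta>\<in>I. AQc (F z) \<theta> = G z \<theta>))"
proof (induction rule: hpoly_in.induct)
  case (zero n)
  show ?case using AQc_scale[OF C1_zero, of _ 0]
    by (intro exI[of _ "\<lambda>_ _. 0"]) (auto simp: QC_zero intro: hpoly_in.zero)
next
  case (tensor n P e)
  then show ?case using AQc_scale[OF QC_C1[OF tensor(2)]] QC_scale[OF tensor(2)]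
    by (intro exI[of _ "\<lambda>z \<theta>. P z * AQc e \<theta>"]) (auto intro: hpoly_in.tensor AQc_BQ)
next
  case (add n F G)
  then obtain F' G' where "hpoly_in V BQ n F'" "hpoly_in V BQ n G'"
    "\<And>z. F z \<in> QC \<and> (\<forall>\<theta>\<in>I. AQc (F z) \<theta> = F' z \<theta>)" "\<And>z. G z \<in> QC \<and> (\<forall>\<theta>\<in>I. AQc (G z) \<theta> = G' z \<theta>)"
    by blast
  then show ?case
    by (intro exI[of _ "\<lambda>z \<theta>. F' z \<theta> + G' z \<theta>"]) (auto intro: hpoly_in.add QC_add simp: AQc_add QC_C1)
qed

lemma goody_dirD:
  assumes w: "goodx (Suc n) w"
  shows "goody (j + n) (\<lambda>x y \<mu> \<theta>. dirD (\<lambda>x. U2 x \<mu> \<theta>) x (w x y \<mu>))"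
proof -
  obtain F where F: "hpoly_in V0 QC j F"
    "\<And>x \<mu> \<theta>. x \<in> cpts zr p \<Longrightarrow> \<mu> \<in> params s \<Longrightarrow> \<theta> \<in> I \<Longrightarrow> complex_of_real (U2 x \<mu> \<theta>) = F (x, (\<lambda>_. 0), \<mu>) \<theta>"
    using U2 unfolding goodU2_def by blast
  obtain W where W: "\<And>k. k \<in> K \<Longrightarrow> hpoly V1 (Suc n) (\<lambda>z. W z k)" "\<And>x y \<mu>. (x, y, \<mu>) \<in> S \<Longrightarrow> w x y \<mu> = W (x, y, \<mu>)"
    "\<And>x y \<mu> t. (x, y, \<mu>) \<in> S \<Longrightarrow> (\<lambda>k. x k + of_real t * W (x, y, \<mu>) k) \<in> cpts zr p"
    using goodx_direction[OF w] by blast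
  obtain D where D: "hpoly_in V1 QC (j + n) D" "\<And>z \<theta>. ((\<lambda>t. F (\<lambda>k. fst z k + of_real t * W z k, fst (snd z), snd (snd z)) \<theta>)
     has_vector_derivative D z \<theta>) (at 0)"
    using hpoly_in_dirD[OF F(1), of V1 n W] W(1) V0_subset_V1 by blast
  have "hpoly_in V1 BQ (j + n) D" using hpoly_in_mono[OF D(1)] QC_BQ by blast
  moreover have "complex_of_real (dirD (\<lambda>x. U2 x \<mu> \<theta>) x (w x y \<mu>)) = D (x, y, \<mu>) \<theta>"
    if z: "(x, y, \<mu>) \<in> S" and \<theta>: "\<theta> \<in> I" for x y \<mu> \<theta>
  proof -
    have \<mu>: "\<mu> \<in> params s" using z by (simp add: S_def)
    have "complex_of_real (U2 (\<lambda>k. x k + of_real t * w x y \<mu> k) \<mu> \<theta>) = F (\<lambda>k. x k + of_real t * W (x, y, \<mu>) k, y, \<mu>) \<theta>" for t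
      unfolding W(2)[OF z] F(2)[OF W(3)[OF z] \<mu> \<theta>] by (rule hpoly_Vx_indep[OF hpoly_in_eval[OF F(1)]])
    then have d: "((\<lambda>t. complex_of_real (U2 (\<lambda>k. x k + of_real t * w x y \<mu> k) \<mu> \<theta>)) has_vector_derivative D (x, y, \<mu>) \<theta>) (at 0)"
      using D(2)[of "(x, y, \<mu>)" \<theta>] by simp
    have "((\<lambda>t. U2 (\<lambda>k. x k + of_real t * w x y \<mu> k) \<mu> \<theta>) has_vector_derivative Re (D (x, y, \<mu>) \<theta>)) (at 0)"
      using bounded_linear.has_vector_derivative[OF bounded_linear_Re d] by simp
    moreover have "((\<lambda>_. 0) has_vector_derivative Im (D (x, y, \<mu>) \<theta>)) (at 0)"
      using bounded_linear.has_vector_derivative[OF bounded_linear_Im d] by simp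
    then have "Im (D (x, y, \<mu>) \<theta>) = 0" using vector_derivative_at by fastforce
    ultimately show ?thesis unfolding dirD_def by (simp add: vector_derivative_at complex_eq_iff)
  qed
  ultimately show ?thesis unfolding goody_def by blast
qed

lemma goody_diff: "goody m f \<Longrightarrow> goody m g \<Longrightarrow> goody m (\<lambda>x y \<mu> \<theta>. f x y \<mu> \<theta> - g x y \<mu> \<theta>)"
proof -
  assume "goody m f" "goody m g"
  then obtain F G where "hpoly_in V1 BQ m F" "hpoly_in V1 BQ m G"
    "\<And>x y \<mu> \<theta>. (x, y, \<mu>) \<in> S \<Longrightarrow> \<theta> \<in> I \<Longrightarrow> complex_of_real (f x y \<mu> \<theta>) = F (x, y, \<mu>) \<theta>"
    "\<And>x y \<mu> \<theta>. (x, y, \<mu>) \<in> S \<Longrightarrow> \<theta> \<in> I \<Longrightarrow> complex_of_real (g x y \<mu> \<theta>) = G (x, y, \<mu>) \<theta>"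
    unfolding goody_def by blast
  then show "goody m (\<lambda>x y \<mu> \<theta>. f x y \<mu> \<theta> - g x y \<mu> \<theta>)"
    unfolding goody_def by (intro exI[of _ "\<lambda>z \<theta>. F z \<theta> - G z \<theta>"]) (simp add: hpoly_in_diff)
qed

text \<open>The linear term \<open>AQ1 y\<close> depends on all of y, not just on its values at
  \<open>Y\<close>, so it is treated apart from the polynomial terms. Along the bent ray it equals
  \<open>t * AQ1 y\<close> plus \<open>t ^ j\<close> times the image of \<open>U2\<close>, hence
  contributes in degrees 1 and \<open>j\<close> only.\<close>

lemma goody_taylor:
  assumes f: "\<And>n. n \<ge> 2 \<Longrightarrow> goody n (f n)"
    and f1: "\<And>x y \<mu> \<theta>. (x, y, \<mu>) \<in> S \<Longrightarrow> \<theta> \<in> I \<Longrightarrow> f 1 x y \<mu> \<theta> = AQ1 r M y \<theta>" and "m \<ge> 1"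
  shows "\<exists>F. hpoly_in V1 BQ m F \<and> (\<forall>x y \<mu>. (x, y, \<mu>) \<in> S \<longrightarrow> (\<forall>\<theta>\<in>I.
    complex_of_real (taylor_coeff m (\<lambda>t. \<Sum>n = 1..m. f n (curX U1 x \<mu> t) (curY U2 x y \<mu> t) (\<lambda>i. t * \<mu> i) \<theta>))
    = (if m = 1 then of_real (AQ1 r M y \<theta>) else F (x, y, \<mu>) \<theta>)))"
proof -
  define ff where "ff n F \<longleftrightarrow> n \<ge> 2 \<longrightarrow> hpoly_in V1 BQ n F \<and>
    (\<forall>x y \<mu>. (x, y, \<mu>) \<in> S \<longrightarrow> (\<forall>\<theta>\<in>I. complex_of_real (f n x y \<mu> \<theta>) = F (x, y, \<mu>) \<theta>))" for n F
  have "\<exists>F. ff n F" for n using f unfolding goody_def ff_def by (cases "n \<ge> 2") blast+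
  then obtain F where ff: "\<And>n. ff n (F n)" by metis
  have F: "\<And>n. n \<ge> 2 \<Longrightarrow> hpoly_in V1 BQ n (F n)"
    "\<And>n x y \<mu> \<theta>. n \<ge> 2 \<Longrightarrow> (x, y, \<mu>) \<in> S \<Longrightarrow> \<theta> \<in> I \<Longrightarrow> complex_of_real (f n x y \<mu> \<theta>) = F n (x, y, \<mu>) \<theta>"
    using ff unfolding ff_def by blast+
  define cc where "cc n C \<longleftrightarrow> n \<ge> 2 \<longrightarrow> (\<forall>i. hpoly_in V1 BQ i (\<lambda>z \<theta>. coeff (C z \<theta>) i)) \<and>
    (\<forall>z\<in>S. \<forall>t::real. \<forall>\<theta>. F n (cur z t) \<theta> = poly (C z \<theta>) (of_real t))" for n C
  have "\<exists>C. cc n C" for n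
  proof (cases "n \<ge> 2")
    case True
    from hpoly_in_curve[OF F(1)[OF True] order_refl j cur_var] show ?thesis unfolding cc_def by blast
  qed (simp add: cc_def)
  then obtain C where cc: "\<And>n. cc n (C n)" by metis
  have C: "\<And>n i. n \<ge> 2 \<Longrightarrow> hpoly_in V1 BQ i (\<lambda>z \<theta>. coeff (C n z \<theta>) i)"
    "\<And>n z t \<theta>. n \<ge> 2 \<Longrightarrow> z \<in> S \<Longrightarrow> F n (cur z t) \<theta> = poly (C n z \<theta>) (of_real t)"
    using cc unfolding cc_def by blast+
  obtain H where H: "hpoly_in V0 QC j H" "\<And>x y \<mu> \<theta> t. (x, y, \<mu>) \<in> S \<Longrightarrow> \<theta> \<in> I \<Longrightarrow>
     complex_of_real (U2 (\<lambda>k. of_real t * x k) (\<lambda>i. t * \<mu> i) \<theta>) = of_real t ^ j * H (x, y, \<mu>) \<theta>"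
    using U2_poly by blast
  obtain G where G: "hpoly_in V1 BQ j G" "\<And>z. H z \<in> QC" "\<And>z \<theta>. \<theta> \<in> I \<Longrightarrow> AQc (H z) \<theta> = G z \<theta>"
    using hpoly_in_AQc[OF hpoly_in_mono[OF H(1) V0_subset_V1 order_refl]] by blast
  have S': "(curX U1 x \<mu> t, curY U2 x y \<mu> t, \<lambda>i. t * \<mu> i) \<in> S" if "(x, y, \<mu>) \<in> S" for x y \<mu> t
    using cur_S[OF that, of t] by (simp add: cur_def)
  have lin: "complex_of_real (f 1 (curX U1 x \<mu> t) (curY U2 x y \<mu> t) (\<lambda>i. t * \<mu> i) \<theta>)
    = of_real t * of_real (AQ1 r M y \<theta>) + of_real t ^ j * G (x, y, \<mu>) \<theta>"
    if z: "(x, y, \<mu>) \<in> S" and \<theta>: "\<theta> \<in> I" for x y \<mu> \<theta> t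
  proof -
    have y: "C1_on r (\<lambda>\<theta>. complex_of_real (y \<theta>))" using z QQ_iff QC_C1 by (auto simp: S_def)
    have Hz: "C1_on r (H (x, y, \<mu>))" using G(2) QC_C1 by blast
    have c: "C1_on r (\<lambda>\<theta>. complex_of_real (curY U2 x y \<mu> t \<theta>))"
      using S'[OF z, of t] QQ_iff QC_C1 by (auto simp: S_def)
    have "complex_of_real (f 1 (curX U1 x \<mu> t) (curY U2 x y \<mu> t) (\<lambda>i. t * \<mu> i) \<theta>)
      = AQc (\<lambda>\<theta>. complex_of_real (curY U2 x y \<mu> t \<theta>)) \<theta>"
      unfolding f1[OF S'[OF z] \<theta>] using c \<theta> by (intro AQ1_of_real) (simp_all add: C1_of_real)
    also have "\<dots> = AQc (\<lambda>\<theta>. of_real t * complex_of_real (y \<theta>) + of_real t ^ j * H (x, y, \<mu>) \<theta>) \<theta>"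
      by (rule AQc_cong[OF _ _ \<theta>]) (auto intro!: C1_add C1_scale y Hz simp: curY_def H(2)[OF z])
    also have "\<dots> = of_real t * AQc (\<lambda>\<theta>. complex_of_real (y \<theta>)) \<theta> + of_real t ^ j * AQc (H (x, y, \<mu>)) \<theta>"
      by (simp add: AQc_add AQc_scale C1_scale y Hz \<theta> del: atLeastAtMost_iff)
    finally show ?thesis using AQ1_of_real[of y \<theta>] y \<theta> G(3)[OF \<theta>] by (simp add: C1_of_real)
  qed
  define c where "c z \<theta> = monom (complex_of_real (AQ1 r M (fst (snd z)) \<theta>)) 1 + monom (G z \<theta>) j + (\<Sum>n = 2..m. C n z \<theta>)" for z :: point and \<theta>
  have sum1: "(\<Sum>n = 1..m. a n) = a 1 + (\<Sum>n = 2..m. a n)" for a :: "nat \<Rightarrow> complex"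
    using \<open>m \<ge> 1\<close> by (simp add: sum.atLeast_Suc_atMost numeral_2_eq_2)
  have T: "complex_of_real (taylor_coeff m (\<lambda>t. \<Sum>n = 1..m. f n (curX U1 x \<mu> t) (curY U2 x y \<mu> t) (\<lambda>i. t * \<mu> i) \<theta>))
     = coeff (c (x, y, \<mu>) \<theta>) m" if z: "(x, y, \<mu>) \<in> S" and \<theta>: "\<theta> \<in> I" for x y \<mu> \<theta>
  proof (rule taylor_coeff_poly_real)
    fix t
    have "complex_of_real (f n (curX U1 x \<mu> t) (curY U2 x y \<mu> t) (\<lambda>i. t * \<mu> i) \<theta>) = poly (C n (x, y, \<mu>) \<theta>) (of_real t)"
      if "n \<ge> 2" for n
      using F(2)[OF that S'[OF z, of t] \<theta>] C(2)[OF that z, of t \<theta>] by (simp add: cur_def)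
    then show "complex_of_real (\<Sum>n = 1..m. f n (curX U1 x \<mu> t) (curY U2 x y \<mu> t) (\<lambda>i. t * \<mu> i) \<theta>) = poly (c (x, y, \<mu>) \<theta>) (of_real t)"
      unfolding of_real_sum sum1 lin[OF z \<theta>] c_def by (simp add: poly_monom poly_sum mult.commute)
  qed
  have "hpoly_in V1 BQ m (\<lambda>z \<theta>. (if m = j then G z \<theta> else 0) + (\<Sum>n = 2..m. coeff (C n z \<theta>) m))"
  proof (rule hpoly_in.add)
    show "hpoly_in V1 BQ m (\<lambda>z \<theta>. if m = j then G z \<theta> else 0)"
      using G(1) hpoly_in.zero by (cases "m = j") simp_all
    show "hpoly_in V1 BQ m (\<lambda>z \<theta>. \<Sum>n = 2..m. coeff (C n z \<theta>) m)"
      using C(1) by (intro hpoly_in_sum) auto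
  qed
  moreover have "coeff (c (x, y, \<mu>) \<theta>) m = (if m = 1 then of_real (AQ1 r M y \<theta>)
     else (if m = j then G (x, y, \<mu>) \<theta> else 0) + (\<Sum>n = 2..m. coeff (C n (x, y, \<mu>) \<theta>) m))" for x y \<mu> \<theta>
    using j unfolding c_def by (auto simp: coeff_sum)
  ultimately show ?thesis using T
    by (intro exI[of _ "\<lambda>z \<theta>. (if m = j then G z \<theta> else 0) + (\<Sum>n = 2..m. coeff (C n z \<theta>) m)"]) simp
qed

lemma stepy_good:
  assumes f: "\<And>n. n \<ge> 2 \<Longrightarrow> goody n (f2 n)"
    and f1: "\<And>x y \<mu> \<theta>. (x, y, \<mu>) \<in> S \<Longrightarrow> \<theta> \<in> I \<Longrightarrow> f2 1 x y \<mu> \<theta> = AQ1 r M y \<theta>"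
    and fx: "\<And>n. n \<ge> 1 \<Longrightarrow> goodx n (f n)"
  shows "m \<ge> 2 \<Longrightarrow> goody m (stepy j U1 U2 f f2 m)"
    and "(x, y, \<mu>) \<in> S \<Longrightarrow> \<theta> \<in> I \<Longrightarrow> stepy j U1 U2 f f2 1 x y \<mu> \<theta> = AQ1 r M y \<theta>"
proof -
  show "goody m (stepy j U1 U2 f f2 m)" if m: "m \<ge> 2"
  proof -
    have T: "goody m (\<lambda>x y \<mu> \<theta>. taylor_coeff m (\<lambda>t. \<Sum>n = 1..m. f2 n (curX U1 x \<mu> t) (curY U2 x y \<mu> t) (\<lambda>i. t * \<mu> i) \<theta>))"
      using goody_taylor[of f2 m, OF f f1] m unfolding goody_def by auto
    show ?thesis
    proof (cases "j \<le> m")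
      case True
      have "goodx (Suc (m - j)) (stepx j U1 U2 f (m + 1 - j))"
        using stepx_good[OF fx, of "m + 1 - j"] True j by (simp add: Suc_diff_le)
      from goody_diff[OF T] goody_dirD[OF this] True j show ?thesis by (simp add: stepy_def[abs_def])
    next
      case False
      then show ?thesis using T by (simp add: stepy_def[abs_def])
    qed
  qed
  show "stepy j U1 U2 f f2 1 x y \<mu> \<theta> = AQ1 r M y \<theta>" if "(x, y, \<mu>) \<in> S" "\<theta> \<in> I"
    using goody_taylor[of f2 1, OF f f1] that j unfolding stepy_def by (auto simp del: One_nat_def)
qed

end

text \<open>Monomials are eigenvectors of the derivation along \<open>Bx\<close>, so each coefficient solves a resolvent
  equation for \<open>A\<close> restricted to \<open>Q\<^sup>1\<close>.\<close>

lemma HQ1_solution: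
  assumes F: "\<And>x \<mu> \<theta>. x \<in> cpts zr p \<Longrightarrow> \<mu> \<in> params s \<Longrightarrow> \<theta> \<in> I \<Longrightarrow>
      complex_of_real (F x \<mu> \<theta>) = heval K s j (\<lambda>m q. c m q \<theta>) x \<mu>"
    and c: "\<And>m q. c m q \<in> BQ"
  shows "\<exists>U\<in>HQ1 r M zr p \<omega> b s j. \<forall>x\<in>cpts zr p. \<forall>\<mu>\<in>params s. \<forall>\<theta>\<in>I.
    dirD (\<lambda>x. U x \<mu> \<theta>) x (Bop \<omega> x) - AQ1 r M (U x \<mu>) \<theta> = F x \<mu> \<theta>"
proof -
  define ev where "ev m = (\<Sum>k\<in>K. of_nat (m k) * \<sigma> k)" for m
  \<comment> \<open>The eigenvalue of every monomial is purely imaginary, which puts it within reach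
    of \<open>AQc_resolvent\<close>.\<close>
  have "Re (ev m) = 0" for m by (simp add: ev_def \<sigma>_def)
  then have "\<forall>m q. \<exists>d. d \<in> QC \<and> (\<forall>\<theta>\<in>I. ev m * d \<theta> - AQc d \<theta> = c m q \<theta>)"
    using AQc_resolvent[OF c] by blast
  then obtain d where d: "\<And>m q. d m q \<in> QC" "\<And>m q \<theta>. \<theta> \<in> I \<Longrightarrow> ev m * d m q \<theta> - AQc (d m q) \<theta> = c m q \<theta>"
    by metis
  define H where "H x \<mu> \<theta> = heval K s j (\<lambda>m q. d m q \<theta>) x \<mu>" for x \<mu> \<theta>
  \<comment> \<open>The complex solution may fail to be real. Its real part solves the equation too,
    since \<open>F\<close> is real and both operators commute with \<open>Re\<close>; its
    coefficients are the symmetrized ones.\<close>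
  define U where "U x \<mu> \<theta> = Re (H x \<mu> \<theta>)" for x \<mu> \<theta>
  have "U \<in> HQ1 r M zr p \<omega> b s j"
    unfolding HQ1_def mem_Collect_eq QC_def[symmetric]
  proof (intro exI[of _ "\<lambda>m q \<theta>. (1/2) * (d m q \<theta> + cnj (d (\<lambda>k. m (- k)) q \<theta>))"] conjI allI ballI)
    show "(\<lambda>\<theta>. (1/2) * (d m q \<theta> + cnj (d (\<lambda>k. m (- k)) q \<theta>))) \<in> QC" for m q
      by (intro QC_scale QC_add QC_cnj d)
    fix x \<mu> \<theta> assume x: "x \<in> cpts zr p"
    have "complex_of_real (U x \<mu> \<theta>) = (1/2) * (H x \<mu> \<theta> + cnj (H x \<mu> \<theta>))"
      by (simp add: U_def complex_add_cnj)
    also have "\<dots> = heval K s j (\<lambda>m q. (1/2) * (d m q \<theta> + cnj (d (\<lambda>k. m (- k)) q \<theta>))) x \<mu>"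
      by (simp only: H_def heval_cnj[OF x] heval_add heval_scale)
    finally show "complex_of_real (U x \<mu> \<theta>) = heval K s j (\<lambda>m q. (1/2) * (d m q \<theta> + cnj (d (\<lambda>k. m (- k)) q \<theta>))) x \<mu>" .
  qed
  moreover have "dirD (\<lambda>x. U x \<mu> \<theta>) x (Bop \<omega> x) - AQ1 r M (U x \<mu>) \<theta> = F x \<mu> \<theta>"
    if x: "x \<in> cpts zr p" and \<mu>: "\<mu> \<in> params s" and \<theta>: "\<theta> \<in> I" for x \<mu> \<theta>
  proof -
    have "dirD (\<lambda>x. U x \<mu> \<theta>) x (Bop \<omega> x) = Re (heval K s j (\<lambda>m q. ev m * d m q \<theta>) x \<mu>)"
      unfolding dirD_def U_def H_def Bop_\<sigma> ev_def
      by (rule vector_derivative_at) (rule bounded_linear.has_vector_derivative[OF bounded_linear_Re dirD_heval[OF cidx_finite]])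
    moreover have "AQ1 r M (U x \<mu>) \<theta> = Re (heval K s j (\<lambda>m q. AQc (d m q) \<theta>) x \<mu>)"
    proof -
      have C1: "C1_on r (\<lambda>\<theta>. mon K s (fst a) (snd a) x \<mu> * d (fst a) (snd a) \<theta>)" for a
        by (intro C1_scale QC_C1 d)
      have H: "H x \<mu> = (\<lambda>\<theta>. \<Sum>a\<in>mexps K s j. mon K s (fst a) (snd a) x \<mu> * d (fst a) (snd a) \<theta>)"
        by (simp add: H_def[abs_def] heval_def case_prod_unfold mult.commute)
      have A: "C1_on r (H x \<mu>)" "AQc (H x \<mu>) \<theta> = (\<Sum>a\<in>mexps K s j. AQc (\<lambda>\<theta>. mon K s (fst a) (snd a) x \<mu> * d (fst a) (snd a) \<theta>) \<theta>)"
        unfolding H using AQc_sum[of "mexps K s j" "\<lambda>a \<theta>. mon K s (fst a) (snd a) x \<mu> * d (fst a) (snd a) \<theta>" \<theta>, OF _ C1 \<theta>] by simp_all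
      have "AQ1 r M (U x \<mu>) \<theta> = Re (AQc (H x \<mu>) \<theta>)"
        using AQ1_Re[OF A(1) \<theta>] by (simp add: U_def[abs_def])
      moreover have "AQc (\<lambda>\<theta>. mon K s (fst a) (snd a) x \<mu> * d (fst a) (snd a) \<theta>) \<theta>
          = AQc (d (fst a) (snd a)) \<theta> * mon K s (fst a) (snd a) x \<mu>" for a
        unfolding AQc_scale[OF QC_C1[OF d(1)] \<theta>] by (rule mult.commute)
      ultimately show ?thesis unfolding A(2) by (simp only: heval_def case_prod_unfold)
    qed
    ultimately have "dirD (\<lambda>x. U x \<mu> \<theta>) x (Bop \<omega> x) - AQ1 r M (U x \<mu>) \<theta>
      = Re (heval K s j (\<lambda>m q. ev m * d m q \<theta> - AQc (d m q) \<theta>) x \<mu>)"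
      by (simp flip: heval_diff)
    also have "\<dots> = Re (complex_of_real (F x \<mu> \<theta>))" unfolding F[OF x \<mu> \<theta>] d(2)[OF \<theta>] ..
    finally show ?thesis by simp
  qed
  ultimately show ?thesis by blast
qed

end

section \<open>Generic solvability of linear systems\<close>

text \<open>Gaussian elimination over a ring of functions: solvability at one point persists
  wherever the product of the pivots does not vanish.\<close>

lemma solvable_generic:
  fixes a :: "'i \<Rightarrow> 'j \<Rightarrow> 'x \<Rightarrow> real"
  assumes one: "P (\<lambda>_. 1)" and mult: "\<And>f g. P f \<Longrightarrow> P g \<Longrightarrow> P (\<lambda>x. f x * g x)"
    and diff: "\<And>f g. P f \<Longrightarrow> P g \<Longrightarrow> P (\<lambda>x. f x - g x)"
    and "finite R" "finite J" "\<And>i j. i \<in> R \<Longrightarrow> j \<in> J \<Longrightarrow> P (a i j)"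
    and "\<And>y. \<exists>c. \<forall>i\<in>R. (\<Sum>j\<in>J. a i j x0 * c j) = y i"
  shows "\<exists>D. P D \<and> D x0 \<noteq> 0 \<and> (\<forall>x. D x \<noteq> 0 \<longrightarrow> (\<forall>y. \<exists>c. \<forall>i\<in>R. (\<Sum>j\<in>J. a i j x * c j) = y i))"
  using assms(4-)
proof (induction R arbitrary: J a rule: finite_induct)
  case empty
  show ?case by (rule exI[of _ "\<lambda>_. 1"]) (simp add: one)
next
  case (insert k R)
  obtain c0 where "(\<Sum>j\<in>J. a k j x0 * c0 j) = 1" using insert.prems(3)[of "\<lambda>_. 1"] by auto
  \<comment> \<open>Row \<open>k\<close> reaches the value 1 at \<open>x0\<close>, so it has a
    nonzero entry there: the pivot.\<close>
  then obtain l where l: "l \<in> J" "a k l x0 \<noteq> 0"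
    by (metis (mono_tags, lifting) mult_zero_left sum.neutral zero_neq_one)
  define J' where "J' = J - {l}"
  have J: "J = insert l J'" "l \<notin> J'" "finite J'" using l insert.prems(1) by (auto simp: J'_def)
  \<comment> \<open>Elimination by cross multiplication involves no division, so the entries stay in
    the class \<open>P\<close>.\<close>
  define a' where "a' i j x = a k l x * a i j x - a i l x * a k j x" for i j x
  have P': "P (a' i j)" if "i \<in> R" "j \<in> J'" for i j
    unfolding a'_def[abs_def] using that l(1) insert.prems(2) J by (intro diff mult) auto
  have "\<exists>c. \<forall>i\<in>R. (\<Sum>j\<in>J'. a' i j x0 * c j) = y i" for y
  proof -
    \<comment> \<open>The pivot row gets right-hand side zero; the others are divided by the pivot
      to offset the factor that cross multiplication introduces.\<close>
    obtain c where c: "\<forall>i\<in>insert k R. (\<Sum>j\<in>J. a i j x0 * c j) = (if i = k then 0 else y i / a k l x0)"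
      using insert.prems(3)[of "\<lambda>i. if i = k then 0 else y i / a k l x0"] by blast
    have "(\<Sum>j\<in>J'. a' i j x0 * c j) = y i" if i: "i \<in> R" for i
    proof -
      have "i \<noteq> k" using i insert.hyps by auto
      have "(\<Sum>j\<in>J'. a' i j x0 * c j) = (\<Sum>j\<in>J. a' i j x0 * c j)"
        unfolding J(1) using J(2,3) by (simp add: a'_def)
      also have "\<dots> = a k l x0 * (\<Sum>j\<in>J. a i j x0 * c j) - a i l x0 * (\<Sum>j\<in>J. a k j x0 * c j)"
        unfolding a'_def sum_distrib_left sum_subtractf[symmetric] by (intro sum.cong refl) (simp add: algebra_simps)
      also have "\<dots> = y i" using c i \<open>i \<noteq> k\<close> l(2) by simp
      finally show ?thesis .
    qed
    then show ?thesis by blast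
  qed
  from insert.IH[OF J(3) P' this]
  obtain D where D: "P D" "D x0 \<noteq> 0"
    "\<And>x. D x \<noteq> 0 \<Longrightarrow> \<forall>y. \<exists>c. \<forall>i\<in>R. (\<Sum>j\<in>J'. a' i j x * c j) = y i" by blast
  have "\<exists>c. \<forall>i\<in>insert k R. (\<Sum>j\<in>J. a i j x * c j) = y i" if nz: "D x * a k l x \<noteq> 0" for x y
  proof -
    obtain c where c: "\<forall>i\<in>R. (\<Sum>j\<in>J'. a' i j x * c j) = a k l x * y i - a i l x * y k"
      using D(3)[of x, THEN spec[of _ "\<lambda>i. a k l x * y i - a i l x * y k"]] nz by auto
    define c' where "c' = c(l := (y k - (\<Sum>j\<in>J'. a k j x * c j)) / a k l x)"
    have s: "(\<Sum>j\<in>J. a i j x * c' j) = a i l x * c' l + (\<Sum>j\<in>J'. a i j x * c j)" for i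
    proof -
      have "(\<Sum>j\<in>J'. a i j x * c' j) = (\<Sum>j\<in>J'. a i j x * c j)"
        using J(2) by (intro sum.cong) (auto simp: c'_def)
      then show ?thesis unfolding J(1) using J(2,3) by simp
    qed
    have k: "(\<Sum>j\<in>J. a k j x * c' j) = y k" unfolding s using nz by (simp add: c'_def)
    have "(\<Sum>j\<in>J. a i j x * c' j) = y i" if i: "i \<in> R" for i
    proof -
      have "a k l x * (\<Sum>j\<in>J. a i j x * c' j) = a i l x * (\<Sum>j\<in>J. a k j x * c' j) + (\<Sum>j\<in>J'. a' i j x * c j)"
      proof -
        have "(\<Sum>j\<in>J'. a' i j x * c j) = a k l x * (\<Sum>j\<in>J'. a i j x * c j) - a i l x * (\<Sum>j\<in>J'. a k j x * c j)"
          unfolding a'_def sum_distrib_left sum_subtractf[symmetric] by (intro sum.cong refl) (simp add: algebra_simps)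
        then show ?thesis unfolding s by (simp add: algebra_simps)
      qed
      also have "\<dots> = a k l x * y i" using c i k by simp
      finally show ?thesis using nz by simp
    qed
    then show ?thesis using k by blast
  qed
  moreover have "P (\<lambda>x. D x * a k l x)" using D(1) l(1) insert.prems(2) by (intro mult) auto
  ultimately show ?case using D(2) l(2) by (intro exI[of _ "\<lambda>x. D x * a k l x"]) auto
qed

section \<open>Trigonometric polynomials in the delays\<close>

text \<open>\<open>\<alpha> k c\<close> is the angle of frequency \<open>k\<close> at delay
  \<open>c\<close>, freed from the relation
  \<open>\<alpha> k c = \<omega> k * \<tau> c\<close>.\<close>

inductive trig :: "(nat \<times> nat) set \<Rightarrow> ((nat \<Rightarrow> nat \<Rightarrow> real) \<Rightarrow> real) \<Rightarrow> bool" for J where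
  const: "trig J (\<lambda>_. c)"
| cos: "(k, c) \<in> J \<Longrightarrow> trig J (\<lambda>\<alpha>. cos (\<alpha> k c))"
| sin: "(k, c) \<in> J \<Longrightarrow> trig J (\<lambda>\<alpha>. sin (\<alpha> k c))"
| add: "trig J f \<Longrightarrow> trig J g \<Longrightarrow> trig J (\<lambda>\<alpha>. f \<alpha> + g \<alpha>)"
| mult: "trig J f \<Longrightarrow> trig J g \<Longrightarrow> trig J (\<lambda>\<alpha>. f \<alpha> * g \<alpha>)"

lemma trig_diff: "trig J f \<Longrightarrow> trig J g \<Longrightarrow> trig J (\<lambda>\<alpha>. f \<alpha> - g \<alpha>)"
  using trig.add[OF _ trig.mult[OF trig.const[of J "-1"]], of f g] by simp

lemma trig_minus: "trig J f \<Longrightarrow> trig J (\<lambda>\<alpha>. - f \<alpha>)"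
  using trig_diff[OF trig.const[of J 0]] by simp

lemma trig_sum: "finite A \<Longrightarrow> (\<And>a. a \<in> A \<Longrightarrow> trig J (f a)) \<Longrightarrow> trig J (\<lambda>\<alpha>. \<Sum>a\<in>A. f a \<alpha>)"
  by (induction A rule: finite_induct) (auto intro: trig.intros)

definition ctrig :: "(nat \<times> nat) set \<Rightarrow> ((nat \<Rightarrow> nat \<Rightarrow> real) \<Rightarrow> complex) \<Rightarrow> bool" where
  "ctrig J f \<longleftrightarrow> trig J (\<lambda>\<alpha>. Re (f \<alpha>)) \<and> trig J (\<lambda>\<alpha>. Im (f \<alpha>))"

lemma ctrig_const: "ctrig J (\<lambda>_. c)" by (simp add: ctrig_def trig.const)

lemma ctrig_mult: "ctrig J f \<Longrightarrow> ctrig J g \<Longrightarrow> ctrig J (\<lambda>\<alpha>. f \<alpha> * g \<alpha>)"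
  by (auto simp: ctrig_def intro!: trig_diff trig.add trig.mult)

lemma ctrig_sum: "finite A \<Longrightarrow> (\<And>a. a \<in> A \<Longrightarrow> ctrig J (f a)) \<Longrightarrow> ctrig J (\<lambda>\<alpha>. \<Sum>a\<in>A. f a \<alpha>)"
  by (auto simp: ctrig_def intro!: trig_sum)

lemma ctrig_prod_list: "(\<And>a. a \<in> set xs \<Longrightarrow> ctrig J (f a)) \<Longrightarrow> ctrig J (\<lambda>\<alpha>. \<Prod>a\<leftarrow>xs. f a \<alpha>)"
  by (induction xs) (auto intro: ctrig_const ctrig_mult)

lemma ctrig_exp:
  assumes "k \<in> cidx zr p" "{1..p} \<times> {c} \<subseteq> J"
  shows "ctrig J (\<lambda>\<alpha>. exp (\<i> * of_real (odd_ext (\<lambda>k. \<alpha> k c) k)))"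
  using assms(1)
proof (cases rule: cidx_cases)
  case 1 then show ?thesis by (simp add: ctrig_const)
next
  case (2 i)
  then have "(i, c) \<in> J" using assms(2) by auto
  then show ?thesis using 2 by (simp add: ctrig_def Re_exp Im_exp trig.cos trig.sin)
next
  case (3 i)
  then have "(i, c) \<in> J" using assms(2) by auto
  then show ?thesis using 3 by (simp add: ctrig_def Re_exp Im_exp trig.cos trig.sin trig_minus)
qed

text \<open>An angle enters through its sine and cosine only, so at each term of the sequence it may
  be shifted by a multiple of 2 \<pi>.\<close>

lemma trig_limit:
  assumes "trig J f" "\<And>k c. (k, c) \<in> J \<Longrightarrow> (\<lambda>n. \<alpha> n k c - 2 * pi * of_int (h n k c)) \<longlonglongrightarrow> \<alpha>0 k c"
  shows "(\<lambda>n. f (\<alpha> n)) \<longlonglongrightarrow> f \<alpha>0"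
  using assms(1)
proof (induction rule: trig.induct)
  case (cos k c)
  have "cos (\<alpha> n k c - 2 * pi * of_int (h n k c)) = cos (\<alpha> n k c)" for n
    using cos.plus_of_int[of "\<alpha> n k c" "- h n k c"] by (simp add: algebra_simps)
  then show ?case using tendsto_cos[OF assms(2)[OF cos]] by simp
next
  case (sin k c)
  have "sin (\<alpha> n k c - 2 * pi * of_int (h n k c)) = sin (\<alpha> n k c)" for n
    using sin.plus_of_int[of "\<alpha> n k c" "- h n k c"] by (simp add: algebra_simps)
  then show ?case using tendsto_sin[OF assms(2)[OF sin]] by simp
qed (auto intro: tendsto_intros)

text \<open>Density of a nonvanishing set then needs the identity theorem in one variable only.\<close>

definition line_analytic :: "((nat \<Rightarrow> real) \<Rightarrow> real) \<Rightarrow> bool" where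
  "line_analytic F \<longleftrightarrow> continuous_on UNIV F \<and> (\<forall>a b. \<exists>h. h holomorphic_on UNIV \<and>
     (\<forall>t::real. h (of_real t) = complex_of_real (F (\<lambda>c. a c + t * b c))))"

lemma line_analytic_coord: "line_analytic (\<lambda>\<tau>. \<tau> c)"
  unfolding line_analytic_def
proof (intro conjI allI)
  fix a b :: "nat \<Rightarrow> real"
  show "\<exists>h. h holomorphic_on UNIV \<and> (\<forall>t::real. h (of_real t) = complex_of_real (a c + t * b c))"
    by (rule exI[of _ "\<lambda>z. of_real (a c) + z * of_real (b c)"]) (auto intro!: holomorphic_intros)
qed (rule continuous_on_product_coordinates)

lemma line_analytic_const: "line_analytic (\<lambda>_. c)"
  unfolding line_analytic_def
  by (intro conjI allI exI[of _ "\<lambda>_. of_real c"]) (auto intro!: holomorphic_intros continuous_intros)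

lemma line_analytic_add:
  assumes "line_analytic f" "line_analytic g" shows "line_analytic (\<lambda>x. f x + g x)"
  unfolding line_analytic_def
proof (intro conjI allI)
  show "continuous_on UNIV (\<lambda>x. f x + g x)"
    using assms unfolding line_analytic_def by (auto intro: continuous_on_add)
  fix a b
  obtain h h' where "h holomorphic_on UNIV" "h' holomorphic_on UNIV"
    "\<And>t::real. h (of_real t) = complex_of_real (f (\<lambda>c. a c + t * b c))"
    "\<And>t::real. h' (of_real t) = complex_of_real (g (\<lambda>c. a c + t * b c))"
    using assms unfolding line_analytic_def by metis
  then show "\<exists>h. h holomorphic_on UNIV \<and> (\<forall>t::real. h (of_real t) = complex_of_real (f (\<lambda>c. a c + t * b c) + g (\<lambda>c. a c + t * b c)))"
    by (intro exI[of _ "\<lambda>z. h z + h' z"]) (auto intro!: holomorphic_intros)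
qed

lemma line_analytic_mult:
  assumes "line_analytic f" "line_analytic g" shows "line_analytic (\<lambda>x. f x * g x)"
  unfolding line_analytic_def
proof (intro conjI allI)
  show "continuous_on UNIV (\<lambda>x. f x * g x)"
    using assms unfolding line_analytic_def by (auto intro: continuous_on_mult)
  fix a b
  obtain h h' where "h holomorphic_on UNIV" "h' holomorphic_on UNIV"
    "\<And>t::real. h (of_real t) = complex_of_real (f (\<lambda>c. a c + t * b c))"
    "\<And>t::real. h' (of_real t) = complex_of_real (g (\<lambda>c. a c + t * b c))"
    using assms unfolding line_analytic_def by metis
  then show "\<exists>h. h holomorphic_on UNIV \<and> (\<forall>t::real. h (of_real t) = complex_of_real (f (\<lambda>c. a c + t * b c) * g (\<lambda>c. a c + t * b c)))"
    by (intro exI[of _ "\<lambda>z. h z * h' z"]) (auto intro!: holomorphic_intros)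
qed

lemma line_analytic_prod:
  "finite A \<Longrightarrow> (\<And>a. a \<in> A \<Longrightarrow> line_analytic (f a)) \<Longrightarrow> line_analytic (\<lambda>x. \<Prod>a\<in>A. f a x)"
  by (induction A rule: finite_induct) (auto intro: line_analytic_const line_analytic_mult)

lemma line_analytic_trig:
  assumes "trig J f" shows "line_analytic (\<lambda>\<tau>. f (\<lambda>k c. \<omega> k * \<tau> c))"
  using assms
proof (induction rule: trig.induct)
  case (cos k c)
  show ?case unfolding line_analytic_def
  proof (intro conjI allI)
    show "continuous_on UNIV (\<lambda>\<tau>::nat \<Rightarrow> real. cos (\<omega> k * \<tau> c))"
      by (intro continuous_intros continuous_on_product_coordinates)
    fix a b :: "nat \<Rightarrow> real"
    show "\<exists>h. h holomorphic_on UNIV \<and> (\<forall>t::real. h (of_real t) = complex_of_real (cos (\<omega> k * (a c + t * b c))))"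
      by (rule exI[of _ "\<lambda>z. cos (of_real (\<omega> k) * (of_real (a c) + z * of_real (b c)))"])
        (auto intro!: holomorphic_intros simp flip: cos_of_real)
  qed
next
  case (sin k c)
  show ?case unfolding line_analytic_def
  proof (intro conjI allI)
    show "continuous_on UNIV (\<lambda>\<tau>::nat \<Rightarrow> real. sin (\<omega> k * \<tau> c))"
      by (intro continuous_intros continuous_on_product_coordinates)
    fix a b :: "nat \<Rightarrow> real"
    show "\<exists>h. h holomorphic_on UNIV \<and> (\<forall>t::real. h (of_real t) = complex_of_real (sin (\<omega> k * (a c + t * b c))))"
      by (rule exI[of _ "\<lambda>z. sin (of_real (\<omega> k) * (of_real (a c) + z * of_real (b c)))"])
        (auto intro!: holomorphic_intros simp flip: sin_of_real)
  qed
qed (auto intro: line_analytic_const line_analytic_add line_analytic_mult)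

text \<open>The point \<open>\<tau>0\<close> may lie far outside the cube. After a small push of
  \<open>\<tau>\<close> into the interior, the beginning of the segment towards
  \<open>\<tau>0\<close> stays in \<open>U\<close> and in the cube. Along this line \<open>F\<close>
  extends to an entire function that is nonzero at parameter 1, so its zeros cannot fill an
  interval.\<close>

lemma line_analytic_dense:
  assumes F: "line_analytic F" and \<tau>0: "\<tau>0 \<in> vecs {1..d}" "F \<tau>0 \<noteq> 0" and r: "r > 0"
    and U: "open U" "\<tau> \<in> U" "\<tau> \<in> delay_cube r d"
  shows "\<exists>\<tau>'\<in>U \<inter> delay_cube r d. F \<tau>' \<noteq> 0"
proof -
  have line: "continuous_on UNIV (\<lambda>t::real. (\<lambda>c::nat. a c + t * b c))" for a b :: "nat \<Rightarrow> real"
    by (intro continuous_on_coordinatewise_then_product continuous_intros)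
  have nearU: "\<exists>e>0. \<forall>t. 0 < t \<and> t < e \<longrightarrow> (\<lambda>c. a c + t * b c) \<in> U" if "a \<in> U" for a b :: "nat \<Rightarrow> real"
  proof -
    have "open ((\<lambda>t::real. (\<lambda>c::nat. a c + t * b c)) -` U)"
      using open_vimage[OF U(1) line] .
    moreover have "0 \<in> (\<lambda>t::real. (\<lambda>c::nat. a c + t * b c)) -` U" using that by simp
    ultimately obtain e where "e > 0" "ball 0 e \<subseteq> (\<lambda>t::real. (\<lambda>c::nat. a c + t * b c)) -` U"
      using open_contains_ball by blast
    then have "t \<in> (\<lambda>t::real. (\<lambda>c::nat. a c + t * b c)) -` U" if "0 < t" "t < e" for t
      using that by (auto simp: dist_real_def subset_eq)
    then show ?thesis using \<open>e > 0\<close> by auto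
  qed
  \<comment> \<open>The centre of the cube: moving towards it makes all inequalities strict.\<close>
  define m where "m c = (if c \<in> {1..d} then - r / 2 else 0)" for c :: nat
  obtain e where e: "e > 0" "\<And>t. 0 < t \<Longrightarrow> t < e \<Longrightarrow> (\<lambda>c. \<tau> c + t * (m c - \<tau> c)) \<in> U"
    using nearU[OF U(2), of "\<lambda>c. m c - \<tau> c"] by blast
  define t1 where "t1 = min (e / 2) (1 / 2)"
  have t1: "0 < t1" "t1 < e" "t1 \<le> 1 / 2" using e(1) by (auto simp: t1_def)
  define \<tau>1 where "\<tau>1 c = \<tau> c + t1 * (m c - \<tau> c)" for c
  have \<tau>1U: "\<tau>1 \<in> U" unfolding \<tau>1_def[abs_def] by (rule e(2)[OF t1(1,2)])
  have \<tau>1v: "\<tau>1 c = 0" if "c \<notin> {1..d}" for c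
    using U(3) that by (auto simp: \<tau>1_def m_def delay_cube_def vecs_def)
  have int: "- r < \<tau>1 c \<and> \<tau>1 c < 0" if c: "c \<in> {1..d}" for c
  proof -
    have b: "- r \<le> \<tau> c" "\<tau> c \<le> 0" using U(3) c by (auto simp: delay_cube_def)
    have "\<tau>1 c = (1 - t1) * \<tau> c + t1 * (- r / 2)" using c by (simp add: \<tau>1_def m_def algebra_simps)
    moreover have "(1 - t1) * \<tau> c \<le> 0" using b t1 by (simp add: mult_nonneg_nonpos)
    moreover have "t1 * (- r / 2) < 0" using t1 r by (simp add: mult_pos_neg)
    moreover have "(1 - t1) * (- r) \<le> (1 - t1) * \<tau> c" using b t1 by (intro mult_left_mono) auto
    moreover have "(1 - t1) * (- r) + t1 * (- r / 2) > - r" using t1 r by (simp add: algebra_simps)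
    ultimately show ?thesis by linarith
  qed
  \<comment> \<open>Parameter 1 on the line with this direction is \<open>\<tau>0\<close>, where
    \<open>F\<close> is nonzero.\<close>
  define D where "D c = \<tau>0 c - \<tau>1 c" for c
  obtain e2 where e2: "e2 > 0" "\<And>t. 0 < t \<Longrightarrow> t < e2 \<Longrightarrow> (\<lambda>c. \<tau>1 c + t * D c) \<in> U"
    using nearU[OF \<tau>1U, of D] by blast
  have "\<exists>e>0. \<forall>t. 0 < t \<and> t < e \<longrightarrow> - r \<le> \<tau>1 c + t * D c \<and> \<tau>1 c + t * D c \<le> 0" if c: "c \<in> {1..d}" for c
  proof -
    have lim: "((\<lambda>t. \<tau>1 c + t * D c) \<longlongrightarrow> \<tau>1 c) (at_right 0)" by (auto intro!: tendsto_eq_intros)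
    have "\<forall>\<^sub>F t in at_right 0. - r < \<tau>1 c + t * D c" "\<forall>\<^sub>F t in at_right 0. \<tau>1 c + t * D c < 0"
      using order_tendstoD[OF lim] int[OF c] by auto
    then have "\<forall>\<^sub>F t in at_right 0. - r \<le> \<tau>1 c + t * D c \<and> \<tau>1 c + t * D c \<le> 0"
      by eventually_elim simp
    then show ?thesis unfolding eventually_at_right_field by auto
  qed
  then obtain e3 where e3: "\<And>c. c \<in> {1..d} \<Longrightarrow> e3 c > 0"
    "\<And>c t. c \<in> {1..d} \<Longrightarrow> 0 < t \<Longrightarrow> t < e3 c \<Longrightarrow> - r \<le> \<tau>1 c + t * D c \<and> \<tau>1 c + t * D c \<le> 0" by metis
  define e4 where "e4 = Min (insert e2 (e3 ` {1..d}))"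
  have e4: "e4 > 0" "e4 \<le> e2" "\<And>c. c \<in> {1..d} \<Longrightarrow> e4 \<le> e3 c"
    unfolding e4_def using e2(1) e3(1) by (auto intro: Min_le simp del: Min_insert)
  have good: "(\<lambda>c. \<tau>1 c + t * D c) \<in> U \<inter> delay_cube r d" if "0 < t" "t < e4" for t
  proof -
    have "\<tau>1 c + t * D c = 0" if "c \<notin> {1..d}" for c
      using \<tau>1v[OF that] \<tau>0(1) that by (simp add: D_def vecs_def)
    then show ?thesis using e2(2)[of t] e3(2)[of _ t] e4 that by (fastforce simp: delay_cube_def vecs_def)
  qed
  obtain h where h: "h holomorphic_on UNIV" "\<And>t::real. h (of_real t) = complex_of_real (F (\<lambda>c. \<tau>1 c + t * D c))"
    using F unfolding line_analytic_def by metis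
  have h1: "h 1 \<noteq> 0" using h(2)[of 1] \<tau>0(2) by (simp add: D_def)
  have "\<exists>t. 0 < t \<and> t < e4 \<and> h (of_real t) \<noteq> 0"
  proof (rule ccontr)
    assume "\<not> ?thesis"
    then have z: "h (of_real t) = 0" if "0 < t" "t < e4" for t using that by blast
    obtain \<rho> where \<rho>: "\<rho> > 0" "\<And>z. z \<in> ball (of_real (e4 / 2)) \<rho> - {of_real (e4 / 2)} \<Longrightarrow> h z \<noteq> 0"
      using isolated_zeros[OF h(1), of "of_real (e4 / 2)" 1] z[of "e4 / 2"] e4(1) h1 by auto
    \<comment> \<open>A point of the punctured isolating disc around \<open>e4 / 2\<close> that
      still lies in the interval of supposed zeros.\<close>
    define t where "t = e4 / 2 + min (\<rho> / 2) (e4 / 4)"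
    have "t > e4 / 2" "t < e4" "t - e4 / 2 < \<rho>" using \<rho>(1) e4(1) by (auto simp: t_def min_def)
    then have "complex_of_real t \<in> ball (of_real (e4 / 2)) \<rho> - {of_real (e4 / 2)}"
      by (auto simp: dist_norm norm_minus_commute simp flip: of_real_diff of_real_divide)
    then show False using \<rho>(2) z[of t] \<open>t > e4 / 2\<close> \<open>t < e4\<close> e4(1) by auto
  qed
  then obtain t where "0 < t" "t < e4" "F (\<lambda>c. \<tau>1 c + t * D c) \<noteq> 0" using h(2) by auto
  then show ?thesis using good by blast
qed

text \<open>Angles are measured in full turns: targets and tolerance are divided by 2 \<pi>, and the
  time found is multiplied by it. Kronecker's theorem takes independence over the integers, hence
  the module structure on the reals.\<close>

lemma kronecker_angles:
  fixes \<omega> :: "nat \<Rightarrow> real"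
  assumes indep: "\<forall>c :: nat \<Rightarrow> rat. (\<Sum>j = 1..p. of_rat (c j) * \<omega> j) = 0 \<longrightarrow> (\<forall>j\<in>{1..p}. c j = 0)"
    and "\<epsilon> > 0"
  shows "\<exists>t h. \<forall>k\<in>{1..p}. \<bar>\<omega> k * t - 2 * pi * of_int (h k) - \<alpha> k\<bar> < \<epsilon>"
proof -
  define \<theta> where "\<theta> i = \<omega> (Suc i)" for i
  have indep_int: "c i = 0" if "(\<Sum>i<p. of_int (c i) * \<theta> i) = 0" "i < p" for c :: "nat \<Rightarrow> int" and i
  proof -
    have "(\<Sum>j = 1..p. of_rat (of_int (c (j - 1))) * \<omega> j) = (\<Sum>i<p. of_int (c i) * \<theta> i)"
      by (rule sum.reindex_bij_witness[of _ Suc "\<lambda>j. j - 1"]) (auto simp: \<theta>_def)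
    then show ?thesis using indep[rule_format, of "\<lambda>j. of_int (c (j - 1))" "Suc i"] that by simp
  qed
  have inj: "inj_on \<theta> {..<p}"
  proof (rule inj_onI, rule ccontr)
    fix i j assume ij: "i \<in> {..<p}" "j \<in> {..<p}" "\<theta> i = \<theta> j" "i \<noteq> j"
    define c :: "nat \<Rightarrow> int" where "c x = (if x = i then 1 else 0) - (if x = j then 1 else 0)" for x
    have "(\<Sum>x<p. of_int (c x) * \<theta> x) = \<theta> i - \<theta> j"
      using ij by (simp add: c_def left_diff_distrib sum_subtractf if_distrib[of real_of_int] if_distrib[of "\<lambda>a. a * _"] cong: if_cong)
    then have "c i = 0" using indep_int[of c i] ij by simp
    then show False using ij by (simp add: c_def)
  qed
  interpret Modules.module "(\<lambda>r. (*) (real_of_int r))"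
    by (simp add: Modules.module.intro distrib_left mult.commute)
  have "independent (\<theta> ` {..<p})"
  proof
    assume "dependent (\<theta> ` {..<p})"
    then obtain u where u: "\<exists>v\<in>\<theta> ` {..<p}. u v \<noteq> 0" "(\<Sum>v\<in>\<theta> ` {..<p}. of_int (u v) * v) = 0"
      using dependent_finite[of "\<theta> ` {..<p}"] by auto
    have "(\<Sum>i<p. of_int (u (\<theta> i)) * \<theta> i) = 0"
      using u(2) by (simp add: sum.reindex[OF inj])
    then show False using indep_int[of "\<lambda>i. u (\<theta> i)"] u(1) by auto
  qed
  then obtain t h where th: "\<And>i. i < p \<Longrightarrow> \<bar>t * \<theta> i - of_int (h i) - \<alpha> (Suc i) / (2 * pi)\<bar> < \<epsilon> / (2 * pi)"
    using Kronecker_thm_1[of \<theta> p "\<epsilon> / (2 * pi)" "\<lambda>i. \<alpha> (Suc i) / (2 * pi)"] inj \<open>\<epsilon> > 0\<close> by auto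
  have "\<bar>\<omega> k * (2 * pi * t) - 2 * pi * of_int (h (k - 1)) - \<alpha> k\<bar> < \<epsilon>" if k: "k \<in> {1..p}" for k
  proof -
    have "\<bar>t * \<omega> k - of_int (h (k - 1)) - \<alpha> k / (2 * pi)\<bar> < \<epsilon> / (2 * pi)"
      using th[of "k - 1"] k by (cases k) (auto simp: \<theta>_def)
    then have "(2 * pi) * \<bar>t * \<omega> k - of_int (h (k - 1)) - \<alpha> k / (2 * pi)\<bar> < \<epsilon>"
      by (simp add: field_simps)
    also have "(2 * pi) * \<bar>t * \<omega> k - of_int (h (k - 1)) - \<alpha> k / (2 * pi)\<bar> = \<bar>(2 * pi) * (t * \<omega> k - of_int (h (k - 1)) - \<alpha> k / (2 * pi))\<bar>"
      by (simp add: abs_mult)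
    also have "(2 * pi) * (t * \<omega> k - of_int (h (k - 1)) - \<alpha> k / (2 * pi)) = \<omega> k * (2 * pi * t) - 2 * pi * of_int (h (k - 1)) - \<alpha> k"
      by (simp add: field_simps)
    finally show ?thesis .
  qed
  then show ?thesis by (intro exI[of _ "2 * pi * t"] exI[of _ "\<lambda>k. h (k - 1)"]) blast
qed

text \<open>Each delay is a time of its own, so the angles can be approximated separately for every
  column \<open>c\<close>, always with the same frequencies. The size of the resulting delays is not
  controlled.\<close>

lemma trig_nonzero_delays:
  fixes \<omega> :: "nat \<Rightarrow> real"
  assumes indep: "\<forall>c :: nat \<Rightarrow> rat. (\<Sum>j = 1..p. of_rat (c j) * \<omega> j) = 0 \<longrightarrow> (\<forall>j\<in>{1..p}. c j = 0)"
    and f: "trig ({1..p} \<times> {1..d}) f" "f \<alpha>0 \<noteq> 0"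
  shows "\<exists>\<tau>\<in>vecs {1..d}. f (\<lambda>k c. \<omega> k * \<tau> c) \<noteq> 0"
proof -
  define good where "good c n t h \<longleftrightarrow> (\<forall>k\<in>{1..p}. \<bar>\<omega> k * t - 2 * pi * of_int (h k) - \<alpha>0 k c\<bar> < 1 / Suc n)"
    for c n :: nat and t and h :: "nat \<Rightarrow> int"
  have "\<exists>t h. good c n t h" for c n :: nat
    unfolding good_def by (rule kronecker_angles[OF indep]) simp
  then obtain t h where good: "\<And>c n. good c n (t c n) (h c n)" by metis
  have th: "\<And>c n k. k \<in> {1..p} \<Longrightarrow> \<bar>\<omega> k * t c n - 2 * pi * of_int (h c n k) - \<alpha>0 k c\<bar> < 1 / Suc n"
    using good unfolding good_def by blast
  define \<tau> where "\<tau> n c = (if c \<in> {1..d} then t c n else 0)" for n c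
  have "(\<lambda>n. f (\<lambda>k c. \<omega> k * \<tau> n c)) \<longlonglongrightarrow> f \<alpha>0"
  proof (rule trig_limit[OF f(1), where h = "\<lambda>n k c. h c n k"])
    fix k c assume "(k, c) \<in> {1..p} \<times> {1..d}"
    then have k: "k \<in> {1..p}" "c \<in> {1..d}" by auto
    have "(\<lambda>n. \<omega> k * \<tau> n c - 2 * pi * of_int (h c n k) - \<alpha>0 k c) \<longlonglongrightarrow> 0"
    proof (rule Lim_null_comparison[OF _ lim_inverse_n'[THEN LIMSEQ_Suc]])
      show "\<forall>\<^sub>F n in sequentially. norm (\<omega> k * \<tau> n c - 2 * pi * of_int (h c n k) - \<alpha>0 k c) \<le> 1 / real (Suc n)"
        using th[OF k(1), of c] k by (intro always_eventually) (simp add: \<tau>_def less_imp_le)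
    qed
    then show "(\<lambda>n. \<omega> k * \<tau> n c - 2 * pi * of_int (h c n k)) \<longlonglongrightarrow> \<alpha>0 k c"
      by (rule LIM_zero_cancel)
  qed
  then have "\<forall>\<^sub>F n in sequentially. f (\<lambda>k c. \<omega> k * \<tau> n c) \<noteq> 0"
    using f(2) tendsto_imp_eventually_ne by blast
  then obtain n where "f (\<lambda>k c. \<omega> k * \<tau> n c) \<noteq> 0" by (auto simp: eventually_sequentially)
  then show ?thesis by (intro bexI[of _ "\<tau> n"]) (auto simp: vecs_def \<tau>_def)
qed

lemma generic_delays:
  fixes \<omega> :: "nat \<Rightarrow> real"
  assumes indep: "\<forall>c :: nat \<Rightarrow> rat. (\<Sum>j = 1..p. of_rat (c j) * \<omega> j) = 0 \<longrightarrow> (\<forall>j\<in>{1..p}. c j = 0)"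
    and f: "trig ({1..p} \<times> {1..d}) f" "f \<alpha>0 \<noteq> 0" and r: "r > 0"
  defines "T \<equiv> {\<tau> \<in> delay_cube r d. inj_on \<tau> {1..d} \<and> f (\<lambda>k c. \<omega> k * \<tau> c) \<noteq> 0}"
  shows "openin (top_of_set (delay_cube r d)) T" "delay_cube r d \<subseteq> closure T"
proof -
  define F where "F \<tau> = f (\<lambda>k c. \<omega> k * \<tau> c)" for \<tau>
  \<comment> \<open>Distinctness of the delays becomes the nonvanishing of a polynomial, which is
    generic in the same sense as that of \<open>F\<close>.\<close>
  define G where "G \<tau> = (\<Prod>a\<in>{1..d}. \<Prod>c\<in>{1..d}. if a = c then 1 else \<tau> a - \<tau> c)" for \<tau> :: "nat \<Rightarrow> real"
  have inj: "inj_on \<tau> {1..d} \<longleftrightarrow> G \<tau> \<noteq> 0" for \<tau>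
    unfolding G_def by (simp add: inj_on_def) blast
  have LF: "line_analytic F" unfolding F_def[abs_def] by (rule line_analytic_trig[OF f(1)])
  have "line_analytic (\<lambda>\<tau>. if a = c then 1 else \<tau> a - \<tau> c)" for a c
    using line_analytic_add[OF line_analytic_coord[of a] line_analytic_mult[OF line_analytic_const[of "-1"] line_analytic_coord[of c]]]
      line_analytic_const[of 1] by (cases "a = c") simp_all
  then have LG: "line_analytic G" unfolding G_def[abs_def] by (intro line_analytic_prod) simp_all
  have T: "T = delay_cube r d \<inter> ((\<lambda>\<tau>. G \<tau> * F \<tau>) -` (- {0}))"
    unfolding T_def inj F_def by auto
  have "continuous_on UNIV (\<lambda>\<tau>. G \<tau> * F \<tau>)"
    using line_analytic_mult[OF LG LF] by (simp add: line_analytic_def)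
  then have "open ((\<lambda>\<tau>. G \<tau> * F \<tau>) -` (- {0}))" by (intro open_vimage) auto
  then show "openin (top_of_set (delay_cube r d)) T" unfolding T by (rule openin_open_Int)
  obtain \<tau>F where \<tau>F: "\<tau>F \<in> vecs {1..d}" "F \<tau>F \<noteq> 0" using trig_nonzero_delays[OF indep f] by (auto simp: F_def)
  \<comment> \<open>Some vector with distinct coordinates; like \<open>\<tau>F\<close>, it may lie
    outside the cube.\<close>
  define \<tau>G where "\<tau>G c = (if c \<in> {1..d} then real c else 0)" for c
  have \<tau>G: "\<tau>G \<in> vecs {1..d}" "G \<tau>G \<noteq> 0" unfolding inj[symmetric] by (auto simp: vecs_def \<tau>G_def inj_on_def)
  show "delay_cube r d \<subseteq> closure T"
  proof
    fix \<tau> assume \<tau>: "\<tau> \<in> delay_cube r d"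
    show "\<tau> \<in> closure T"
      unfolding closure_iff_nhds_not_empty
    proof (intro allI impI)
      fix A V assume "V \<subseteq> A" "open V" "\<tau> \<in> V"
      then obtain \<tau>' where \<tau>': "\<tau>' \<in> V \<inter> delay_cube r d" "F \<tau>' \<noteq> 0"
        using line_analytic_dense[OF LF \<tau>F r _ _ \<tau>] by blast
      \<comment> \<open>The second perturbation takes place inside the open set where
        \<open>F\<close> is nonzero, so \<open>G\<close> becomes nonzero without losing
        \<open>F\<close>.\<close>
      have "open (F -` (- {0}))" using LF by (intro open_vimage) (auto simp: line_analytic_def)
      then have "open (V \<inter> F -` (- {0}))" using \<open>open V\<close> by blast
      then obtain \<tau>'' where "\<tau>'' \<in> V \<inter> F -` (- {0}) \<inter> delay_cube r d" "G \<tau>'' \<noteq> 0"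
        using line_analytic_dense[OF LG \<tau>G r, of "V \<inter> F -` (- {0})" \<tau>'] \<tau>' by blast
      then show "T \<inter> A \<noteq> {}" using \<open>V \<subseteq> A\<close> unfolding T by auto
    qed
  qed
qed

section \<open>The linear map from nonlinearities to radial parts\<close>

text \<open>Monomials before commuting factors are collected. Products of linear forms expand over
  words without multinomial coefficients, and equal monomials are grouped only at the end.\<close>

definition words :: "'k set \<Rightarrow> nat \<Rightarrow> 'k list set" where
  "words A n = {w. set w \<subseteq> A \<and> length w = n}"

lemma finite_words [simp]: "finite A \<Longrightarrow> finite (words A n)"
  unfolding words_def by (rule finite_lists_length_eq)

lemma prod_list_sum_words:
  fixes l :: "'i \<Rightarrow> 'k \<Rightarrow> 'a::comm_semiring_1"
  assumes "finite A"
  shows "(\<Prod>i\<leftarrow>u. \<Sum>k\<in>A. l i k * x k) =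
    (\<Sum>w\<in>words A (length u). (\<Prod>(i, k)\<leftarrow>zip u w. l i k) * (\<Prod>k\<leftarrow>w. x k))"
proof (induction u)
  case Nil
  have "words A 0 = {[]}" by (auto simp: words_def)
  then show ?case by simp
next
  case (Cons i u)
  have W: "words A (Suc (length u)) = (\<lambda>(k, w). k # w) ` (A \<times> words A (length u))"
    by (auto simp: words_def length_Suc_conv image_iff)
  have "(\<Sum>w\<in>words A (length (i # u)). (\<Prod>(i, k)\<leftarrow>zip (i # u) w. l i k) * (\<Prod>k\<leftarrow>w. x k))
    = (\<Sum>(k, w)\<in>A \<times> words A (length u). (l i k * (\<Prod>(i, k)\<leftarrow>zip u w. l i k)) * (x k * (\<Prod>k\<leftarrow>w. x k)))"
    unfolding length_Cons W by (subst sum.reindex) (auto simp: inj_on_def case_prod_unfold)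
  also have "\<dots> = (\<Sum>k\<in>A. l i k * x k) * (\<Sum>w\<in>words A (length u). (\<Prod>(i, k)\<leftarrow>zip u w. l i k) * (\<Prod>k\<leftarrow>w. x k))"
    unfolding sum_product sum.cartesian_product by (intro sum.cong) (auto simp: ac_simps)
  finally show ?case using Cons.IH by simp
qed

lemma prod_list_count:
  fixes f :: "'k \<Rightarrow> 'a::comm_semiring_1"
  shows "finite A \<Longrightarrow> set w \<subseteq> A \<Longrightarrow> (\<Prod>k\<leftarrow>w. f k) = (\<Prod>k\<in>A. f k ^ count_list w k)"
proof (induction w)
  case (Cons a w)
  have "(\<Prod>k\<in>A. f k ^ count_list (a # w) k) = (\<Prod>k\<in>A. (if k = a then f a else 1) * f k ^ count_list w k)"
    by (intro prod.cong) auto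
  then show ?case using Cons by (simp add: prod.distrib)
qed simp

lemma ex_word:
  assumes "finite A"
  shows "\<exists>u. set u \<subseteq> A \<and> (\<forall>a\<in>A. count_list u a = (m a :: nat))"
proof -
  have rep: "count_list (replicate n a) b = (if a = b then n else 0)" for n and a b :: 'a
    by (induction n) auto
  show ?thesis using assms
  proof (induction A rule: finite_induct)
    case (insert a A)
    then obtain u where u: "set u \<subseteq> A" "\<forall>a\<in>A. count_list u a = m a" by blast
    have "count_list u a = 0" using u(1) insert.hyps by (auto simp: count_list_0_iff)
    then show ?case using u insert.hyps
      by (intro exI[of _ "replicate (m a) a @ u"]) (auto simp: rep)
  qed simp
qed

definition word_of :: "'i set \<Rightarrow> ('i \<Rightarrow> nat) \<Rightarrow> 'i list" where
  "word_of A m = (SOME u. set u \<subseteq> A \<and> (\<forall>a\<in>A. count_list u a = m a))"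

lemma word_of:
  assumes "finite A"
  shows "set (word_of A m) \<subseteq> A" "a \<in> A \<Longrightarrow> count_list (word_of A m) a = m a"
    "length (word_of A m) = sum m A"
proof -
  have *: "set (word_of A m) \<subseteq> A \<and> (\<forall>a\<in>A. count_list (word_of A m) a = m a)"
    unfolding word_of_def using ex_word[OF assms] by (rule someI_ex)
  then show "set (word_of A m) \<subseteq> A" "a \<in> A \<Longrightarrow> count_list (word_of A m) a = m a" by auto
  show "length (word_of A m) = sum m A"
    using sum_count_set[of "word_of A m" A] * assms by simp
qed

lemma prod_word_of:
  fixes f :: "'k \<Rightarrow> 'a::comm_semiring_1"
  assumes "finite A" shows "(\<Prod>a\<in>A. f a ^ m a) = (\<Prod>a\<leftarrow>word_of A m. f a)"
  using prod_list_count[OF assms word_of(1)[OF assms], of f m] word_of(2)[OF assms, of _ m] by simp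

abbreviation absword :: "int list \<Rightarrow> nat list" where "absword w \<equiv> map (\<lambda>k. nat \<bar>k\<bar>) w"

text \<open>Successive occurrences of a letter receive alternating signs: they cancel in pairs, and
  an odd number leaves one positive surplus. This yields a resonant word over every exponent of the
  right parity.\<close>

lemma signed_word:
  "\<exists>w. absword w = u \<and> (\<forall>l\<ge>1. int (count_list w (int l)) - int (count_list w (- int l)) = (if odd (count_list u l) then 1 else 0))"
proof (induction u)
  case (Cons a u)
  then obtain w where w: "absword w = u"
    "\<forall>l\<ge>1. int (count_list w (int l)) - int (count_list w (- int l)) = (if odd (count_list u l) then 1 else 0)" by blast
  define k where "k = (if odd (count_list u a) then - int a else int a)"
  have "nat \<bar>k\<bar> = a" by (simp add: k_def)
  moreover have "int (count_list (k # w) (int l)) - int (count_list (k # w) (- int l)) = (if odd (count_list (a # u) l) then 1 else 0)"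
    if "l \<ge> 1" for l
    using w(2)[rule_format, OF that] that by (auto simp: k_def)
  ultimately show ?case using w(1) by (intro exI[of _ "k # w"]) simp
qed simp

lemma count_absword:
  "count_list (absword w) 0 = count_list w 0"
  "l \<ge> 1 \<Longrightarrow> count_list (absword w) l = count_list w (int l) + count_list w (- int l)"
  by (induction w) auto

subsection \<open>Exponents and parities\<close>

text \<open>The condition on monomials in component \<open>i\<close> of a map equivariant under sign
  changes. For \<open>i = 0\<close>, which lies outside \<open>{1..p}\<close>, all exponents are
  even.\<close>

definition parity :: "nat \<Rightarrow> nat \<Rightarrow> (nat \<Rightarrow> nat) \<Rightarrow> bool" where
  "parity p i m \<longleftrightarrow> (\<forall>l\<in>{1..p}. odd (m l) \<longleftrightarrow> l = i)"

text \<open>Recovers \<open>i\<close> from \<open>parity p i m\<close>; the default 0 is the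
  component of the all-even monomials. An exponent thus encodes a monomial together with the
  component of the radial map in which it occurs.\<close>

definition component :: "nat \<Rightarrow> (nat \<Rightarrow> nat) \<Rightarrow> nat" where
  "component p m = (if \<exists>c\<in>{1..p}. odd (m c) then SOME c. c \<in> {1..p} \<and> odd (m c) else 0)"

lemma component_eq:
  assumes "parity p i m" "i \<in> ridx zr p" shows "component p m = i"
proof (cases "i = 0")
  case True
  then show ?thesis using assms by (auto simp: parity_def component_def)
next
  case False
  then have "i \<in> {1..p}" using assms(2) by (auto simp: ridx_def split: if_splits)
  then have e: "(\<lambda>c. c \<in> {1..p} \<and> odd (m c)) = (\<lambda>c. c = i)" and ex: "\<exists>c\<in>{1..p}. odd (m c)"
    using assms(1) by (auto simp: parity_def fun_eq_iff)
  show ?thesis unfolding component_def if_P[OF ex] e by simp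
qed

lemma Vmon_parity: "Vmon zr p m \<longleftrightarrow> (\<exists>i\<in>ridx zr p. parity p i m)"
proof
  assume "Vmon zr p m"
  then consider k c where "c \<in> {1..p}" "\<forall>i\<in>{1..p}. m i = 2 * k i + (if i = c then 1 else 0)"
    | k where zr "\<forall>i\<in>{1..p}. m i = 2 * k i" unfolding Vmon_def by blast
  then show "\<exists>i\<in>ridx zr p. parity p i m"
  proof cases
    case 1 then show ?thesis by (intro bexI[of _ c]) (auto simp: parity_def ridx_def)
  next
    case 2 then show ?thesis by (intro bexI[of _ 0]) (auto simp: parity_def ridx_def)
  qed
next
  assume "\<exists>i\<in>ridx zr p. parity p i m"
  then obtain i where i: "i \<in> ridx zr p" "parity p i m" by blast
  show "Vmon zr p m"
  proof (cases "i = 0")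
    case True
    then have "\<forall>l\<in>{1..p}. m l = 2 * (m l div 2)" using i by (auto simp: parity_def)
    then show ?thesis using i True unfolding Vmon_def by (auto simp: ridx_def split: if_splits intro: exI[of _ "\<lambda>l. m l div 2"])
  next
    case False
    then have "i \<in> {1..p}" using i(1) by (auto simp: ridx_def split: if_splits)
    moreover have "\<forall>l\<in>{1..p}. m l = 2 * (m l div 2) + (if l = i then 1 else 0)"
      using i(2) unfolding parity_def by (metis even_two_times_div_two odd_two_times_div_two_succ add_0_right)
    ultimately show ?thesis unfolding Vmon_def by (intro disjI1 exI[of _ "\<lambda>l. m l div 2"] bexI[of _ i]) assumption+
  qed
qed

definition rows :: "bool \<Rightarrow> nat \<Rightarrow> nat \<Rightarrow> (nat \<Rightarrow> nat) set" where
  "rows zr p n = {m \<in> vecs (ridx zr p). sum m (ridx zr p) = n \<and> Vmon zr p m}"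

lemma finite_rows [simp]: "finite (rows zr p n)"
proof (rule finite_surj[OF finite_mexps[OF ridx_finite, of zr p 0 n], of _ fst])
  show "rows zr p n \<subseteq> fst ` mexps (ridx zr p) 0 n"
    by (auto simp: rows_def mexps_def vecs_def image_iff intro!: exI[of _ "\<lambda>_. 0"])
qed

subsection \<open>The matrix \<open>K\<close>\<close>

text \<open>Row 1 of \<open>K\<close> is all ones and row \<open>d\<close> is 1 followed by -1's, so
  half their sum is the first unit vector. For a \<ge> 2 the rows \<open>d + 1 - a\<close> and
  \<open>d + 2 - a\<close> differ in column \<open>a\<close> only, by 2.\<close>

definition Kinv :: "nat \<Rightarrow> nat \<Rightarrow> nat \<Rightarrow> real" where
  "Kinv d a c = (if a = 1 then (if c = d then 1 / 2 else 0) + (if c = 1 then 1 / 2 else 0)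
     else (if c = d + 1 - a then 1 / 2 else 0) - (if c = d + 2 - a then 1 / 2 else 0))"

lemma Kinv_Kmat:
  assumes "a \<in> {1..d}" "b \<in> {1..d}"
  shows "(\<Sum>c = 1..d. Kinv d a c * Kmat d c b) = (if a = b then 1 else 0)"
proof (cases "a = 1")
  case True
  then show ?thesis using assms
    by (simp add: Kinv_def distrib_right sum.distrib if_distrib[of "\<lambda>x. x * _"] Kmat_def cong: if_cong)
next
  case False
  have "(\<Sum>c = 1..d. Kinv d a c * Kmat d c b) = (\<Sum>c = 1..d. if c = d + 1 - a then Kmat d c b / 2 else 0) - (\<Sum>c = 1..d. if c = d + 2 - a then Kmat d c b / 2 else 0)"
    unfolding sum_subtractf[symmetric] using False by (intro sum.cong) (auto simp: Kinv_def)
  also have "\<dots> = Kmat d (d + 1 - a) b / 2 - Kmat d (d + 2 - a) b / 2"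
    using assms False by (subst sum.delta, simp, subst sum.delta, simp) auto
  also have "\<dots> = (if a = b then 1 else 0)" using assms False by (auto simp: Kmat_def)
  finally show ?thesis .
qed

lemma bij_pos: "bij_betw (pos zr) (ridx zr p) {1..rdim zr p}"
proof (rule bij_betw_byWitness[where f' = "\<lambda>c. if zr then c - 1 else c"])
qed (auto simp: pos_def ridx_def rdim_def split: if_splits)

lemma pos_range: "i \<in> ridx zr p \<Longrightarrow> pos zr i \<in> {1..rdim zr p}"
  using bij_pos bij_betwE by blast

lemma pos_inj: "i \<in> ridx zr p \<Longrightarrow> j \<in> ridx zr p \<Longrightarrow> pos zr i = pos zr j \<longleftrightarrow> i = j"
  by (auto simp: pos_def)

lemma sum_pos: "(\<Sum>i\<in>ridx zr p. f (pos zr i)) = (\<Sum>c = 1..rdim zr p. f c)"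
  by (rule sum.reindex_bij_betw[OF bij_pos])

text \<open>The inverse of \<open>mulKT\<close>. A row vector times the transpose has the same
  entries as the matrix times the column vector, so no transpose is visible in the sum.\<close>

definition Kinv_transpose_mult :: "bool \<Rightarrow> nat \<Rightarrow> (nat \<Rightarrow> real) \<Rightarrow> nat \<Rightarrow> real" where
  "Kinv_transpose_mult zr p v = (\<lambda>i. if i \<in> ridx zr p then \<Sum>j\<in>ridx zr p. Kinv (rdim zr p) (pos zr i) (pos zr j) * v j else 0)"

lemma Kinv_transpose_mult_mulKT:
  assumes "v \<in> vecs (ridx zr p)" shows "Kinv_transpose_mult zr p (mulKT zr p v) = v"
proof
  fix i
  show "Kinv_transpose_mult zr p (mulKT zr p v) i = v i"
  proof (cases "i \<in> ridx zr p")
    case True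
    let ?d = "rdim zr p" and ?I = "ridx zr p"
    have "Kinv_transpose_mult zr p (mulKT zr p v) i = (\<Sum>j\<in>?I. \<Sum>k\<in>?I. Kinv ?d (pos zr i) (pos zr j) * (v k * Kmat ?d (pos zr j) (pos zr k)))"
      using True by (simp add: Kinv_transpose_mult_def mulKT_def sum_distrib_left)
    also have "\<dots> = (\<Sum>k\<in>?I. v k * (\<Sum>j\<in>?I. Kinv ?d (pos zr i) (pos zr j) * Kmat ?d (pos zr j) (pos zr k)))"
      by (subst sum.swap) (simp add: sum_distrib_left ac_simps)
    also have "\<dots> = (\<Sum>k\<in>?I. if k = i then v k else 0)"
    proof (intro sum.cong refl)
      fix k assume k: "k \<in> ?I"
      have "(\<Sum>j\<in>?I. Kinv ?d (pos zr i) (pos zr j) * Kmat ?d (pos zr j) (pos zr k)) = (if k = i then 1 else 0)"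
        unfolding sum_pos[of "\<lambda>c. Kinv ?d (pos zr i) c * Kmat ?d c (pos zr k)"]
        using Kinv_Kmat[OF pos_range[OF True] pos_range[OF k]] pos_inj[OF True k] by auto
      then show "v k * (\<Sum>j\<in>?I. Kinv ?d (pos zr i) (pos zr j) * Kmat ?d (pos zr j) (pos zr k)) = (if k = i then v k else 0)"
        by simp
    qed
    finally show ?thesis using True by simp
  qed (use assms in \<open>simp add: Kinv_transpose_mult_def vecs_def\<close>)
qed

text \<open>With free angles, the coefficient of \<open>x k\<close> in coordinate \<open>i\<close>
  of the inverse of \<open>K\<close> applied to the delayed values of \<Phi> x; see
  \<open>Kinv_transpose_mult_Phix\<close>.\<close>

definition delay_form :: "bool \<Rightarrow> nat \<Rightarrow> (nat \<Rightarrow> nat \<Rightarrow> real) \<Rightarrow> nat \<Rightarrow> int \<Rightarrow> complex" where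
  "delay_form zr p \<alpha> i k = (\<Sum>j\<in>ridx zr p. of_real (Kinv (rdim zr p) (pos zr i) (pos zr j)) *
     exp (\<i> * of_real (odd_ext (\<lambda>k. \<alpha> k (pos zr j)) k)))"

abbreviation delay_prod :: "bool \<Rightarrow> nat \<Rightarrow> (nat \<Rightarrow> nat \<Rightarrow> real) \<Rightarrow> nat list \<Rightarrow> int list \<Rightarrow> complex" where
  "delay_prod zr p \<alpha> u w \<equiv> (\<Prod>(i, k)\<leftarrow>zip u w. delay_form zr p \<alpha> i k)"

text \<open>The words that contribute to the monomial \<open>m'\<close> in the radial component of
  \<open>m'\<close>: resonance selects what averaging keeps, and at real points only absolute values
  of the letters remain.\<close>

definition row_words :: "bool \<Rightarrow> nat \<Rightarrow> nat \<Rightarrow> (nat \<Rightarrow> nat) \<Rightarrow> int list set" where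
  "row_words zr p n m' = {w \<in> words (cidx zr p) n. resonant p (int (component p m')) (count_list w) \<and>
     (\<forall>i\<in>ridx zr p. count_list (absword w) i = m' i)}"

text \<open>The weight with which the monomial \<open>m\<close>, in the coordinates straightened by
  \<open>K\<close>, feeds the radial monomial \<open>m'\<close>. Parameters are absent because
  powers of \<mu> pass through the average as factors.\<close>

definition radial_matrix :: "bool \<Rightarrow> nat \<Rightarrow> (int \<Rightarrow> complex) \<Rightarrow> (nat \<Rightarrow> nat \<Rightarrow> real) \<Rightarrow> (nat \<Rightarrow> nat) \<Rightarrow> (nat \<Rightarrow> nat) \<Rightarrow> real" where
  "radial_matrix zr p b \<alpha> m' m = (\<Sum>w\<in>row_words zr p (sum m (ridx zr p)) m'.
     Re (b (int (component p m')) * delay_prod zr p \<alpha> (word_of (ridx zr p) m) w))"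

lemma finite_row_words [simp]: "finite (row_words zr p n m')"
  unfolding row_words_def by simp

lemma trig_radial_matrix: "trig ({1..p} \<times> {1..rdim zr p}) (\<lambda>\<alpha>. radial_matrix zr p b \<alpha> m' m)"
  unfolding radial_matrix_def
proof (rule trig_sum)
  let ?J = "{1..p} \<times> {1..rdim zr p}"
  fix w assume w: "w \<in> row_words zr p (sum m (ridx zr p)) m'"
  have "ctrig ?J (\<lambda>\<alpha>. delay_form zr p \<alpha> i k)" if "k \<in> cidx zr p" for i k
    unfolding delay_form_def using that pos_range
    by (intro ctrig_sum ctrig_mult ctrig_const ctrig_exp) auto
  moreover have "snd a \<in> cidx zr p" if "a \<in> set (zip (word_of (ridx zr p) m) w)" for a
    using w that set_zip_rightD[of "fst a" "snd a"] by (force simp: row_words_def words_def)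
  ultimately have "ctrig ?J (\<lambda>\<alpha>. delay_prod zr p \<alpha> (word_of (ridx zr p) m) w)"
    by (intro ctrig_prod_list) (auto simp: case_prod_unfold)
  then have "ctrig ?J (\<lambda>\<alpha>. b (int (component p m')) * delay_prod zr p \<alpha> (word_of (ridx zr p) m) w)"
    by (intro ctrig_mult ctrig_const)
  then show "trig ?J (\<lambda>\<alpha>. Re (b (int (component p m')) * delay_prod zr p \<alpha> (word_of (ridx zr p) m) w))"
    by (simp add: ctrig_def)
qed simp

text \<open>At these angles the linear forms decouple up to the sign matrix \<open>K\<close>, and the phases are chosen
  such that \<open>b\<^sub>k e\<^bsup>i\<beta>\<^sub>k\<^esup>\<close> is positive.\<close>

definition \<alpha>0 :: "bool \<Rightarrow> nat \<Rightarrow> (int \<Rightarrow> complex) \<Rightarrow> nat \<Rightarrow> nat \<Rightarrow> real" where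
  "\<alpha>0 zr p b k c = - Arg (b (int k)) + (if Kmat (rdim zr p) c (pos zr k) = - 1 then pi else 0)"

text \<open>A shift of the angle by \<pi> produces the sign in \<open>K\<close>, and the same phase
  occurs at all delays; what is left is the product of the inverse of \<open>K\<close> with
  \<open>K\<close>.\<close>

lemma delay_form_\<alpha>0:
  assumes i: "i \<in> ridx zr p" and k: "k \<in> cidx zr p"
  shows "delay_form zr p (\<alpha>0 zr p b) i k =
    (if nat \<bar>k\<bar> = i then exp (\<i> * of_real (odd_ext (\<lambda>l. - Arg (b (int l))) k)) else 0)"
proof -
  let ?d = "rdim zr p" and ?I = "ridx zr p" and ?l = "nat \<bar>k\<bar>"
  let ?e = "exp (\<i> * of_real (odd_ext (\<lambda>l. - Arg (b (int l))) k))"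
  have l: "?l \<in> ?I" using k by (auto simp: cidx_def ridx_def split: if_splits)
  have "exp (\<i> * of_real (odd_ext (\<lambda>l. \<alpha>0 zr p b l c) k)) = of_real (Kmat ?d c (pos zr ?l)) * ?e" if c: "c \<in> {1..?d}" for c
    using k
  proof (cases rule: cidx_cases)
    case 1
    \<comment> \<open>The zero eigenvalue has no angle to adjust. Its index sits at position 1,
      where the column of \<open>K\<close> consists of ones.\<close>
    then have "Kmat ?d c (pos zr ?l) = 1" using c by (auto simp: Kmat_def pos_def)
    then show ?thesis using 1 by simp
  next
    case (2 l)
    have "exp (\<i> * complex_of_real (a + pi)) = - exp (\<i> * of_real a)" for a
      by (simp add: exp_add distrib_left)
    from this[of "- Arg (b (int l))"] show ?thesis using 2 by (auto simp: \<alpha>0_def Kmat_def)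
  next
    case (3 l)
    have "exp (\<i> * complex_of_real (a - pi)) = - exp (\<i> * of_real a)" for a
      by (simp add: right_diff_distrib exp_diff)
    from this[of "Arg (b (int l))"] show ?thesis using 3 by (auto simp: \<alpha>0_def Kmat_def)
  qed
  then have "delay_form zr p (\<alpha>0 zr p b) i k
     = (\<Sum>j\<in>?I. of_real (Kinv ?d (pos zr i) (pos zr j) * Kmat ?d (pos zr j) (pos zr ?l)) * ?e)"
    unfolding delay_form_def using pos_range by (intro sum.cong) auto
  also have "\<dots> = of_real (\<Sum>c = 1..?d. Kinv ?d (pos zr i) c * Kmat ?d c (pos zr ?l)) * ?e"
    unfolding sum_pos[of "\<lambda>c. Kinv ?d (pos zr i) c * Kmat ?d c (pos zr ?l)", symmetric] by (simp add: sum_distrib_right)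
  also have "\<dots> = (if ?l = i then ?e else 0)"
    unfolding Kinv_Kmat[OF pos_range[OF i] pos_range[OF l]] using pos_inj[OF i l] by auto
  finally show ?thesis .
qed

lemma delay_prod_\<alpha>0:
  assumes "set u \<subseteq> ridx zr p" "set w \<subseteq> cidx zr p" "length w = length u"
  shows "delay_prod zr p (\<alpha>0 zr p b) u w =
    (if absword w = u then exp (\<i> * of_real (\<Sum>k\<leftarrow>w. odd_ext (\<lambda>l. - Arg (b (int l))) k)) else 0)"
  using assms
proof (induction u arbitrary: w)
  case (Cons i u)
  then obtain k w' where "w = k # w'" by (cases w) auto
  then show ?case using Cons by (auto simp: delay_form_\<alpha>0 distrib_left exp_add)
qed simp

lemma sum_list_odd_ext:
  assumes "set w \<subseteq> cidx zr p"
  shows "(\<Sum>k\<leftarrow>w. odd_ext a k) = (\<Sum>i = 1..p. of_int (int (count_list w (int i)) - int (count_list w (- int i))) * a i)"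
proof -
  have "(\<Sum>k\<leftarrow>w. odd_ext a k) = (\<Sum>k\<in>cidx zr p. odd_ext a k * count_list w k)"
    using assms
  proof (induction w)
    case (Cons k w)
    have "(\<Sum>l\<in>cidx zr p. odd_ext a l * count_list (k # w) l) = (\<Sum>l\<in>cidx zr p. (if l = k then odd_ext a k else 0) + odd_ext a l * count_list w l)"
      by (intro sum.cong) (auto simp: algebra_simps)
    then show ?case using Cons by (simp add: sum.distrib)
  qed simp
  also have "\<dots> = (\<Sum>i = 1..p. of_int (int (count_list w (int i)) - int (count_list w (- int i))) * a i)"
    unfolding sum_cidx by (simp add: algebra_simps cong: if_cong)
  finally show ?thesis .
qed

text \<open>Decoupled forms pick the words that agree with the letters of \<open>m\<close> up to
  sign, so off the diagonal nothing is left. On the diagonal all these words contribute the same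
  number, because resonance leaves one net letter \<open>i\<close> whose phase compensates that of
  \<open>b (int i)\<close>; hence the sum cannot cancel.\<close>

lemma radial_matrix_\<alpha>0:
  assumes b0: "\<And>k. k \<in> cidx zr p \<Longrightarrow> b k \<noteq> 0" and bc: "\<And>k. b (- k) = cnj (b k)"
    and m: "m \<in> rows zr p n" and m': "m' \<in> rows zr p n"
  shows "radial_matrix zr p b (\<alpha>0 zr p b) m' m = 0 \<longleftrightarrow> m' \<noteq> m"
proof -
  let ?I = "ridx zr p" and ?K = "cidx zr p" and ?u = "word_of (ridx zr p) m"
  let ?W = "row_words zr p (sum m ?I) m'"
  define i where "i = component p m'"
  obtain i' where i': "i' \<in> ?I" "parity p i' m'" using m' by (auto simp: rows_def Vmon_parity)
  have i: "i \<in> ?I" "parity p i m'" using component_eq[OF i'(2,1)] i' by (simp_all add: i_def)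
  have u: "set ?u \<subseteq> ?I" "length ?u = sum m ?I" "\<And>a. a \<in> ?I \<Longrightarrow> count_list ?u a = m a" using word_of[OF ridx_finite] by auto
  \<comment> \<open>For \<open>i = 0\<close> no phase is at hand, but 0 is its own opposite, so
    \<open>b 0\<close> is real; being nonzero is enough.\<close>
  define c where "c = (if i = 0 then Re (b 0) else norm (b (int i)))"
  have c0: "c \<noteq> 0"
  proof (cases "i = 0")
    case True
    then have "b 0 \<noteq> 0" using b0[of 0] i(1) by (auto simp: ridx_def split: if_splits)
    moreover have "Im (b 0) = 0" using bc[of 0] by (metis complex_cnj_cancel_iff add.inverse_neutral cnj.sel(2) equal_neg_zero)
    ultimately show ?thesis using True by (simp add: c_def complex_eq_iff)
  qed (use b0[of "int i"] i(1) in \<open>simp add: c_def\<close>)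
  have val: "Re (b (int i) * delay_prod zr p (\<alpha>0 zr p b) ?u w) = (if absword w = ?u then c else 0)" if w: "w \<in> ?W" for w
  proof -
    have ws: "set w \<subseteq> ?K" "length w = length ?u" and res: "resonant p (int i) (count_list w)"
      using w u(2) by (auto simp: row_words_def words_def i_def)
    have "(\<Sum>k\<leftarrow>w. odd_ext (\<lambda>l. - Arg (b (int l))) k) = (\<Sum>l = 1..p. if l = i then - Arg (b (int l)) else 0)"
      unfolding sum_list_odd_ext[OF ws(1)]
    proof (intro sum.cong refl)
      fix l assume "l \<in> {1..p}"
      then show "of_int (int (count_list w (int l)) - int (count_list w (- int l))) * - Arg (b (int l)) = (if l = i then - Arg (b (int l)) else 0)"
        using res unfolding resonant_def by auto
    qed
    also have "\<dots> = (if i = 0 then 0 else - Arg (b (int i)))"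
      using i(1) by (auto simp: ridx_def split: if_splits)
    finally have s: "(\<Sum>k\<leftarrow>w. odd_ext (\<lambda>l. - Arg (b (int l))) k) = (if i = 0 then 0 else - Arg (b (int i)))" .
    have "b (int i) * exp (\<i> * of_real (- Arg (b (int i)))) = of_real (norm (b (int i)))"
    proof -
      have "b (int i) = of_real (norm (b (int i))) * exp (\<i> * of_real (Arg (b (int i))))"
        using Arg_eq[of "b (int i)"] by (cases "b (int i) = 0") auto
      then have "b (int i) * exp (\<i> * of_real (- Arg (b (int i)))) =
         of_real (norm (b (int i))) * (exp (\<i> * of_real (Arg (b (int i)))) * exp (\<i> * of_real (- Arg (b (int i)))))"
        by (metis mult.assoc)
      then show ?thesis by (simp flip: exp_add)
    qed
    then have bb: "Re (b (int i) * exp (\<i> * of_real (- Arg (b (int i))))) = norm (b (int i))" by (simp only: Re_complex_of_real)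
    show ?thesis
    proof (cases "absword w = ?u \<and> i \<noteq> 0")
      case True
      then show ?thesis unfolding delay_prod_\<alpha>0[OF u(1) ws] s c_def using bb by (simp only: if_True if_False simp_thms)
    next
      case False
      then show ?thesis unfolding delay_prod_\<alpha>0[OF u(1) ws] s by (auto simp: c_def)
    qed
  qed
  have A: "radial_matrix zr p b (\<alpha>0 zr p b) m' m = of_nat (card {w \<in> ?W. absword w = ?u}) * c"
  proof -
    have "radial_matrix zr p b (\<alpha>0 zr p b) m' m = (\<Sum>w\<in>?W. if absword w = ?u then c else 0)"
      unfolding radial_matrix_def i_def[symmetric] using val by (intro sum.cong) auto
    also have "\<dots> = (\<Sum>w\<in>{w \<in> ?W. absword w = ?u}. c)" by (rule sum.inter_filter[symmetric]) simp
    finally show ?thesis by simp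
  qed
  show ?thesis
  proof
    assume "radial_matrix zr p b (\<alpha>0 zr p b) m' m = 0"
    then have empty: "{w \<in> ?W. absword w = ?u} = {}" unfolding A using c0 by simp
    show "m' \<noteq> m"
    proof
      assume mm: "m' = m"
      \<comment> \<open>The entry is the number of matching words times \<open>c\<close>, so one
        such word suffices; alternating signs provide it.\<close>
      obtain w where w: "absword w = ?u"
        "\<forall>l\<ge>1. int (count_list w (int l)) - int (count_list w (- int l)) = (if odd (count_list ?u l) then 1 else 0)"
        using signed_word by blast
      have "nat \<bar>k\<bar> \<in> ?I" if "k \<in> set w" for k using that w(1) u(1) by (metis image_eqI list.set_map subsetD)
      then have "set w \<subseteq> ?K" by (force simp: ridx_def cidx_def split: if_splits)
      moreover have "length w = sum m ?I" using w(1) u(2) by (metis length_map)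
      moreover have "resonant p (int i) (count_list w)"
        unfolding resonant_def
      proof
        fix l assume l: "l \<in> {1..p}"
        then have "l \<in> ?I" by (auto simp: ridx_def)
        then have "odd (count_list ?u l) \<longleftrightarrow> l = i" using u(3) i(2) mm l by (auto simp: parity_def)
        then show "int (count_list w (int l)) - int (count_list w (- int l)) =
          (if int i = int l then 1 else 0) - (if int i = - int l then 1 else 0)" using w(2) l by auto
      qed
      ultimately have "w \<in> ?W" using w(1) u(3) mm by (simp add: row_words_def words_def i_def)
      then show False using empty w(1) by blast
    qed
  next
    assume "m' \<noteq> m"
    have "{w \<in> ?W. absword w = ?u} = {}"
    proof (rule ccontr)
      assume "{w \<in> ?W. absword w = ?u} \<noteq> {}"
      then have "m' a = m a" if "a \<in> ?I" for a using u(3)[OF that] that by (auto simp: row_words_def)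
      moreover have "m' a = m a" if "a \<notin> ?I" for a using m m' that by (simp add: rows_def vecs_def)
      ultimately show False using \<open>m' \<noteq> m\<close> by blast
    qed
    then show "radial_matrix zr p b (\<alpha>0 zr p b) m' m = 0" unfolding A by (simp only: card.empty of_nat_0 mult_zero_left)
  qed
qed

definition solvable :: "bool \<Rightarrow> nat \<Rightarrow> (int \<Rightarrow> complex) \<Rightarrow> (nat \<Rightarrow> nat \<Rightarrow> real) \<Rightarrow> nat \<Rightarrow> bool" where
  "solvable zr p b \<alpha> n \<longleftrightarrow> (\<forall>y. \<exists>c. \<forall>m'\<in>rows zr p n. (\<Sum>m\<in>rows zr p n. radial_matrix zr p b \<alpha> m' m * c m) = y m')"

text \<open>One factor for each degree. Degrees below 2 are included because a monomial in \<rho>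
  and \<mu> together may have any smaller degree in \<rho> alone.\<close>

lemma trig_solvable:
  assumes b0: "\<And>k. k \<in> cidx zr p \<Longrightarrow> b k \<noteq> 0" and bc: "\<And>k. b (- k) = cnj (b k)"
  shows "\<exists>f. trig ({1..p} \<times> {1..rdim zr p}) f \<and> f (\<alpha>0 zr p b) \<noteq> 0 \<and> (\<forall>\<alpha>. f \<alpha> \<noteq> 0 \<longrightarrow> (\<forall>n\<le>N. solvable zr p b \<alpha> n))"
proof (induction N)
  let ?J = "{1..p} \<times> {1..rdim zr p}"
  have step: "\<exists>f. trig ?J f \<and> f (\<alpha>0 zr p b) \<noteq> 0 \<and> (\<forall>\<alpha>. f \<alpha> \<noteq> 0 \<longrightarrow> solvable zr p b \<alpha> n)" for n
  proof -
    have "\<exists>c. \<forall>m'\<in>rows zr p n. (\<Sum>m\<in>rows zr p n. radial_matrix zr p b (\<alpha>0 zr p b) m' m * c m) = y m'" for y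
    proof (intro exI ballI)
      fix m' assume m': "m' \<in> rows zr p n"
      have "(\<Sum>m\<in>rows zr p n. radial_matrix zr p b (\<alpha>0 zr p b) m' m * (y m / radial_matrix zr p b (\<alpha>0 zr p b) m m))
        = (\<Sum>m\<in>rows zr p n. if m = m' then y m' else 0)"
        using radial_matrix_\<alpha>0[of zr p b, OF b0 bc _ m'] radial_matrix_\<alpha>0[of zr p b, OF b0 bc m' m'] by (intro sum.cong) auto
      then show "(\<Sum>m\<in>rows zr p n. radial_matrix zr p b (\<alpha>0 zr p b) m' m * (y m / radial_matrix zr p b (\<alpha>0 zr p b) m m)) = y m'"
        using m' by simp
    qed
    from solvable_generic[of "trig ?J" "rows zr p n" "rows zr p n" "\<lambda>m' m \<alpha>. radial_matrix zr p b \<alpha> m' m" "\<alpha>0 zr p b",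
        OF trig.const trig.mult trig_diff finite_rows finite_rows trig_radial_matrix this]
    show ?thesis unfolding solvable_def by blast
  qed
  case 0 show ?case using step[of 0] by simp
  case (Suc N)
  obtain f g where "trig ?J f" "f (\<alpha>0 zr p b) \<noteq> 0" "\<forall>\<alpha>. f \<alpha> \<noteq> 0 \<longrightarrow> (\<forall>n\<le>N. solvable zr p b \<alpha> n)"
    "trig ?J g" "g (\<alpha>0 zr p b) \<noteq> 0" "\<forall>\<alpha>. g \<alpha> \<noteq> 0 \<longrightarrow> solvable zr p b \<alpha> (Suc N)"
    using Suc.IH step[of "Suc N"] by blast
  then show ?case by (intro exI[of _ "\<lambda>\<alpha>. f \<alpha> * g \<alpha>"]) (auto simp: le_Suc_eq intro: trig.mult)
qed

section \<open>Averages of delayed nonlinearities\<close>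

context center_spectrum
begin

abbreviation R where "R \<equiv> ridx zr p"

definition Vset :: "nat \<Rightarrow> nat \<Rightarrow> ((nat \<Rightarrow> nat) \<times> (nat \<Rightarrow> nat)) set" where
  "Vset s j = {(m, q) \<in> mexps R s j. Vmon zr p m}"

lemma finite_Vset [simp]: "finite (Vset s j)"
  unfolding Vset_def by (rule finite_subset[OF _ finite_mexps[OF ridx_finite]]) auto

text \<open>The argument is pulled back by the inverse of \<open>K\<close>, so that
  \<open>calK\<close> returns a combination of monomials of \<open>V\<close> and the delayed values
  enter through \<open>delay_form\<close>.\<close>

definition nonlin :: "nat \<Rightarrow> nat \<Rightarrow> ((nat \<Rightarrow> nat) \<Rightarrow> (nat \<Rightarrow> nat) \<Rightarrow> real) \<Rightarrow> (nat \<Rightarrow> real) \<Rightarrow> (nat \<Rightarrow> real) \<Rightarrow> real" where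
  "nonlin s j c v \<mu> = (\<Sum>(m, q)\<in>Vset s j. c m q * mon R s m q (Kinv_transpose_mult zr p v) \<mu>)"

lemma mon_words:
  fixes x :: "'i \<Rightarrow> 'a::real_normed_field" and l :: "'b \<Rightarrow> 'i \<Rightarrow> 'a"
  assumes A: "finite A" and B: "finite B"
  shows "mon B s m q (\<lambda>i. \<Sum>k\<in>A. l i k * x k) \<mu> =
    (\<Sum>w\<in>words A (sum m B). (\<Prod>(i, k)\<leftarrow>zip (word_of B m) w. l i k) * mon A s (count_list w) q x \<mu>)"
proof -
  have "(\<Prod>i\<in>B. (\<Sum>k\<in>A. l i k * x k) ^ m i) = (\<Prod>i\<leftarrow>word_of B m. \<Sum>k\<in>A. l i k * x k)"
    by (rule prod_word_of[OF B])
  also have "\<dots> = (\<Sum>w\<in>words A (sum m B). (\<Prod>(i, k)\<leftarrow>zip (word_of B m) w. l i k) * (\<Prod>k\<leftarrow>w. x k))"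
    unfolding prod_list_sum_words[OF A] word_of(3)[OF B] ..
  also have "\<dots> = (\<Sum>w\<in>words A (sum m B). (\<Prod>(i, k)\<leftarrow>zip (word_of B m) w. l i k) * (\<Prod>k\<in>A. x k ^ count_list w k))"
    by (intro sum.cong refl) (simp add: words_def prod_list_count[OF A])
  finally have e: "(\<Prod>i\<in>B. (\<Sum>k\<in>A. l i k * x k) ^ m i) =
    (\<Sum>w\<in>words A (sum m B). (\<Prod>(i, k)\<leftarrow>zip (word_of B m) w. l i k) * (\<Prod>k\<in>A. x k ^ count_list w k))" .
  show ?thesis unfolding mon_def e sum_distrib_right mult.assoc ..
qed

lemma words_mexps:
  assumes "w \<in> words A n" "finite A" "q \<in> vecs {1..s}" "n + sum q {1..s} = j"
  shows "(count_list w, q) \<in> mexps A s j"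
proof -
  have "sum (count_list w) A = n" using assms sum_count_set[of w A] by (auto simp: words_def)
  moreover have "count_list w \<in> vecs A" using assms by (auto simp: words_def vecs_def count_list_0_iff)
  ultimately show ?thesis using assms by (simp add: mexps_def)
qed

lemma nonlin_Hscal: "nonlin s j c \<in> Hscal zr p s j"
proof -
  let ?S = "Sigma (Vset s j) (\<lambda>e. words R (sum (fst e) R))"
  let ?l = "\<lambda>i k. Kinv (rdim zr p) (pos zr i) (pos zr k)"
  let ?C = "\<lambda>a. c (fst (fst a)) (snd (fst a)) * (\<Prod>(i, k)\<leftarrow>zip (word_of R (fst (fst a))) (snd a). ?l i k)"
  have fin: "finite ?S" by (intro finite_SigmaI) auto
  have "nonlin s j c v \<mu> = (\<Sum>a\<in>?S. ?C a * mon R s (count_list (snd a)) (snd (fst a)) v \<mu>)" for v \<mu>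
  proof -
    have "mon R s m q (Kinv_transpose_mult zr p v) \<mu> = mon R s m q (\<lambda>i. \<Sum>k\<in>R. ?l i k * v k) \<mu>" for m q
      by (simp add: mon_def Kinv_transpose_mult_def)
    then have "nonlin s j c v \<mu> = (\<Sum>e\<in>Vset s j. \<Sum>w\<in>words R (sum (fst e) R).
        c (fst e) (snd e) * ((\<Prod>(i, k)\<leftarrow>zip (word_of R (fst e)) w. ?l i k) * mon R s (count_list w) (snd e) v \<mu>))"
      unfolding nonlin_def by (simp add: mon_words sum_distrib_left case_prod_unfold)
    also have "\<dots> = (\<Sum>a\<in>?S. ?C a * mon R s (count_list (snd a)) (snd (fst a)) v \<mu>)"
      by (subst sum.Sigma) (auto simp: case_prod_unfold mult.assoc)
    finally show ?thesis .
  qed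
  moreover have mex: "(count_list (snd a), snd (fst a)) \<in> mexps R s j" if "a \<in> ?S" for a
    using that by (intro words_mexps[of _ _ "sum (fst (fst a)) R"]) (auto simp: Vset_def mexps_def)
  note heval_collect[where m = "\<lambda>a. count_list (snd a)" and q = "\<lambda>a. snd (fst a)" and C = ?C, OF ridx_finite fin mex]
  ultimately have "nonlin s j c v \<mu> = heval R s j (\<lambda>m' q'. \<Sum>a\<in>{a \<in> ?S. (count_list (snd a), snd (fst a)) = (m', q')}. ?C a) v \<mu>" for v \<mu>
    by simp
  then show ?thesis unfolding Hscal_def by blast
qed

lemma nonlin_calK: "v \<in> vecs R \<Longrightarrow> calK zr p (nonlin s j c) v \<mu> = (\<Sum>(m, q)\<in>Vset s j. c m q * mon R s m q v \<mu>)"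
  by (simp add: calK_def nonlin_def Kinv_transpose_mult_mulKT)

lemma nonlin_Vsp: "calK zr p (nonlin s j c) \<in> Vsp zr p s j"
  unfolding Vsp_def using nonlin_calK unfolding Vset_def by blast

lemma Phix_complex:
  assumes "x \<in> cpts zr p"
  shows "complex_of_real (Phix zr p \<omega> x \<theta>) = (\<Sum>k\<in>K. Phi \<omega> k \<theta> * x k)"
proof -
  have "cnj (\<Sum>k\<in>K. Phi \<omega> k \<theta> * x k) = (\<Sum>k\<in>K. Phi \<omega> (- k) \<theta> * x (- k))"
    by (simp add: Phi_E E_cnj \<sigma>_minus cptsD(1)[OF assms])
  also have "\<dots> = (\<Sum>k\<in>K. Phi \<omega> k \<theta> * x k)"
    by (rule sum.reindex_bij_witness[of _ uminus uminus]) auto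
  finally have "(\<Sum>k\<in>K. Phi \<omega> k \<theta> * x k) \<in> \<real>" by (simp add: Reals_cnj_iff)
  then show ?thesis unfolding Phix_def by (rule of_real_Re)
qed

definition delay_angles :: "(nat \<Rightarrow> real) \<Rightarrow> nat \<Rightarrow> nat \<Rightarrow> real" where "delay_angles \<tau> k c = \<omega> k * \<tau> c"

lemma Kinv_transpose_mult_Phix:
  assumes "x \<in> cpts zr p" "i \<in> R"
  shows "complex_of_real (Kinv_transpose_mult zr p (delay_args zr p \<tau> (Phix zr p \<omega> x)) i) = (\<Sum>k\<in>K. delay_form zr p (delay_angles \<tau>) i k * x k)"
proof -
  have e: "Phi \<omega> k (\<tau> c) = exp (\<i> * of_real (odd_ext (\<lambda>k. delay_angles \<tau> k c) k))" for k c
    by (simp add: Phi_def delay_angles_def odd_ext_def mult.assoc)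
  have "complex_of_real (Kinv_transpose_mult zr p (delay_args zr p \<tau> (Phix zr p \<omega> x)) i)
    = (\<Sum>j\<in>R. \<Sum>k\<in>K. of_real (Kinv (rdim zr p) (pos zr i) (pos zr j)) * (Phi \<omega> k (\<tau> (pos zr j)) * x k))"
    using assms by (simp add: Kinv_transpose_mult_def delay_args_def Phix_complex sum_distrib_left)
  also have "\<dots> = (\<Sum>k\<in>K. delay_form zr p (delay_angles \<tau>) i k * x k)"
    unfolding delay_form_def sum_distrib_right e by (subst sum.swap) (simp add: mult.assoc)
  finally show ?thesis .
qed

text \<open>Each pulled-back coordinate is a linear form in x, so a monomial expands over words in
  the indices, and the average keeps the resonant words.\<close>

lemma nonlin_average:
  fixes i :: nat
  assumes x: "x \<in> cpts zr p" and i: "i \<in> R"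
  shows "average p (\<lambda>x \<mu> k. b k * of_real (nonlin s j c (delay_args zr p \<tau> (Phix zr p \<omega> x)) \<mu>)) x \<mu> (int i) =
    (\<Sum>(m, q)\<in>Vset s j. \<Sum>w\<in>{w \<in> words K (sum m R). resonant p (int i) (count_list w)}.
       b (int i) * of_real (c m q) * delay_prod zr p (delay_angles \<tau>) (word_of R m) w * mon K s (count_list w) q x \<mu>)"
proof -
  let ?S = "Sigma (Vset s j) (\<lambda>e. words K (sum (fst e) R))"
  let ?C = "\<lambda>a. b (int i) * of_real (c (fst (fst a)) (snd (fst a))) * delay_prod zr p (delay_angles \<tau>) (word_of R (fst (fst a))) (snd a)"
  let ?D = "\<lambda>m' q'. \<Sum>a\<in>{a \<in> ?S. (count_list (snd a), snd (fst a)) = (m', q')}. ?C a"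
  have fin: "finite ?S" by (intro finite_SigmaI) auto
  have mex: "(count_list (snd a), snd (fst a)) \<in> mexps K s j" if "a \<in> ?S" for a
    using that by (intro words_mexps[of _ _ "sum (fst (fst a)) R"]) (auto simp: Vset_def mexps_def)
  have F: "b (int i) * of_real (nonlin s j c (delay_args zr p \<tau> (Phix zr p \<omega> x)) \<mu>) = heval K s j ?D x \<mu>"
    if x: "x \<in> cpts zr p" for x
  proof -
    have "complex_of_real (mon R s m q (Kinv_transpose_mult zr p (delay_args zr p \<tau> (Phix zr p \<omega> x))) \<mu>)
        = mon R s m q (\<lambda>i. \<Sum>k\<in>K. delay_form zr p (delay_angles \<tau>) i k * x k) \<mu>" for m q
      by (simp add: mon_def Kinv_transpose_mult_Phix[OF x])
    then have "b (int i) * of_real (nonlin s j c (delay_args zr p \<tau> (Phix zr p \<omega> x)) \<mu>)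
      = (\<Sum>e\<in>Vset s j. \<Sum>w\<in>words K (sum (fst e) R). (b (int i) * of_real (c (fst e) (snd e)) * delay_prod zr p (delay_angles \<tau>) (word_of R (fst e)) w)
         * mon K s (count_list w) (snd e) x \<mu>)"
      unfolding nonlin_def by (simp add: mon_words sum_distrib_left case_prod_unfold mult.assoc)
    also have "\<dots> = (\<Sum>a\<in>?S. ?C a * mon K s (count_list (snd a)) (snd (fst a)) x \<mu>)"
      by (subst sum.Sigma) (auto simp: case_prod_unfold)
    also have "\<dots> = heval K s j ?D x \<mu>"
      by (rule heval_collect[where m = "\<lambda>a. count_list (snd a)" and q = "\<lambda>a. snd (fst a)" and C = ?C, OF cidx_finite fin mex])
    finally show ?thesis .
  qed
  have "average p (\<lambda>x \<mu> k. b k * of_real (nonlin s j c (delay_args zr p \<tau> (Phix zr p \<omega> x)) \<mu>)) x \<mu> (int i)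
     = heval K s j (\<lambda>m q. if resonant p (int i) m then ?D m q else 0) x \<mu>"
    by (rule average_heval) (use F i x in auto)
  also have "\<dots> = heval K s j (\<lambda>m' q'. \<Sum>a\<in>{a \<in> ?S. (count_list (snd a), snd (fst a)) = (m', q')}.
       if resonant p (int i) (count_list (snd a)) then ?C a else 0) x \<mu>"
    by (intro heval_coeff_cong) (auto intro!: sum.cong sum.neutral[symmetric])
  also have "\<dots> = (\<Sum>a\<in>?S. (if resonant p (int i) (count_list (snd a)) then ?C a else 0) * mon K s (count_list (snd a)) (snd (fst a)) x \<mu>)"
    by (rule heval_collect[where m = "\<lambda>a. count_list (snd a)" and q = "\<lambda>a. snd (fst a)", OF cidx_finite fin mex, symmetric])
  also have "\<dots> = (\<Sum>e\<in>Vset s j. \<Sum>w\<in>words K (sum (fst e) R). (if resonant p (int i) (count_list w) then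
       b (int i) * of_real (c (fst e) (snd e)) * delay_prod zr p (delay_angles \<tau>) (word_of R (fst e)) w * mon K s (count_list w) (snd e) x \<mu> else 0))"
    by (subst sum.Sigma) (auto simp: case_prod_unfold intro!: sum.cong)
  also have "\<dots> = (\<Sum>(m, q)\<in>Vset s j. \<Sum>w\<in>{w \<in> words K (sum m R). resonant p (int i) (count_list w)}.
       b (int i) * of_real (c m q) * delay_prod zr p (delay_angles \<tau>) (word_of R m) w * mon K s (count_list w) q x \<mu>)"
    unfolding case_prod_unfold by (intro sum.cong refl sum.inter_filter[symmetric] finite_words cidx_finite)
  finally show ?thesis .
qed

lemma mon_real_point:
  assumes "set w \<subseteq> K"
  shows "mon K s (count_list w) q (real_point \<rho>) \<mu> = of_real (mon R s (count_list (absword w)) q \<rho> \<mu>)"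
proof -
  have aw: "set (absword w) \<subseteq> R" using assms by (force simp: cidx_def ridx_def split: if_splits)
  have "(\<Prod>k\<in>K. real_point \<rho> k ^ count_list w k) = (\<Prod>k\<leftarrow>w. real_point \<rho> k)"
    using prod_list_count[OF cidx_finite assms] by metis
  also have "\<dots> = (\<Prod>i\<leftarrow>absword w. complex_of_real (\<rho> i))" by (simp add: real_point_def[abs_def] comp_def)
  also have "\<dots> = (\<Prod>i\<in>R. complex_of_real (\<rho> i) ^ count_list (absword w) i)"
    by (rule prod_list_count[OF ridx_finite aw])
  finally show ?thesis by (simp add: mon_def)
qed

lemma resonant_parity:
  assumes "resonant p (int i) (count_list w)"
  shows "parity p i (count_list (absword w))"
  unfolding parity_def
proof
  fix l assume l: "l \<in> {1..p}"
  let ?a = "count_list w (int l)" and ?b = "count_list w (- int l)"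
  have "count_list (absword w) l = ?a + ?b" using count_absword(2)[of l w] l by simp
  moreover have "int ?a - int ?b = (if l = i then 1 else 0)"
    using assms l unfolding resonant_def by auto
  then have "?a = ?b + (if l = i then 1 else 0)" by (auto split: if_splits)
  ultimately show "odd (count_list (absword w) l) \<longleftrightarrow> l = i" by simp
qed

lemma mon_restrict: "(\<And>i. i \<in> A \<Longrightarrow> m i = m' i) \<Longrightarrow> mon A s m q x \<mu> = mon A s m' q x \<mu>"
  by (simp add: mon_def)

text \<open>At a real point a word matters only through the absolute values of its letters. When
  resonant words are grouped by the resulting exponent, the fibre over \<open>m'\<close> is
  \<open>row_words\<close>.\<close>

lemma nonlin_average_rows:
  assumes \<rho>: "\<rho> \<in> vecs R" and i: "i \<in> R"
  shows "Re (average p (\<lambda>x \<mu> k. b k * of_real (nonlin s j c (delay_args zr p \<tau> (Phix zr p \<omega> x)) \<mu>)) (real_point \<rho>) \<mu> (int i)) =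
    (\<Sum>(m, q)\<in>Vset s j. \<Sum>m'\<in>{m' \<in> rows zr p (sum m R). component p m' = i}.
      radial_matrix zr p b (delay_angles \<tau>) m' m * c m q * mon R s m' q \<rho> \<mu>)"
proof -
  let ?W = "\<lambda>m. {w \<in> words K (sum m R). resonant p (int i) (count_list w)}"
  let ?M = "\<lambda>m. {m' \<in> rows zr p (sum m R). component p m' = i}"
  have "(\<Sum>w\<in>?W m. Re (b (int i) * delay_prod zr p (delay_angles \<tau>) (word_of R m) w) * (c m q * mon R s (count_list (absword w)) q \<rho> \<mu>))
    = (\<Sum>m'\<in>?M m. radial_matrix zr p b (delay_angles \<tau>) m' m * c m q * mon R s m' q \<rho> \<mu>)" for m q
  proof -
    define f where "f w = (\<lambda>i. if i \<in> R then count_list (absword w) i else 0)" for w :: "int list"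
    have f: "f w \<in> ?M m" if w: "w \<in> ?W m" for w
    proof -
      have aw: "set (absword w) \<subseteq> R" using w by (force simp: words_def cidx_def ridx_def split: if_splits)
      have "parity p i (count_list (absword w))" using w by (intro resonant_parity) auto
      then have par: "parity p i (f w)" unfolding parity_def f_def by (auto simp: ridx_def)
      have "sum (f w) R = sum m R" using sum_count_set[OF aw] w by (simp add: f_def words_def)
      then show ?thesis using par component_eq[OF par i] i by (auto simp: rows_def Vmon_parity vecs_def f_def)
    qed
    have "(\<Sum>w\<in>?W m. Re (b (int i) * delay_prod zr p (delay_angles \<tau>) (word_of R m) w) * (c m q * mon R s (count_list (absword w)) q \<rho> \<mu>))
      = (\<Sum>m'\<in>?M m. \<Sum>w\<in>{w \<in> ?W m. f w = m'}. Re (b (int i) * delay_prod zr p (delay_angles \<tau>) (word_of R m) w) * (c m q * mon R s (count_list (absword w)) q \<rho> \<mu>))"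
      using f by (intro sum.group[symmetric]) auto
    also have "\<dots> = (\<Sum>m'\<in>?M m. radial_matrix zr p b (delay_angles \<tau>) m' m * c m q * mon R s m' q \<rho> \<mu>)"
    proof (intro sum.cong refl)
      fix m' assume m': "m' \<in> ?M m"
      then have "m' \<in> vecs R" and ci: "component p m' = i" by (auto simp: rows_def)
      then have "f w = m' \<longleftrightarrow> (\<forall>i\<in>R. count_list (absword w) i = m' i)" for w
        by (auto simp: f_def vecs_def fun_eq_iff)
      then have W: "{w \<in> ?W m. f w = m'} = row_words zr p (sum m R) m'"
        unfolding row_words_def ci by auto
      have "mon R s (count_list (absword w)) q \<rho> \<mu> = mon R s m' q \<rho> \<mu>" if "w \<in> row_words zr p (sum m R) m'" for w
        using that by (intro mon_restrict) (auto simp: row_words_def)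
      then show "(\<Sum>w\<in>{w \<in> ?W m. f w = m'}. Re (b (int i) * delay_prod zr p (delay_angles \<tau>) (word_of R m) w) * (c m q * mon R s (count_list (absword w)) q \<rho> \<mu>))
        = radial_matrix zr p b (delay_angles \<tau>) m' m * c m q * mon R s m' q \<rho> \<mu>"
        unfolding W radial_matrix_def ci sum_distrib_right by (intro sum.cong refl) simp
    qed
    finally show ?thesis .
  qed
  note inner = this
  have "Re (average p (\<lambda>x \<mu> k. b k * of_real (nonlin s j c (delay_args zr p \<tau> (Phix zr p \<omega> x)) \<mu>)) (real_point \<rho>) \<mu> (int i))
    = (\<Sum>(m, q)\<in>Vset s j. \<Sum>w\<in>?W m. Re (b (int i) * delay_prod zr p (delay_angles \<tau>) (word_of R m) w) * (c m q * mon R s (count_list (absword w)) q \<rho> \<mu>))"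
    unfolding nonlin_average[OF real_point_cpts[OF \<rho>] i] Re_sum case_prod_unfold
  proof (intro sum.cong refl)
    fix e :: "(nat \<Rightarrow> nat) \<times> (nat \<Rightarrow> nat)" and w assume "w \<in> ?W (fst e)"
    then have "set w \<subseteq> K" by (auto simp: words_def)
    from mon_real_point[OF this, of s "snd e" \<rho> \<mu>]
    have "b (int i) * of_real (c (fst e) (snd e)) * delay_prod zr p (delay_angles \<tau>) (word_of R (fst e)) w * mon K s (count_list w) (snd e) (real_point \<rho>) \<mu>
      = (b (int i) * delay_prod zr p (delay_angles \<tau>) (word_of R (fst e)) w) * of_real (c (fst e) (snd e) * mon R s (count_list (absword w)) (snd e) \<rho> \<mu>)"
      by (simp only: of_real_mult ac_simps)
    then show "Re (b (int i) * of_real (c (fst e) (snd e)) * (\<Prod>a\<leftarrow>zip (word_of R (fst e)) w. delay_form zr p (delay_angles \<tau>) (fst a) (snd a)) * mon K s (count_list w) (snd e) (real_point \<rho>) \<mu>)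
      = Re (b (int i) * (\<Prod>a\<leftarrow>zip (word_of R (fst e)) w. delay_form zr p (delay_angles \<tau>) (fst a) (snd a))) * (c (fst e) (snd e) * mon R s (count_list (absword w)) (snd e) \<rho> \<mu>)"
      by (simp only: case_prod_unfold Re_complex_of_real Im_complex_of_real times_complex.sel mult_zero_right diff_zero)
  qed
  also have "\<dots> = (\<Sum>(m, q)\<in>Vset s j. \<Sum>m'\<in>?M m. radial_matrix zr p b (delay_angles \<tau>) m' m * c m q * mon R s m' q \<rho> \<mu>)"
    unfolding inner ..
  finally show ?thesis .
qed

text \<open>Average over one sign change at a time.\<close>

lemma HZ2_parity:
  assumes S: "S \<in> HZ2 zr p s j" and i: "i \<in> R"
  shows "\<exists>c. \<forall>\<rho>\<in>vecs R. \<forall>\<mu>\<in>params s. S \<rho> \<mu> i = heval R s j (\<lambda>m q. if parity p i m then c m q else 0) \<rho> \<mu>"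
proof -
  have "\<exists>c. \<forall>\<rho>\<in>vecs R. \<forall>\<mu>\<in>params s. S \<rho> \<mu> i = heval R s j (\<lambda>m q. if \<forall>l\<in>A. odd (m l) \<longleftrightarrow> l = i then c m q else 0) \<rho> \<mu>"
    if "finite A" "A \<subseteq> {1..p}" for A
    using that
  proof (induction A rule: finite_induct)
    case empty
    then show ?case using S i by (auto simp: HZ2_def Hscal_def)
  next
    case (insert l A)
    then obtain c where c: "\<And>\<rho> \<mu>. \<rho> \<in> vecs R \<Longrightarrow> \<mu> \<in> params s \<Longrightarrow>
        S \<rho> \<mu> i = heval R s j (\<lambda>m q. if \<forall>l\<in>A. odd (m l) \<longleftrightarrow> l = i then c m q else 0) \<rho> \<mu>" by blast
    let ?c = "\<lambda>m q. if \<forall>l\<in>A. odd (m l) \<longleftrightarrow> l = i then c m q else 0"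
    define sg where "sg k = (if k = l then - 1 else 1 :: real)" for k
    have l: "l \<in> {1..p}" "l \<in> R" using insert.prems by (auto simp: ridx_def)
    have "sg \<in> sign_vecs p" using l by (auto simp: sign_vecs_def sg_def)
    have "S \<rho> \<mu> i = heval R s j (\<lambda>m q. if \<forall>l\<in>insert l A. odd (m l) \<longleftrightarrow> l = i then c m q else 0) \<rho> \<mu>"
      if \<rho>: "\<rho> \<in> vecs R" and \<mu>: "\<mu> \<in> params s" for \<rho> \<mu>
    proof -
      have flip: "mon R s m q (\<lambda>k. sg k * \<rho> k) \<mu> = (- 1) ^ m l * mon R s m q \<rho> \<mu>" for m q
      proof -
        have "(\<Prod>k\<in>R. (sg k * \<rho> k) ^ m k) = (\<Prod>k\<in>R. sg k ^ m k) * (\<Prod>k\<in>R. \<rho> k ^ m k)"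
          by (simp add: power_mult_distrib prod.distrib)
        also have "(\<Prod>k\<in>R. sg k ^ m k) = (\<Prod>k\<in>R. if k = l then (- 1) ^ m l else 1)"
          by (intro prod.cong) (auto simp: sg_def)
        also have "\<dots> = (- 1) ^ m l" using l(2) by simp
        finally show ?thesis by (simp add: mon_def)
      qed
      have \<rho>': "(\<lambda>k. sg k * \<rho> k) \<in> vecs R" using \<rho> by (simp add: vecs_def)
      have "S (\<lambda>k. sg k * \<rho> k) \<mu> i = sg i * S \<rho> \<mu> i"
        using S \<open>sg \<in> sign_vecs p\<close> \<rho> \<mu> i unfolding HZ2_def by blast
      \<comment> \<open>The projection onto the right parity in variable \<open>l\<close>. Applied
        to any choice of coefficients, it removes those of the wrong parity.\<close>
      then have "S \<rho> \<mu> i = (1/2) * (S \<rho> \<mu> i + sg i * S (\<lambda>k. sg k * \<rho> k) \<mu> i)"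
        by (auto simp: sg_def)
      also have "S (\<lambda>k. sg k * \<rho> k) \<mu> i = heval R s j (\<lambda>m q. (- 1) ^ m l * ?c m q) \<rho> \<mu>"
        unfolding c[OF \<rho>' \<mu>] heval_def flip by (intro sum.cong refl) (simp add: case_prod_unfold)
      also have "(1/2) * (S \<rho> \<mu> i + sg i * \<dots>) = heval R s j (\<lambda>m q. (1/2) * (?c m q + sg i * ((- 1) ^ m l * ?c m q))) \<rho> \<mu>"
        unfolding c[OF \<rho> \<mu>] heval_scale heval_add ..
      also have "\<dots> = heval R s j (\<lambda>m q. if \<forall>l\<in>insert l A. odd (m l) \<longleftrightarrow> l = i then c m q else 0) \<rho> \<mu>"
        by (intro heval_coeff_cong) (auto simp: sg_def)
      finally show ?thesis .
    qed
    then show ?case by blast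
  qed
  from this[of "{1..p}"] show ?thesis unfolding parity_def by simp
qed

text \<open>Different powers of \<mu> do not mix, so each parameter exponent \<open>q\<close> gives
  a separate linear system, in the degree that \<open>q\<close> leaves for \<rho>.\<close>

lemma nonlin_surj:
  assumes sol: "\<And>n. n \<le> j \<Longrightarrow> solvable zr p b (delay_angles \<tau>) n" and S: "S \<in> HZ2 zr p s j"
  shows "\<exists>c. \<forall>\<rho>\<in>vecs R. \<forall>\<mu>\<in>params s. \<forall>i\<in>R.
    Re (average p (\<lambda>x \<mu> k. b k * of_real (nonlin s j c (delay_args zr p \<tau> (Phix zr p \<omega> x)) \<mu>)) (real_point \<rho>) \<mu> (int i))
     = S \<rho> \<mu> i"
proof -
  define par where "par i cc \<longleftrightarrow> i \<in> R \<longrightarrow> (\<forall>\<rho>\<in>vecs R. \<forall>\<mu>\<in>params s.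
      S \<rho> \<mu> i = heval R s j (\<lambda>m q. if parity p i m then cc m q else 0) \<rho> \<mu>)" for i cc
  have "\<exists>cc. par i cc" for i using HZ2_parity[OF S, of i] unfolding par_def by (cases "i \<in> R") blast+
  then obtain t where par: "\<And>i. par i (t i)" by metis
  define sy where "sy q c \<longleftrightarrow> sum q {1..s} \<le> j \<longrightarrow> (\<forall>m'\<in>rows zr p (j - sum q {1..s}).
     (\<Sum>m\<in>rows zr p (j - sum q {1..s}). radial_matrix zr p b (delay_angles \<tau>) m' m * c m) = t (component p m') m' q)" for q :: "nat \<Rightarrow> nat" and c
  have "\<exists>c. sy q c" for q
    unfolding sy_def using sol[of "j - sum q {1..s}"] unfolding solvable_def by auto
  then obtain C where C: "\<And>q. sy q (C q)" by metis
  define c where "c m q = C q m" for m q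
  define Q where "Q = {q \<in> vecs {1..s}. sum q {1..s} \<le> j}"
  have finQ: "finite Q"
  proof (rule finite_subset[of _ "snd ` (\<Union>n\<le>j. mexps ({} :: nat set) s n)"])
    show "finite (snd ` (\<Union>n\<le>j. mexps ({} :: nat set) s n))" by simp
    show "Q \<subseteq> snd ` (\<Union>n\<le>j. mexps ({} :: nat set) s n)"
    proof
      fix q assume q: "q \<in> Q"
      then have "(\<lambda>_. 0, q) \<in> mexps ({} :: nat set) s (sum q {1..s})" by (simp add: Q_def mexps_def vecs_def)
      then show "q \<in> snd ` (\<Union>n\<le>j. mexps ({} :: nat set) s n)" using q by (force simp: Q_def)
    qed
  qed
  let ?n = "\<lambda>q :: nat \<Rightarrow> nat. j - sum q {1..s}"
  have Vset_eq: "Vset s j = (\<lambda>(q, m). (m, q)) ` Sigma Q (\<lambda>q. rows zr p (?n q))"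
    by (auto simp: Vset_def mexps_def Q_def rows_def image_iff)
  have sumV: "(\<Sum>(m, q)\<in>Vset s j. f m q) = (\<Sum>q\<in>Q. \<Sum>m\<in>rows zr p (?n q). f m q)" for f :: "_ \<Rightarrow> _ \<Rightarrow> real"
    unfolding Vset_eq by (subst sum.reindex) (auto simp: inj_on_def sum.Sigma finQ intro!: sum.cong)
  have "Re (average p (\<lambda>x \<mu> k. b k * of_real (nonlin s j c (delay_args zr p \<tau> (Phix zr p \<omega> x)) \<mu>)) (real_point \<rho>) \<mu> (int i)) = S \<rho> \<mu> i"
    if \<rho>: "\<rho> \<in> vecs R" and \<mu>: "\<mu> \<in> params s" and i: "i \<in> R" for \<rho> \<mu> i
  proof -
    let ?M = "\<lambda>n. {m' \<in> rows zr p n. component p m' = i}"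
    have "Re (average p (\<lambda>x \<mu> k. b k * of_real (nonlin s j c (delay_args zr p \<tau> (Phix zr p \<omega> x)) \<mu>)) (real_point \<rho>) \<mu> (int i))
      = (\<Sum>q\<in>Q. \<Sum>m\<in>rows zr p (?n q). \<Sum>m'\<in>?M (sum m R). radial_matrix zr p b (delay_angles \<tau>) m' m * c m q * mon R s m' q \<rho> \<mu>)"
      unfolding nonlin_average_rows[OF \<rho> i] sumV ..
    also have "\<dots> = (\<Sum>q\<in>Q. \<Sum>m'\<in>?M (?n q). t i m' q * mon R s m' q \<rho> \<mu>)"
    proof (rule sum.cong[OF refl])
      fix q assume q: "q \<in> Q"
      have "(\<Sum>m\<in>rows zr p (?n q). \<Sum>m'\<in>?M (sum m R). radial_matrix zr p b (delay_angles \<tau>) m' m * c m q * mon R s m' q \<rho> \<mu>)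
        = (\<Sum>m\<in>rows zr p (?n q). \<Sum>m'\<in>?M (?n q). radial_matrix zr p b (delay_angles \<tau>) m' m * c m q * mon R s m' q \<rho> \<mu>)"
        by (intro sum.cong refl) (simp add: rows_def)
      also have "\<dots> = (\<Sum>m'\<in>?M (?n q). (\<Sum>m\<in>rows zr p (?n q). radial_matrix zr p b (delay_angles \<tau>) m' m * c m q) * mon R s m' q \<rho> \<mu>)"
        by (subst sum.swap) (simp add: sum_distrib_right)
      also have "\<dots> = (\<Sum>m'\<in>?M (?n q). t i m' q * mon R s m' q \<rho> \<mu>)"
        using C[of q] q by (intro sum.cong refl) (auto simp: sy_def c_def Q_def)
      finally show "(\<Sum>m\<in>rows zr p (?n q). \<Sum>m'\<in>?M (sum m R). radial_matrix zr p b (delay_angles \<tau>) m' m * c m q * mon R s m' q \<rho> \<mu>)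
        = (\<Sum>m'\<in>?M (?n q). t i m' q * mon R s m' q \<rho> \<mu>)" .
    qed
    also have "\<dots> = (\<Sum>q\<in>Q. \<Sum>m\<in>rows zr p (?n q). if component p m = i then t i m q * mon R s m q \<rho> \<mu> else 0)"
      by (intro sum.cong refl sum.inter_filter finite_rows)
    also have "\<dots> = (\<Sum>(m, q)\<in>Vset s j. if component p m = i then t i m q * mon R s m q \<rho> \<mu> else 0)"
      unfolding sumV ..
    also have "\<dots> = (\<Sum>a\<in>{a \<in> mexps R s j. Vmon zr p (fst a)}. if component p (fst a) = i then t i (fst a) (snd a) * mon R s (fst a) (snd a) \<rho> \<mu> else 0)"
      unfolding Vset_def by (intro sum.cong) (auto simp: case_prod_unfold)
    also have "\<dots> = (\<Sum>a\<in>mexps R s j. if Vmon zr p (fst a) then if component p (fst a) = i then t i (fst a) (snd a) * mon R s (fst a) (snd a) \<rho> \<mu> else 0 else 0)"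
      by (rule sum.inter_filter) simp
    also have "\<dots> = heval R s j (\<lambda>m q. if parity p i m then t i m q else 0) \<rho> \<mu>"
      unfolding heval_def
    proof (intro sum.cong refl)
      fix a assume "a \<in> mexps R s j"
      have "Vmon zr p (fst a) \<and> component p (fst a) = i \<longleftrightarrow> parity p i (fst a)"
        using component_eq i unfolding Vmon_parity by blast
      then show "(if Vmon zr p (fst a) then if component p (fst a) = i then t i (fst a) (snd a) * mon R s (fst a) (snd a) \<rho> \<mu> else 0 else 0)
        = (case a of (m, q) \<Rightarrow> (if parity p i m then t i m q else 0) * mon R s m q \<rho> \<mu>)"
        by (auto simp: case_prod_unfold)
    qed
    also have "\<dots> = S \<rho> \<mu> i" using par[of i] \<rho> \<mu> i unfolding par_def by simp
    finally show ?thesis .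
  qed
  then show ?thesis by blast
qed

end

lemma heval_homogeneous:
  assumes "finite A"
  shows "heval A s j c (\<lambda>i. of_real t * x i) (\<lambda>i. t * \<mu> i) = of_real t ^ j * heval A s j c x \<mu>"
proof -
  have "mon A s m q (\<lambda>i. of_real t * x i) (\<lambda>i. t * \<mu> i) = of_real t ^ j * mon A s m q x \<mu>" if "(m, q) \<in> mexps A s j" for m q
  proof -
    have "(\<Prod>i\<in>A. of_real t ^ m i) * (\<Prod>i = 1..s. of_real t ^ q i) = (of_real t ^ j :: 'b)"
    proof -
      have j: "j = sum m A + sum q {1..s}" using that by (simp add: mexps_def)
      show ?thesis unfolding j power_add power_sum ..
    qed
    from this[symmetric] show ?thesis
      unfolding mon_def power_mult_distrib prod.distrib of_real_mult of_real_prod of_real_power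
      by (simp only: ac_simps)
  qed
  then show ?thesis unfolding heval_def sum_distrib_left by (intro sum.cong refl) auto
qed

lemma sum_ridx:
  fixes f :: "nat \<Rightarrow> 'a::comm_monoid_add"
  shows "(\<Sum>i\<in>ridx zr p. f i) = (if zr then f 0 else 0) + (\<Sum>i = 1..p. f i)"
  by (simp add: ridx_def sum.atLeast_Suc_atMost)

text \<open>This allows the contribution of lower degrees to be subtracted from the target. A sign
  change at a real point fixes the invariants in a resonant monomial and acts only on its surplus
  factor.\<close>

lemma average_HZ2:
  assumes F: "F \<in> HK zr p s j"
  shows "(\<lambda>\<rho> \<mu> i. Re (average p F (real_point \<rho>) \<mu> (int i))) \<in> HZ2 zr p s j"
proof -
  let ?K = "cidx zr p" and ?R = "ridx zr p"
  obtain c where c: "\<And>k x \<mu>. k \<in> ?K \<Longrightarrow> x \<in> cpts zr p \<Longrightarrow> \<mu> \<in> params s \<Longrightarrow> F x \<mu> k = heval ?K s j (c k) x \<mu>"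
    using HK_symmetric[OF F] by metis
  have av: "average p F x \<mu> (int i) = (\<Sum>(m, q)\<in>mexps ?K s j. (if resonant p (int i) m then c (int i) m q else 0) * mon ?K s m q x \<mu>)"
    if "x \<in> cpts zr p" "\<mu> \<in> params s" "i \<in> ?R" for x \<mu> i
    using average_heval[of zr p F \<mu> "int i" s j "c (int i)" x] c that by (simp add: heval_def)
  define f where "f m = (\<lambda>i. if i \<in> ?R then if i = 0 then m 0 else m (int i) + m (- int i) else 0)" for m :: "int \<Rightarrow> nat"
  have mon: "mon ?K s m q (real_point \<rho>) \<mu> = of_real (mon ?R s (f m) q \<rho> \<mu>)" for m q \<rho> \<mu>
  proof -
    have "(\<Prod>k\<in>?K. real_point \<rho> k ^ m k) = (\<Prod>i\<in>?R. complex_of_real (\<rho> i) ^ f m i)"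
      unfolding prod_cidx prod_ridx by (auto simp: f_def real_point_def ridx_def power_add intro!: prod.cong)
    then show ?thesis by (simp add: mon_def)
  qed
  have fm: "(f m, q) \<in> mexps ?R s j" if "(m, q) \<in> mexps ?K s j" for m q
  proof -
    have "sum (f m) ?R = sum m ?K" unfolding sum_cidx sum_ridx by (auto simp: f_def ridx_def intro!: sum.cong)
    then show ?thesis using that by (auto simp: mexps_def vecs_def f_def)
  qed
  then have fm': "(f (fst a), snd a) \<in> mexps ?R s j" if "a \<in> mexps ?K s j" for a
    using that by (cases a) simp
  show ?thesis
    unfolding HZ2_def mem_Collect_eq
  proof (intro conjI ballI)
    fix i assume i: "i \<in> ?R"
    let ?C = "\<lambda>a. Re (if resonant p (int i) (fst a) then c (int i) (fst a) (snd a) else 0)"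
    let ?D = "\<lambda>m' q'. \<Sum>a\<in>{a \<in> mexps ?K s j. (f (fst a), snd a) = (m', q')}. ?C a"
    have "Re (average p F (real_point \<rho>) \<mu> (int i)) = heval ?R s j ?D \<rho> \<mu>"
      if "\<rho> \<in> vecs ?R" "\<mu> \<in> params s" for \<rho> \<mu>
    proof -
      have "Re (average p F (real_point \<rho>) \<mu> (int i)) = (\<Sum>a\<in>mexps ?K s j. ?C a * mon ?R s (f (fst a)) (snd a) \<rho> \<mu>)"
        unfolding av[OF real_point_cpts[OF that(1)] that(2) i] mon by (simp add: case_prod_unfold)
      also have "\<dots> = heval ?R s j ?D \<rho> \<mu>"
        by (rule heval_collect[where m = "\<lambda>a. f (fst a)" and q = snd and C = ?C, OF ridx_finite finite_mexps[OF cidx_finite] fm'])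
      finally show ?thesis .
    qed
    then show "(\<lambda>\<rho> \<mu>. Re (average p F (real_point \<rho>) \<mu> (int i))) \<in> Hscal zr p s j"
      unfolding Hscal_def mem_Collect_eq by (intro exI[of _ ?D]) blast
  next
    fix sg \<rho> \<mu> :: "nat \<Rightarrow> real" and i assume sg: "sg \<in> sign_vecs p" and \<rho>: "\<rho> \<in> vecs ?R" and \<mu>: "\<mu> \<in> params s" and i: "i \<in> ?R"
    let ?x = "real_point \<rho>" and ?y = "real_point (\<lambda>k. sg k * \<rho> k)"
    have \<rho>': "(\<lambda>k. sg k * \<rho> k) \<in> vecs ?R" using \<rho> by (auto simp: vecs_def)
    have sq: "sg l * sg l = 1" if "l \<in> ?R" for l
    proof (cases "l = 0")
      case False
      then have "l \<in> {1..p}" using that by (auto simp: ridx_def split: if_splits)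
      then have "sg l = 1 \<or> sg l = - 1" using sg unfolding sign_vecs_def by blast
      then show ?thesis by auto
    qed (use sg in \<open>simp add: sign_vecs_def\<close>)
    have "mon ?K s m q ?y \<mu> = of_real (sg i) * mon ?K s m q ?x \<mu>" if res: "resonant p (int i) m" for m q
    proof -
      let ?ivs = "\<lambda>x. \<lambda>l::nat. if l = 0 then x 0 else x (int l) * x (- int l)"
      have "mon ?R s m' q (?ivs ?y) \<mu> = mon ?R s m' q (?ivs ?x) \<mu>" for m'
      proof -
        have "?ivs ?y l = ?ivs ?x l" if "l \<in> ?R" for l
        proof (cases "l = 0")
          case True
          then show ?thesis using sg by (simp add: real_point_def sign_vecs_def)
        next
          case False
          have "?ivs ?y l = of_real (sg l * sg l) * ?ivs ?x l" using False by (simp add: real_point_def ac_simps)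
          then show ?thesis using sq[OF that] by simp
        qed
        then show ?thesis by (simp add: mon_def)
      qed
      then show ?thesis
        unfolding resonant_mon[OF real_point_cpts[OF \<rho>'] i res] resonant_mon[OF real_point_cpts[OF \<rho>] i res]
        using sg by (auto simp: real_point_def sign_vecs_def)
    qed
    then have "average p F ?y \<mu> (int i) = of_real (sg i) * average p F ?x \<mu> (int i)"
      unfolding av[OF real_point_cpts[OF \<rho>'] \<mu> i] av[OF real_point_cpts[OF \<rho>] \<mu> i] sum_distrib_left
      by (intro sum.cong refl) (auto simp: case_prod_unfold)
    then show "Re (average p F ?y \<mu> (int i)) = sg i * Re (average p F ?x \<mu> (int i))" by simp
  qed
qed

lemma Hscal_combine:
  assumes "f \<in> Hscal zr p s j" "g \<in> Hscal zr p s j"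
  shows "(\<lambda>v \<mu>. a * f v \<mu> + d * g v \<mu>) \<in> Hscal zr p s j"
proof -
  obtain c c' where "\<And>v \<mu>. v \<in> vecs (ridx zr p) \<Longrightarrow> \<mu> \<in> params s \<Longrightarrow> f v \<mu> = heval (ridx zr p) s j c v \<mu>"
    "\<And>v \<mu>. v \<in> vecs (ridx zr p) \<Longrightarrow> \<mu> \<in> params s \<Longrightarrow> g v \<mu> = heval (ridx zr p) s j c' v \<mu>"
    using assms unfolding Hscal_def by blast
  then show ?thesis unfolding Hscal_def
    by (intro CollectI exI[of _ "\<lambda>m q. a * c m q + d * c' m q"]) (simp add: heval_scale heval_add)
qed

lemma HZ2_combine:
  assumes "f \<in> HZ2 zr p s j" "g \<in> HZ2 zr p s j"
  shows "(\<lambda>\<rho> \<mu> i. a * f \<rho> \<mu> i + d * g \<rho> \<mu> i) \<in> HZ2 zr p s j"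
  using assms unfolding HZ2_def by (auto intro!: Hscal_combine simp: algebra_simps)

text \<open>State \<open>n\<close> is the system after the changes of degrees 2 to \<open>n\<close>.
  States 0 and 1 are both the original system, as there is no change of degree 1.\<close>

primrec fseq :: "xterms \<Rightarrow> yterms \<Rightarrow> (nat \<Rightarrow> xfield) \<Rightarrow> (nat \<Rightarrow> yfield) \<Rightarrow> nat \<Rightarrow> xterms \<times> yterms" where
  "fseq f1 f2 U1 U2 0 = (f1, f2)"
| "fseq f1 f2 U1 U2 (Suc n) = (if n = 0 then (f1, f2) else
     (stepx (Suc n) (U1 (Suc n)) (U2 (Suc n)) (fst (fseq f1 f2 U1 U2 n)),
      stepy (Suc n) (U1 (Suc n)) (U2 (Suc n)) (fst (fseq f1 f2 U1 U2 n)) (snd (fseq f1 f2 U1 U2 n))))"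

lemma fseq_cong:
  assumes "\<And>j. 2 \<le> j \<Longrightarrow> j \<le> n \<Longrightarrow> U1 j = U1' j \<and> U2 j = U2' j"
  shows "fseq f1 f2 U1 U2 n = fseq f1 f2 U1' U2' n"
  using assms by (induction n) auto

section \<open>Effect of an added term of top degree on the normal form recursion\<close>

context delayed_center
begin

lemma goodx_HK:
  assumes "goodx m f" shows "(\<lambda>x \<mu>. f x (\<lambda>_. 0) \<mu>) \<in> HK zr p s m"
proof -
  obtain P where "repx m f P" using assms unfolding goodx_rep by blast
  note P = repxD[OF this]
  have z: "(x, (\<lambda>_. 0), \<mu>) \<in> S" if "x \<in> cpts zr p" "\<mu> \<in> params s" for x \<mu>
    using that zero_QQ by (simp add: S_def)
  have "\<exists>c. \<forall>x\<in>cpts zr p. \<forall>\<mu>\<in>params s. f x (\<lambda>_. 0) \<mu> k = heval K s m c x \<mu>" if k: "k \<in> K" for k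
  proof -
    obtain c where "\<And>x \<mu>. P k (x, (\<lambda>_. 0), \<mu>) = heval K s m c x \<mu>" using hpoly_heval[OF P(1)[OF k]] by auto
    then show ?thesis using P(2)[OF z] k by (intro exI[of _ c]) simp
  qed
  then show ?thesis using goodx_cpts[OF assms z] unfolding HK_def by blast
qed

lemma goody_solution:
  assumes "goody m f"
  shows "\<exists>U\<in>HQ1 r M zr p \<omega> b s m. \<forall>x\<in>cpts zr p. \<forall>\<mu>\<in>params s. \<forall>\<theta>\<in>I.
    dirD (\<lambda>x. U x \<mu> \<theta>) x (Bop \<omega> x) - AQ1 r M (U x \<mu>) \<theta> = f x (\<lambda>_. 0) \<mu> \<theta>"
proof -
  obtain F where F: "hpoly_in V1 BQ m F"
     "\<And>x y \<mu> \<theta>. (x, y, \<mu>) \<in> S \<Longrightarrow> \<theta> \<in> I \<Longrightarrow> complex_of_real (f x y \<mu> \<theta>) = F (x, y, \<mu>) \<theta>"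
    using assms unfolding goody_def by blast
  obtain c where c: "\<And>m q. c m q \<in> BQ" "\<And>x \<mu> \<theta>. F (x, (\<lambda>_. 0), \<mu>) \<theta> = heval K s m (\<lambda>m q. c m q \<theta>) x \<mu>"
    using hpoly_in_heval[OF F(1) cidx_finite BQ_add BQ_scale BQ_zero] by blast
  have "complex_of_real (f x (\<lambda>_. 0) \<mu> \<theta>) = heval K s m (\<lambda>m q. c m q \<theta>) x \<mu>"
    if "x \<in> cpts zr p" "\<mu> \<in> params s" "\<theta> \<in> I" for x \<mu> \<theta>
    using F(2)[of x "\<lambda>_. 0" \<mu> \<theta>] that zero_QQ c(2) by (simp add: S_def)
  from HQ1_solution[OF this c(1)] show ?thesis .
qed

definition good_changes :: "nat \<Rightarrow> (nat \<Rightarrow> xfield) \<Rightarrow> (nat \<Rightarrow> yfield) \<Rightarrow> bool" where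
  "good_changes n U1 U2 \<longleftrightarrow> (\<forall>j. 2 \<le> j \<and> j \<le> n \<longrightarrow> goodU1 j (U1 j) \<and> goodU2 j (U2 j))"

definition good_expansions :: "xterms \<times> yterms \<Rightarrow> bool" where
  "good_expansions f \<longleftrightarrow> (\<forall>m\<ge>1. goodx m (fst f m)) \<and> (\<forall>m\<ge>2. goody m (snd f m)) \<and>
     (\<forall>x y \<mu> \<theta>. (x, y, \<mu>) \<in> S \<longrightarrow> \<theta> \<in> I \<longrightarrow> snd f 1 x y \<mu> \<theta> = AQ1 r M y \<theta>)"

lemma goodfD:
  assumes "good_expansions f"
  shows "m \<ge> 1 \<Longrightarrow> goodx m (fst f m)" "m \<ge> 2 \<Longrightarrow> goody m (snd f m)"
    "(x, y, \<mu>) \<in> S \<Longrightarrow> \<theta> \<in> I \<Longrightarrow> snd f 1 x y \<mu> \<theta> = AQ1 r M y \<theta>"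
  using assms unfolding good_expansions_def by blast+

lemma fseq_good:
  assumes "good_expansions (f1, f2)" "good_changes n U1 U2"
  shows "good_expansions (fseq f1 f2 U1 U2 n)"
  using assms(2)
proof (induction n)
  case (Suc n)
  show ?case
  proof (cases "n = 0")
    case False
    have g: "good_expansions (fseq f1 f2 U1 U2 n)" using Suc by (simp add: good_changes_def)
    have U: "2 \<le> Suc n" "goodU1 (Suc n) (U1 (Suc n))" "goodU2 (Suc n) (U2 (Suc n))"
      using Suc.prems False by (auto simp: good_changes_def)
    note gx = goodfD(1)[OF g] and gy = goodfD(2)[OF g] and g1 = goodfD(3)[OF g]
    show ?thesis
      using False stepx_good[OF U gx] stepy_good[OF U gy g1 gx] unfolding good_expansions_def
      by (simp del: One_nat_def)
  qed (use assms(1) in simp)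
qed (use assms(1) in simp)

text \<open>The y-terms of degree \<open>L\<close> are left free: the change \<open>U2\<close> of
  that degree is chosen only after the nonlinearity of degree \<open>L\<close> has been
  fixed.\<close>

definition close :: "nat \<Rightarrow> (point \<Rightarrow> complex) \<Rightarrow> xterms \<times> yterms \<Rightarrow> xterms \<times> yterms \<Rightarrow> bool" where
  "close L P f f' \<longleftrightarrow> (\<forall>n x y \<mu>. 1 \<le> n \<longrightarrow> n < L \<longrightarrow> (x, y, \<mu>) \<in> S \<longrightarrow>
      fst f' n x y \<mu> = fst f n x y \<mu> \<and> (\<forall>\<theta>\<in>I. snd f' n x y \<mu> \<theta> = snd f n x y \<mu> \<theta>)) \<and>
     (\<forall>x y \<mu> k. (x, y, \<mu>) \<in> S \<longrightarrow> fst f' L x y \<mu> k = fst f L x y \<mu> k + b k * P (x, y, \<mu>))"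

lemma closeD:
  assumes "close L P f f'"
  shows "1 \<le> n \<Longrightarrow> n < L \<Longrightarrow> (x, y, \<mu>) \<in> S \<Longrightarrow> fst f' n x y \<mu> = fst f n x y \<mu>"
    "1 \<le> n \<Longrightarrow> n < L \<Longrightarrow> (x, y, \<mu>) \<in> S \<Longrightarrow> \<theta> \<in> I \<Longrightarrow> snd f' n x y \<mu> \<theta> = snd f n x y \<mu> \<theta>"
    "(x, y, \<mu>) \<in> S \<Longrightarrow> fst f' L x y \<mu> k = fst f L x y \<mu> k + b k * P (x, y, \<mu>)"
  using assms unfolding close_def by blast+

lemma stepy_agree:
  assumes U: "2 \<le> j" "goodU1 j V" "goodU2 j W"
    and cl: "close L P f f'" and x: "\<And>n x y \<mu>. 1 \<le> n \<Longrightarrow> n < L \<Longrightarrow> (x, y, \<mu>) \<in> S \<Longrightarrow>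
      stepx j V W (fst f') n x y \<mu> = stepx j V W (fst f) n x y \<mu>"
    and n: "1 \<le> n" "n < L" "(x, y, \<mu>) \<in> S" "\<theta> \<in> I"
  shows "stepy j V W (fst f') (snd f') n x y \<mu> \<theta> = stepy j V W (fst f) (snd f) n x y \<mu> \<theta>"
proof -
  have S': "(curX V x \<mu> t, curY W x y \<mu> t, \<lambda>i. t * \<mu> i) \<in> S" for t
    using cur_S[OF U n(3), of t] by (simp add: cur_def[OF U])
  have 1: "(\<Sum>i = 1..n. snd f' i (curX V x \<mu> t) (curY W x y \<mu> t) (\<lambda>i. t * \<mu> i) \<theta>)
    = (\<Sum>i = 1..n. snd f i (curX V x \<mu> t) (curY W x y \<mu> t) (\<lambda>i. t * \<mu> i) \<theta>)" for t
    using closeD(2)[OF cl _ _ S' n(4)] n(2) by (intro sum.cong refl) auto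
  show ?thesis
  proof (cases "j \<le> n")
    case True
    have "stepx j V W (fst f') (n + 1 - j) x y \<mu> = stepx j V W (fst f) (n + 1 - j) x y \<mu>"
      using True U(1) n by (intro x) auto
    then show ?thesis unfolding stepy_def 1 by simp
  next
    case False
    then show ?thesis unfolding stepy_def 1 by simp
  qed
qed

text \<open>\<open>stepx_perturb\<close> carries the added term through one change after another, so
  it reaches step \<open>L\<close> as it was put in.\<close>

lemma fseq_close:
  assumes f: "good_expansions (f1, f2)" and f': "good_expansions (f1', f2')" and cl: "close L P (f1, f2) (f1', f2')"
    and P: "hpoly V1 L P" and "L \<ge> 1" and "good_changes n U1 U2"
  shows "close L P (fseq f1 f2 U1 U2 n) (fseq f1' f2' U1 U2 n)"
  using assms(6)
proof (induction n)
  case (Suc n)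
  show ?case
  proof (cases "n = 0")
    case False
    have U': "good_changes n U1 U2" using Suc.prems by (simp add: good_changes_def)
    have cn: "close L P (fseq f1 f2 U1 U2 n) (fseq f1' f2' U1 U2 n)" by (rule Suc.IH[OF U'])
    have U: "2 \<le> Suc n" "goodU1 (Suc n) (U1 (Suc n))" "goodU2 (Suc n) (U2 (Suc n))"
      using Suc.prems False by (auto simp: good_changes_def)
    note g = goodfD(1)[OF fseq_good[OF f U']] and g' = goodfD(1)[OF fseq_good[OF f' U']]
    note sx = stepx_perturb[where B = b and R = P and L = L and f = "fst (fseq f1 f2 U1 U2 n)"
        and f' = "fst (fseq f1' f2' U1 U2 n)", OF U g g' closeD(1)[OF cn] closeD(3)[OF cn] P \<open>L \<ge> 1\<close>]
    show ?thesis
      unfolding close_def fseq.simps if_not_P[OF False] fst_conv snd_conv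
      using sx stepy_agree[OF U cn sx(1)] by blast
  qed (use cl in simp)
qed (use cl in simp)

end

section \<open>Realization\<close>

context center_spectrum
begin

lemma nonlin_Vhat:
  assumes "\<And>v \<mu>. nonlin s j c v \<mu> = \<eta> v" shows "\<eta> \<in> Vhat zr p s j"
proof -
  have "(\<lambda>v \<mu>. \<eta> v) = nonlin s j c" using assms by (intro ext) simp
  then show ?thesis using nonlin_Hscal nonlin_Vsp by (simp add: Vhat_def)
qed

lemma nonlin_What:
  assumes "\<And>v. v \<in> vecs R \<Longrightarrow> calK zr p (nonlin s j c) v (\<lambda>_. 0) = 0"
  shows "nonlin s j c \<in> What zr p s j"
  using assms nonlin_Hscal nonlin_Vsp by (simp add: What_def Wsp_def)

lemma zero_Vhat: "(\<lambda>_. 0) \<in> Vhat zr p s j"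
  by (rule nonlin_Vhat[of s j "\<lambda>_ _. 0"]) (simp add: nonlin_def)

lemma zero_What: "(\<lambda>_ _. 0) \<in> What zr p s j"
proof -
  have "nonlin s j (\<lambda>_ _. 0) = (\<lambda>_ _. 0)" by (intro ext) (simp add: nonlin_def)
  moreover have "nonlin s j (\<lambda>_ _. 0) \<in> What zr p s j" by (rule nonlin_What) (simp add: nonlin_def calK_def)
  ultimately show ?thesis by simp
qed

text \<open>Monomials free of \<mu> go to \<eta>; the others vanish at \<mu> = 0 and go to \<xi>.
  One choice of coefficients can therefore serve \<open>h\<close> and \<open>q\<close>
  together.\<close>

lemma nonlin_split:
  "\<exists>\<eta> \<xi>. \<eta> \<in> Vhat zr p s j \<and> \<xi> \<in> What zr p s j \<and> (\<forall>v \<mu>. \<eta> v + \<xi> v \<mu> = nonlin s j c v \<mu>)"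
proof -
  define c0 where "c0 m q = (if q = (\<lambda>_. 0) then c m q else 0)" for m and q :: "nat \<Rightarrow> nat"
  define c1 where "c1 m q = (if q = (\<lambda>_. 0) then 0 else c m q)" for m and q :: "nat \<Rightarrow> nat"
  have c0: "nonlin s j c0 v \<mu> = nonlin s j c0 v (\<lambda>_. 0)" for v \<mu>
    unfolding nonlin_def by (intro sum.cong refl) (auto simp: c0_def mon_def)
  have "nonlin s j c1 \<in> What zr p s j"
  proof (rule nonlin_What)
    fix v :: "nat \<Rightarrow> real" assume "v \<in> vecs R"
    have "mon R s m q v (\<lambda>_. 0) = 0" if "(m, q) \<in> mexps R s j" "q \<noteq> (\<lambda>_. 0)" for m q
    proof -
      obtain i where "q i \<noteq> 0" using \<open>q \<noteq> _\<close> by auto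
      then have "i \<in> {1..s}" "q i > 0" using that(1) by (auto simp: mexps_def vecs_def)
      then have "(\<Prod>i = 1..s. (0::real) ^ q i) = 0" by (intro prod_zero) auto
      then show ?thesis by (simp add: mon_def)
    qed
    then show "calK zr p (nonlin s j c1) v (\<lambda>_. 0) = 0"
      unfolding nonlin_calK[OF \<open>v \<in> vecs R\<close>] by (intro sum.neutral) (auto simp: c1_def Vset_def)
  qed
  moreover have "(\<lambda>v. nonlin s j c0 v (\<lambda>_. 0)) \<in> Vhat zr p s j" by (rule nonlin_Vhat[OF c0])
  moreover have "nonlin s j c0 v (\<lambda>_. 0) + nonlin s j c1 v \<mu> = nonlin s j c v \<mu>" for v \<mu>
    unfolding c0[of v \<mu>, symmetric] unfolding nonlin_def sum.distrib[symmetric]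
    by (intro sum.cong refl) (auto simp: c0_def c1_def)
  ultimately show ?thesis by blast
qed

text \<open>The added term is known to be polynomial only as a difference of two maps in
  \<open>HK\<close>; on the level of coefficients additivity is then immediate.\<close>

lemma average_add:
  assumes "F \<in> HK zr p s j" "F' \<in> HK zr p s j"
    and eq: "\<And>x k. x \<in> cpts zr p \<Longrightarrow> k \<in> K \<Longrightarrow> F' x \<mu> k = F x \<mu> k + N x \<mu> k"
    and \<mu>: "\<mu> \<in> params s" and x: "x \<in> cpts zr p" and k: "k \<in> K"
  shows "average p F' x \<mu> k = average p F x \<mu> k + average p N x \<mu> k"
proof -
  obtain c where c: "\<And>k x \<mu>. k \<in> K \<Longrightarrow> x \<in> cpts zr p \<Longrightarrow> \<mu> \<in> params s \<Longrightarrow> F x \<mu> k = heval K s j (c k) x \<mu>"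
    using HK_symmetric[OF assms(1)] by metis
  obtain c' where c': "\<And>k x \<mu>. k \<in> K \<Longrightarrow> x \<in> cpts zr p \<Longrightarrow> \<mu> \<in> params s \<Longrightarrow> F' x \<mu> k = heval K s j (c' k) x \<mu>"
    using HK_symmetric[OF assms(2)] by metis
  have N: "N x \<mu> k = heval K s j (\<lambda>m q. c' k m q - c k m q) x \<mu>" if "x \<in> cpts zr p" for x
    using eq[OF that k] c[OF k that \<mu>] c'[OF k that \<mu>] by (simp flip: heval_diff)
  have 1: "average p F x \<mu> k = heval K s j (\<lambda>m q. if resonant p k m then c k m q else 0) x \<mu>"
    by (rule average_heval) (use c k \<mu> x in auto)
  have 2: "average p F' x \<mu> k = heval K s j (\<lambda>m q. if resonant p k m then c' k m q else 0) x \<mu>"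
    by (rule average_heval) (use c' k \<mu> x in auto)
  have 3: "average p N x \<mu> k = heval K s j (\<lambda>m q. if resonant p k m then c' k m q - c k m q else 0) x \<mu>"
    by (rule average_heval) (use N k x in auto)
  show ?thesis unfolding 1 2 3 heval_add by (intro heval_coeff_cong) simp
qed

lemma average_cong:
  assumes "\<And>x. x \<in> cpts zr p \<Longrightarrow> F x \<mu> = F' x \<mu>" "x \<in> cpts zr p"
  shows "average p F x \<mu> k = average p F' x \<mu> k"
  unfolding average_def using assms(1)[OF rot_cpts[OF assms(2)]] by simp

lemma HK_cong:
  assumes "F \<in> HK zr p s j" "\<And>x \<mu>. x \<in> cpts zr p \<Longrightarrow> \<mu> \<in> params s \<Longrightarrow> F' x \<mu> = F x \<mu>"
  shows "F' \<in> HK zr p s j"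
  using assms unfolding HK_def by auto

end

locale realization = delayed_center r M zr p \<omega> s "\<tau> ` {1..rdim zr p}"
  for r M zr p \<omega> s \<tau> +
  fixes l :: nat
begin

abbreviation delayed :: "(real \<Rightarrow> real) \<Rightarrow> nat \<Rightarrow> real" where "delayed \<equiv> delay_args zr p \<tau>"

definition nonlinear_term where
  "nonlinear_term \<eta> \<xi> = (\<lambda>u \<mu>. (\<Sum>j = 2..l. \<eta> j (delayed u)) + (\<Sum>j = 2..l. \<xi> j (delayed u) \<mu>))"

definition admissible where
  "admissible \<eta> \<xi> \<longleftrightarrow> (\<forall>j\<in>{2..l}. \<eta> j \<in> Vhat zr p s j \<and> \<xi> j \<in> What zr p s j)"

lemma delayed_vecs: "delayed u \<in> vecs R" by (simp add: delay_args_def vecs_def)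

lemma Hscal_homogeneous:
  assumes "H \<in> Hscal zr p s j" "v \<in> vecs R" "\<mu> \<in> params s"
  shows "H (\<lambda>i. t * v i) (\<lambda>i. t * \<mu> i) = t ^ j * H v \<mu>"
proof -
  obtain c where c: "\<And>v \<mu>. v \<in> vecs R \<Longrightarrow> \<mu> \<in> params s \<Longrightarrow> H v \<mu> = heval R s j c v \<mu>"
    using assms(1) unfolding Hscal_def by blast
  have "(\<lambda>i. t * v i) \<in> vecs R" "(\<lambda>i. t * \<mu> i) \<in> params s" using assms(2,3) by (auto simp: vecs_def)
  then show ?thesis using c assms(2,3) heval_homogeneous[OF ridx_finite, of zr p s j c t v \<mu>] by simp
qed

lemma admissible_Hscal: "admissible \<eta> \<xi> \<Longrightarrow> j \<in> {2..l} \<Longrightarrow> (\<lambda>v \<mu>. \<eta> j v + \<xi> j v \<mu>) \<in> Hscal zr p s j"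
  using Hscal_combine[of "\<lambda>v \<mu>. \<eta> j v" zr p s j "\<xi> j" 1 1] by (simp add: admissible_def Vhat_def What_def)

text \<open>Delayed values scale linearly along a ray, so there the nonlinearity is a polynomial in
  \<open>t\<close> whose coefficients are its homogeneous pieces.\<close>

lemma Gterm_nonlinear_term:
  assumes "admissible \<eta> \<xi>" "\<mu> \<in> params s"
  shows "Gterm (nonlinear_term \<eta> \<xi>) m u \<mu> = (if m \<in> {2..l} then \<eta> m (delayed u) + \<xi> m (delayed u) \<mu> else 0)"
proof -
  let ?H = "\<lambda>j. \<eta> j (delayed u) + \<xi> j (delayed u) \<mu>"
  have "complex_of_real (nonlinear_term \<eta> \<xi> (\<lambda>\<theta>. t * u \<theta>) (\<lambda>i. t * \<mu> i)) = poly (\<Sum>j = 2..l. monom (of_real (?H j)) j) (of_real t)" for t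
  proof -
    have "delayed (\<lambda>\<theta>. t * u \<theta>) = (\<lambda>i. t * delayed u i)" by (auto simp: delay_args_def)
    then have "nonlinear_term \<eta> \<xi> (\<lambda>\<theta>. t * u \<theta>) (\<lambda>i. t * \<mu> i) = (\<Sum>j = 2..l. \<eta> j (\<lambda>i. t * delayed u i) + \<xi> j (\<lambda>i. t * delayed u i) (\<lambda>i. t * \<mu> i))"
      by (simp add: nonlinear_term_def sum.distrib)
    also have "\<dots> = (\<Sum>j = 2..l. t ^ j * ?H j)"
      using Hscal_homogeneous[OF admissible_Hscal[OF assms(1)] delayed_vecs assms(2)] by (intro sum.cong refl) simp
    finally show ?thesis by (simp add: poly_sum poly_monom mult.commute)
  qed
  from taylor_coeff_poly_real[OF this, of m]
  have "complex_of_real (Gterm (nonlinear_term \<eta> \<xi>) m u \<mu>) = (\<Sum>j = 2..l. if j = m then of_real (?H j) else 0)"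
    by (simp add: Gterm_def coeff_sum)
  also have "\<dots> = of_real (if m \<in> {2..l} then ?H m else 0)" by simp
  finally show ?thesis by (simp only: of_real_eq_iff)
qed

lemma Hscal_hpoly:
  assumes "H \<in> Hscal zr p s m"
  shows "\<exists>P. hpoly V1 m P \<and> (\<forall>x y \<mu>. (x, y, \<mu>) \<in> S \<longrightarrow>
    complex_of_real (H (delayed (\<lambda>\<theta>. Phix zr p \<omega> x \<theta> + y \<theta>)) \<mu>) = P (x, y, \<mu>))"
proof -
  obtain c where c: "\<And>v \<mu>. v \<in> vecs R \<Longrightarrow> \<mu> \<in> params s \<Longrightarrow> H v \<mu> = heval R s m c v \<mu>"
    using assms unfolding Hscal_def by blast
  define X where "X z i = (\<Sum>k\<in>K. Phi \<omega> k (\<tau> (pos zr i)) * xvar k z) + yvar (\<tau> (pos zr i)) z" for z i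
  have "hpoly V1 1 (\<lambda>z. X z i)" if i: "i \<in> R" for i
    unfolding X_def
  proof (intro hpoly.add hpoly_sum hpoly_scale hpoly.var cidx_finite)
    show "xvar k \<in> V1" if "k \<in> K" for k using that by (simp add: Vxy_def Vx_def)
    show "yvar (\<tau> (pos zr i)) \<in> V1" using pos_range[OF i] by (simp add: Vxy_def)
  qed
  moreover have "\<mu>var ` {1..s} \<subseteq> V1" by (auto simp: Vxy_def Vx_def)
  ultimately have "hpoly V1 m (\<lambda>z. heval R s m (\<lambda>m q. of_real (c m q)) (X z) (snd (snd z)))"
    by (intro heval_hpoly) auto
  moreover have "complex_of_real (H (delayed (\<lambda>\<theta>. Phix zr p \<omega> x \<theta> + y \<theta>)) \<mu>) =
      heval R s m (\<lambda>m q. of_real (c m q)) (X (x, y, \<mu>)) \<mu>" if z: "(x, y, \<mu>) \<in> S" for x y \<mu>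
  proof -
    have x: "x \<in> cpts zr p" "\<mu> \<in> params s" using z by (auto simp: S_def)
    have "complex_of_real (delayed (\<lambda>\<theta>. Phix zr p \<omega> x \<theta> + y \<theta>) i) = X (x, y, \<mu>) i" if "i \<in> R" for i
      using that by (simp add: delay_args_def X_def xvar_def yvar_def Phix_complex[OF x(1)])
    then show ?thesis unfolding c[OF delayed_vecs x(2)] heval_of_real by (simp add: heval_def mon_def)
  qed
  ultimately show ?thesis by (intro exI conjI) auto
qed

abbreviation init1 where "init1 \<eta> \<xi> \<equiv> f1_init zr p \<omega> b (nonlinear_term \<eta> \<xi>)"
abbreviation init2 where "init2 \<eta> \<xi> \<equiv> f2_init r M zr p \<omega> b (nonlinear_term \<eta> \<xi>)"

lemma f1_init_ge2: "m \<ge> 2 \<Longrightarrow> f1_init zr p \<omega> b G m x y \<mu> k = b k * of_real (Gterm G m (\<lambda>\<theta>. Phix zr p \<omega> x \<theta> + y \<theta>) \<mu>)"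
  by (simp add: f1_init_def)

text \<open>The nonlinear y-terms are single tensors: a scalar polynomial times the fixed function
  \<open>(I - \<pi>) X0\<close>.\<close>

lemma f2_init_ge2:
  assumes "m \<ge> 2"
  shows "complex_of_real (f2_init r M zr p \<omega> b G m x y \<mu> \<theta>) =
    of_real (Gterm G m (\<lambda>\<theta>. Phix zr p \<omega> x \<theta> + y \<theta>) \<mu>) * (of_real (X0 \<theta>) - (\<Sum>k\<in>K. Phi \<omega> k \<theta> * b k))"
proof -
  let ?a = "Gterm G m (\<lambda>\<theta>. Phix zr p \<omega> x \<theta> + y \<theta>) \<mu>"
  have "bform M (Psi \<omega> b k) (\<lambda>\<theta>. of_real 0) = 0" for k
    by (subst bform_Psi) simp_all
  then have e: "complex_of_real (proj_BC M zr p \<omega> b (\<lambda>_. 0) ?a \<theta>) = complex_of_real (Phix zr p \<omega> (\<lambda>k. b k * of_real ?a) \<theta>)"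
    by (simp add: proj_BC_def)
  have "(\<lambda>k. b k * complex_of_real ?a) \<in> cpts zr p"
    by (auto simp: cpts_def vecs_def b_minus) (simp add: b_def)
  from Phix_complex[OF this, of \<theta>] show ?thesis
    using assms e by (simp add: f2_init_def Let_def sum_distrib_left right_diff_distrib ac_simps)
qed

lemma Gterm_hpoly:
  assumes sp: "admissible \<eta> \<xi>"
  shows "\<exists>P. hpoly V1 m P \<and> (\<forall>x y \<mu>. (x, y, \<mu>) \<in> S \<longrightarrow>
    complex_of_real (Gterm (nonlinear_term \<eta> \<xi>) m (\<lambda>\<theta>. Phix zr p \<omega> x \<theta> + y \<theta>) \<mu>) = P (x, y, \<mu>))"
proof (cases "m \<in> {2..l}")
  case True
  from Hscal_hpoly[OF admissible_Hscal[OF sp True]] obtain P where "hpoly V1 m P"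
    "\<And>x y \<mu>. (x, y, \<mu>) \<in> S \<Longrightarrow> complex_of_real (\<eta> m (delayed (\<lambda>\<theta>. Phix zr p \<omega> x \<theta> + y \<theta>)) + \<xi> m (delayed (\<lambda>\<theta>. Phix zr p \<omega> x \<theta> + y \<theta>)) \<mu>) = P (x, y, \<mu>)"
    by blast
  then show ?thesis using Gterm_nonlinear_term[OF sp] True by (intro exI[of _ P]) (auto simp: S_def)
next
  case False
  then show ?thesis using Gterm_nonlinear_term[OF sp] by (intro exI[of _ "\<lambda>_. 0"]) (auto simp: S_def intro: hpoly.zero)
qed

lemma init_good:
  assumes sp: "admissible \<eta> \<xi>"
  shows "good_expansions (init1 \<eta> \<xi>, init2 \<eta> \<xi>)"
  unfolding good_expansions_def fst_conv snd_conv
proof (intro conjI allI impI)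
  fix m :: nat assume "m \<ge> 1"
  show "goodx m (init1 \<eta> \<xi> m)"
  proof (cases "m = 1")
    case True
    show ?thesis unfolding True
    proof (rule goodxI[of 1 "\<lambda>k z. \<sigma> k * xvar k z"])
      show "hpoly V1 1 (\<lambda>z. \<sigma> k * xvar k z)" if "k \<in> K" for k
        using that by (intro hpoly_scale hpoly.var) (simp add: Vxy_def Vx_def)
      show "init1 \<eta> \<xi> 1 x y \<mu> k = (if k \<in> K then \<sigma> k * xvar k (x, y, \<mu>) else 0)" if "(x, y, \<mu>) \<in> S" for x y \<mu> k
        using that cptsD(2)[of x zr p k] by (auto simp: f1_init_def Bop_\<sigma> xvar_def S_def)
      show "init1 \<eta> \<xi> 1 x y \<mu> (- k) = cnj (init1 \<eta> \<xi> 1 x y \<mu> k)" if "(x, y, \<mu>) \<in> S" for x y \<mu> k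
        using that cptsD(1)[of x zr p k] by (auto simp: f1_init_def Bop_\<sigma> \<sigma>_minus S_def)
    qed
  next
    case False
    then have m: "m \<ge> 2" using \<open>m \<ge> 1\<close> by simp
    obtain P where P: "hpoly V1 m P" "\<And>x y \<mu>. (x, y, \<mu>) \<in> S \<Longrightarrow>
       complex_of_real (Gterm (nonlinear_term \<eta> \<xi>) m (\<lambda>\<theta>. Phix zr p \<omega> x \<theta> + y \<theta>) \<mu>) = P (x, y, \<mu>)"
      using Gterm_hpoly[OF sp] by blast
    show ?thesis
    proof (rule goodxI[of m "\<lambda>k z. b k * P z"])
      show "hpoly V1 m (\<lambda>z. b k * P z)" for k by (rule hpoly_scale[OF P(1)])
      show "init1 \<eta> \<xi> m x y \<mu> k = (if k \<in> K then b k * P (x, y, \<mu>) else 0)" if "(x, y, \<mu>) \<in> S" for x y \<mu> k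
        using P(2)[OF that] m by (simp add: f1_init_ge2 b_def)
    qed (simp add: f1_init_ge2[OF m] b_minus)
  qed
next
  fix m :: nat assume m: "m \<ge> 2"
  obtain P where P: "hpoly V1 m P" "\<And>x y \<mu>. (x, y, \<mu>) \<in> S \<Longrightarrow>
     complex_of_real (Gterm (nonlinear_term \<eta> \<xi>) m (\<lambda>\<theta>. Phix zr p \<omega> x \<theta> + y \<theta>) \<mu>) = P (x, y, \<mu>)"
    using Gterm_hpoly[OF sp] by blast
  show "goody m (init2 \<eta> \<xi> m)"
    unfolding goody_def
    by (intro exI conjI, rule hpoly_in.tensor[OF P(1) projected_X0_BQ]) (simp add: f2_init_ge2[OF m] P(2))
next
  show "init2 \<eta> \<xi> 1 x y \<mu> \<theta> = AQ1 r M y \<theta>" for x y \<mu> \<theta>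
    by (simp add: f2_init_def)
qed

lemma init_close:
  assumes sp: "admissible \<eta> \<xi>" and sp': "admissible \<eta>' \<xi>'" and L: "L \<in> {2..l}"
    and eq: "\<And>j. j < L \<Longrightarrow> \<eta>' j = \<eta> j \<and> \<xi>' j = \<xi> j"
    and H: "\<And>v \<mu>. \<eta>' L v + \<xi>' L v \<mu> = \<eta> L v + \<xi> L v \<mu> + H v \<mu>"
    and P: "\<And>x y \<mu>. (x, y, \<mu>) \<in> S \<Longrightarrow> complex_of_real (H (delayed (\<lambda>\<theta>. Phix zr p \<omega> x \<theta> + y \<theta>)) \<mu>) = P (x, y, \<mu>)"
  shows "close L P (init1 \<eta> \<xi>, init2 \<eta> \<xi>) (init1 \<eta>' \<xi>', init2 \<eta>' \<xi>')"
  unfolding close_def fst_conv snd_conv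
proof (intro conjI allI impI ballI)
  fix n x y \<mu> assume n: "1 \<le> n" "n < L" and z: "(x, y, \<mu>) \<in> S"
  have "Gterm (nonlinear_term \<eta>' \<xi>') n u \<mu> = Gterm (nonlinear_term \<eta> \<xi>) n u \<mu>" for u
    using z eq[OF n(2)] by (simp add: Gterm_nonlinear_term[OF sp] Gterm_nonlinear_term[OF sp'] S_def)
  then show "init1 \<eta>' \<xi>' n x y \<mu> = init1 \<eta> \<xi> n x y \<mu>" "init2 \<eta>' \<xi>' n x y \<mu> \<theta> = init2 \<eta> \<xi> n x y \<mu> \<theta>" for \<theta>
    by (simp_all add: f1_init_def f2_init_def)
next
  fix x y \<mu> k assume z: "(x, y, \<mu>) \<in> S"
  have \<mu>: "\<mu> \<in> params s" using z by (simp add: S_def)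
  show "init1 \<eta>' \<xi>' L x y \<mu> k = init1 \<eta> \<xi> L x y \<mu> k + b k * P (x, y, \<mu>)"
    using L P[OF z, symmetric]
    by (simp only: f1_init_ge2[of L] atLeastAtMost_iff Gterm_nonlinear_term[OF sp \<mu>] Gterm_nonlinear_term[OF sp' \<mu>] if_True simp_thms H of_real_add distrib_left)
qed

definition expansion_after where "expansion_after \<eta> \<xi> U1 U2 n = fseq (init1 \<eta> \<xi>) (init2 \<eta> \<xi>) U1 U2 n"

definition x_residual where "x_residual \<eta> \<xi> U1 U2 j = (\<lambda>x \<mu>. fst (expansion_after \<eta> \<xi> U1 U2 (j - 1)) j x (\<lambda>_. 0) \<mu>)"
definition y_residual where "y_residual \<eta> \<xi> U1 U2 j = (\<lambda>x \<mu>. snd (expansion_after \<eta> \<xi> U1 U2 (j - 1)) j x (\<lambda>_. 0) \<mu>)"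

text \<open>The demands of \<open>normal_form\<close> at step \<open>j\<close> except
  \<open>transformed\<close>, which holds by construction of \<open>expansion_after\<close>, and the
  definition of the normal form term. In addition the residual is a real polynomial map whose
  average has the prescribed radial part.\<close>

definition stage where
  "stage h q \<eta> \<xi> U1 U2 j \<longleftrightarrow>
     U1 j \<in> range_LB zr p \<omega> s j \<and>
     (\<forall>x\<in>cpts zr p. \<forall>\<mu>\<in>params s. \<forall>k\<in>K. LB \<omega> (U1 j) x \<mu> k = x_residual \<eta> \<xi> U1 U2 j x \<mu> k - average p (x_residual \<eta> \<xi> U1 U2 j) x \<mu> k) \<and>
     U2 j \<in> HQ1 r M zr p \<omega> b s j \<and>
     (\<forall>x\<in>cpts zr p. \<forall>\<mu>\<in>params s. \<forall>\<theta>\<in>I.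
        dirD (\<lambda>x. U2 j x \<mu> \<theta>) x (Bop \<omega> x) - AQ1 r M (U2 j x \<mu>) \<theta> = y_residual \<eta> \<xi> U1 U2 j x \<mu> \<theta>) \<and>
     x_residual \<eta> \<xi> U1 U2 j \<in> HK zr p s j \<and>
     (\<forall>\<rho>\<in>vecs R. \<forall>\<mu>\<in>params s. \<forall>i\<in>R.
        Re (average p (x_residual \<eta> \<xi> U1 U2 j) (real_point \<rho>) \<mu> (int i)) = h j \<rho> i + q j \<rho> \<mu> i)"

lemma stage_good_changes: "(\<And>j. 2 \<le> j \<Longrightarrow> j \<le> n \<Longrightarrow> stage h q \<eta> \<xi> U1 U2 j) \<Longrightarrow> good_changes n U1 U2"
  unfolding good_changes_def stage_def range_LB_def by (auto intro: HK_goodU1 HQ1_goodU2)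

lemma stage_cong:
  assumes st: "stage h q \<eta> \<xi> U1 U2 j" and U: "U1' j = U1 j" "U2' j = U2 j"
    and T: "\<And>x \<mu>. x \<in> cpts zr p \<Longrightarrow> \<mu> \<in> params s \<Longrightarrow> x_residual \<eta>' \<xi>' U1' U2' j x \<mu> = x_residual \<eta> \<xi> U1 U2 j x \<mu>"
      "\<And>x \<mu> \<theta>. x \<in> cpts zr p \<Longrightarrow> \<mu> \<in> params s \<Longrightarrow> \<theta> \<in> I \<Longrightarrow> y_residual \<eta>' \<xi>' U1' U2' j x \<mu> \<theta> = y_residual \<eta> \<xi> U1 U2 j x \<mu> \<theta>"
  shows "stage h q \<eta>' \<xi>' U1' U2' j"
proof -
  have av: "average p (x_residual \<eta>' \<xi>' U1' U2' j) x \<mu> k = average p (x_residual \<eta> \<xi> U1 U2 j) x \<mu> k"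
    if "x \<in> cpts zr p" "\<mu> \<in> params s" for x \<mu> k
    using that T(1) by (intro average_cong) auto
  have HK: "x_residual \<eta>' \<xi>' U1' U2' j \<in> HK zr p s j"
    by (rule HK_cong[OF _ T(1)]) (use st in \<open>auto simp: stage_def\<close>)
  show ?thesis using st HK unfolding stage_def U
    by (simp add: T av real_point_cpts del: atLeastAtMost_iff)
qed

text \<open>The terms constructed so far produce some radial part in degree \<open>L\<close>, and
  the nonlinearity of degree \<open>L\<close> supplies what is missing. Nonlinearities vanish above
  the degree reached, so adding overwrites nothing, and completed stages see lower degrees
  only.\<close>

lemma realization_induct:
  assumes sol: "\<And>n. n \<le> l \<Longrightarrow> solvable zr p b (delay_angles \<tau>) n"
    and hq: "\<And>j. j \<in> {2..l} \<Longrightarrow> h j \<in> HdZ2 zr p s j \<and> q j \<in> PZ2 zr p s j"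
    and "1 \<le> n" "n \<le> l"
  shows "\<exists>\<eta> \<xi> U1 U2. admissible \<eta> \<xi> \<and> (\<forall>j>n. \<eta> j = (\<lambda>_. 0) \<and> \<xi> j = (\<lambda>_ _. 0)) \<and>
    (\<forall>j. 2 \<le> j \<and> j \<le> n \<longrightarrow> stage h q \<eta> \<xi> U1 U2 j)"
  using assms(3,4)
proof (induction n rule: nat_induct_at_least)
  case base
  show ?case
    \<comment> \<open>There is no stage below degree 2, so the changes of variables are arbitrary
      here.\<close>
    by (intro exI[of _ "\<lambda>_ _. 0"] exI[of _ "\<lambda>_ _ _. 0"] exI[of _ undefined])
      (auto simp: admissible_def zero_Vhat zero_What)
next
  case (Suc n)
  define L where "L = Suc n"
  have L: "L \<in> {2..l}" using Suc.hyps Suc.prems by (simp add: L_def)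
  obtain \<eta> \<xi> U1 U2 where sp: "admissible \<eta> \<xi>" and z: "\<And>j. j > n \<Longrightarrow> \<eta> j = (\<lambda>_. 0) \<and> \<xi> j = (\<lambda>_ _. 0)"
    and st: "\<And>j. 2 \<le> j \<Longrightarrow> j \<le> n \<Longrightarrow> stage h q \<eta> \<xi> U1 U2 j"
  proof -
    have "n \<le> l" using Suc.prems by simp
    from Suc.IH[OF this] obtain \<eta> \<xi> U1 U2 where *: "admissible \<eta> \<xi>" "\<forall>j>n. \<eta> j = (\<lambda>_. 0) \<and> \<xi> j = (\<lambda>_ _. 0)"
      "\<forall>j. 2 \<le> j \<and> j \<le> n \<longrightarrow> stage h q \<eta> \<xi> U1 U2 j" by blast
    show thesis by (rule that[of \<eta> \<xi> U1 U2]) (use * in blast)+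
  qed
  have gU: "good_changes n U1 U2" by (rule stage_good_changes[OF st])
  have inS: "(x, (\<lambda>_. 0), \<mu>) \<in> S" if "x \<in> cpts zr p" "\<mu> \<in> params s" for x \<mu>
    using that zero_QQ by (simp add: S_def)
  define F0 where "F0 = x_residual \<eta> \<xi> U1 U2 L"
  have gf: "good_expansions (expansion_after \<eta> \<xi> U1 U2 n)" unfolding expansion_after_def by (rule fseq_good[OF init_good[OF sp] gU])
  have F0: "F0 \<in> HK zr p s L"
    unfolding F0_def x_residual_def using goodfD(1)[OF gf, of L] L by (intro goodx_HK) (simp add: L_def)
  \<comment> \<open>The missing part: the target minus what the lower degrees already yield. It is
    sign-equivariant, hence attainable.\<close>
  define Sv where "Sv \<rho> \<mu> i = h L \<rho> i + q L \<rho> \<mu> i - Re (average p F0 (real_point \<rho>) \<mu> (int i))" for \<rho> \<mu> and i :: nat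
  have "(\<lambda>\<rho> \<mu> i. 1 * (1 * h L \<rho> i + 1 * q L \<rho> \<mu> i) + (- 1) * Re (average p F0 (real_point \<rho>) \<mu> (int i))) \<in> HZ2 zr p s L"
    using hq[OF L] by (intro HZ2_combine average_HZ2[OF F0]) (auto simp: HdZ2_def PZ2_def)
  then have "Sv \<in> HZ2 zr p s L" by (simp add: Sv_def[abs_def])
  from nonlin_surj[OF sol this]
  obtain c where c: "\<And>\<rho> \<mu> i. \<rho> \<in> vecs R \<Longrightarrow> \<mu> \<in> params s \<Longrightarrow> i \<in> R \<Longrightarrow>
    Re (average p (\<lambda>x \<mu> k. b k * of_real (nonlin s L c (delayed (Phix zr p \<omega> x)) \<mu>)) (real_point \<rho>) \<mu> (int i)) = Sv \<rho> \<mu> i"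
    using L by (auto simp del: One_nat_def)
  obtain \<eta>L \<xi>L where L\<eta>: "\<eta>L \<in> Vhat zr p s L" "\<xi>L \<in> What zr p s L" "\<And>v \<mu>. \<eta>L v + \<xi>L v \<mu> = nonlin s L c v \<mu>"
    using nonlin_split by blast
  define \<eta>' \<xi>' where "\<eta>' = \<eta>(L := \<eta>L)" and "\<xi>' = \<xi>(L := \<xi>L)"
  have sp': "admissible \<eta>' \<xi>'" using sp L\<eta> by (auto simp: admissible_def \<eta>'_def \<xi>'_def)
  obtain P where P: "hpoly V1 L P" "\<And>x y \<mu>. (x, y, \<mu>) \<in> S \<Longrightarrow>
      complex_of_real (nonlin s L c (delayed (\<lambda>\<theta>. Phix zr p \<omega> x \<theta> + y \<theta>)) \<mu>) = P (x, y, \<mu>)"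
    using Hscal_hpoly[OF nonlin_Hscal[of s L c]] by blast
  have cl0: "close L P (init1 \<eta> \<xi>, init2 \<eta> \<xi>) (init1 \<eta>' \<xi>', init2 \<eta>' \<xi>')"
    by (rule init_close[where H = "nonlin s L c", OF sp sp' L _ _ P(2)])
      (use z[of L] L\<eta>(3) in \<open>auto simp: \<eta>'_def \<xi>'_def L_def\<close>)
  have cl: "close L P (expansion_after \<eta> \<xi> U1 U2 m) (expansion_after \<eta>' \<xi>' U1 U2 m)" if "m \<le> n" for m
    unfolding expansion_after_def using gU that L
    by (intro fseq_close[OF init_good[OF sp] init_good[OF sp'] cl0 P(1)]) (auto simp: good_changes_def)
  have gf': "good_expansions (expansion_after \<eta>' \<xi>' U1 U2 n)" unfolding expansion_after_def by (rule fseq_good[OF init_good[OF sp'] gU])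
  define F1 where "F1 = x_residual \<eta>' \<xi>' U1 U2 L"
  have F1: "F1 \<in> HK zr p s L"
    unfolding F1_def x_residual_def using goodfD(1)[OF gf', of L] L by (intro goodx_HK) (simp add: L_def)
  \<comment> \<open>The changes of degree \<open>L\<close> are solved for after the nonlinearity is
    altered, since their right-hand sides depend on it.\<close>
  obtain W1 where W1: "W1 \<in> range_LB zr p \<omega> s L"
    "\<And>x \<mu> k. x \<in> cpts zr p \<Longrightarrow> \<mu> \<in> params s \<Longrightarrow> k \<in> K \<Longrightarrow> LB \<omega> W1 x \<mu> k = F1 x \<mu> k - average p F1 x \<mu> k"
    using range_LB_solution[OF F1] by blast
  have "goody L (snd (expansion_after \<eta>' \<xi>' U1 U2 n) L)" using goodfD(2)[OF gf', of L] L by simp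
  from goody_solution[OF this] obtain W2 where W2: "W2 \<in> HQ1 r M zr p \<omega> b s L"
    "\<And>x \<mu> \<theta>. x \<in> cpts zr p \<Longrightarrow> \<mu> \<in> params s \<Longrightarrow> \<theta> \<in> I \<Longrightarrow>
      dirD (\<lambda>x. W2 x \<mu> \<theta>) x (Bop \<omega> x) - AQ1 r M (W2 x \<mu>) \<theta> = y_residual \<eta>' \<xi>' U1 U2 L x \<mu> \<theta>"
    unfolding y_residual_def L_def by auto
  define U1' U2' where "U1' = U1(L := W1)" and "U2' = U2(L := W2)"
  have fs': "expansion_after \<eta>' \<xi>' U1' U2' (j - 1) = expansion_after \<eta>' \<xi>' U1 U2 (j - 1)" if "j \<le> L" for j
    unfolding expansion_after_def using that by (intro fseq_cong) (auto simp: U1'_def U2'_def L_def)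
  have "stage h q \<eta>' \<xi>' U1' U2' j" if j: "2 \<le> j" "j \<le> n" for j
  proof (rule stage_cong[OF st[OF j]])
    show "U1' j = U1 j" "U2' j = U2 j" using j by (auto simp: U1'_def U2'_def L_def)
    \<comment> \<open>The added term has degree \<open>L > j\<close>, so the residuals of stage
      \<open>j\<close> are the same as before.\<close>
    have cj: "close L P (expansion_after \<eta> \<xi> U1 U2 (j - 1)) (expansion_after \<eta>' \<xi>' U1 U2 (j - 1))" using j by (intro cl) simp
    show "x_residual \<eta>' \<xi>' U1' U2' j x \<mu> = x_residual \<eta> \<xi> U1 U2 j x \<mu>" if "x \<in> cpts zr p" "\<mu> \<in> params s" for x \<mu>
      using closeD(1)[OF cj, of j x "\<lambda>_. 0" \<mu>] inS[OF that] j fs'[of j] by (simp add: x_residual_def L_def)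
    show "y_residual \<eta>' \<xi>' U1' U2' j x \<mu> \<theta> = y_residual \<eta> \<xi> U1 U2 j x \<mu> \<theta>" if "x \<in> cpts zr p" "\<mu> \<in> params s" "\<theta> \<in> I" for x \<mu> \<theta>
      using closeD(2)[OF cj, of j x "\<lambda>_. 0" \<mu> \<theta>] inS[OF that(1,2)] that(3) j fs'[of j] by (simp add: y_residual_def L_def)
  qed
  moreover have "stage h q \<eta>' \<xi>' U1' U2' L"
  proof -
    have T: "x_residual \<eta>' \<xi>' U1' U2' L = F1" "y_residual \<eta>' \<xi>' U1' U2' L = y_residual \<eta>' \<xi>' U1 U2 L"
      using fs'[of L] by (auto simp: x_residual_def y_residual_def F1_def)
    have "Re (average p F1 (real_point \<rho>) \<mu> (int i)) = h L \<rho> i + q L \<rho> \<mu> i"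
      if \<rho>: "\<rho> \<in> vecs R" and \<mu>: "\<mu> \<in> params s" and i: "i \<in> R" for \<rho> \<mu> i
    proof -
      have "F1 x \<mu> k = F0 x \<mu> k + b k * of_real (nonlin s L c (delayed (Phix zr p \<omega> x)) \<mu>)" if "x \<in> cpts zr p" for x k
        using closeD(3)[OF cl[OF order_refl] inS[OF that \<mu>], of k] P(2)[OF inS[OF that \<mu>]]
        by (simp add: F0_def F1_def x_residual_def L_def)
      then have "average p F1 (real_point \<rho>) \<mu> (int i) = average p F0 (real_point \<rho>) \<mu> (int i) +
          average p (\<lambda>x \<mu> k. b k * of_real (nonlin s L c (delayed (Phix zr p \<omega> x)) \<mu>)) (real_point \<rho>) \<mu> (int i)"
        using \<mu> i \<rho> by (intro average_add[OF F0 F1]) (auto intro: real_point_cpts)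
      then show ?thesis using c[OF \<rho> \<mu> i] by (simp add: Sv_def)
    qed
    then show ?thesis unfolding stage_def T using F1 W1 W2 by (simp add: U1'_def U2'_def del: atLeastAtMost_iff)
  qed
  ultimately have "stage h q \<eta>' \<xi>' U1' U2' j" if "2 \<le> j" "j \<le> Suc n" for j
    using that unfolding L_def by (cases "j = Suc n") auto
  moreover have "\<forall>j>Suc n. \<eta>' j = (\<lambda>_. 0) \<and> \<xi>' j = (\<lambda>_ _. 0)"
    using z by (auto simp: \<eta>'_def \<xi>'_def L_def)
  ultimately show ?case using sp' by blast
qed

lemma realization:
  assumes sol: "\<And>n. n \<le> l \<Longrightarrow> solvable zr p b (delay_angles \<tau>) n" and "l \<ge> 1"
    and hq: "\<And>j. j \<in> {2..l} \<Longrightarrow> h j \<in> HdZ2 zr p s j \<and> q j \<in> PZ2 zr p s j"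
  shows "\<exists>\<eta> \<xi>. (\<forall>j\<in>{2..l}. \<eta> j \<in> Vhat zr p s j \<and> \<xi> j \<in> What zr p s j) \<and>
    realizes r M zr p \<omega> s l \<tau> \<eta> \<xi> h q"
proof -
  obtain \<eta> \<xi> U1 U2 where sp: "admissible \<eta> \<xi>" and st: "\<And>j. j \<in> {2..l} \<Longrightarrow> stage h q \<eta> \<xi> U1 U2 j"
    using realization_induct[OF sol hq \<open>l \<ge> 1\<close> order_refl] by auto
  let ?f = "expansion_after \<eta> \<xi> U1 U2"
  define g where "g j = average p (x_residual \<eta> \<xi> U1 U2 j)" for j
  define Rd where "Rd j \<rho> \<mu> i = h j \<rho> i + q j \<rho> \<mu> i" for j \<rho> \<mu> and i :: nat
  have nf: "normal_form r M zr p \<omega> s l (nonlinear_term \<eta> \<xi>) g"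
    unfolding normal_form_def Let_def
  proof (intro exI[of _ b] exI[of _ "\<lambda>n. fst (?f n)"] exI[of _ "\<lambda>n. snd (?f n)"] exI[of _ U1] exI[of _ U2] conjI)
    show "Psi_normalized M zr p \<omega> b" by (rule Psi_normalized)
    show "fst (?f 1) = init1 \<eta> \<xi>" "snd (?f 1) = init2 \<eta> \<xi>" by (simp_all add: expansion_after_def)
    show "\<forall>j\<in>{2..l}. U1 j \<in> range_LB zr p \<omega> s j \<and>
        (\<forall>x\<in>cpts zr p. \<forall>\<mu>\<in>params s. \<forall>k\<in>cidx zr p. LB \<omega> (U1 j) x \<mu> k = fst (?f (j - 1)) j x (\<lambda>_. 0) \<mu> k -
           average p (\<lambda>x \<mu>. fst (?f (j - 1)) j x (\<lambda>_. 0) \<mu>) x \<mu> k) \<and>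
        U2 j \<in> HQ1 r M zr p \<omega> b s j \<and>
        (\<forall>x\<in>cpts zr p. \<forall>\<mu>\<in>params s. \<forall>\<theta>\<in>{-r..0}.
           dirD (\<lambda>x. U2 j x \<mu> \<theta>) x (Bop \<omega> x) - AQ1 r M (U2 j x \<mu>) \<theta> = snd (?f (j - 1)) j x (\<lambda>_. 0) \<mu> \<theta>) \<and>
        transformed r (Q1 r M zr p \<omega> b) zr p s j (U1 j) (U2 j) (fst (?f (j - 1))) (snd (?f (j - 1))) (fst (?f j)) (snd (?f j)) \<and>
        (\<forall>x\<in>cpts zr p. \<forall>\<mu>\<in>params s. \<forall>k\<in>cidx zr p. g j x \<mu> k = average p (\<lambda>x \<mu>. fst (?f (j - 1)) j x (\<lambda>_. 0) \<mu>) x \<mu> k)"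
    proof
      fix j assume j: "j \<in> {2..l}"
      then obtain n where n: "j = Suc n" "n \<noteq> 0" by (cases j) auto
      have fj: "fst (?f j) = stepx j (U1 j) (U2 j) (fst (?f (j - 1)))"
        "snd (?f j) = stepy j (U1 j) (U2 j) (fst (?f (j - 1))) (snd (?f (j - 1)))"
        using n by (simp_all add: expansion_after_def)
      have "transformed r (Q1 r M zr p \<omega> b) zr p s j (U1 j) (U2 j) (fst (?f (j - 1))) (snd (?f (j - 1))) (fst (?f j)) (snd (?f j))"
        unfolding fj using j by (intro transformed_step) simp
      then show "U1 j \<in> range_LB zr p \<omega> s j \<and>
        (\<forall>x\<in>cpts zr p. \<forall>\<mu>\<in>params s. \<forall>k\<in>cidx zr p. LB \<omega> (U1 j) x \<mu> k = fst (?f (j - 1)) j x (\<lambda>_. 0) \<mu> k -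
           average p (\<lambda>x \<mu>. fst (?f (j - 1)) j x (\<lambda>_. 0) \<mu>) x \<mu> k) \<and>
        U2 j \<in> HQ1 r M zr p \<omega> b s j \<and>
        (\<forall>x\<in>cpts zr p. \<forall>\<mu>\<in>params s. \<forall>\<theta>\<in>{-r..0}.
           dirD (\<lambda>x. U2 j x \<mu> \<theta>) x (Bop \<omega> x) - AQ1 r M (U2 j x \<mu>) \<theta> = snd (?f (j - 1)) j x (\<lambda>_. 0) \<mu> \<theta>) \<and>
        transformed r (Q1 r M zr p \<omega> b) zr p s j (U1 j) (U2 j) (fst (?f (j - 1))) (snd (?f (j - 1))) (fst (?f j)) (snd (?f j)) \<and>
        (\<forall>x\<in>cpts zr p. \<forall>\<mu>\<in>params s. \<forall>k\<in>cidx zr p. g j x \<mu> k = average p (\<lambda>x \<mu>. fst (?f (j - 1)) j x (\<lambda>_. 0) \<mu>) x \<mu> k)"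
        using st[OF j] unfolding stage_def x_residual_def y_residual_def g_def by blast
    qed
  qed
  have rm: "radial_map zr p s (g j) (Rd j)" if "j \<in> {2..l}" for j
    by (rule radial_mapI[of "x_residual \<eta> \<xi> U1 U2 j" zr p s j]) (use st[OF that] in \<open>auto simp: stage_def g_def Rd_def\<close>)
  have "radial_part r M zr p \<omega> s l (nonlinear_term \<eta> \<xi>) (\<lambda>\<rho> \<mu> i. (\<Sum>j = 2..l. h j \<rho> i) + (\<Sum>j = 2..l. q j \<rho> \<mu> i))"
    unfolding radial_part_def
    by (intro exI[of _ g] exI[of _ Rd] conjI nf ballI rm) (simp_all add: Rd_def sum.distrib)
  then have "realizes r M zr p \<omega> s l \<tau> \<eta> \<xi> h q" unfolding realizes_def nonlinear_term_def .
  then show ?thesis using sp unfolding admissible_def by blast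
qed

end

theorem theorem5p2:
  fixes r :: real and s p l :: nat and zr :: bool
    and L :: "(nat \<Rightarrow> real) \<Rightarrow> (real \<Rightarrow> real) \<Rightarrow> real"
    and \<omega> :: "nat \<Rightarrow> real"
  assumes "r > 0" and "p \<ge> 1" and "l \<ge> 2"
    and "smooth_family r s L"
    and "\<forall>\<^sub>F \<mu> in at (\<lambda>_. 0) within params s.
           card (imag_spectrum r (L \<mu>)) < card (imag_spectrum r (L (\<lambda>_. 0)))"
    and "\<forall>\<zeta>\<in>imag_spectrum r (L (\<lambda>_. 0)). simple_eigenvalue r (L (\<lambda>_. 0)) \<zeta>"
    and "imag_spectrum r (L (\<lambda>_. 0)) =
           (if zr then {0} else {}) \<union> (\<Union>j\<in>{1..p}. {\<i> * of_real (\<omega> j), - \<i> * of_real (\<omega> j)})"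
    and "\<forall>j\<in>{1..p}. \<omega> j > 0"
    and "\<forall>c :: nat \<Rightarrow> rat. (\<Sum>j = 1..p. of_rat (c j) * \<omega> j) = 0 \<longrightarrow> (\<forall>j\<in>{1..p}. c j = 0)"
  shows
    "(\<forall>h q. (\<forall>j\<in>{2..l}. h j \<in> HdZ2 zr p s j \<and> q j \<in> PZ2 zr p s j) \<longrightarrow>
        (\<exists>\<tau> \<eta> \<xi>. \<tau> \<in> delay_cube r (rdim zr p) \<and> inj_on \<tau> {1..rdim zr p} \<and>
           (\<forall>j\<in>{2..l}. \<eta> j \<in> Vhat zr p s j \<and> \<xi> j \<in> What zr p s j) \<and>
           realizes r (L (\<lambda>_. 0)) zr p \<omega> s l \<tau> \<eta> \<xi> h q)) \<and>
     (\<exists>T. T \<subseteq> {\<tau> \<in> delay_cube r (rdim zr p). inj_on \<tau> {1..rdim zr p}} \<and>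
        openin (top_of_set (delay_cube r (rdim zr p))) T \<and>
        delay_cube r (rdim zr p) \<subseteq> closure T \<and>
        (\<forall>\<tau>\<in>T. \<forall>h q. (\<forall>j\<in>{2..l}. h j \<in> HdZ2 zr p s j \<and> q j \<in> PZ2 zr p s j) \<longrightarrow>
           (\<exists>\<eta> \<xi>. (\<forall>j\<in>{2..l}. \<eta> j \<in> Vhat zr p s j \<and> \<xi> j \<in> What zr p s j) \<and>
              realizes r (L (\<lambda>_. 0)) zr p \<omega> s l \<tau> \<eta> \<xi> h q)))"
proof -
  have "(\<lambda>_. 0) \<in> params s" by (simp add: vecs_def)
  then have bounded: "bounded_op r (L (\<lambda>_. 0))"
    using assms(4) unfolding smooth_family_def by (metis lists.Nil)
  interpret center_spectrum r "L (\<lambda>_. 0)" zr p \<omega>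
    using assms bounded by unfold_locales
  let ?d = "rdim zr p"
  \<comment> \<open>One trigonometric polynomial witnesses solvability in all degrees up to
    \<open>l\<close>. It is chosen before \<open>h\<close> and \<open>q\<close>, so the set
    \<open>T\<close> does not depend on them.\<close>
  obtain f where f: "trig ({1..p} \<times> {1..?d}) f" "f (\<alpha>0 zr p b) \<noteq> 0"
    "\<And>\<alpha> n. f \<alpha> \<noteq> 0 \<Longrightarrow> n \<le> l \<Longrightarrow> solvable zr p b \<alpha> n"
    using trig_solvable[of zr p b l, OF b_nonzero b_minus] by blast
  define T where "T = {\<tau> \<in> delay_cube r ?d. inj_on \<tau> {1..?d} \<and> f (\<lambda>k c. \<omega> k * \<tau> c) \<noteq> 0}"
  note T = generic_delays[OF assms(9) f(1,2) assms(1), folded T_def]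
  have real: "\<exists>\<eta> \<xi>. (\<forall>j\<in>{2..l}. \<eta> j \<in> Vhat zr p s j \<and> \<xi> j \<in> What zr p s j) \<and>
      realizes r (L (\<lambda>_. 0)) zr p \<omega> s l \<tau> \<eta> \<xi> h q"
    if \<tau>: "\<tau> \<in> T" and hq: "\<forall>j\<in>{2..l}. h j \<in> HdZ2 zr p s j \<and> q j \<in> PZ2 zr p s j" for \<tau> h q
  proof -
    interpret realization r "L (\<lambda>_. 0)" zr p \<omega> s \<tau> l
      using \<tau> by unfold_locales (auto simp: T_def delay_cube_def)
    have "f (delay_angles \<tau>) \<noteq> 0" using \<tau> by (simp add: T_def delay_angles_def[abs_def])
    then show ?thesis using f(3) hq assms(3) by (intro realization) auto
  qed
  \<comment> \<open>The closure of \<open>T\<close> contains the nonempty cube, so \<open>T\<close>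
    is nonempty; any one of its points settles the first assertion.\<close>
  have "(\<lambda>_. 0) \<in> delay_cube r ?d" using assms(1) by (simp add: delay_cube_def vecs_def)
  then have "T \<noteq> {}" using T(2) by auto
  then obtain \<tau> where "\<tau> \<in> T" by blast
  then have "\<tau> \<in> delay_cube r ?d" "inj_on \<tau> {1..?d}" by (auto simp: T_def)
  then show ?thesis
    using real[OF \<open>\<tau> \<in> T\<close>] T real by (intro conjI exI[of _ T]) (blast | auto simp: T_def)+
qed

end
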